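(* Let $k$ be a field of characteristic zero and let $\mathcal O$ be a non-unital operad in $k$-vector spaces. The partial compositions of $\mathcal O$ and the induced action of $\mathcal O$ on $|\delta_{1,1}\mathcal O|$ induce (by the contraction rule described in the context) a $\mathsf D_-$-module structure on the $k\mathsf B$-module $\Lambda^*_{\circledcirc}\mathcal O\circledcirc S^*_{\circledcirc}|\delta_{1,1}\mathcal O|$, natural in $\mathcal O$, where $\mathsf D_-=(k\mathsf{dwb})_-$. Via the surjection $$\Lambda^*_{\circledcirc}\mathcal O\circledcirc S^*_{\circledcirc}|\delta_{1,1}\mathcal O|\twoheadrightarrow\Lambda^*_{\circledcirc}\mathcal O$$ induced by sending $|\delta_{1,1}\mathcal O|$ to zero, this induces a natural $\mathsf D_-$-module structure on $\Lambda^*_{\circledcirc}\mathcal O$; thus this is a natural surjection of $\mathsf D_-$-modules.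
   Context: Generalities. $\mathbf n=\{1,\dots,n\}$, $\mathfrak S_n$ is the symmetric group, $\mathrm{sgn}_n$ its sign representation. $\mathsf{FB}$ is the category of finite sets and bijections, $\mathsf B:=\mathsf{FB}\times\mathsf{FB}$; a $k\mathsf B$-module is a functor from $\mathsf B$ to $k$-vector spaces. For a $k$-linear category $\mathcal A$, an $\mathcal A$-module is a $k$-linear functor from $\mathcal A$ to $k$-vector spaces. The category $\mathsf D_-$. $(k\mathsf{uwb})_-$ is the $k$-linear category with objects pairs $(X,Y)$ of finite sets and morphisms from $(X,Y)$ to $(U,V)$ zero unless $|U|-|X|=|V|-|Y|=n\ge0$ (the degree), in which case they are $k\,\mathrm{Hom}_{\mathsf B}((X\sqcup\mathbf n,Y\sqcup\mathbf n),(U,V))\otimes_{\mathfrak S_n}\mathrm{sgn}_n$ (diagonal action on the two copies of $\mathbf n$). The composite of the classes of $(f_1,f_2)$ of degree $n$ from $(X,Y)$ to $(U,V)$ and $(g_1,g_2)$ of degree $r$ from $(U,V)$ to $(W,Z)$ is the class of $X\sqcup(\mathbf{n+r})\cong(X\sqcup\mathbf n)\sqcup\mathbf r\to U\sqcup\mathbf r\to W$ and similarly for $Y$. $\mathsf D_-=(k\mathsf{dwb})_-$ is its opposite. The degree-zero morphisms form $k\mathsf B$ (identifying $\mathsf B\cong\mathsf B^{op}$ by inverting morphisms). Write $c_{x,y}:(X\sqcup\{x\},Y\sqcup\{y\})\to(X,Y)$ for the degree-one morphism of $\mathsf D_-$ opposite to the class of the identifications $X\sqcup\mathbf 1\cong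 X\sqcup\{x\}$, $Y\sqcup\mathbf 1\cong Y\sqcup\{y\}$. Degree-zero morphisms and the $c_{x,y}$ generate $\mathsf D_-$. Convolution. For $k\mathsf B$-modules, $(F\circledcirc G)(X,Y)=\bigoplus F(S_1,T_1)\otimes G(S_2,T_2)$, the sum over ordered decompositions $X=S_1\sqcup S_2$, $Y=T_1\sqcup T_2$; this is symmetric monoidal, with symmetry induced by that of vector spaces (no signs). $S^d_{\circledcirc}F:=F^{\circledcirc d}/\mathfrak S_d$, $\Lambda^d_{\circledcirc}F:=(F^{\circledcirc d}\otimes\mathrm{sgn}_d)/\mathfrak S_d$, $S^*_{\circledcirc}=\bigoplus_dS^d_{\circledcirc}$, $\Lambda^*_{\circledcirc}=\bigoplus_d\Lambda^d_{\circledcirc}$. Operads. A non-unital operad $\mathcal O$ is a functor $X\mapsto\mathcal O(X)$ from $\mathsf{FB}$ to $k$-vector spaces with partial compositions $\circ_*:\mathcal O(X\sqcup\{*\})\otimes\mathcal O(Z)\to\mathcal O(X\sqcup Z)$, natural with respect to bijections, such that $(a\circ_*b)\circ_{*'}c=a\circ_*(b\circ_{*'}c)$ when $*'$ is an input of $b$, and $(a\circ_*b)\circ_{*'}c=(a\circ_{*'}c)\circ_*b$ when $*\neq*'$ are inputs of $a$; no unit is required. $\mathcal O$ is regarded as a $k\mathsf B$-module by $\mathcal O(X,Y)=\mathcal O(X)$ if $|Y|=1$ and $0$ otherwise. $|\delta_{1,1}\mathcal O|$ is the $k\mathsf B$-module supported on pairs $(X,\emptyset)$, with $|\delta_{1,1}\mathcal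 O|(X,\emptyset)$ the quotient of $\mathcal O(X\sqcup\{*\})$ by the span of the $a\circ_*b-b\circ_*a$, for $X=X_1\sqcup X_2$, $a\in\mathcal O(X_1\sqcup\{*\})$, $b\in\mathcal O(X_2\sqcup\{*\})$ (the point $*$ of $b$, respectively of $a$, remains as the distinguished point of $a\circ_*b$, respectively $b\circ_*a$). The action of $\mathcal O$ on $|\delta_{1,1}\mathcal O|$ is $[c]\circ_xb:=[c\circ_xb]$, for $c\in\mathcal O(X\sqcup\{*\})$, $x\in X$, $b\in\mathcal O(Z)$. Contraction rule. An element of $(\Lambda^*_{\circledcirc}\mathcal O\circledcirc S^*_{\circledcirc}|\delta_{1,1}\mathcal O|)(X\sqcup\{x\},Y\sqcup\{y\})$ is a sum of terms $a_1\wedge\dots\wedge a_n\wedge b\cdot w_1\cdots w_r$, where $b\in\mathcal O(Z,\{y\})$, $a_i\in\mathcal O(X_i,\{y_i\})$ with $Y=\{y_1,\dots,y_n\}$, $w_j\in|\delta_{1,1}\mathcal O|(Z_j,\emptyset)$, and $X\sqcup\{x\}$ is the disjoint union of $Z$, the $X_i$ and the $Z_j$. The morphism $c_{x,y}$ sends this term to: (i) $a_1\wedge\dots\wedge a_n\cdot[b]w_1\cdots w_r$ if $x\in Z$, with $[b]\in|\delta_{1,1}\mathcal O|(Z\setminus\{x\},\emptyset)$ the class of $b$ with distinguished input $x$; (ii) $a_1\wedge\dots\wedge(a_i\circ_xb)\wedge\dots\wedge a_n\cdot w_1\cdots w_r$ if $x\in X_i$; (iii) $a_1\wedge\dots\wedge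 a_n\cdot w_1\cdots(w_j\circ_xb)\cdots w_r$ if $x\in Z_j$. *)

theory Defs
  imports "Jordan_Normal_Form.Missing_VectorSpace" "HOL-Algebra.AbelCoset" "HOL-Combinatorics.Permutations"
begin

text \<open>
  Vector spaces over a field \<open>K\<close> are modules with explicit carriers (locale \<open>vectorspace\<close>), linear
  maps are elements of \<open>module_hom\<close>. The category of finite sets is represented by the finite subsets
  of a type of labels, which has to be infinite for all finite cardinalities to occur.
\<close>

section \<open>Linear algebra\<close>

definition quot_space :: "('k, 'v) module \<Rightarrow> 'v set \<Rightarrow> ('k, 'v set) module" where
  "quot_space V N =
    \<lparr>carrier = A_RCOSETS V N, mult = (\<lambda>_ _. N), one = N, zero = N,
     add = set_add V, smult = (\<lambda>c C. \<Union>v\<in>C. a_r_coset V N (c \<odot>\<^bsub>V\<^esub> v))\<rparr>"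

definition zero_space :: "'v \<Rightarrow> ('k, 'v) module" where
  "zero_space z =
    \<lparr>carrier = {z}, mult = (\<lambda>_ _. z), one = z, zero = z, add = (\<lambda>_ _. z), smult = (\<lambda>_ _. z)\<rparr>"

definition free_space :: "'k ring \<Rightarrow> 's set \<Rightarrow> ('k, 's \<Rightarrow> 'k) module" where
  "free_space K S =
    (ring.func_space K S)\<lparr>carrier := {f \<in> S \<rightarrow>\<^sub>E carrier K. finite {s \<in> S. f s \<noteq> \<zero>\<^bsub>K\<^esub>}}\<rparr>"

definition basis_vec :: "'k ring \<Rightarrow> 's set \<Rightarrow> 's \<Rightarrow> 's \<Rightarrow> 'k" where
  "basis_vec K S s = (\<lambda>t\<in>S. if t = s then \<one>\<^bsub>K\<^esub> else \<zero>\<^bsub>K\<^esub>)"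

definition dsum :: "'i set \<Rightarrow> ('i \<Rightarrow> ('k, 'v) module) \<Rightarrow> ('k, 'i \<Rightarrow> 'v) module" where
  "dsum I V =
    \<lparr>carrier = {f \<in> (\<Pi>\<^sub>E i\<in>I. carrier (V i)). finite {i \<in> I. f i \<noteq> \<zero>\<^bsub>V i\<^esub>}},
     mult = (\<lambda>_ _. \<lambda>i\<in>I. \<zero>\<^bsub>V i\<^esub>), one = (\<lambda>i\<in>I. \<zero>\<^bsub>V i\<^esub>), zero = (\<lambda>i\<in>I. \<zero>\<^bsub>V i\<^esub>),
     add = (\<lambda>f g. \<lambda>i\<in>I. f i \<oplus>\<^bsub>V i\<^esub> g i), smult = (\<lambda>c f. \<lambda>i\<in>I. c \<odot>\<^bsub>V i\<^esub> f i)\<rparr>"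

definition dsum_incl :: "'i set \<Rightarrow> ('i \<Rightarrow> ('k, 'v) module) \<Rightarrow> 'i \<Rightarrow> 'v \<Rightarrow> 'i \<Rightarrow> 'v" where
  "dsum_incl I V i v = (\<lambda>j\<in>I. if j = i then v else \<zero>\<^bsub>V j\<^esub>)"

text \<open>
  \<open>lin_ext K V W P\<close> is the linear map from \<open>V\<close> to \<open>W\<close> that sends \<open>v\<close> to \<open>w\<close> for all \<open>(v, w) \<in> P\<close>;
  it is only used when the first components of \<open>P\<close> span \<open>V\<close>. Likewise \<open>bilin_ext\<close>.
\<close>

definition lin_ext ::
  "'k ring \<Rightarrow> ('k, 'v) module \<Rightarrow> ('k, 'w) module \<Rightarrow> ('v \<times> 'w) set \<Rightarrow> 'v \<Rightarrow> 'w" where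
  "lin_ext K V W P =
    (THE \<phi>. \<phi> \<in> module_hom K V W \<and> \<phi> \<in> extensional (carrier V) \<and> (\<forall>(v, w)\<in>P. \<phi> v = w))"

definition bilin_ext ::
  "'k ring \<Rightarrow> ('k, 'v) module \<Rightarrow> ('k, 'w) module \<Rightarrow> ('k, 'u) module \<Rightarrow> (('v \<times> 'w) \<times> 'u) set
    \<Rightarrow> 'v \<Rightarrow> 'w \<Rightarrow> 'u" where
  "bilin_ext K V W U P =
    (THE \<phi>. (\<forall>v\<in>carrier V. \<phi> v \<in> module_hom K W U \<and> \<phi> v \<in> extensional (carrier W)) \<and>
         (\<forall>w\<in>carrier W. (\<lambda>v. \<phi> v w) \<in> module_hom K V U) \<and> \<phi> \<in> extensional (carrier V) \<and>
         (\<forall>((v, w), u)\<in>P. \<phi> v w = u))"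

definition tensor_rel :: "'k ring \<Rightarrow> ('k, 'v) module \<Rightarrow> ('k, 'w) module \<Rightarrow> ('v \<times> 'w \<Rightarrow> 'k) set" where
  "tensor_rel K V W =
    (let S = carrier V \<times> carrier W; F = free_space K S; e = (\<lambda>v w. basis_vec K S (v, w)) in
      {e (v \<oplus>\<^bsub>V\<^esub> v') w \<ominus>\<^bsub>F\<^esub> (e v w \<oplus>\<^bsub>F\<^esub> e v' w) |v v' w.
         v \<in> carrier V \<and> v' \<in> carrier V \<and> w \<in> carrier W} \<union>
      {e v (w \<oplus>\<^bsub>W\<^esub> w') \<ominus>\<^bsub>F\<^esub> (e v w \<oplus>\<^bsub>F\<^esub> e v w') |v w w'.
         v \<in> carrier V \<and> w \<in> carrier W \<and> w' \<in> carrier W} \<union>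
      {e (c \<odot>\<^bsub>V\<^esub> v) w \<ominus>\<^bsub>F\<^esub> c \<odot>\<^bsub>F\<^esub> e v w |c v w.
         c \<in> carrier K \<and> v \<in> carrier V \<and> w \<in> carrier W} \<union>
      {e v (c \<odot>\<^bsub>W\<^esub> w) \<ominus>\<^bsub>F\<^esub> c \<odot>\<^bsub>F\<^esub> e v w |c v w.
         c \<in> carrier K \<and> v \<in> carrier V \<and> w \<in> carrier W})"

definition tensor_sub :: "'k ring \<Rightarrow> ('k, 'v) module \<Rightarrow> ('k, 'w) module \<Rightarrow> ('v \<times> 'w \<Rightarrow> 'k) set" where
  "tensor_sub K V W =
    module.span K (free_space K (carrier V \<times> carrier W)) (tensor_rel K V W)"

definition tensor ::
  "'k ring \<Rightarrow> ('k, 'v) module \<Rightarrow> ('k, 'w) module \<Rightarrow> ('k, ('v \<times> 'w \<Rightarrow> 'k) set) module" where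
  "tensor K V W = quot_space (free_space K (carrier V \<times> carrier W)) (tensor_sub K V W)"

definition pure_tensor ::
  "'k ring \<Rightarrow> ('k, 'v) module \<Rightarrow> ('k, 'w) module \<Rightarrow> 'v \<Rightarrow> 'w \<Rightarrow> ('v \<times> 'w \<Rightarrow> 'k) set" where
  "pure_tensor K V W v w =
    a_r_coset (free_space K (carrier V \<times> carrier W)) (tensor_sub K V W)
      (basis_vec K (carrier V \<times> carrier W) (v, w))"

text \<open>The tensor product of a finite list of vector spaces.\<close>

definition lcarrier :: "('k, 'v) module list \<Rightarrow> 'v list set" where
  "lcarrier Vs = {vs. list_all2 (\<lambda>v V. v \<in> carrier V) vs Vs}"

definition ltensor_rel :: "'k ring \<Rightarrow> ('k, 'v) module list \<Rightarrow> ('v list \<Rightarrow> 'k) set" where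
  "ltensor_rel K Vs =
    (let S = lcarrier Vs; F = free_space K S; e = basis_vec K S in
      {e (vs[i := v \<oplus>\<^bsub>Vs ! i\<^esub> v']) \<ominus>\<^bsub>F\<^esub> (e (vs[i := v]) \<oplus>\<^bsub>F\<^esub> e (vs[i := v'])) |vs i v v'.
         vs \<in> S \<and> i < length Vs \<and> v \<in> carrier (Vs ! i) \<and> v' \<in> carrier (Vs ! i)} \<union>
      {e (vs[i := c \<odot>\<^bsub>Vs ! i\<^esub> v]) \<ominus>\<^bsub>F\<^esub> c \<odot>\<^bsub>F\<^esub> e (vs[i := v]) |vs i c v.
         vs \<in> S \<and> i < length Vs \<and> c \<in> carrier K \<and> v \<in> carrier (Vs ! i)})"

definition ltensor_sub :: "'k ring \<Rightarrow> ('k, 'v) module list \<Rightarrow> ('v list \<Rightarrow> 'k) set" where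
  "ltensor_sub K Vs = module.span K (free_space K (lcarrier Vs)) (ltensor_rel K Vs)"

definition ltensor :: "'k ring \<Rightarrow> ('k, 'v) module list \<Rightarrow> ('k, ('v list \<Rightarrow> 'k) set) module" where
  "ltensor K Vs = quot_space (free_space K (lcarrier Vs)) (ltensor_sub K Vs)"

definition pure_ltensor :: "'k ring \<Rightarrow> ('k, 'v) module list \<Rightarrow> 'v list \<Rightarrow> ('v list \<Rightarrow> 'k) set" where
  "pure_ltensor K Vs vs =
    a_r_coset (free_space K (lcarrier Vs)) (ltensor_sub K Vs)
      (basis_vec K (lcarrier Vs) vs)"

definition perm_sgn :: "'k ring \<Rightarrow> (nat \<Rightarrow> nat) \<Rightarrow> 'k" where
  "perm_sgn K \<sigma> = (if evenperm \<sigma> then \<one>\<^bsub>K\<^esub> else \<ominus>\<^bsub>K\<^esub> \<one>\<^bsub>K\<^esub>)"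

definition perm_triv :: "'k ring \<Rightarrow> (nat \<Rightarrow> nat) \<Rightarrow> 'k" where
  "perm_triv K \<sigma> = \<one>\<^bsub>K\<^esub>"


section \<open>Linear categories and their modules\<close>

text \<open>\<open>Comp A B C g f\<close> is the composite of \<open>f\<close> from \<open>A\<close> to \<open>B\<close> and \<open>g\<close> from \<open>B\<close> to \<open>C\<close>.\<close>

record ('o, 'k, 'm) lincat =
  Obj :: "'o set"
  Hom :: "'o \<Rightarrow> 'o \<Rightarrow> ('k, 'm) module"
  Ident :: "'o \<Rightarrow> 'm"
  Comp :: "'o \<Rightarrow> 'o \<Rightarrow> 'o \<Rightarrow> 'm \<Rightarrow> 'm \<Rightarrow> 'm"

definition opposite :: "('o, 'k, 'm) lincat \<Rightarrow> ('o, 'k, 'm) lincat" where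
  "opposite C = \<lparr>Obj = Obj C, Hom = (\<lambda>A B. Hom C B A), Ident = Ident C,
    Comp = (\<lambda>A B D g f. Comp C D B A f g)\<rparr>"

locale lin_module =
  fixes K :: "'k ring" and C :: "('o, 'k, 'm) lincat"
    and M :: "'o \<Rightarrow> ('k, 'w) module" and act :: "'o \<Rightarrow> 'o \<Rightarrow> 'm \<Rightarrow> 'w \<Rightarrow> 'w"
  assumes space: "A \<in> Obj C \<Longrightarrow> vectorspace K (M A)"
    and hom: "\<lbrakk>A \<in> Obj C; B \<in> Obj C; f \<in> carrier (Hom C A B)\<rbrakk>
      \<Longrightarrow> act A B f \<in> module_hom K (M A) (M B)"
    and add: "\<lbrakk>A \<in> Obj C; B \<in> Obj C; f \<in> carrier (Hom C A B); g \<in> carrier (Hom C A B);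
        v \<in> carrier (M A)\<rbrakk>
      \<Longrightarrow> act A B (f \<oplus>\<^bsub>Hom C A B\<^esub> g) v = act A B f v \<oplus>\<^bsub>M B\<^esub> act A B g v"
    and smult: "\<lbrakk>A \<in> Obj C; B \<in> Obj C; f \<in> carrier (Hom C A B); c \<in> carrier K; v \<in> carrier (M A)\<rbrakk>
      \<Longrightarrow> act A B (c \<odot>\<^bsub>Hom C A B\<^esub> f) v = c \<odot>\<^bsub>M B\<^esub> act A B f v"
    and ident: "\<lbrakk>A \<in> Obj C; v \<in> carrier (M A)\<rbrakk> \<Longrightarrow> act A A (Ident C A) v = v"
    and comp: "\<lbrakk>A \<in> Obj C; B \<in> Obj C; D \<in> Obj C; f \<in> carrier (Hom C A B);
        g \<in> carrier (Hom C B D); v \<in> carrier (M A)\<rbrakk>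
      \<Longrightarrow> act A D (Comp C A B D g f) v = act B D g (act A B f v)"

definition lin_module_hom ::
  "'k ring \<Rightarrow> ('o, 'k, 'm) lincat
    \<Rightarrow> ('o \<Rightarrow> ('k, 'v) module) \<Rightarrow> ('o \<Rightarrow> 'o \<Rightarrow> 'm \<Rightarrow> 'v \<Rightarrow> 'v)
    \<Rightarrow> ('o \<Rightarrow> ('k, 'w) module) \<Rightarrow> ('o \<Rightarrow> 'o \<Rightarrow> 'm \<Rightarrow> 'w \<Rightarrow> 'w)
    \<Rightarrow> ('o \<Rightarrow> 'v \<Rightarrow> 'w) \<Rightarrow> bool" where
  "lin_module_hom K C M act N act' \<eta> \<longleftrightarrow>
    (\<forall>A\<in>Obj C. \<eta> A \<in> module_hom K (M A) (N A)) \<and>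
    (\<forall>A\<in>Obj C. \<forall>B\<in>Obj C. \<forall>f\<in>carrier (Hom C A B). \<forall>v\<in>carrier (M A).
      \<eta> B (act A B f v) = act' A B f (\<eta> A v))"

definition same_action ::
  "('o, 'k, 'm) lincat \<Rightarrow> ('o \<Rightarrow> ('k, 'v) module)
    \<Rightarrow> ('o \<Rightarrow> 'o \<Rightarrow> 'm \<Rightarrow> 'v \<Rightarrow> 'v) \<Rightarrow> ('o \<Rightarrow> 'o \<Rightarrow> 'm \<Rightarrow> 'v \<Rightarrow> 'v) \<Rightarrow> bool" where
  "same_action C M act act' \<longleftrightarrow>
    (\<forall>A\<in>Obj C. \<forall>B\<in>Obj C. \<forall>f\<in>carrier (Hom C A B). \<forall>v\<in>carrier (M A).
      act A B f v = act' A B f v)"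


section \<open>Pairs of finite sets\<close>

type_synonym 'a bob = "'a set \<times> 'a set"
type_synonym 'a bmor = "('a \<Rightarrow> 'a) \<times> ('a \<Rightarrow> 'a)"

definition FB_hom :: "'x set \<Rightarrow> 'y set \<Rightarrow> ('x \<Rightarrow> 'y) set" where
  "FB_hom X Y = {f \<in> extensional X. bij_betw f X Y}"

definition B_obj :: "'a bob set" where
  "B_obj = {(X, Y). finite X \<and> finite Y}"

definition B_hom :: "'a bob \<Rightarrow> 'a bob \<Rightarrow> 'a bmor set" where
  "B_hom A B = FB_hom (fst A) (fst B) \<times> FB_hom (snd A) (snd B)"

definition B_restrict :: "'a bmor \<Rightarrow> 'a bob \<Rightarrow> 'a bmor" where
  "B_restrict h A = (restrict (fst h) (fst A), restrict (snd h) (snd A))"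

definition B_image :: "'a bmor \<Rightarrow> 'a bob \<Rightarrow> 'a bob" where
  "B_image h A = (fst h ` fst A, snd h ` snd A)"

definition B_id :: "'a bob \<Rightarrow> 'a bmor" where
  "B_id A = B_restrict (id, id) A"

definition B_comp :: "'a bob \<Rightarrow> 'a bmor \<Rightarrow> 'a bmor \<Rightarrow> 'a bmor" where
  "B_comp A g f = (compose (fst A) (fst g) (fst f), compose (snd A) (snd g) (snd f))"

definition B_inv :: "'a bob \<Rightarrow> 'a bob \<Rightarrow> 'a bmor \<Rightarrow> 'a bmor" where
  "B_inv A B h =
    (restrict (inv_into (fst A) (fst h)) (fst B), restrict (inv_into (snd A) (snd h)) (snd B))"

record ('a, 'k, 'w) kBmod =
  kb_sp :: "'a bob \<Rightarrow> ('k, 'w) module"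
  kb_act :: "'a bob \<Rightarrow> 'a bob \<Rightarrow> 'a bmor \<Rightarrow> 'w \<Rightarrow> 'w"

locale kB_module =
  fixes K :: "'k ring" and F :: "('a, 'k, 'w) kBmod"
  assumes space: "A \<in> B_obj \<Longrightarrow> vectorspace K (kb_sp F A)"
    and hom: "\<lbrakk>A \<in> B_obj; B \<in> B_obj; h \<in> B_hom A B\<rbrakk>
      \<Longrightarrow> kb_act F A B h \<in> module_hom K (kb_sp F A) (kb_sp F B)"
    and ident: "\<lbrakk>A \<in> B_obj; v \<in> carrier (kb_sp F A)\<rbrakk> \<Longrightarrow> kb_act F A A (B_id A) v = v"
    and comp: "\<lbrakk>A \<in> B_obj; B \<in> B_obj; C \<in> B_obj; f \<in> B_hom A B; g \<in> B_hom B C;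
        v \<in> carrier (kb_sp F A)\<rbrakk>
      \<Longrightarrow> kb_act F A C (B_comp A g f) v = kb_act F B C g (kb_act F A B f v)"


section \<open>The category \<open>D_minus\<close>\<close>

text \<open>
  \<open>adjoin X n\<close> is the disjoint union of \<open>X\<close> and \<open>{1, ..., n}\<close>. The set \<open>uwb_maps A B\<close> of pairs
  of bijections is empty, hence the space of morphisms is zero, unless the two components of \<open>B\<close>
  exceed those of \<open>A\<close> in cardinality by the same \<open>n \<ge> 0\<close>.
\<close>

type_synonym 'a umor = "('a + nat \<Rightarrow> 'a) \<times> ('a + nat \<Rightarrow> 'a)"

abbreviation adjoin :: "'a set \<Rightarrow> nat \<Rightarrow> ('a + nat) set" where
  "adjoin X n \<equiv> Sum_Type.Plus X {1..n}"

definition uwb_deg :: "'a bob \<Rightarrow> 'a bob \<Rightarrow> nat" where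
  "uwb_deg A B = card (fst B) - card (fst A)"

definition uwb_maps :: "'a bob \<Rightarrow> 'a bob \<Rightarrow> 'a umor set" where
  "uwb_maps A B = FB_hom (adjoin (fst A) (uwb_deg A B)) (fst B) \<times>
                  FB_hom (adjoin (snd A) (uwb_deg A B)) (snd B)"

definition uwb_twist :: "'a set \<Rightarrow> nat \<Rightarrow> (nat \<Rightarrow> nat) \<Rightarrow> ('a + nat \<Rightarrow> 'a) \<Rightarrow> 'a + nat \<Rightarrow> 'a" where
  "uwb_twist X n \<sigma> f = restrict (f \<circ> map_sum id \<sigma>) (adjoin X n)"

definition uwb_sub :: "'k ring \<Rightarrow> 'a bob \<Rightarrow> 'a bob \<Rightarrow> ('a umor \<Rightarrow> 'k) set" where
  "uwb_sub K A B =
    (let S = uwb_maps A B; F = free_space K S; n = uwb_deg A B in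
      module.span K F
        {basis_vec K S (uwb_twist (fst A) n \<sigma> f, uwb_twist (snd A) n \<sigma> g)
           \<ominus>\<^bsub>F\<^esub> perm_sgn K \<sigma> \<odot>\<^bsub>F\<^esub> basis_vec K S (f, g) |\<sigma> f g.
         \<sigma> permutes {1..n} \<and> (f, g) \<in> S})"

definition uwb_hom :: "'k ring \<Rightarrow> 'a bob \<Rightarrow> 'a bob \<Rightarrow> ('k, ('a umor \<Rightarrow> 'k) set) module" where
  "uwb_hom K A B = quot_space (free_space K (uwb_maps A B)) (uwb_sub K A B)"

definition uwb_cls :: "'k ring \<Rightarrow> 'a bob \<Rightarrow> 'a bob \<Rightarrow> 'a umor \<Rightarrow> ('a umor \<Rightarrow> 'k) set" where
  "uwb_cls K A B h =
    a_r_coset (free_space K (uwb_maps A B)) (uwb_sub K A B) (basis_vec K (uwb_maps A B) h)"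

definition uwb_glue ::
  "'a set \<Rightarrow> nat \<Rightarrow> nat \<Rightarrow> ('a + nat \<Rightarrow> 'a) \<Rightarrow> ('a + nat \<Rightarrow> 'a) \<Rightarrow> 'a + nat \<Rightarrow> 'a" where
  "uwb_glue X n r g f =
    restrict
      (\<lambda>t. case t of
          Inl x \<Rightarrow> g (Inl (f (Inl x)))
        | Inr i \<Rightarrow> if i \<le> n then g (Inl (f (Inr i))) else g (Inr (i - n)))
      (adjoin X (n + r))"

definition uwb_comp ::
  "'k ring \<Rightarrow> 'a bob \<Rightarrow> 'a bob \<Rightarrow> 'a bob
    \<Rightarrow> ('a umor \<Rightarrow> 'k) set \<Rightarrow> ('a umor \<Rightarrow> 'k) set \<Rightarrow> ('a umor \<Rightarrow> 'k) set" where
  "uwb_comp K A B C =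
    bilin_ext K (uwb_hom K B C) (uwb_hom K A B) (uwb_hom K A C)
      {((uwb_cls K B C (g1, g2), uwb_cls K A B (f1, f2)),
        uwb_cls K A C (uwb_glue (fst A) (uwb_deg A B) (uwb_deg B C) g1 f1,
                       uwb_glue (snd A) (uwb_deg A B) (uwb_deg B C) g2 f2)) |g1 g2 f1 f2.
       (g1, g2) \<in> uwb_maps B C \<and> (f1, f2) \<in> uwb_maps A B}"

definition uwb_zero :: "'k ring \<Rightarrow> 'a bob \<Rightarrow> 'a bob \<Rightarrow> 'a bmor \<Rightarrow> ('a umor \<Rightarrow> 'k) set" where
  "uwb_zero K A B h =
    uwb_cls K A B (restrict (case_sum (fst h) undefined) (adjoin (fst A) 0),
                   restrict (case_sum (snd h) undefined) (adjoin (snd A) 0))"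

definition uwb :: "'k ring \<Rightarrow> ('a bob, 'k, ('a umor \<Rightarrow> 'k) set) lincat" where
  "uwb K = \<lparr>Obj = B_obj, Hom = uwb_hom K, Ident = (\<lambda>A. uwb_zero K A A (B_id A)), Comp = uwb_comp K\<rparr>"

definition D_minus :: "'k ring \<Rightarrow> ('a bob, 'k, ('a umor \<Rightarrow> 'k) set) lincat" where
  "D_minus K = opposite (uwb K)"

text \<open>The morphism \<open>c_{x,y}\<close> of \<open>D_minus\<close> from \<open>(X \<squnion> {x}, Y \<squnion> {y})\<close> to \<open>(X, Y)\<close>.\<close>

definition contr :: "'k ring \<Rightarrow> 'a set \<Rightarrow> 'a set \<Rightarrow> 'a \<Rightarrow> 'a \<Rightarrow> ('a umor \<Rightarrow> 'k) set" where
  "contr K X Y x y =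
    uwb_cls K (X, Y) (insert x X, insert y Y)
      (restrict (case_sum id (\<lambda>_. x)) (adjoin X 1), restrict (case_sum id (\<lambda>_. y)) (adjoin Y 1))"

text \<open>
  A \<open>D_minus\<close>-module structure on a \<open>kB\<close>-module. A bijection \<open>h\<close> from \<open>A\<close> to \<open>B\<close> is a morphism of
  \<open>D_minus\<close> from \<open>B\<close> to \<open>A\<close>, which acts as the inverse of \<open>h\<close>.
\<close>

definition D_structure ::
  "'k ring \<Rightarrow> ('a, 'k, 'w) kBmod
    \<Rightarrow> ('a bob \<Rightarrow> 'a bob \<Rightarrow> ('a umor \<Rightarrow> 'k) set \<Rightarrow> 'w \<Rightarrow> 'w) \<Rightarrow> bool" where
  "D_structure K F act \<longleftrightarrow>
    kB_module K F \<and> lin_module K (D_minus K) (kb_sp F) act \<and>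
    (\<forall>A\<in>B_obj. \<forall>B\<in>B_obj. \<forall>h\<in>B_hom A B. \<forall>v\<in>carrier (kb_sp F B).
      act B A (uwb_zero K A B h) v = kb_act F B A (B_inv A B h) v)"


section \<open>Convolution\<close>

text \<open>
  A pair \<open>(A, v)\<close> stands for an element \<open>v\<close> of the value of a \<open>kB\<close>-module at \<open>A\<close>.
\<close>

definition transport :: "('a, 'k, 'w) kBmod \<Rightarrow> 'a bmor \<Rightarrow> 'a bob \<times> 'w \<Rightarrow> 'a bob \<times> 'w" where
  "transport F h = (\<lambda>(A, v). (B_image h A, kb_act F A (B_image h A) (B_restrict h A) v))"

definition is_decomp :: "'a bob list \<Rightarrow> 'a bob \<Rightarrow> bool" where
  "is_decomp Ds A \<longleftrightarrow>
    (\<Union>D\<in>set Ds. fst D) = fst A \<and> (\<Union>D\<in>set Ds. snd D) = snd A \<and>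
    (\<forall>i<length Ds. \<forall>j<i. fst (Ds ! i) \<inter> fst (Ds ! j) = {} \<and> snd (Ds ! i) \<inter> snd (Ds ! j) = {})"

definition decomps2 :: "'a bob \<Rightarrow> ('a bob \<times> 'a bob) set" where
  "decomps2 A = {(A1, A2). is_decomp [A1, A2] A}"

definition decomps :: "nat \<Rightarrow> 'a bob \<Rightarrow> 'a bob list set" where
  "decomps d A = {Ds. length Ds = d \<and> is_decomp Ds A}"

type_synonym ('a, 'k, 'v, 'w) cnv = "'a bob \<times> 'a bob \<Rightarrow> ('v \<times> 'w \<Rightarrow> 'k) set"

definition conv_summand ::
  "'k ring \<Rightarrow> ('a, 'k, 'v) kBmod \<Rightarrow> ('a, 'k, 'w) kBmod \<Rightarrow> 'a bob \<times> 'a bob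
    \<Rightarrow> ('k, ('v \<times> 'w \<Rightarrow> 'k) set) module" where
  "conv_summand K F G = (\<lambda>(A1, A2). tensor K (kb_sp F A1) (kb_sp G A2))"

definition conv_sp ::
  "'k ring \<Rightarrow> ('a, 'k, 'v) kBmod \<Rightarrow> ('a, 'k, 'w) kBmod \<Rightarrow> 'a bob
    \<Rightarrow> ('k, ('a, 'k, 'v, 'w) cnv) module" where
  "conv_sp K F G A = dsum (decomps2 A) (conv_summand K F G)"

definition conv_elt ::
  "'k ring \<Rightarrow> ('a, 'k, 'v) kBmod \<Rightarrow> ('a, 'k, 'w) kBmod \<Rightarrow> 'a bob
    \<Rightarrow> 'a bob \<times> 'v \<Rightarrow> 'a bob \<times> 'w \<Rightarrow> ('a, 'k, 'v, 'w) cnv" where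
  "conv_elt K F G A p q =
    dsum_incl (decomps2 A) (conv_summand K F G) (fst p, fst q)
      (pure_tensor K (kb_sp F (fst p)) (kb_sp G (fst q)) (snd p) (snd q))"

definition conv_terms ::
  "('a, 'k, 'v) kBmod \<Rightarrow> ('a, 'k, 'w) kBmod \<Rightarrow> 'a bob \<Rightarrow> (('a bob \<times> 'v) \<times> ('a bob \<times> 'w)) set" where
  "conv_terms F G A = {((A1, v), (A2, w)).
     is_decomp [A1, A2] A \<and> v \<in> carrier (kb_sp F A1) \<and> w \<in> carrier (kb_sp G A2)}"

definition conv :: "'k ring \<Rightarrow> ('a, 'k, 'v) kBmod \<Rightarrow> ('a, 'k, 'w) kBmod
    \<Rightarrow> ('a, 'k, ('a, 'k, 'v, 'w) cnv) kBmod" where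
  "conv K F G =
    \<lparr>kb_sp = conv_sp K F G,
     kb_act = (\<lambda>A B h. lin_ext K (conv_sp K F G A) (conv_sp K F G B)
       {(conv_elt K F G A p q, conv_elt K F G B (transport F h p) (transport G h q)) |p q.
        (p, q) \<in> conv_terms F G A})\<rparr>"

definition conv_map ::
  "'k ring \<Rightarrow> ('a, 'k, 'v) kBmod \<Rightarrow> ('a, 'k, 'w) kBmod \<Rightarrow> ('a, 'k, 'v2) kBmod \<Rightarrow> ('a, 'k, 'w2) kBmod
    \<Rightarrow> ('a bob \<Rightarrow> 'v \<Rightarrow> 'v2) \<Rightarrow> ('a bob \<Rightarrow> 'w \<Rightarrow> 'w2)
    \<Rightarrow> 'a bob \<Rightarrow> ('a, 'k, 'v, 'w) cnv \<Rightarrow> ('a, 'k, 'v2, 'w2) cnv" where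
  "conv_map K F G F' G' \<eta> \<theta> A =
    lin_ext K (conv_sp K F G A) (conv_sp K F' G' A)
      {(conv_elt K F G A (A1, v) (A2, w), conv_elt K F' G' A (A1, \<eta> A1 v) (A2, \<theta> A2 w)) |A1 v A2 w.
       ((A1, v), (A2, w)) \<in> conv_terms F G A}"

text \<open>
  The convolution power of exponent \<open>d\<close> is the direct sum, over the ordered decompositions into
  \<open>d\<close> parts, of the tensor products of \<open>d\<close> factors. A binary convolution iterated \<open>d\<close> times would
  have a type depending on \<open>d\<close>.
\<close>

type_synonym ('a, 'k, 'w) pow = "'a bob list \<Rightarrow> ('w list \<Rightarrow> 'k) set"

definition pow_summand ::
  "'k ring \<Rightarrow> ('a, 'k, 'w) kBmod \<Rightarrow> 'a bob list \<Rightarrow> ('k, ('w list \<Rightarrow> 'k) set) module" where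
  "pow_summand K F Ds = ltensor K (map (kb_sp F) Ds)"

definition pow_sp ::
  "'k ring \<Rightarrow> ('a, 'k, 'w) kBmod \<Rightarrow> nat \<Rightarrow> 'a bob \<Rightarrow> ('k, ('a, 'k, 'w) pow) module" where
  "pow_sp K F d A = dsum (decomps d A) (pow_summand K F)"

definition pow_terms :: "('a, 'k, 'w) kBmod \<Rightarrow> 'a bob \<Rightarrow> ('a bob \<times> 'w) list set" where
  "pow_terms F A =
    {ps. is_decomp (map fst ps) A \<and> (\<forall>(D, v)\<in>set ps. v \<in> carrier (kb_sp F D))}"

definition pow_elt ::
  "'k ring \<Rightarrow> ('a, 'k, 'w) kBmod \<Rightarrow> 'a bob \<Rightarrow> ('a bob \<times> 'w) list \<Rightarrow> ('a, 'k, 'w) pow" where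
  "pow_elt K F A ps =
    dsum_incl (decomps (length ps) A) (pow_summand K F) (map fst ps)
      (pure_ltensor K (map (kb_sp F) (map fst ps)) (map snd ps))"

text \<open>
  The coinvariants of the symmetric group on the convolution power twisted by a character \<open>\<chi>\<close>,
  which is \<open>perm_triv\<close> or \<open>perm_sgn\<close>. Pure tensors span the convolution power.
\<close>

definition coinv_sub ::
  "'k ring \<Rightarrow> ((nat \<Rightarrow> nat) \<Rightarrow> 'k) \<Rightarrow> ('a, 'k, 'w) kBmod \<Rightarrow> nat \<Rightarrow> 'a bob \<Rightarrow> ('a, 'k, 'w) pow set" where
  "coinv_sub K \<chi> F d A =
    module.span K (pow_sp K F d A)
      {pow_elt K F A (permute_list \<sigma> ps) \<ominus>\<^bsub>pow_sp K F d A\<^esub> \<chi> \<sigma> \<odot>\<^bsub>pow_sp K F d A\<^esub> pow_elt K F A ps |\<sigma> ps.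
       ps \<in> pow_terms F A \<and> length ps = d \<and> \<sigma> permutes {..<d}}"

definition coinv_sp ::
  "'k ring \<Rightarrow> ((nat \<Rightarrow> nat) \<Rightarrow> 'k) \<Rightarrow> ('a, 'k, 'w) kBmod \<Rightarrow> 'a bob \<Rightarrow> nat
    \<Rightarrow> ('k, ('a, 'k, 'w) pow set) module" where
  "coinv_sp K \<chi> F A d = quot_space (pow_sp K F d A) (coinv_sub K \<chi> F d A)"

type_synonym ('a, 'k, 'w) star = "nat \<Rightarrow> ('a, 'k, 'w) pow set"

definition star_sp ::
  "'k ring \<Rightarrow> ((nat \<Rightarrow> nat) \<Rightarrow> 'k) \<Rightarrow> ('a, 'k, 'w) kBmod \<Rightarrow> 'a bob
    \<Rightarrow> ('k, ('a, 'k, 'w) star) module" where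
  "star_sp K \<chi> F A = dsum UNIV (coinv_sp K \<chi> F A)"

definition star_elt ::
  "'k ring \<Rightarrow> ((nat \<Rightarrow> nat) \<Rightarrow> 'k) \<Rightarrow> ('a, 'k, 'w) kBmod \<Rightarrow> 'a bob
    \<Rightarrow> ('a bob \<times> 'w) list \<Rightarrow> ('a, 'k, 'w) star" where
  "star_elt K \<chi> F A ps =
    dsum_incl UNIV (coinv_sp K \<chi> F A) (length ps)
      (a_r_coset (pow_sp K F (length ps) A) (coinv_sub K \<chi> F (length ps) A) (pow_elt K F A ps))"

definition star ::
  "'k ring \<Rightarrow> ((nat \<Rightarrow> nat) \<Rightarrow> 'k) \<Rightarrow> ('a, 'k, 'w) kBmod \<Rightarrow> ('a, 'k, ('a, 'k, 'w) star) kBmod" where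
  "star K \<chi> F =
    \<lparr>kb_sp = star_sp K \<chi> F,
     kb_act = (\<lambda>A B h. lin_ext K (star_sp K \<chi> F A) (star_sp K \<chi> F B)
       {(star_elt K \<chi> F A ps, star_elt K \<chi> F B (map (transport F h) ps)) |ps. ps \<in> pow_terms F A})\<rparr>"

definition star_map ::
  "'k ring \<Rightarrow> ((nat \<Rightarrow> nat) \<Rightarrow> 'k) \<Rightarrow> ('a, 'k, 'v) kBmod \<Rightarrow> ('a, 'k, 'w) kBmod
    \<Rightarrow> ('a bob \<Rightarrow> 'v \<Rightarrow> 'w) \<Rightarrow> 'a bob \<Rightarrow> ('a, 'k, 'v) star \<Rightarrow> ('a, 'k, 'w) star" where
  "star_map K \<chi> F G \<eta> A =
    lin_ext K (star_sp K \<chi> F A) (star_sp K \<chi> G A)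
      {(star_elt K \<chi> F A ps, star_elt K \<chi> G A (map (\<lambda>(D, v). (D, \<eta> D v)) ps)) |ps. ps \<in> pow_terms F A}"

abbreviation "Sym_star K \<equiv> star K (perm_triv K)"
abbreviation "Lambda_star K \<equiv> star K (perm_sgn K)"


section \<open>Non-unital operads\<close>

record ('l, 'k, 'v) operad =
  op_sp :: "'l set \<Rightarrow> ('k, 'v) module"
  op_act :: "'l set \<Rightarrow> 'l set \<Rightarrow> ('l \<Rightarrow> 'l) \<Rightarrow> 'v \<Rightarrow> 'v"
  op_comp :: "'l set \<Rightarrow> 'l \<Rightarrow> 'l set \<Rightarrow> 'v \<Rightarrow> 'v \<Rightarrow> 'v"

text \<open>
  \<open>op_comp P A x B a b\<close> is the composite of \<open>a \<in> P A\<close> and \<open>b \<in> P B\<close> at the input \<open>x \<in> A\<close>, where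
  \<open>B\<close> is disjoint from \<open>A - {x}\<close>; the label \<open>x\<close> itself may occur in \<open>B\<close>.
\<close>

definition composable :: "'l set \<Rightarrow> 'l \<Rightarrow> 'l set \<Rightarrow> bool" where
  "composable A x B \<longleftrightarrow> finite A \<and> finite B \<and> x \<in> A \<and> (A - {x}) \<inter> B = {}"

locale nonunital_operad =
  fixes K :: "'k ring" and P :: "('l, 'k, 'v) operad"
  assumes space: "finite A \<Longrightarrow> vectorspace K (op_sp P A)"
    and hom: "\<lbrakk>finite A; finite B; f \<in> FB_hom A B\<rbrakk>
      \<Longrightarrow> op_act P A B f \<in> module_hom K (op_sp P A) (op_sp P B)"
    and ident: "\<lbrakk>finite A; a \<in> carrier (op_sp P A)\<rbrakk> \<Longrightarrow> op_act P A A (restrict id A) a = a"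
    and functorial: "\<lbrakk>finite A; finite B; finite C; f \<in> FB_hom A B; g \<in> FB_hom B C;
        a \<in> carrier (op_sp P A)\<rbrakk>
      \<Longrightarrow> op_act P A C (compose A g f) a = op_act P B C g (op_act P A B f a)"
    and comp_right: "\<lbrakk>composable A x B; a \<in> carrier (op_sp P A)\<rbrakk>
      \<Longrightarrow> op_comp P A x B a \<in> module_hom K (op_sp P B) (op_sp P ((A - {x}) \<union> B))"
    and comp_left: "\<lbrakk>composable A x B; b \<in> carrier (op_sp P B)\<rbrakk>
      \<Longrightarrow> (\<lambda>a. op_comp P A x B a b) \<in> module_hom K (op_sp P A) (op_sp P ((A - {x}) \<union> B))"
    and equivariant: "\<lbrakk>composable A x B; composable A' (f x) B'; f \<in> FB_hom A A'; g \<in> FB_hom B B';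
        a \<in> carrier (op_sp P A); b \<in> carrier (op_sp P B)\<rbrakk>
      \<Longrightarrow> op_comp P A' (f x) B' (op_act P A A' f a) (op_act P B B' g b) =
          op_act P ((A - {x}) \<union> B) ((A' - {f x}) \<union> B')
            (restrict (\<lambda>t. if t \<in> B then g t else f t) ((A - {x}) \<union> B)) (op_comp P A x B a b)"
    and assoc_sequential: "\<lbrakk>composable A x B; y \<in> B; composable ((A - {x}) \<union> B) y C;
        a \<in> carrier (op_sp P A); b \<in> carrier (op_sp P B); c \<in> carrier (op_sp P C)\<rbrakk>
      \<Longrightarrow> op_comp P ((A - {x}) \<union> B) y C (op_comp P A x B a b) c =
          op_comp P A x ((B - {y}) \<union> C) a (op_comp P B y C b c)"
    and assoc_parallel: "\<lbrakk>x \<noteq> y; composable A x B; composable A y C; B \<inter> C = {};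
        a \<in> carrier (op_sp P A); b \<in> carrier (op_sp P B); c \<in> carrier (op_sp P C)\<rbrakk>
      \<Longrightarrow> op_comp P ((A - {x}) \<union> B) y C (op_comp P A x B a b) c =
          op_comp P ((A - {y}) \<union> C) x B (op_comp P A y C a c) b"

definition operad_hom ::
  "'k ring \<Rightarrow> ('l, 'k, 'v) operad \<Rightarrow> ('l, 'k, 'w) operad \<Rightarrow> ('l set \<Rightarrow> 'v \<Rightarrow> 'w) \<Rightarrow> bool" where
  "operad_hom K P Q \<phi> \<longleftrightarrow>
    (\<forall>A. finite A \<longrightarrow> \<phi> A \<in> module_hom K (op_sp P A) (op_sp Q A)) \<and>
    (\<forall>A B f a. finite A \<and> finite B \<and> f \<in> FB_hom A B \<and> a \<in> carrier (op_sp P A) \<longrightarrow>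
      \<phi> B (op_act P A B f a) = op_act Q A B f (\<phi> A a)) \<and>
    (\<forall>A x B a b. composable A x B \<and> a \<in> carrier (op_sp P A) \<and> b \<in> carrier (op_sp P B) \<longrightarrow>
      \<phi> ((A - {x}) \<union> B) (op_comp P A x B a b) = op_comp Q A x B (\<phi> A a) (\<phi> B b))"

text \<open>
  Operads have labels in \<open>'a option\<close> and \<open>kB\<close>-modules have labels in \<open>'a\<close>: a finite set \<open>X\<close> of labels
  is identified with \<open>Some ` X\<close>, and \<open>None\<close> is the additional point in \<open>X \<squnion> {*}\<close>.
\<close>

abbreviation pointed :: "'a set \<Rightarrow> 'a option set" where
  "pointed X \<equiv> insert None (Some ` X)"

definition op_kB :: "('a option, 'k, 'v) operad \<Rightarrow> ('a, 'k, 'v) kBmod" where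
  "op_kB P =
    \<lparr>kb_sp = (\<lambda>(X, Y). if card Y = 1 then op_sp P (Some ` X) else zero_space \<zero>\<^bsub>op_sp P {}\<^esub>),
     kb_act = (\<lambda>(X, Y) (U, V) (f, g).
       if card Y = 1 then op_act P (Some ` X) (Some ` U) (restrict (map_option f) (Some ` X))
       else (\<lambda>v. v))\<rparr>"

definition op_kB_map ::
  "('a option, 'k, 'w) operad \<Rightarrow> ('a option set \<Rightarrow> 'v \<Rightarrow> 'w) \<Rightarrow> 'a bob \<Rightarrow> 'v \<Rightarrow> 'w" where
  "op_kB_map Q \<phi> = (\<lambda>(X, Y). if card Y = 1 then \<phi> (Some ` X) else (\<lambda>_. \<zero>\<^bsub>op_sp Q {}\<^esub>))"

definition delta_sub :: "'k ring \<Rightarrow> ('a option, 'k, 'v) operad \<Rightarrow> 'a set \<Rightarrow> 'v set" where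
  "delta_sub K P X =
    module.span K (op_sp P (pointed X))
      {op_comp P (pointed X1) None (pointed X2) a b
         \<ominus>\<^bsub>op_sp P (pointed X)\<^esub> op_comp P (pointed X2) None (pointed X1) b a |X1 X2 a b.
       X1 \<union> X2 = X \<and> X1 \<inter> X2 = {} \<and>
       a \<in> carrier (op_sp P (pointed X1)) \<and> b \<in> carrier (op_sp P (pointed X2))}"

definition delta_sp :: "'k ring \<Rightarrow> ('a option, 'k, 'v) operad \<Rightarrow> 'a set \<Rightarrow> ('k, 'v set) module" where
  "delta_sp K P X = quot_space (op_sp P (pointed X)) (delta_sub K P X)"

definition delta_cls :: "'k ring \<Rightarrow> ('a option, 'k, 'v) operad \<Rightarrow> 'a set \<Rightarrow> 'v \<Rightarrow> 'v set" where
  "delta_cls K P X c = a_r_coset (op_sp P (pointed X)) (delta_sub K P X) c"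

definition delta :: "'k ring \<Rightarrow> ('a option, 'k, 'v) operad \<Rightarrow> ('a, 'k, 'v set) kBmod" where
  "delta K P =
    \<lparr>kb_sp = (\<lambda>(X, Y). if Y = {} then delta_sp K P X else zero_space {}),
     kb_act = (\<lambda>(X, Y) (U, V) (f, g).
       if Y = {} then
         lin_ext K (delta_sp K P X) (delta_sp K P U)
           {(delta_cls K P X c, delta_cls K P U
               (op_act P (pointed X) (pointed U) (restrict (map_option f) (pointed X)) c)) |c.
            c \<in> carrier (op_sp P (pointed X))}
       else (\<lambda>w. w))\<rparr>"

definition delta_map ::
  "'k ring \<Rightarrow> ('a option, 'k, 'v) operad \<Rightarrow> ('a option, 'k, 'w) operad
    \<Rightarrow> ('a option set \<Rightarrow> 'v \<Rightarrow> 'w) \<Rightarrow> 'a bob \<Rightarrow> 'v set \<Rightarrow> 'w set" where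
  "delta_map K P Q \<phi> = (\<lambda>(X, Y).
     if Y = {} then
       lin_ext K (delta_sp K P X) (delta_sp K Q X)
         {(delta_cls K P X c, delta_cls K Q X (\<phi> (pointed X) c)) |c. c \<in> carrier (op_sp P (pointed X))}
     else (\<lambda>_. {}))"

definition delta_act ::
  "'k ring \<Rightarrow> ('a option, 'k, 'v) operad \<Rightarrow> 'a set \<Rightarrow> 'a \<Rightarrow> 'a set \<Rightarrow> 'v set \<Rightarrow> 'v \<Rightarrow> 'v set" where
  "delta_act K P X x Z w b =
    lin_ext K (delta_sp K P X) (delta_sp K P ((X - {x}) \<union> Z))
      {(delta_cls K P X c,
        delta_cls K P ((X - {x}) \<union> Z) (op_comp P (pointed X) (Some x) (Some ` Z) c b)) |c.
       c \<in> carrier (op_sp P (pointed X))} w"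

text \<open>The class of \<open>b \<in> P Z\<close> with distinguished input \<open>x \<in> Z\<close>.\<close>

definition delta_mark ::
  "'k ring \<Rightarrow> ('a option, 'k, 'v) operad \<Rightarrow> 'a set \<Rightarrow> 'a \<Rightarrow> 'v \<Rightarrow> 'v set" where
  "delta_mark K P Z x b =
    delta_cls K P (Z - {x})
      (op_act P (Some ` Z) (pointed (Z - {x}))
        (restrict (\<lambda>t. if t = Some x then None else t) (Some ` Z)) b)"


section \<open>The contraction rule\<close>

definition LS :: "'k ring \<Rightarrow> ('a option, 'k, 'v) operad
    \<Rightarrow> ('a, 'k, ('a, 'k, ('a, 'k, 'v) star, ('a, 'k, 'v set) star) cnv) kBmod" where
  "LS K P = conv K (Lambda_star K (op_kB P)) (Sym_star K (delta K P))"

definition Lam :: "'k ring \<Rightarrow> ('a option, 'k, 'v) operad \<Rightarrow> ('a, 'k, ('a, 'k, 'v) star) kBmod" where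
  "Lam K P = Lambda_star K (op_kB P)"

definition Lam_map ::
  "'k ring \<Rightarrow> ('a option, 'k, 'v) operad \<Rightarrow> ('a option, 'k, 'w) operad
    \<Rightarrow> ('a option set \<Rightarrow> 'v \<Rightarrow> 'w) \<Rightarrow> 'a bob \<Rightarrow> ('a, 'k, 'v) star \<Rightarrow> ('a, 'k, 'w) star" where
  "Lam_map K P Q \<phi> = star_map K (perm_sgn K) (op_kB P) (op_kB Q) (op_kB_map Q \<phi>)"

definition LS_map ::
  "'k ring \<Rightarrow> ('a option, 'k, 'v) operad \<Rightarrow> ('a option, 'k, 'w) operad
    \<Rightarrow> ('a option set \<Rightarrow> 'v \<Rightarrow> 'w) \<Rightarrow> 'a bob
    \<Rightarrow> ('a, 'k, ('a, 'k, 'v) star, ('a, 'k, 'v set) star) cnv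
    \<Rightarrow> ('a, 'k, ('a, 'k, 'w) star, ('a, 'k, 'w set) star) cnv" where
  "LS_map K P Q \<phi> =
    conv_map K (Lambda_star K (op_kB P)) (Sym_star K (delta K P))
      (Lambda_star K (op_kB Q)) (Sym_star K (delta K Q))
      (Lam_map K P Q \<phi>)
      (star_map K (perm_triv K) (delta K P) (delta K Q) (delta_map K P Q \<phi>))"

definition total :: "('a bob \<times> 'w) list \<Rightarrow> 'a bob" where
  "total ps = (\<Union>p\<in>set ps. fst (fst p), \<Union>p\<in>set ps. snd (fst p))"

text \<open>The element \<open>a_1 \<and> ... \<and> a_n \<cdot> w_1 ... w_r\<close> at \<open>A\<close>.\<close>

definition LS_term ::
  "'k ring \<Rightarrow> ('a option, 'k, 'v) operad \<Rightarrow> 'a bob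
    \<Rightarrow> ('a bob \<times> 'v) list \<Rightarrow> ('a bob \<times> 'v set) list
    \<Rightarrow> ('a, 'k, ('a, 'k, 'v) star, ('a, 'k, 'v set) star) cnv" where
  "LS_term K P A as ws =
    conv_elt K (Lambda_star K (op_kB P)) (Sym_star K (delta K P)) A
      (total as, star_elt K (perm_sgn K) (op_kB P) (total as) as)
      (total ws, star_elt K (perm_triv K) (delta K P) (total ws) ws)"

definition contr_rule ::
  "'k ring \<Rightarrow> ('a option, 'k, 'v) operad
    \<Rightarrow> ('a bob \<Rightarrow> 'a bob \<Rightarrow> ('a umor \<Rightarrow> 'k) set
      \<Rightarrow> ('a, 'k, ('a, 'k, 'v) star, ('a, 'k, 'v set) star) cnv
      \<Rightarrow> ('a, 'k, ('a, 'k, 'v) star, ('a, 'k, 'v set) star) cnv) \<Rightarrow> bool" where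
  "contr_rule K P act \<longleftrightarrow>
    (\<forall>X Y x y as Z b ws.
      finite X \<and> finite Y \<and> x \<notin> X \<and> y \<notin> Y \<and>
      (\<forall>(D, a)\<in>set as. \<exists>S t. D = (S, {t}) \<and> a \<in> carrier (op_sp P (Some ` S))) \<and>
      b \<in> carrier (op_sp P (Some ` Z)) \<and>
      (\<forall>(D, w)\<in>set ws. \<exists>S. D = (S, {}) \<and> w \<in> carrier (delta_sp K P S)) \<and>
      is_decomp (map fst as @ [(Z, {y})] @ map fst ws) (insert x X, insert y Y) \<longrightarrow>
      (let c = act (insert x X, insert y Y) (X, Y) (contr K X Y x y)
                 (LS_term K P (insert x X, insert y Y) (as @ [((Z, {y}), b)]) ws)
       in
        (x \<in> Z \<longrightarrow>
          c = LS_term K P (X, Y) as (((Z - {x}, {}), delta_mark K P Z x b) # ws)) \<and>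
        (\<forall>i<length as. \<forall>S T a. as ! i = ((S, T), a) \<and> x \<in> S \<longrightarrow>
          c = LS_term K P (X, Y)
                (as[i := (((S - {x}) \<union> Z, T), op_comp P (Some ` S) (Some x) (Some ` Z) a b)]) ws) \<and>
        (\<forall>j<length ws. \<forall>S T w. ws ! j = ((S, T), w) \<and> x \<in> S \<longrightarrow>
          c = LS_term K P (X, Y) as
                (ws[j := (((S - {x}) \<union> Z, T), delta_act K P S x Z w b)]))))"

text \<open>
  The surjection that sends the second tensor factor to zero: a term with \<open>r \<ge> 1\<close> factors \<open>w_j\<close> is
  sent to zero, and a term without such factors to the element of the exterior power.
\<close>

definition LS_proj ::
  "'k ring \<Rightarrow> ('a option, 'k, 'v) operad \<Rightarrow> 'a bob
    \<Rightarrow> ('a, 'k, ('a, 'k, 'v) star, ('a, 'k, 'v set) star) cnv \<Rightarrow> ('a, 'k, 'v) star" where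
  "LS_proj K P A =
    lin_ext K (kb_sp (LS K P) A) (kb_sp (Lam K P) A)
      {(LS_term K P A as ws,
        if ws = [] then star_elt K (perm_sgn K) (op_kB P) A as else \<zero>\<^bsub>kb_sp (Lam K P) A\<^esub>) |as ws.
       as \<in> pow_terms (op_kB P) (total as) \<and> ws \<in> pow_terms (delta K P) (total ws) \<and>
       is_decomp [total as, total ws] A}"

definition contr_structure ::
  "'k ring \<Rightarrow> ('a option, 'k, 'v) operad
    \<Rightarrow> ('a bob \<Rightarrow> 'a bob \<Rightarrow> ('a umor \<Rightarrow> 'k) set
      \<Rightarrow> ('a, 'k, ('a, 'k, 'v) star, ('a, 'k, 'v set) star) cnv
      \<Rightarrow> ('a, 'k, ('a, 'k, 'v) star, ('a, 'k, 'v set) star) cnv) \<Rightarrow> bool" where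
  "contr_structure K P act \<longleftrightarrow> D_structure K (LS K P) act \<and> contr_rule K P act"

definition induced_structure ::
  "'k ring \<Rightarrow> ('a option, 'k, 'v) operad
    \<Rightarrow> ('a bob \<Rightarrow> 'a bob \<Rightarrow> ('a umor \<Rightarrow> 'k) set
      \<Rightarrow> ('a, 'k, ('a, 'k, 'v) star, ('a, 'k, 'v set) star) cnv
      \<Rightarrow> ('a, 'k, ('a, 'k, 'v) star, ('a, 'k, 'v set) star) cnv)
    \<Rightarrow> ('a bob \<Rightarrow> 'a bob \<Rightarrow> ('a umor \<Rightarrow> 'k) set \<Rightarrow> ('a, 'k, 'v) star \<Rightarrow> ('a, 'k, 'v) star) \<Rightarrow> bool" where
  "induced_structure K P act act' \<longleftrightarrow>
    D_structure K (Lam K P) act' \<and>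
    lin_module_hom K (D_minus K) (kb_sp (LS K P)) act (kb_sp (Lam K P)) act' (LS_proj K P)"

end

theory Submission
  imports Defs
begin

text \<open>
  A \<open>D_minus\<close>-module is a \<open>kB\<close>-module with natural contractions \<open>c_{x,y}\<close> that anticommute at disjoint
  pairs: a morphism of degree \<open>n\<close> is the class of a pair of bijections, it acts by contracting the
  images of \<open>1, ..., n\<close> one after the other, and anticommutation is what the sign twist requires of
  adjacent transpositions. Since the contractions and the bijections generate, uniqueness and the
  compatibility of maps need to be checked on the \<open>c_{x,y}\<close> only.

  On a term of \<open>LS\<close> the factor \<open>b\<close> that carries \<open>y\<close> is moved to the last position, at the cost of
  the exterior sign, and then inserted into the factor containing \<open>x\<close>. For two factors \<open>b, b'\<close> the two
  orders of contraction give the same element, so that only the sign from exchanging \<open>b\<close> and \<open>b'\<close>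
  remains: if one is inserted into the other and the result into a third factor, this is sequential
  associativity; if both are inserted into the same factor, it is parallel associativity; if each is
  inserted into the other, it is the relation \<open>a \<circ> b = b \<circ> a\<close> that defines \<open>delta\<close>.

  A contraction never lowers the number of factors from \<open>delta\<close>, so the terms with at least one such
  factor span a submodule, which is the kernel of the projection.
\<close>

section \<open>Linear maps and generating sets\<close>

text \<open>The maps in the definitions are descriptions such as \<open>lin_ext\<close>: they
  prescribe values on a spanning family of terms in which one vector has many expressions. Each
  construction therefore pairs a universal property, which gives existence, with a spanning
  statement, which gives uniqueness; afterwards identities of linear maps are checked on terms only.
  The obstacle is that terms are lists, while the contraction rule singles out a factor by its
  output \<open>y\<close> and not by its position. Since an operad factor has exactly one output and
  a factor from \<open>delta\<close> has none, \<open>y\<close> determines the factor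
  \<open>b\<close>, and the sign of moving it to the end is -1 to the number of factors behind it.
  Iterated contractions start with the largest label, because gluing two morphisms puts the labels
  of the one nearer to the source of the action above those of the other. The exterior part is not
  treated as a quotient by a submodule: its contractions are defined through the linear section that
  multiplies by the empty product, and all identities are carried over along the surjection.\<close>

lemma vs_add: "vectorspace K V \<Longrightarrow> u \<in> carrier V \<Longrightarrow> v \<in> carrier V \<Longrightarrow> u \<oplus>\<^bsub>V\<^esub> v \<in> carrier V"
  by (simp add: vectorspace_def module_def abelian_group_def abelian_monoid.a_closed)

lemma vs_smult: "vectorspace K V \<Longrightarrow> c \<in> carrier K \<Longrightarrow> v \<in> carrier V \<Longrightarrow> c \<odot>\<^bsub>V\<^esub> v \<in> carrier V"
  by (auto simp: vectorspace_def intro: module.smult_closed)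

lemma vs_zero: "vectorspace K V \<Longrightarrow> \<zero>\<^bsub>V\<^esub> \<in> carrier V"
  by (simp add: vectorspace_def module_def abelian_group_def abelian_monoid.zero_closed)

lemma vs_minus_zeroD:
  assumes "vectorspace K V" "u \<ominus>\<^bsub>V\<^esub> v = \<zero>\<^bsub>V\<^esub>" "u \<in> carrier V" "v \<in> carrier V"
  shows "u = v"
proof -
  interpret V: vectorspace K V by fact
  have "u = (u \<ominus>\<^bsub>V\<^esub> v) \<oplus>\<^bsub>V\<^esub> v"
    using assms(3,4) by (simp add: a_minus_def V.M.a_assoc V.M.l_neg)
  then show ?thesis using assms(2,4) by simp
qed

lemma hom_closed: "\<phi> \<in> module_hom K V W \<Longrightarrow> v \<in> carrier V \<Longrightarrow> \<phi> v \<in> carrier W"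
  by (auto simp: module_hom_def)

lemma homI:
  assumes "\<And>v. v \<in> carrier V \<Longrightarrow> \<phi> v \<in> carrier W"
    and "\<And>u v. u \<in> carrier V \<Longrightarrow> v \<in> carrier V \<Longrightarrow> \<phi> (u \<oplus>\<^bsub>V\<^esub> v) = \<phi> u \<oplus>\<^bsub>W\<^esub> \<phi> v"
    and "\<And>c v. c \<in> carrier K \<Longrightarrow> v \<in> carrier V \<Longrightarrow> \<phi> (c \<odot>\<^bsub>V\<^esub> v) = c \<odot>\<^bsub>W\<^esub> \<phi> v"
  shows "\<phi> \<in> module_hom K V W"
  using assms by (auto simp: module_hom_def)

lemma mod_homI:
  "vectorspace K V \<Longrightarrow> vectorspace K W \<Longrightarrow> \<phi> \<in> module_hom K V W \<Longrightarrow> mod_hom K V W \<phi>"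
  by (simp add: mod_hom_def mod_hom_axioms_def vectorspace_def)

lemma hom_zero:
  "vectorspace K V \<Longrightarrow> vectorspace K W \<Longrightarrow> \<phi> \<in> module_hom K V W \<Longrightarrow> \<phi> \<zero>\<^bsub>V\<^esub> = \<zero>\<^bsub>W\<^esub>"
  by (rule mod_hom.f0_is_0[OF mod_homI])

lemma hom_minus:
  "vectorspace K V \<Longrightarrow> vectorspace K W \<Longrightarrow> \<phi> \<in> module_hom K V W \<Longrightarrow> u \<in> carrier V \<Longrightarrow> v \<in> carrier V
    \<Longrightarrow> \<phi> (u \<ominus>\<^bsub>V\<^esub> v) = \<phi> u \<ominus>\<^bsub>W\<^esub> \<phi> v"
  by (rule mod_hom.f_minus[OF mod_homI])

lemma hom_comp:
  "\<phi> \<in> module_hom K U V \<Longrightarrow> \<psi> \<in> module_hom K V W \<Longrightarrow> (\<lambda>v. \<psi> (\<phi> v)) \<in> module_hom K U W"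
  by (intro homI) (simp_all add: hom_closed module_hom_add module_hom_smult)

lemma hom_cong:
  assumes "vectorspace K V" "\<phi> \<in> module_hom K V W" "\<And>v. v \<in> carrier V \<Longrightarrow> \<psi> v = \<phi> v"
  shows "\<psi> \<in> module_hom K V W"
  using assms
  by (intro homI) (simp_all add: hom_closed module_hom_add module_hom_smult vs_add vs_smult)

lemma hom_const_zero:
  assumes "vectorspace K W"
  shows "(\<lambda>_. \<zero>\<^bsub>W\<^esub>) \<in> module_hom K V W"
proof -
  interpret W: vectorspace K W by fact
  show ?thesis by (intro homI) auto
qed

lemma hom_ident: "(\<lambda>v. v) \<in> module_hom K V V"
  by (intro homI) auto

lemma hom_smult_fun:
  assumes "vectorspace K W" "\<phi> \<in> module_hom K V W" "c \<in> carrier K"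
  shows "(\<lambda>v. c \<odot>\<^bsub>W\<^esub> \<phi> v) \<in> module_hom K V W"
proof -
  interpret W: vectorspace K W by fact
  show ?thesis using assms(2,3)
    by (intro homI)
      (simp_all add: hom_closed module_hom_add module_hom_smult W.smult_r_distr
        flip: W.smult_assoc1, simp add: W.m_comm)
qed

lemma hom_add_fun:
  assumes "vectorspace K W" "\<phi> \<in> module_hom K V W" "\<psi> \<in> module_hom K V W"
  shows "(\<lambda>v. \<phi> v \<oplus>\<^bsub>W\<^esub> \<psi> v) \<in> module_hom K V W"
proof -
  interpret W: vectorspace K W by fact
  show ?thesis using assms(2,3)
    by (intro homI)
      (simp_all add: hom_closed module_hom_add module_hom_smult W.smult_r_distr W.M.a_ac)
qed

text \<open>An inductively generated span: statements about all vectors become rule inductions over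
  sums and multiples, with no linear combinations indexed by finite sets.\<close>

inductive_set lspan :: "'k ring \<Rightarrow> ('k, 'v) module \<Rightarrow> 'v set \<Rightarrow> 'v set" for K V E where
  zero: "\<zero>\<^bsub>V\<^esub> \<in> lspan K V E"
| gen: "v \<in> E \<Longrightarrow> v \<in> lspan K V E"
| add: "u \<in> lspan K V E \<Longrightarrow> v \<in> lspan K V E \<Longrightarrow> u \<oplus>\<^bsub>V\<^esub> v \<in> lspan K V E"
| smult: "c \<in> carrier K \<Longrightarrow> v \<in> lspan K V E \<Longrightarrow> c \<odot>\<^bsub>V\<^esub> v \<in> lspan K V E"

definition spanning :: "'k ring \<Rightarrow> ('k, 'v) module \<Rightarrow> 'v set \<Rightarrow> bool" where
  "spanning K V E \<longleftrightarrow> E \<subseteq> carrier V \<and> carrier V \<subseteq> lspan K V E"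

lemma lspan_closed: "vectorspace K V \<Longrightarrow> E \<subseteq> carrier V \<Longrightarrow> v \<in> lspan K V E \<Longrightarrow> v \<in> carrier V"
  by (erule lspan.induct) (auto simp: vs_zero vs_add vs_smult)

lemma lspan_image:
  assumes "vectorspace K V" "vectorspace K W" "\<phi> \<in> module_hom K V W" "E \<subseteq> carrier V"
    and "\<phi> ` E \<subseteq> lspan K W E'" "v \<in> lspan K V E"
  shows "\<phi> v \<in> lspan K W E'"
  using assms(6)
proof (induction rule: lspan.induct)
  case zero
  then show ?case using hom_zero[OF assms(1-3)] by (simp add: lspan.zero)
next
  case (gen v)
  then show ?case using assms(5) by blast
next
  case (add u v)
  then show ?case
    using module_hom_add[OF assms(3)] lspan_closed[OF assms(1,4)] by (simp add: lspan.add)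
next
  case (smult c v)
  then show ?case
    using module_hom_smult[OF assms(3)] lspan_closed[OF assms(1,4)] by (simp add: lspan.smult)
qed

lemma spanning_image:
  assumes "vectorspace K V" "vectorspace K W" "\<phi> \<in> module_hom K V W" "spanning K V E"
    and "carrier W \<subseteq> \<phi> ` carrier V"
  shows "spanning K W (\<phi> ` E)"
  unfolding spanning_def
proof (intro conjI subsetI)
  fix w assume "w \<in> \<phi> ` E"
  then show "w \<in> carrier W" using assms(3,4) by (auto simp: spanning_def hom_closed)
next
  fix w assume "w \<in> carrier W"
  then obtain v where v: "v \<in> carrier V" "w = \<phi> v" using assms(5) by blast
  with assms(4) have "v \<in> lspan K V E" by (auto simp: spanning_def)
  then show "w \<in> lspan K W (\<phi> ` E)" unfolding v(2)
    using assms(4) by (intro lspan_image[OF assms(1-3)]) (auto simp: spanning_def lspan.gen)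
qed

text \<open>Serves to exchange a large generating family, such as all pure tensors, for a smaller
  one whose span contains it.\<close>

lemma spanning_trans:
  assumes "spanning K V E" "E \<subseteq> lspan K V E'" "E' \<subseteq> carrier V"
  shows "spanning K V E'"
proof -
  have "v \<in> lspan K V E'" if "v \<in> lspan K V E" for v
    using that by induction (use assms(2) in \<open>auto intro: lspan.intros\<close>)
  with assms show ?thesis by (auto simp: spanning_def)
qed

text \<open>The uniqueness half of every construction below. Two linear maps agree on zero, sums and
  multiples as soon as they agree on the generators.\<close>

lemma spanning_hom_eq:
  assumes "vectorspace K V" "vectorspace K W" "spanning K V E"
    and "\<phi> \<in> module_hom K V W" "\<psi> \<in> module_hom K V W" "\<And>v. v \<in> E \<Longrightarrow> \<phi> v = \<psi> v" "v \<in> carrier V"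
  shows "\<phi> v = \<psi> v"
proof -
  have E: "E \<subseteq> carrier V" using assms(3) by (simp add: spanning_def)
  have "v \<in> lspan K V E" using assms(3,7) by (auto simp: spanning_def)
  then show ?thesis
  proof induction
    case zero
    then show ?case using hom_zero[OF assms(1,2)] assms(4,5) by metis
  next
    case (gen v)
    then show ?case by (rule assms(6))
  next
    case (add u v)
    then show ?case using lspan_closed[OF assms(1) E] assms(4,5) by (simp add: module_hom_add)
  next
    case (smult c v)
    then show ?case using lspan_closed[OF assms(1) E] assms(4,5) by (simp add: module_hom_smult)
  qed
qed

text \<open>A description with \<open>THE\<close> says nothing until a unique solution exists. The
  witness \<open>\<phi>\<close> gives existence, the spanning hypothesis determines the values on
  the carrier, and extensionality determines the function outside it.\<close>

lemma lin_ext_works: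
  assumes "vectorspace K V" "vectorspace K W" "spanning K V (fst ` P)"
    and "\<phi> \<in> module_hom K V W" "\<And>v w. (v, w) \<in> P \<Longrightarrow> \<phi> v = w"
  shows "lin_ext K V W P \<in> module_hom K V W" "\<And>v w. (v, w) \<in> P \<Longrightarrow> lin_ext K V W P v = w"
    "lin_ext K V W P \<in> extensional (carrier V)"
proof -
  have cl: "v \<in> carrier V" if "(v, w) \<in> P" for v w
  proof -
    have "v \<in> fst ` P" using that by (metis fst_conv imageI)
    then show ?thesis using assms(3) by (auto simp: spanning_def)
  qed
  let ?Q = "\<lambda>\<phi>. \<phi> \<in> module_hom K V W \<and> \<phi> \<in> extensional (carrier V) \<and> (\<forall>(v, w)\<in>P. \<phi> v = w)"
  \<comment> \<open>The witness itself need not be extensional, so its restriction is the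
    candidate.\<close>
  have ex: "?Q (restrict \<phi> (carrier V))"
  proof (intro conjI)
    show "restrict \<phi> (carrier V) \<in> module_hom K V W" by (rule hom_cong[OF assms(1,4)]) simp
    show "\<forall>(v, w)\<in>P. restrict \<phi> (carrier V) v = w" using assms(5) cl by (auto simp: restrict_def)
  qed simp
  have uniq: "\<psi> = \<psi>'" if "?Q \<psi>" "?Q \<psi>'" for \<psi> \<psi>'
  proof (rule extensionalityI[where A = "carrier V"])
    fix v assume v: "v \<in> carrier V"
    show "\<psi> v = \<psi>' v"
    proof (rule spanning_hom_eq[OF assms(1-3) _ _ _ v])
      fix u assume "u \<in> fst ` P"
      then obtain w where "(u, w) \<in> P" by force
      then have "\<psi> u = w" "\<psi>' u = w" using that by (metis (mono_tags, lifting) case_prodD)+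
      then show "\<psi> u = \<psi>' u" by simp
    qed (use that in blast)+
  qed (use that in auto)
  have "?Q (lin_ext K V W P)"
    unfolding lin_ext_def by (rule theI[where P = ?Q, OF ex]) (use uniq ex in blast)
  then show "lin_ext K V W P \<in> module_hom K V W" "\<And>v w. (v, w) \<in> P \<Longrightarrow> lin_ext K V W P v = w"
    "lin_ext K V W P \<in> extensional (carrier V)" by auto
qed

text \<open>The form in which descriptions are used: values are prescribed on terms
  \<open>s\<close>, and distinct terms may denote the same vector \<open>e s\<close>. Consistency of
  the prescription is contained in the existence of a linear map with these values.\<close>

lemma lin_ext_family:
  assumes "vectorspace K V" "vectorspace K W" "spanning K V (e ` S)"
    and "\<exists>\<phi>\<in>module_hom K V W. \<forall>s\<in>S. \<phi> (e s) = g s" and "P = (\<lambda>s. (e s, g s)) ` S"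
  shows "lin_ext K V W P \<in> module_hom K V W" "\<And>s. s \<in> S \<Longrightarrow> lin_ext K V W P (e s) = g s"
proof -
  have "fst ` P = e ` S" using assms(5) by force
  with assms(3) have s: "spanning K V (fst ` P)" by simp
  obtain \<phi> where p: "\<phi> \<in> module_hom K V W" "\<forall>s\<in>S. \<phi> (e s) = g s" using assms(4) by blast
  have q: "\<phi> v = w" if "(v, w) \<in> P" for v w using that p(2) assms(5) by auto
  show "lin_ext K V W P \<in> module_hom K V W" by (rule lin_ext_works(1)[OF assms(1,2) s p(1) q])
  show "lin_ext K V W P (e s) = g s" if "s \<in> S" for s
    by (rule lin_ext_works(2)[OF assms(1,2) s p(1) q]) (use that assms(5) in auto)
qed

section \<open>Quotients, free spaces and direct sums\<close>

text \<open>Every element of \<open>Q\<close> is an image under \<open>\<pi>\<close> and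
  \<open>\<pi>\<close> respects the operations, so each module axiom of \<open>Q\<close> is the
  image of the same axiom of \<open>V\<close>. Applied to coset maps, this replaces all computation
  with cosets.\<close>

lemma vs_of_surj:
  assumes "vectorspace K V" "carrier Q = \<pi> ` carrier V" "\<zero>\<^bsub>Q\<^esub> = \<pi> \<zero>\<^bsub>V\<^esub>"
    and "\<And>u v. u \<in> carrier V \<Longrightarrow> v \<in> carrier V \<Longrightarrow> \<pi> (u \<oplus>\<^bsub>V\<^esub> v) = \<pi> u \<oplus>\<^bsub>Q\<^esub> \<pi> v"
    and "\<And>c v. c \<in> carrier K \<Longrightarrow> v \<in> carrier V \<Longrightarrow> \<pi> (c \<odot>\<^bsub>V\<^esub> v) = c \<odot>\<^bsub>Q\<^esub> \<pi> v"
  shows "vectorspace K Q" "\<pi> \<in> module_hom K V Q"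
proof -
  interpret V: vectorspace K V by fact
  show "\<pi> \<in> module_hom K V Q"
    by (rule homI) (simp add: assms(2), (rule assms(4,5); assumption)+)
  have "module K Q"
  proof (rule module_criteria)
    show "cring K" by (rule V.R.is_cring)
    show "\<forall>v\<in>carrier Q. \<exists>w\<in>carrier Q. v \<oplus>\<^bsub>Q\<^esub> w = \<zero>\<^bsub>Q\<^esub>"
    proof
      fix w assume "w \<in> carrier Q"
      then obtain v where v: "v \<in> carrier V" "w = \<pi> v" unfolding assms(2) by blast
      have "w \<oplus>\<^bsub>Q\<^esub> \<pi> (\<ominus>\<^bsub>V\<^esub> v) = \<pi> (v \<oplus>\<^bsub>V\<^esub> \<ominus>\<^bsub>V\<^esub> v)"
        unfolding v(2) by (rule assms(4)[symmetric]) (use v in auto)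
      then have "w \<oplus>\<^bsub>Q\<^esub> \<pi> (\<ominus>\<^bsub>V\<^esub> v) = \<zero>\<^bsub>Q\<^esub>" using v by (simp add: V.M.r_neg assms(3))
      then show "\<exists>w'\<in>carrier Q. w \<oplus>\<^bsub>Q\<^esub> w' = \<zero>\<^bsub>Q\<^esub>"
        unfolding assms(2) using v by blast
    qed
  qed ((intro ballI allI impI, elim conjE)?, (unfold assms(2,3))?, (elim imageE)?,
      simp add: imageI V.M.a_ac V.smult_l_distr V.smult_r_distr V.smult_assoc1 flip: assms(4,5))+
  then show "vectorspace K Q" by (simp add: vectorspace_def V.field_axioms)
qed

locale quotient_space =
  V?: vectorspace K V for K :: "'k ring" and V :: "('k, 'v) module" +
  fixes N assumes N: "LinearCombinations.submodule K N V"
begin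

lemma N_sub: "N \<subseteq> carrier V" using N by (rule LinearCombinations.submodule.subset)

lemma subgroup_N: "subgroup N (add_monoid V)"
proof (rule V.module.M.add.subgroupI)
  show "N \<subseteq> carrier V" by (rule N_sub)
  show "N \<noteq> {}" using LinearCombinations.submodule.zero_closed[OF N] by auto
  fix a assume "a \<in> N"
  then show "\<ominus>\<^bsub>V\<^esub> a \<in> N" unfolding V.module.smult_minus_1[OF subsetD[OF N_sub \<open>a \<in> N\<close>], symmetric]
    by (intro LinearCombinations.submodule.smult_closed[OF N]) auto
next
  fix a b assume "a \<in> N" "b \<in> N"
  then show "a \<oplus>\<^bsub>V\<^esub> b \<in> N" by (rule LinearCombinations.submodule.m_closed[OF N])
qed

lemma abelian_subgroup_N: "abelian_subgroup N V"
  by (rule abelian_subgroupI3[OF additive_subgroup.intro[OF subgroup_N]]) (rule V.module.M.abelian_group_axioms)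

lemma coset_eq_iff:
  assumes "u \<in> carrier V" "v \<in> carrier V"
  shows "a_r_coset V N u = a_r_coset V N v \<longleftrightarrow> u \<ominus>\<^bsub>V\<^esub> v \<in> N"
proof
  assume "a_r_coset V N u = a_r_coset V N v"
  moreover have "u \<in> a_r_coset V N u" 
    using abelian_subgroup.a_rcos_self[OF abelian_subgroup_N assms(1)] .
  ultimately have "u \<in> a_r_coset V N v" by simp
  then obtain h where h: "h \<in> N" "u = h \<oplus>\<^bsub>V\<^esub> v" by (auto simp: a_r_coset_def')
  then have "u \<ominus>\<^bsub>V\<^esub> v = h" using N_sub assms
    by (auto simp: a_minus_def V.module.M.a_assoc V.module.M.r_neg)
  with h show "u \<ominus>\<^bsub>V\<^esub> v \<in> N" by simp
next
  assume "u \<ominus>\<^bsub>V\<^esub> v \<in> N"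
  moreover have "u = (u \<ominus>\<^bsub>V\<^esub> v) \<oplus>\<^bsub>V\<^esub> v"
    using assms by (simp add: a_minus_def V.module.M.a_assoc V.module.M.l_neg)
  ultimately have "u \<in> a_r_coset V N v" by (auto simp: a_r_coset_def')
  then show "a_r_coset V N u = a_r_coset V N v"
    using V.module.M.a_repr_independence[OF _ assms(2) subgroup_N] by metis
qed

lemma quot_structure:
  shows carrier_quot: "carrier (quot_space V N) = a_r_coset V N ` carrier V"
    and zero_quot: "\<zero>\<^bsub>quot_space V N\<^esub> = a_r_coset V N \<zero>\<^bsub>V\<^esub>"
    and add_quot: "u \<in> carrier V \<Longrightarrow> v \<in> carrier V \<Longrightarrow>
      a_r_coset V N (u \<oplus>\<^bsub>V\<^esub> v) = a_r_coset V N u \<oplus>\<^bsub>quot_space V N\<^esub> a_r_coset V N v"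
    and smult_quot: "c \<in> carrier K \<Longrightarrow> v \<in> carrier V \<Longrightarrow>
      a_r_coset V N (c \<odot>\<^bsub>V\<^esub> v) = c \<odot>\<^bsub>quot_space V N\<^esub> a_r_coset V N v"
proof -
  show "carrier (quot_space V N) = a_r_coset V N ` carrier V"
    by (auto simp: quot_space_def A_RCOSETS_def')
  show "\<zero>\<^bsub>quot_space V N\<^esub> = a_r_coset V N \<zero>\<^bsub>V\<^esub>"
    using V.module.M.a_coset_add_zero[OF N_sub] by (simp add: quot_space_def)
  show "a_r_coset V N (u \<oplus>\<^bsub>V\<^esub> v) = a_r_coset V N u \<oplus>\<^bsub>quot_space V N\<^esub> a_r_coset V N v"
    if "u \<in> carrier V" "v \<in> carrier V"
    using abelian_subgroup.a_rcos_sum[OF abelian_subgroup_N that] by (simp add: quot_space_def)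
  show "a_r_coset V N (c \<odot>\<^bsub>V\<^esub> v) = c \<odot>\<^bsub>quot_space V N\<^esub> a_r_coset V N v"
    if c: "c \<in> carrier K" and v: "v \<in> carrier V"
  proof -
    \<comment> \<open>Scalar multiplication in \<open>quot_space\<close> is a union over all
      representatives of a coset. All of them contribute the same coset, since two representatives
      differ by an element of \<open>N\<close> and \<open>N\<close> absorbs scalars.\<close>
    have "a_r_coset V N (c \<odot>\<^bsub>V\<^esub> u) = a_r_coset V N (c \<odot>\<^bsub>V\<^esub> v)" if u: "u \<in> a_r_coset V N v" for u
    proof -
      obtain h where h: "h \<in> N" "u = h \<oplus>\<^bsub>V\<^esub> v" using u by (auto simp: a_r_coset_def')
      have hc: "h \<in> carrier V" using h N_sub by auto
      have "c \<odot>\<^bsub>V\<^esub> u \<ominus>\<^bsub>V\<^esub> c \<odot>\<^bsub>V\<^esub> v = c \<odot>\<^bsub>V\<^esub> h"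
        using c v hc by (simp add: h(2) V.module.smult_r_distr a_minus_def V.module.M.a_assoc V.module.M.r_neg)
      then show ?thesis
        using c v hc h LinearCombinations.submodule.smult_closed[OF N c h(1)] by (subst coset_eq_iff) auto
    qed
    moreover have "v \<in> a_r_coset V N v" using abelian_subgroup.a_rcos_self[OF abelian_subgroup_N v] .
    ultimately have "(\<Union>u\<in>a_r_coset V N v. a_r_coset V N (c \<odot>\<^bsub>V\<^esub> u)) = a_r_coset V N (c \<odot>\<^bsub>V\<^esub> v)"
      by (intro equalityI UN_least) (blast, metis UN_upper)
    then show ?thesis by (simp add: quot_space_def)
  qed
qed

lemma vs_quot: "vectorspace K (quot_space V N)"
  and quot_hom: "a_r_coset V N \<in> module_hom K V (quot_space V N)"
  by (rule vs_of_surj[OF V.vectorspace_axioms carrier_quot zero_quot add_quot smult_quot]; assumption)+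

lemma spanning_quot: "spanning K V E \<Longrightarrow> spanning K (quot_space V N) (a_r_coset V N ` E)"
  by (rule spanning_image[OF V.vectorspace_axioms vs_quot quot_hom]) (auto simp: carrier_quot)

text \<open>The universal property of the quotient: a linear map that vanishes on \<open>N\<close>
  takes one value on each coset.\<close>

lemma quot_ext:
  assumes "vectorspace K W" "\<phi> \<in> module_hom K V W" "\<And>v. v \<in> N \<Longrightarrow> \<phi> v = \<zero>\<^bsub>W\<^esub>"
  shows "\<exists>\<psi>\<in>module_hom K (quot_space V N) W. \<forall>v\<in>carrier V. \<psi> (a_r_coset V N v) = \<phi> v"
proof -
  interpret W: vectorspace K W by fact
  \<comment> \<open>Evaluation at an arbitrary representative; the choice does not matter because
    representatives differ by elements on which \<open>\<phi>\<close> vanishes.\<close>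
  define \<psi> where "\<psi> C = \<phi> (SOME v. v \<in> carrier V \<and> a_r_coset V N v = C)" for C
  have *: "\<psi> (a_r_coset V N v) = \<phi> v" if v: "v \<in> carrier V" for v
  proof -
    define u where "u = (SOME u. u \<in> carrier V \<and> a_r_coset V N u = a_r_coset V N v)"
    have u: "u \<in> carrier V \<and> a_r_coset V N u = a_r_coset V N v"
      unfolding u_def by (rule someI[of _ v]) (use v in auto)
    then have "u \<ominus>\<^bsub>V\<^esub> v \<in> N" using coset_eq_iff v by blast
    then have "\<phi> u \<ominus>\<^bsub>W\<^esub> \<phi> v = \<zero>\<^bsub>W\<^esub>"
      using assms(3) hom_minus[OF V.vectorspace_axioms assms(1,2)] u v by metis
    then have "\<phi> u = \<phi> v"
      by (rule vs_minus_zeroD[OF assms(1)]) (use u v assms(2) in \<open>auto simp: hom_closed\<close>)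
    then show ?thesis by (simp add: \<psi>_def u_def)
  qed
  have "\<psi> \<in> module_hom K (quot_space V N) W"
    by (intro homI; unfold carrier_quot; elim imageE)
      (use assms(2) in \<open>simp_all add: * hom_closed module_hom_add module_hom_smult
        flip: add_quot smult_quot\<close>)
  with * show ?thesis by (intro bexI[of _ \<psi>]) simp_all
qed

end

lemma span_submodule:
  "vectorspace K V \<Longrightarrow> R \<subseteq> carrier V
    \<Longrightarrow> LinearCombinations.submodule K (module.span K V R) V"
  by (simp add: vectorspace_def module.span_is_submodule)

lemma quotient_span: fixes K :: "'k ring" and V :: "('k, 'v) module"
  shows "vectorspace K V \<Longrightarrow> R \<subseteq> carrier V \<Longrightarrow> quotient_space K V (module.span K V R)"
  by (simp add: quotient_space_def quotient_space_axioms_def span_submodule)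

lemma in_span: "vectorspace K V \<Longrightarrow> R \<subseteq> carrier V \<Longrightarrow> r \<in> R \<Longrightarrow> r \<in> module.span K V R"
  using module.in_own_span[of K V R] by (auto simp: vectorspace_def)

text \<open>The kernel is a submodule, so it contains the span of any set of relations that it
  contains. Relations thus need to be checked on generators only.\<close>

lemma hom_vanishes_span:
  assumes "vectorspace K V" "vectorspace K W" "\<phi> \<in> module_hom K V W"
    and "R \<subseteq> carrier V" "\<And>r. r \<in> R \<Longrightarrow> \<phi> r = \<zero>\<^bsub>W\<^esub>" "v \<in> module.span K V R"
  shows "\<phi> v = \<zero>\<^bsub>W\<^esub>"
proof -
  interpret h: mod_hom K V W \<phi> by (rule mod_homI[OF assms(1-3)])
  have "R \<subseteq> h.ker" using assms(4,5) by (auto simp: h.ker_def)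
  then have "module.span K V R \<subseteq> h.ker"
    using module.span_is_subset[OF h.M.module_axioms _ h.ker_is_submodule] by blast
  then show ?thesis using assms(6) by (auto simp: h.ker_def)
qed

lemma coset_eqI:
  fixes K :: "'k ring" and V :: "('k, 'v) module"
  assumes "vectorspace K V" "R \<subseteq> carrier V" "u \<in> carrier V" "v \<in> carrier V" "u \<ominus>\<^bsub>V\<^esub> v \<in> R"
  shows "a_r_coset V (module.span K V R) u = a_r_coset V (module.span K V R) v"
  using quotient_space.coset_eq_iff[OF quotient_span[OF assms(1,2)] assms(3,4)]
    in_span[OF assms(1,2,5)] by blast

text \<open>Common source of the universal properties of free spaces and direct sums: the map is the
  sum of the \<open>t i\<close>, which is finite for each vector. Only its values on vectors with a
  single nonzero contribution are recorded, as these are the basis vectors and the images of the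
  summands.\<close>

lemma vs_finsum_hom:
  assumes V: "vectorspace K V" and W: "vectorspace K W"
    and t: "\<And>i. i \<in> I \<Longrightarrow> t i \<in> module_hom K V W"
    and fin: "\<And>f. f \<in> carrier V \<Longrightarrow> finite {i \<in> I. t i f \<noteq> \<zero>\<^bsub>W\<^esub>}"
  shows "\<exists>\<phi>\<in>module_hom K V W. \<forall>f\<in>carrier V. \<forall>j\<in>I.
    (\<forall>i\<in>I. i \<noteq> j \<longrightarrow> t i f = \<zero>\<^bsub>W\<^esub>) \<longrightarrow> \<phi> f = t j f"
proof -
  interpret V: vectorspace K V by fact
  interpret W: vectorspace K W by fact
  define \<phi> where "\<phi> f = finsum W (\<lambda>i. t i f) {i \<in> I. t i f \<noteq> \<zero>\<^bsub>W\<^esub>}" for f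
  have cl: "t i f \<in> carrier W" if "i \<in> I" "f \<in> carrier V" for i f
    using t[OF that(1)] that(2) by (rule hom_closed)
  \<comment> \<open>The sum may be taken over any finite set containing the support; for additivity
    one set must serve two vectors and their sum.\<close>
  have ext: "\<phi> f = finsum W (\<lambda>i. t i f) T"
    if "f \<in> carrier V" "finite T" "T \<subseteq> I" "{i \<in> I. t i f \<noteq> \<zero>\<^bsub>W\<^esub>} \<subseteq> T" for f T
    unfolding \<phi>_def
    by (rule W.M.add.finprod_mono_neutral_cong_left) (use that cl in auto)
  have "\<phi> \<in> module_hom K V W"
  proof (rule homI)
    fix f assume f: "f \<in> carrier V"
    show "\<phi> f \<in> carrier W" unfolding \<phi>_def using f cl by (intro W.M.finsum_closed) auto
    fix c assume c: "c \<in> carrier K"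
    let ?T = "{i \<in> I. t i f \<noteq> \<zero>\<^bsub>W\<^esub>} \<union> {i \<in> I. t i (c \<odot>\<^bsub>V\<^esub> f) \<noteq> \<zero>\<^bsub>W\<^esub>}"
    have T: "finite ?T" "?T \<subseteq> I" using fin f c by auto
    have "\<phi> (c \<odot>\<^bsub>V\<^esub> f) = finsum W (\<lambda>i. t i (c \<odot>\<^bsub>V\<^esub> f)) ?T"
      using T f c by (intro ext) auto
    also have "\<dots> = finsum W (\<lambda>i. c \<odot>\<^bsub>W\<^esub> t i f) ?T"
      using T f c cl by (intro W.M.finsum_cong') (auto simp: module_hom_smult[OF t])
    also have "\<dots> = c \<odot>\<^bsub>W\<^esub> finsum W (\<lambda>i. t i f) ?T"
      using T f c cl by (intro W.finsum_smult[symmetric]) auto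
    also have "finsum W (\<lambda>i. t i f) ?T = \<phi> f" using T f by (intro ext[symmetric]) auto
    finally show "\<phi> (c \<odot>\<^bsub>V\<^esub> f) = c \<odot>\<^bsub>W\<^esub> \<phi> f" .
  next
    fix f g assume f: "f \<in> carrier V" and g: "g \<in> carrier V"
    let ?T = "{i \<in> I. t i f \<noteq> \<zero>\<^bsub>W\<^esub>} \<union> {i \<in> I. t i g \<noteq> \<zero>\<^bsub>W\<^esub>} \<union> {i \<in> I. t i (f \<oplus>\<^bsub>V\<^esub> g) \<noteq> \<zero>\<^bsub>W\<^esub>}"
    have T: "finite ?T" "?T \<subseteq> I" using fin f g by auto
    have "\<phi> (f \<oplus>\<^bsub>V\<^esub> g) = finsum W (\<lambda>i. t i (f \<oplus>\<^bsub>V\<^esub> g)) ?T"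
      using T f g by (intro ext) auto
    also have "\<dots> = finsum W (\<lambda>i. t i f \<oplus>\<^bsub>W\<^esub> t i g) ?T"
      using T f g cl by (intro W.M.finsum_cong') (auto simp: module_hom_add[OF t])
    also have "\<dots> = finsum W (\<lambda>i. t i f) ?T \<oplus>\<^bsub>W\<^esub> finsum W (\<lambda>i. t i g) ?T"
      using T f g cl by (intro W.M.finsum_addf) auto
    also have "finsum W (\<lambda>i. t i f) ?T = \<phi> f" using T f by (intro ext[symmetric]) auto
    also have "finsum W (\<lambda>i. t i g) ?T = \<phi> g" using T g by (intro ext[symmetric]) auto
    finally show "\<phi> (f \<oplus>\<^bsub>V\<^esub> g) = \<phi> f \<oplus>\<^bsub>W\<^esub> \<phi> g" .
  qed
  moreover have "\<phi> f = t j f" if "f \<in> carrier V" "j \<in> I" "\<forall>i\<in>I. i \<noteq> j \<longrightarrow> t i f = \<zero>\<^bsub>W\<^esub>" for f j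
  proof -
    have "\<phi> f = finsum W (\<lambda>i. t i f) {j}" using that by (intro ext) auto
    then show ?thesis using cl[OF that(2,1)] by simp
  qed
  ultimately show ?thesis by (intro bexI[of _ \<phi>]) simp_all
qed

section \<open>Free spaces and spaces presented by generators and relations\<close>

lemma free_space_simps:
  "carrier (free_space K S) = {f \<in> S \<rightarrow>\<^sub>E carrier K. finite {s \<in> S. f s \<noteq> \<zero>\<^bsub>K\<^esub>}}"
  "field K \<Longrightarrow> \<zero>\<^bsub>free_space K S\<^esub> = (\<lambda>s\<in>S. \<zero>\<^bsub>K\<^esub>)"
  "field K \<Longrightarrow> f \<oplus>\<^bsub>free_space K S\<^esub> g = (\<lambda>s\<in>S. f s \<oplus>\<^bsub>K\<^esub> g s)"
  "field K \<Longrightarrow> c \<odot>\<^bsub>free_space K S\<^esub> f = (\<lambda>s\<in>S. c \<otimes>\<^bsub>K\<^esub> f s)"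
proof -
  show "carrier (free_space K S) = {f \<in> S \<rightarrow>\<^sub>E carrier K. finite {s \<in> S. f s \<noteq> \<zero>\<^bsub>K\<^esub>}}"
    by (simp add: free_space_def)
  assume "field K"
  then interpret field K .
  show "\<zero>\<^bsub>free_space K S\<^esub> = (\<lambda>s\<in>S. \<zero>\<^bsub>K\<^esub>)" "f \<oplus>\<^bsub>free_space K S\<^esub> g = (\<lambda>s\<in>S. f s \<oplus>\<^bsub>K\<^esub> g s)"
    "c \<odot>\<^bsub>free_space K S\<^esub> f = (\<lambda>s\<in>S. c \<otimes>\<^bsub>K\<^esub> f s)"
    by (simp_all add: free_space_def func_space_def)
qed

lemma vs_free_space: assumes "field K" shows "vectorspace K (free_space K S)"
proof -
  interpret K: field K by fact
  let ?C = "{f \<in> S \<rightarrow>\<^sub>E carrier K. finite {s \<in> S. f s \<noteq> \<zero>\<^bsub>K\<^esub>}}"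
  interpret F: module K "K.func_space S" by (rule K.func_space_is_module)
  have "submodule K ?C (K.func_space S)"
  proof
    fix v w assume v: "v \<in> ?C" and w: "w \<in> ?C"
    have "{s \<in> S. v s \<oplus>\<^bsub>K\<^esub> w s \<noteq> \<zero>\<^bsub>K\<^esub>} \<subseteq> {s \<in> S. v s \<noteq> \<zero>\<^bsub>K\<^esub>} \<union> {s \<in> S. w s \<noteq> \<zero>\<^bsub>K\<^esub>}"
      by auto
    then have "finite {s \<in> S. v s \<oplus>\<^bsub>K\<^esub> w s \<noteq> \<zero>\<^bsub>K\<^esub>}"
      using v w finite_subset by blast
    then show "v \<oplus>\<^bsub>K.func_space S\<^esub> w \<in> ?C" using v w
      by (auto simp: K.func_space_def PiE_mem cong: conj_cong)
  next
    fix c v assume c: "c \<in> carrier K" and v: "v \<in> ?C"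
    have "{s \<in> S. c \<otimes>\<^bsub>K\<^esub> v s \<noteq> \<zero>\<^bsub>K\<^esub>} \<subseteq> {s \<in> S. v s \<noteq> \<zero>\<^bsub>K\<^esub>}" using c by auto
    then have "finite {s \<in> S. c \<otimes>\<^bsub>K\<^esub> v s \<noteq> \<zero>\<^bsub>K\<^esub>}"
      using v finite_subset by blast
    then show "c \<odot>\<^bsub>K.func_space S\<^esub> v \<in> ?C" using c v
      by (auto simp: K.func_space_def PiE_mem cong: conj_cong)
  qed (auto simp: K.func_space_def)
  then have "module K ((K.func_space S)\<lparr>carrier := ?C\<rparr>)" by (rule F.submodule_is_module)
  then show ?thesis by (simp add: vectorspace_def free_space_def assms)
qed

lemma basis_vec_closed: "field K \<Longrightarrow> s \<in> S \<Longrightarrow> basis_vec K S s \<in> carrier (free_space K S)"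
  by (auto simp: free_space_simps basis_vec_def field_def domain_def cring_def ring.ring_simprules
      cong: conj_cong)

lemma free_space_ext:
  assumes "field K" "vectorspace K W" "\<And>s. s \<in> S \<Longrightarrow> e s \<in> carrier W"
  shows "\<exists>\<phi>\<in>module_hom K (free_space K S) W. \<forall>s\<in>S. \<phi> (basis_vec K S s) = e s"
proof -
  interpret K: field K by fact
  interpret W: vectorspace K W by fact
  have t: "(\<lambda>f. f s \<odot>\<^bsub>W\<^esub> e s) \<in> module_hom K (free_space K S) W" if "s \<in> S" for s
    by (rule homI)
      (use that assms(3) in \<open>auto simp: free_space_simps K.field_axioms W.smult_l_distr
        W.smult_assoc1 dest!: PiE_mem[OF _ that]\<close>)
  have f: "finite {s \<in> S. f s \<odot>\<^bsub>W\<^esub> e s \<noteq> \<zero>\<^bsub>W\<^esub>}" if "f \<in> carrier (free_space K S)" for f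
    by (rule finite_subset[of _ "{s \<in> S. f s \<noteq> \<zero>\<^bsub>K\<^esub>}"])
      (use that assms(3) in \<open>auto simp: free_space_simps\<close>)
  have "\<exists>\<phi>\<in>module_hom K (free_space K S) W. \<forall>f\<in>carrier (free_space K S). \<forall>j\<in>S.
      (\<forall>i\<in>S. i \<noteq> j \<longrightarrow> f i \<odot>\<^bsub>W\<^esub> e i = \<zero>\<^bsub>W\<^esub>) \<longrightarrow> \<phi> f = f j \<odot>\<^bsub>W\<^esub> e j"
    by (rule vs_finsum_hom[OF vs_free_space[OF assms(1)] assms(2) t f])
  then obtain \<phi> where p: "\<phi> \<in> module_hom K (free_space K S) W"
    "\<forall>f\<in>carrier (free_space K S). \<forall>j\<in>S.
      (\<forall>i\<in>S. i \<noteq> j \<longrightarrow> f i \<odot>\<^bsub>W\<^esub> e i = \<zero>\<^bsub>W\<^esub>) \<longrightarrow> \<phi> f = f j \<odot>\<^bsub>W\<^esub> e j"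
    by blast
  have "\<phi> (basis_vec K S s) = e s" if "s \<in> S" for s
    using p(2)[rule_format, OF basis_vec_closed[OF assms(1) that] that] that assms(3)
    by (simp add: basis_vec_def)
  with p(1) show ?thesis by (intro bexI[of _ \<phi>]) simp_all
qed

text \<open>Induction on a finite set that contains the support, removing one coordinate at a time.
  The bounding set \<open>T\<close> is a parameter of the claim since the support itself may shrink
  by more than the induction asks for.\<close>

lemma spanning_free_space:
  assumes "field K" shows "spanning K (free_space K S) (basis_vec K S ` S)"
proof -
  interpret K: field K by fact
  have *: "f \<in> lspan K (free_space K S) (basis_vec K S ` S)"
    if "finite T" "f \<in> S \<rightarrow>\<^sub>E carrier K" "{s \<in> S. f s \<noteq> \<zero>\<^bsub>K\<^esub>} \<subseteq> T" for f T
    using that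
  proof (induction T arbitrary: f rule: finite_induct)
    case empty
    then have "f = \<zero>\<^bsub>free_space K S\<^esub>"
      by (auto simp: free_space_simps(2)[OF assms] fun_eq_iff PiE_def extensional_def)
    then show ?case by (simp add: lspan.zero)
  next
    case (insert s T)
    show ?case
    proof (cases "s \<in> S")
      case False
      then show ?thesis using insert by (intro insert.IH) auto
    next
      case True
      \<comment> \<open>The vector with the coordinate \<open>s\<close> erased; what is lost is a
        multiple of one basis vector.\<close>
      let ?f = "f(s := \<zero>\<^bsub>K\<^esub>)"
      have fs: "f s \<in> carrier K" using insert.prems True by auto
      have "?f \<in> lspan K (free_space K S) (basis_vec K S ` S)"
        using insert.prems True by (intro insert.IH) (auto simp: PiE_def extensional_def split: if_splits)
      moreover have "f s \<odot>\<^bsub>free_space K S\<^esub> basis_vec K S s \<in> lspan K (free_space K S) (basis_vec K S ` S)"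
        using True fs by (intro lspan.smult lspan.gen) auto
      ultimately have "?f \<oplus>\<^bsub>free_space K S\<^esub> (f s \<odot>\<^bsub>free_space K S\<^esub> basis_vec K S s)
          \<in> lspan K (free_space K S) (basis_vec K S ` S)" by (rule lspan.add)
      moreover have "?f \<oplus>\<^bsub>free_space K S\<^esub> (f s \<odot>\<^bsub>free_space K S\<^esub> basis_vec K S s) = f"
      proof (rule extensionalityI[where A = S])
        fix i assume i: "i \<in> S"
        have "f i \<in> carrier K" using insert.prems(1) i by auto
        then show "(?f \<oplus>\<^bsub>free_space K S\<^esub> (f s \<odot>\<^bsub>free_space K S\<^esub> basis_vec K S s)) i = f i"
          using i fs by (simp add: free_space_simps(3,4)[OF assms] basis_vec_def)
      qed (use insert.prems in \<open>auto simp: free_space_simps(3,4)[OF assms] PiE_def\<close>)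
      ultimately show ?thesis by simp
    qed
  qed
  show ?thesis unfolding spanning_def
  proof (intro conjI subsetI)
    fix f assume "f \<in> carrier (free_space K S)"
    then have "finite {s \<in> S. f s \<noteq> \<zero>\<^bsub>K\<^esub>}" "f \<in> S \<rightarrow>\<^sub>E carrier K"
      by (simp_all add: free_space_simps(1))
    then show "f \<in> lspan K (free_space K S) (basis_vec K S ` S)"
      by (rule *[OF _ _ subset_refl])
  next
    fix f assume "f \<in> basis_vec K S ` S"
    then show "f \<in> carrier (free_space K S)" by (elim imageE) (simp add: basis_vec_closed[OF assms])
  qed
qed

text \<open>Tensor products and morphism spaces are all presented in this way. The last hypothesis
  quantifies over every linear map with the given values on basis vectors, so that a relation is
  checked by linearity without knowing how the map was obtained.\<close>

lemma free_quot_ext: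
  assumes "field K" "vectorspace K W" "R \<subseteq> carrier (free_space K S)"
    and "\<And>s. s \<in> S \<Longrightarrow> e s \<in> carrier W"
    and "\<And>\<phi> r. \<phi> \<in> module_hom K (free_space K S) W \<Longrightarrow>
      (\<And>s. s \<in> S \<Longrightarrow> \<phi> (basis_vec K S s) = e s) \<Longrightarrow> r \<in> R \<Longrightarrow> \<phi> r = \<zero>\<^bsub>W\<^esub>"
  shows "\<exists>\<phi>\<in>module_hom K (quot_space (free_space K S) (module.span K (free_space K S) R)) W.
    \<forall>s\<in>S. \<phi> (a_r_coset (free_space K S) (module.span K (free_space K S) R) (basis_vec K S s)) = e s"
proof -
  let ?F = "free_space K S"
  interpret QQ: quotient_space K ?F "module.span K ?F R"
    by (rule quotient_span[OF vs_free_space[OF assms(1)] assms(3)])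
  have "\<exists>\<phi>\<in>module_hom K ?F W. \<forall>s\<in>S. \<phi> (basis_vec K S s) = e s"
    by (rule free_space_ext[OF assms(1,2,4)])
  then obtain \<phi> where p: "\<phi> \<in> module_hom K ?F W" "\<forall>s\<in>S. \<phi> (basis_vec K S s) = e s"
    by blast
  have "\<phi> v = \<zero>\<^bsub>W\<^esub>" if "v \<in> module.span K ?F R" for v
    by (rule hom_vanishes_span[OF vs_free_space[OF assms(1)] assms(2) p(1) assms(3)
          assms(5)[OF p(1) p(2)[rule_format]] that])
  then obtain \<psi> where "\<psi> \<in> module_hom K (quot_space ?F (module.span K ?F R)) W"
    "\<forall>v\<in>carrier ?F. \<psi> (a_r_coset ?F (module.span K ?F R) v) = \<phi> v"
    using QQ.quot_ext[OF assms(2) p(1)] by blast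
  then have "\<forall>s\<in>S. \<psi> (a_r_coset ?F (module.span K ?F R) (basis_vec K S s)) = e s"
    using p(2) basis_vec_closed[OF assms(1)] by metis
  with \<open>\<psi> \<in> _\<close> show ?thesis by - (rule bexI[where x = \<psi>])
qed

lemma spanning_free_quot:
  assumes "field K" "R \<subseteq> carrier (free_space K S)"
  shows "vectorspace K (quot_space (free_space K S) (module.span K (free_space K S) R))"
    "spanning K (quot_space (free_space K S) (module.span K (free_space K S) R))
      ((\<lambda>s. a_r_coset (free_space K S) (module.span K (free_space K S) R) (basis_vec K S s)) ` S)"
proof -
  interpret QQ: quotient_space K "free_space K S" "module.span K (free_space K S) R"
    by (rule quotient_span[OF vs_free_space[OF assms(1)] assms(2)])
  show "vectorspace K (quot_space (free_space K S) (module.span K (free_space K S) R))"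
    by (rule QQ.vs_quot)
  show "spanning K (quot_space (free_space K S) (module.span K (free_space K S) R))
      ((\<lambda>s. a_r_coset (free_space K S) (module.span K (free_space K S) R) (basis_vec K S s)) ` S)"
    using QQ.spanning_quot[OF spanning_free_space[OF assms(1)]] by (simp add: image_image)
qed

section \<open>Direct sums\<close>

context
  fixes K :: "'k ring" and I :: "'i set" and V :: "'i \<Rightarrow> ('k, 'v) module"
  assumes K: "field K" and vs: "\<And>i. i \<in> I \<Longrightarrow> vectorspace K (V i)"
begin

lemma dsum_simps:
  "carrier (dsum I V) = {f \<in> (\<Pi>\<^sub>E i\<in>I. carrier (V i)). finite {i \<in> I. f i \<noteq> \<zero>\<^bsub>V i\<^esub>}}"
  "\<zero>\<^bsub>dsum I V\<^esub> = (\<lambda>i\<in>I. \<zero>\<^bsub>V i\<^esub>)"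
  "f \<oplus>\<^bsub>dsum I V\<^esub> g = (\<lambda>i\<in>I. f i \<oplus>\<^bsub>V i\<^esub> g i)"
  "c \<odot>\<^bsub>dsum I V\<^esub> f = (\<lambda>i\<in>I. c \<odot>\<^bsub>V i\<^esub> f i)"
  by (simp_all add: dsum_def)

lemma vs_dsum: "vectorspace K (dsum I V)"
proof -
  interpret K: field K by fact
  have mem: "f i \<in> carrier (V i)" if "f \<in> (\<Pi>\<^sub>E i\<in>I. carrier (V i))" "i \<in> I" for f i
    using that by auto
  have mod: "module K (V i)" if "i \<in> I" for i using vs[OF that] by (simp add: vectorspace_def)
  have ag: "abelian_group (V i)" if "i \<in> I" for i
    using mod[OF that] by (simp add: module_def)
  have am: "abelian_monoid (V i)" if "i \<in> I" for i
    using ag[OF that] by (simp add: abelian_group_def)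
  note ax = vs_add[OF vs] vs_smult[OF vs] vs_zero[OF vs] mem
    abelian_monoid.l_zero[OF am] abelian_monoid.r_zero[OF am] abelian_monoid.a_assoc[OF am]
    module.smult_l_distr[OF mod] module.smult_r_distr[OF mod]
    module.smult_assoc1[OF mod] module.smult_one[OF mod] module.rmult_0[OF mod]
    abelian_group.r_neg[OF ag] abelian_group.a_inv_closed[OF ag]
  have ext: "f \<in> extensional I" if "f \<in> (\<Pi>\<^sub>E i\<in>I. carrier (V i))" for f
    using that by (auto simp: PiE_def)
  have eqI: "f = g" if "f \<in> extensional I" "g \<in> extensional I" "\<And>i. i \<in> I \<Longrightarrow> f i = g i" for f g :: "'i \<Rightarrow> 'v"
    using that by (rule extensionalityI)
  have neg0: "\<ominus>\<^bsub>V i\<^esub> \<zero>\<^bsub>V i\<^esub> = \<zero>\<^bsub>V i\<^esub>" if "i \<in> I" for i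
    using abelian_group.r_neg[OF ag[OF that], of "\<zero>\<^bsub>V i\<^esub>"]
      abelian_monoid.l_zero[OF am[OF that], of "\<ominus>\<^bsub>V i\<^esub> \<zero>\<^bsub>V i\<^esub>"]
      abelian_group.a_inv_closed[OF ag[OF that]] vs_zero[OF vs[OF that]] by simp
  have carI: "restrict h I \<in> carrier (dsum I V)"
    if h: "\<And>i. i \<in> I \<Longrightarrow> h i \<in> carrier (V i)" and T: "finite T"
      "\<And>i. i \<in> I \<Longrightarrow> i \<notin> T \<Longrightarrow> h i = \<zero>\<^bsub>V i\<^esub>" for h T
  proof -
    have "{i \<in> I. restrict h I i \<noteq> \<zero>\<^bsub>V i\<^esub>} \<subseteq> T" using T(2) by auto
    then have "finite {i \<in> I. restrict h I i \<noteq> \<zero>\<^bsub>V i\<^esub>}" using T(1) by (rule finite_subset)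
    with h show ?thesis by (simp add: dsum_simps(1))
  qed
  have carD: "v \<in> (\<Pi>\<^sub>E i\<in>I. carrier (V i))" "finite {i \<in> I. v i \<noteq> \<zero>\<^bsub>V i\<^esub>}"
    if "v \<in> carrier (dsum I V)" for v
    using that by (simp_all add: dsum_simps(1))
  have "module K (dsum I V)"
  proof (rule module_criteria)
    show "cring K" by (rule K.is_cring)
    show "\<zero>\<^bsub>dsum I V\<^esub> \<in> carrier (dsum I V)"
      unfolding dsum_simps(2) by (rule carI[of _ "{}"]) (simp_all add: vs_zero[OF vs])
    show "\<forall>v w. v \<in> carrier (dsum I V) \<and> w \<in> carrier (dsum I V) \<longrightarrow> v \<oplus>\<^bsub>dsum I V\<^esub> w \<in> carrier (dsum I V)"
    proof (intro allI impI, elim conjE)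
      fix v w assume v: "v \<in> carrier (dsum I V)" and w: "w \<in> carrier (dsum I V)"
      show "v \<oplus>\<^bsub>dsum I V\<^esub> w \<in> carrier (dsum I V)" unfolding dsum_simps(3)
        by (rule carI[of _ "{i \<in> I. v i \<noteq> \<zero>\<^bsub>V i\<^esub>} \<union> {i \<in> I. w i \<noteq> \<zero>\<^bsub>V i\<^esub>}"])
          (simp_all add: carD[OF v] carD[OF w] vs_add[OF vs] mem[OF carD(1)[OF v]]
            mem[OF carD(1)[OF w]] abelian_monoid.l_zero[OF am] vs_zero[OF vs])
    qed
    show "\<forall>c v. c \<in> carrier K \<and> v \<in> carrier (dsum I V) \<longrightarrow> c \<odot>\<^bsub>dsum I V\<^esub> v \<in> carrier (dsum I V)"
    proof (intro allI impI, elim conjE)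
      fix c v assume c: "c \<in> carrier K" and v: "v \<in> carrier (dsum I V)"
      show "c \<odot>\<^bsub>dsum I V\<^esub> v \<in> carrier (dsum I V)" unfolding dsum_simps(4)
        by (rule carI[of _ "{i \<in> I. v i \<noteq> \<zero>\<^bsub>V i\<^esub>}"])
          (simp_all add: c carD[OF v] vs_smult[OF vs] mem[OF carD(1)[OF v]] module.rmult_0[OF mod])
    qed
    show "\<forall>v\<in>carrier (dsum I V). \<exists>w\<in>carrier (dsum I V). v \<oplus>\<^bsub>dsum I V\<^esub> w = \<zero>\<^bsub>dsum I V\<^esub>"
    proof
      fix v assume v: "v \<in> carrier (dsum I V)"
      let ?w = "\<lambda>i\<in>I. \<ominus>\<^bsub>V i\<^esub> v i"
      have "?w \<in> carrier (dsum I V)"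
        by (rule carI[of _ "{i \<in> I. v i \<noteq> \<zero>\<^bsub>V i\<^esub>}"])
          (simp_all add: carD[OF v] mem[OF carD(1)[OF v]] abelian_group.a_inv_closed[OF ag]
            neg0)
      moreover have "v \<oplus>\<^bsub>dsum I V\<^esub> ?w = \<zero>\<^bsub>dsum I V\<^esub>"
        by (rule eqI) (simp_all add: dsum_simps mem[OF carD(1)[OF v]] abelian_group.r_neg[OF ag])
      ultimately show "\<exists>w\<in>carrier (dsum I V). v \<oplus>\<^bsub>dsum I V\<^esub> w = \<zero>\<^bsub>dsum I V\<^esub>" by blast
    qed
    show "\<forall>v w. v \<in> carrier (dsum I V) \<and> w \<in> carrier (dsum I V) \<longrightarrow> v \<oplus>\<^bsub>dsum I V\<^esub> w = w \<oplus>\<^bsub>dsum I V\<^esub> v"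
      by (intro allI impI, elim conjE, rule eqI; simp add: dsum_simps abelian_monoid.a_comm[OF am] mem)
  qed (intro allI impI ballI, (elim conjE)?, rule eqI; simp add: dsum_simps ax ext)+
  then show ?thesis by (simp add: vectorspace_def K)
qed

lemma dsum_incl_hom:
  assumes "i \<in> I" shows "dsum_incl I V i \<in> module_hom K (V i) (dsum I V)"
proof (rule homI)
  fix v assume "v \<in> carrier (V i)"
  then show "dsum_incl I V i v \<in> carrier (dsum I V)"
    using vs_zero[OF vs] by (auto simp: dsum_simps dsum_incl_def cong: conj_cong)
next
  fix u v
  show "dsum_incl I V i (u \<oplus>\<^bsub>V i\<^esub> v) = dsum_incl I V i u \<oplus>\<^bsub>dsum I V\<^esub> dsum_incl I V i v"
  proof (intro ext)
    fix j
    show "dsum_incl I V i (u \<oplus>\<^bsub>V i\<^esub> v) j = (dsum_incl I V i u \<oplus>\<^bsub>dsum I V\<^esub> dsum_incl I V i v) j"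
      using vs_zero[OF vs] vs[of j]
      by (auto simp: dsum_simps dsum_incl_def vectorspace_def module_def abelian_group_def
          abelian_monoid.l_zero)
  qed
next
  fix c v assume "c \<in> carrier K"
  then show "dsum_incl I V i (c \<odot>\<^bsub>V i\<^esub> v) = c \<odot>\<^bsub>dsum I V\<^esub> dsum_incl I V i v"
    using module.rmult_0[OF vectorspace.axioms(1)[OF vs]]
    by (auto simp: dsum_simps dsum_incl_def fun_eq_iff)
qed

lemma dsum_ext:
  assumes "vectorspace K W" "\<And>i. i \<in> I \<Longrightarrow> \<phi> i \<in> module_hom K (V i) W"
  shows "\<exists>\<psi>\<in>module_hom K (dsum I V) W.
    \<forall>i\<in>I. \<forall>v\<in>carrier (V i). \<psi> (dsum_incl I V i v) = \<phi> i v"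
proof -
  have t: "(\<lambda>f. \<phi> i (f i)) \<in> module_hom K (dsum I V) W" if "i \<in> I" for i
    by (rule hom_comp[OF _ assms(2)[OF that]], rule homI) (use that in \<open>auto simp: dsum_simps\<close>)
  have z: "\<phi> i \<zero>\<^bsub>V i\<^esub> = \<zero>\<^bsub>W\<^esub>" if "i \<in> I" for i
    by (rule hom_zero[OF vs[OF that] assms(1) assms(2)[OF that]])
  have f: "finite {i \<in> I. \<phi> i (f i) \<noteq> \<zero>\<^bsub>W\<^esub>}" if "f \<in> carrier (dsum I V)" for f
    by (rule finite_subset[of _ "{i \<in> I. f i \<noteq> \<zero>\<^bsub>V i\<^esub>}"])
      (use that z in \<open>auto simp: dsum_simps\<close>)
  have "\<exists>\<psi>\<in>module_hom K (dsum I V) W. \<forall>f\<in>carrier (dsum I V). \<forall>j\<in>I.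
      (\<forall>i\<in>I. i \<noteq> j \<longrightarrow> \<phi> i (f i) = \<zero>\<^bsub>W\<^esub>) \<longrightarrow> \<psi> f = \<phi> j (f j)"
    by (rule vs_finsum_hom[OF vs_dsum assms(1) t f])
  then obtain \<psi> where p: "\<psi> \<in> module_hom K (dsum I V) W"
    "\<forall>f\<in>carrier (dsum I V). \<forall>j\<in>I.
      (\<forall>i\<in>I. i \<noteq> j \<longrightarrow> \<phi> i (f i) = \<zero>\<^bsub>W\<^esub>) \<longrightarrow> \<psi> f = \<phi> j (f j)"
    by blast
  have "\<psi> (dsum_incl I V i v) = \<phi> i v" if "i \<in> I" "v \<in> carrier (V i)" for i v
    using p(2)[rule_format, OF hom_closed[OF dsum_incl_hom[OF that(1)] that(2)] that(1)] that(1) z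
    by (simp add: dsum_incl_def)
  with p(1) show ?thesis by (intro bexI[of _ \<psi>]) simp_all
qed

text \<open>The same induction on the support as for free spaces; a component at one index lies in
  the span of the image of the generators of its summand.\<close>

lemma spanning_dsum:
  assumes "\<And>i. i \<in> I \<Longrightarrow> spanning K (V i) (E i)"
  shows "spanning K (dsum I V) (\<Union>i\<in>I. dsum_incl I V i ` E i)"
proof -
  let ?E = "\<Union>i\<in>I. dsum_incl I V i ` E i"
  have *: "f \<in> lspan K (dsum I V) ?E"
    if "finite T" "f \<in> (\<Pi>\<^sub>E i\<in>I. carrier (V i))" "{i \<in> I. f i \<noteq> \<zero>\<^bsub>V i\<^esub>} \<subseteq> T" for f T
    using that
  proof (induction T arbitrary: f rule: finite_induct)
    case empty
    then have "f = \<zero>\<^bsub>dsum I V\<^esub>"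
      by (auto simp: dsum_simps(2) fun_eq_iff PiE_def extensional_def)
    then show ?case by (simp add: lspan.zero)
  next
    case (insert s T)
    show ?case
    proof (cases "s \<in> I")
      case False
      then show ?thesis using insert by (intro insert.IH) auto
    next
      case True
      let ?f = "f(s := \<zero>\<^bsub>V s\<^esub>)"
      have fs: "f s \<in> carrier (V s)" using insert.prems True by auto
      have "?f \<in> lspan K (dsum I V) ?E"
        using insert.prems True vs_zero[OF vs[OF True]]
        by (intro insert.IH) (auto simp: PiE_def extensional_def split: if_splits)
      moreover have "dsum_incl I V s (f s) \<in> lspan K (dsum I V) ?E"
      proof (rule lspan_image[OF vs[OF True] vs_dsum dsum_incl_hom[OF True]])
        show "E s \<subseteq> carrier (V s)" "f s \<in> lspan K (V s) (E s)"
          using assms[OF True] fs by (auto simp: spanning_def)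
        show "dsum_incl I V s ` E s \<subseteq> lspan K (dsum I V) ?E"
          using True by (auto intro!: lspan.gen)
      qed
      ultimately have "?f \<oplus>\<^bsub>dsum I V\<^esub> dsum_incl I V s (f s) \<in> lspan K (dsum I V) ?E"
        by (rule lspan.add)
      moreover have "?f \<oplus>\<^bsub>dsum I V\<^esub> dsum_incl I V s (f s) = f"
      proof (rule extensionalityI[where A = I])
        fix i assume i: "i \<in> I"
        interpret Vi: vectorspace K "V i" by (rule vs[OF i])
        have "f i \<in> carrier (V i)" using insert.prems i by auto
        then show "(?f \<oplus>\<^bsub>dsum I V\<^esub> dsum_incl I V s (f s)) i = f i"
          using i Vi.M.l_zero[of "f i"] Vi.M.r_zero[of "f i"]
          by (cases "i = s") (simp_all add: dsum_simps dsum_incl_def)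
      qed (use insert.prems in \<open>auto simp: dsum_simps PiE_def\<close>)
      ultimately show ?thesis by simp
    qed
  qed
  show ?thesis unfolding spanning_def
  proof (intro conjI subsetI)
    fix f assume "f \<in> carrier (dsum I V)"
    then have "finite {i \<in> I. f i \<noteq> \<zero>\<^bsub>V i\<^esub>}" "f \<in> (\<Pi>\<^sub>E i\<in>I. carrier (V i))"
      by (simp_all add: dsum_simps(1))
    then show "f \<in> lspan K (dsum I V) ?E"
      by (rule *[OF _ _ subset_refl])
  next
    fix f assume "f \<in> ?E"
    then obtain i v where "i \<in> I" "v \<in> E i" "f = dsum_incl I V i v" by blast
    then show "f \<in> carrier (dsum I V)"
      using assms[of i] hom_closed[OF dsum_incl_hom] by (auto simp: spanning_def)
  qed
qed

end

section \<open>Tensor products\<close>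

definition bilin :: "'k ring \<Rightarrow> ('k, 'v) module \<Rightarrow> ('k, 'w) module \<Rightarrow> ('k, 'u) module
    \<Rightarrow> ('v \<Rightarrow> 'w \<Rightarrow> 'u) \<Rightarrow> bool" where
  "bilin K V W U \<beta> \<longleftrightarrow> (\<forall>v\<in>carrier V. \<beta> v \<in> module_hom K W U) \<and>
    (\<forall>w\<in>carrier W. (\<lambda>v. \<beta> v w) \<in> module_hom K V U)"

lemma vs_minus_closed:
  assumes "vectorspace K V" "u \<in> carrier V" "v \<in> carrier V" shows "u \<ominus>\<^bsub>V\<^esub> v \<in> carrier V"
proof -
  interpret V: vectorspace K V by fact
  show ?thesis using assms(2,3) by (simp add: a_minus_def)
qed

lemma vs_minus_self:
  assumes "vectorspace K V" "u \<in> carrier V" shows "u \<ominus>\<^bsub>V\<^esub> u = \<zero>\<^bsub>V\<^esub>"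
proof -
  interpret V: vectorspace K V by fact
  show ?thesis using assms(2) by (simp add: a_minus_def V.M.r_neg)
qed

section \<open>The tensor product of two spaces\<close>

context
  fixes K :: "'k ring" and V :: "('k, 'v) module" and W :: "('k, 'w) module"
  assumes K: "field K" and V: "vectorspace K V" and W: "vectorspace K W"
begin

lemma tensor_rel_closed: "tensor_rel K V W \<subseteq> carrier (free_space K (carrier V \<times> carrier W))"
proof
  fix r assume r: "r \<in> tensor_rel K V W"
  note F = vs_free_space[OF K, of "carrier V \<times> carrier W"]
  show "r \<in> carrier (free_space K (carrier V \<times> carrier W))"
    using r unfolding tensor_rel_def Let_def
    by (elim UnE CollectE exE conjE; hypsubst; intro vs_minus_closed[OF F] vs_add[OF F] vs_smult[OF F]
        basis_vec_closed[OF K] SigmaI vs_add[OF V] vs_add[OF W] vs_smult[OF V] vs_smult[OF W])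
qed

lemma vs_tensor: "vectorspace K (tensor K V W)"
  and spanning_tensor: "spanning K (tensor K V W)
    ((\<lambda>(v, w). pure_tensor K V W v w) ` (carrier V \<times> carrier W))"
  using spanning_free_quot[OF K tensor_rel_closed]
  by (simp_all add: tensor_def tensor_sub_def pure_tensor_def case_prod_unfold)

text \<open>Each of the four families of relations in \<open>tensor_rel\<close> is sent to a
  difference of equal vectors, by one of the four linearity properties of
  \<open>\<beta>\<close>.\<close>

lemma tensor_ext:
  assumes U: "vectorspace K U" and b: "bilin K V W U \<beta>"
  shows "\<exists>\<phi>\<in>module_hom K (tensor K V W) U.
    \<forall>v\<in>carrier V. \<forall>w\<in>carrier W. \<phi> (pure_tensor K V W v w) = \<beta> v w"
proof -
  let ?S = "carrier V \<times> carrier W"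
  let ?F = "free_space K ?S"
  note F = vs_free_space[OF K, of ?S]
  have hv: "\<beta> v \<in> module_hom K W U" if "v \<in> carrier V" for v using b that by (simp add: bilin_def)
  have hw: "(\<lambda>v. \<beta> v w) \<in> module_hom K V U" if "w \<in> carrier W" for w using b that by (simp add: bilin_def)
  have "\<exists>\<phi>\<in>module_hom K (quot_space ?F (module.span K ?F (tensor_rel K V W))) U.
    \<forall>s\<in>?S. \<phi> (a_r_coset ?F (module.span K ?F (tensor_rel K V W)) (basis_vec K ?S s))
      = case_prod \<beta> s"
  proof (rule free_quot_ext[OF K U tensor_rel_closed])
    fix s assume "s \<in> ?S"
    then show "case_prod \<beta> s \<in> carrier U" using hom_closed[OF hv] by auto
  next
    fix \<phi> r assume p: "\<phi> \<in> module_hom K ?F U" and e: "\<And>s. s \<in> ?S \<Longrightarrow> \<phi> (basis_vec K ?S s) = case_prod \<beta> s"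
      and r: "r \<in> tensor_rel K V W"
    have e': "\<phi> (basis_vec K ?S (v, w)) = \<beta> v w" if "v \<in> carrier V" "w \<in> carrier W" for v w
      using e[of "(v, w)"] that by simp
    have z: "\<phi> (x \<ominus>\<^bsub>?F\<^esub> y) = \<zero>\<^bsub>U\<^esub>" if "x \<in> carrier ?F" "y \<in> carrier ?F" "\<phi> x = \<phi> y" for x y
      using hom_minus[OF F U p that(1,2)] that(3) vs_minus_self[OF U hom_closed[OF p that(2)]] by simp
    show "\<phi> r = \<zero>\<^bsub>U\<^esub>"
      using r unfolding tensor_rel_def Let_def
      by (elim UnE CollectE exE conjE; hypsubst; intro z)
        (simp_all add: basis_vec_closed[OF K] vs_add[OF F] vs_smult[OF F] vs_add[OF V] vs_add[OF W]
          vs_smult[OF V] vs_smult[OF W] module_hom_add[OF p] module_hom_smult[OF p] e'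
          module_hom_add[OF hv] module_hom_add[OF hw] module_hom_smult[OF hv] module_hom_smult[OF hw])
  qed
  then show ?thesis
    by (simp add: tensor_def tensor_sub_def pure_tensor_def)
qed

text \<open>Read in the quotient, the four families of relations in \<open>tensor_rel\<close> are
  exactly the equations required here.\<close>

lemma pure_tensor_bilin: "bilin K V W (tensor K V W) (pure_tensor K V W)"
proof -
  let ?S = "carrier V \<times> carrier W"
  let ?F = "free_space K ?S"
  note F = vs_free_space[OF K, of ?S]
  interpret Q: quotient_space K ?F "module.span K ?F (tensor_rel K V W)"
    by (rule quotient_span[OF F tensor_rel_closed])
  note eq = coset_eqI[OF F tensor_rel_closed, folded tensor_sub_def]
  note Qs = Q.quot_structure[folded tensor_sub_def tensor_def]
  note cl = basis_vec_closed[OF K] vs_add[OF F] vs_smult[OF F] vs_add[OF V] vs_add[OF W]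
          vs_smult[OF V] vs_smult[OF W]
  have "pure_tensor K V W v w \<in> carrier (tensor K V W)" if "v \<in> carrier V" "w \<in> carrier W" for v w
    using that by (auto simp: pure_tensor_def Qs(1) intro!: imageI cl)
  moreover have "pure_tensor K V W (v \<oplus>\<^bsub>V\<^esub> v') w = pure_tensor K V W v w \<oplus>\<^bsub>tensor K V W\<^esub> pure_tensor K V W v' w"
    if "v \<in> carrier V" "v' \<in> carrier V" "w \<in> carrier W" for v v' w
  proof -
    have "basis_vec K ?S (v \<oplus>\<^bsub>V\<^esub> v', w) \<ominus>\<^bsub>?F\<^esub> (basis_vec K ?S (v, w) \<oplus>\<^bsub>?F\<^esub> basis_vec K ?S (v', w))
      \<in> tensor_rel K V W" unfolding tensor_rel_def Let_def using that by blast
    from eq[OF _ _ this] show ?thesis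
      using that by (simp add: pure_tensor_def cl flip: Qs(3))
  qed
  moreover have "pure_tensor K V W v (w \<oplus>\<^bsub>W\<^esub> w') = pure_tensor K V W v w \<oplus>\<^bsub>tensor K V W\<^esub> pure_tensor K V W v w'"
    if "v \<in> carrier V" "w \<in> carrier W" "w' \<in> carrier W" for v w w'
  proof -
    have "basis_vec K ?S (v, w \<oplus>\<^bsub>W\<^esub> w') \<ominus>\<^bsub>?F\<^esub> (basis_vec K ?S (v, w) \<oplus>\<^bsub>?F\<^esub> basis_vec K ?S (v, w'))
      \<in> tensor_rel K V W" unfolding tensor_rel_def Let_def using that by blast
    from eq[OF _ _ this] show ?thesis
      using that by (simp add: pure_tensor_def cl flip: Qs(3))
  qed
  moreover have "pure_tensor K V W (c \<odot>\<^bsub>V\<^esub> v) w = c \<odot>\<^bsub>tensor K V W\<^esub> pure_tensor K V W v w"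
    if "c \<in> carrier K" "v \<in> carrier V" "w \<in> carrier W" for c v w
  proof -
    have "basis_vec K ?S (c \<odot>\<^bsub>V\<^esub> v, w) \<ominus>\<^bsub>?F\<^esub> c \<odot>\<^bsub>?F\<^esub> basis_vec K ?S (v, w)
      \<in> tensor_rel K V W" unfolding tensor_rel_def Let_def using that by blast
    from eq[OF _ _ this] show ?thesis
      using that by (simp add: pure_tensor_def cl flip: Qs(4))
  qed
  moreover have "pure_tensor K V W v (c \<odot>\<^bsub>W\<^esub> w) = c \<odot>\<^bsub>tensor K V W\<^esub> pure_tensor K V W v w"
    if "c \<in> carrier K" "v \<in> carrier V" "w \<in> carrier W" for c v w
  proof -
    have "basis_vec K ?S (v, c \<odot>\<^bsub>W\<^esub> w) \<ominus>\<^bsub>?F\<^esub> c \<odot>\<^bsub>?F\<^esub> basis_vec K ?S (v, w)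
      \<in> tensor_rel K V W" unfolding tensor_rel_def Let_def using that by blast
    from eq[OF _ _ this] show ?thesis
      using that by (simp add: pure_tensor_def cl flip: Qs(4))
  qed
  ultimately show ?thesis unfolding bilin_def
    by (intro conjI ballI homI) simp_all
qed

end

section \<open>The tensor product of a finite list of spaces\<close>

definition multilin :: "'k ring \<Rightarrow> ('k, 'v) module list \<Rightarrow> ('k, 'u) module \<Rightarrow> ('v list \<Rightarrow> 'u) \<Rightarrow> bool" where
  "multilin K Vs U g \<longleftrightarrow> (\<forall>vs\<in>lcarrier Vs. g vs \<in> carrier U) \<and>
    (\<forall>vs\<in>lcarrier Vs. \<forall>i<length Vs. (\<lambda>v. g (vs[i := v])) \<in> module_hom K (Vs ! i) U)"

lemma lcarrier_update:
  "vs \<in> lcarrier Vs \<Longrightarrow> i < length Vs \<Longrightarrow> v \<in> carrier (Vs ! i) \<Longrightarrow> vs[i := v] \<in> lcarrier Vs"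
  by (auto simp: lcarrier_def list_all2_conv_all_nth nth_list_update)

context
  fixes K :: "'k ring" and Vs :: "('k, 'v) module list"
  assumes K: "field K" and Vs: "\<And>V. V \<in> set Vs \<Longrightarrow> vectorspace K V"
begin

lemma ltensor_rel_closed: "ltensor_rel K Vs \<subseteq> carrier (free_space K (lcarrier Vs))"
proof
  fix r assume r: "r \<in> ltensor_rel K Vs"
  note F = vs_free_space[OF K, of "lcarrier Vs"]
  show "r \<in> carrier (free_space K (lcarrier Vs))"
    using r unfolding ltensor_rel_def Let_def
    by (elim UnE CollectE exE conjE; hypsubst; intro vs_minus_closed[OF F] vs_add[OF F] vs_smult[OF F]
        basis_vec_closed[OF K] lcarrier_update vs_add[OF Vs] vs_smult[OF Vs] nth_mem)
qed

lemma vs_ltensor: "vectorspace K (ltensor K Vs)"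
  and spanning_ltensor: "spanning K (ltensor K Vs) (pure_ltensor K Vs ` lcarrier Vs)"
  using spanning_free_quot[OF K ltensor_rel_closed]
  by (simp_all add: ltensor_def ltensor_sub_def pure_ltensor_def image_def)

lemma ltensor_ext:
  assumes U: "vectorspace K U" and g: "multilin K Vs U g"
  shows "\<exists>\<phi>\<in>module_hom K (ltensor K Vs) U. \<forall>vs\<in>lcarrier Vs. \<phi> (pure_ltensor K Vs vs) = g vs"
proof -
  let ?S = "lcarrier Vs"
  let ?F = "free_space K ?S"
  note F = vs_free_space[OF K, of ?S]
  have h: "(\<lambda>v. g (vs[i := v])) \<in> module_hom K (Vs ! i) U" if "vs \<in> lcarrier Vs" "i < length Vs" for vs i
    using g that by (simp add: multilin_def)
  have "\<exists>\<phi>\<in>module_hom K (quot_space ?F (module.span K ?F (ltensor_rel K Vs))) U.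
    \<forall>s\<in>?S. \<phi> (a_r_coset ?F (module.span K ?F (ltensor_rel K Vs)) (basis_vec K ?S s)) = g s"
  proof (rule free_quot_ext[OF K U ltensor_rel_closed])
    fix s assume "s \<in> ?S"
    then show "g s \<in> carrier U" using g by (auto simp: multilin_def)
  next
    fix \<phi> r assume p: "\<phi> \<in> module_hom K ?F U" and e: "\<And>s. s \<in> ?S \<Longrightarrow> \<phi> (basis_vec K ?S s) = g s"
      and r: "r \<in> ltensor_rel K Vs"
    have z: "\<phi> (x \<ominus>\<^bsub>?F\<^esub> y) = \<zero>\<^bsub>U\<^esub>" if "x \<in> carrier ?F" "y \<in> carrier ?F" "\<phi> x = \<phi> y" for x y
      using hom_minus[OF F U p that(1,2)] that(3) vs_minus_self[OF U hom_closed[OF p that(2)]] by simp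
    show "\<phi> r = \<zero>\<^bsub>U\<^esub>"
      using r unfolding ltensor_rel_def Let_def
      by (elim UnE CollectE exE conjE; hypsubst; intro z)
        (simp_all add: basis_vec_closed[OF K] vs_add[OF F] vs_smult[OF F] lcarrier_update
          vs_add[OF Vs] vs_smult[OF Vs] module_hom_add[OF p] module_hom_smult[OF p] e
          module_hom_add[OF h] module_hom_smult[OF h])
  qed
  then show ?thesis
    by (simp add: ltensor_def ltensor_sub_def pure_ltensor_def)
qed

lemma pure_ltensor_multilin: "multilin K Vs (ltensor K Vs) (pure_ltensor K Vs)"
proof -
  let ?S = "lcarrier Vs"
  let ?F = "free_space K ?S"
  note F = vs_free_space[OF K, of ?S]
  interpret Q: quotient_space K ?F "module.span K ?F (ltensor_rel K Vs)"
    by (rule quotient_span[OF F ltensor_rel_closed])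
  note eq = coset_eqI[OF F ltensor_rel_closed, folded ltensor_sub_def]
  note Qs = Q.quot_structure[folded ltensor_sub_def ltensor_def]
  note cl = basis_vec_closed[OF K] vs_add[OF F] vs_smult[OF F] vs_add[OF Vs] vs_smult[OF Vs]
    lcarrier_update
  have "pure_ltensor K Vs vs \<in> carrier (ltensor K Vs)" if "vs \<in> lcarrier Vs" for vs
    using that by (auto simp: pure_ltensor_def Qs(1) intro!: imageI cl)
  moreover have "pure_ltensor K Vs (vs[i := v \<oplus>\<^bsub>Vs ! i\<^esub> v']) =
      pure_ltensor K Vs (vs[i := v]) \<oplus>\<^bsub>ltensor K Vs\<^esub> pure_ltensor K Vs (vs[i := v'])"
    if "vs \<in> lcarrier Vs" "i < length Vs" "v \<in> carrier (Vs ! i)" "v' \<in> carrier (Vs ! i)" for vs i v v'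
  proof -
    have "basis_vec K ?S (vs[i := v \<oplus>\<^bsub>Vs ! i\<^esub> v']) \<ominus>\<^bsub>?F\<^esub>
        (basis_vec K ?S (vs[i := v]) \<oplus>\<^bsub>?F\<^esub> basis_vec K ?S (vs[i := v'])) \<in> ltensor_rel K Vs"
      unfolding ltensor_rel_def Let_def using that by blast
    from eq[OF _ _ this] show ?thesis
      using that by (simp add: pure_ltensor_def cl flip: Qs(3))
  qed
  moreover have "pure_ltensor K Vs (vs[i := c \<odot>\<^bsub>Vs ! i\<^esub> v]) = c \<odot>\<^bsub>ltensor K Vs\<^esub> pure_ltensor K Vs (vs[i := v])"
    if "vs \<in> lcarrier Vs" "i < length Vs" "v \<in> carrier (Vs ! i)" "c \<in> carrier K" for vs i v c
  proof -
    have "basis_vec K ?S (vs[i := c \<odot>\<^bsub>Vs ! i\<^esub> v]) \<ominus>\<^bsub>?F\<^esub> c \<odot>\<^bsub>?F\<^esub> basis_vec K ?S (vs[i := v])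
      \<in> ltensor_rel K Vs"
      unfolding ltensor_rel_def Let_def using that by blast
    from eq[OF _ _ this] show ?thesis
      using that by (simp add: pure_ltensor_def cl flip: Qs(4))
  qed
  ultimately show ?thesis unfolding multilin_def
    by (intro conjI ballI allI impI homI) (simp_all add: lcarrier_update)
qed

end

lemma spanning_mono:
  assumes "spanning K V E" "E \<subseteq> E'" "E' \<subseteq> carrier V" shows "spanning K V E'"
proof (rule spanning_trans[OF assms(1) _ assms(3)])
  show "E \<subseteq> lspan K V E'" using assms(2) by (auto intro: lspan.gen)
qed

abbreviation "neg1 K \<equiv> \<ominus>\<^bsub>K\<^esub> \<one>\<^bsub>K\<^esub>"

section \<open>Permutations and decompositions\<close>

text \<open>A transposition is a product of adjacent ones, and transpositions generate. The interval
  is arbitrary because list positions start at 0 and the labels in the category start at 1.\<close>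

lemma perm_adjacent_induct [consumes 1, case_names id swap]:
  fixes a b :: nat
  assumes \<sigma>: "\<sigma> permutes {a..<b}" and id: "P id"
    and swap: "\<And>i p. a \<le> i \<Longrightarrow> Suc i < b \<Longrightarrow> p permutes {a..<b} \<Longrightarrow> P p \<Longrightarrow> P (transpose i (Suc i) \<circ> p)"
  shows "P \<sigma>"
proof -
  \<comment> \<open>A whole sequence of adjacent transpositions may be composed at once;
    \<open>adj_transp_seq x y\<close> is such a sequence for the transposition of \<open>x\<close>
    and \<open>y\<close>.\<close>
  have adj: "P (apply_adj_transps xs \<circ> p)"
    if "\<forall>i\<in>set xs. a \<le> i \<and> Suc i < b" "p permutes {a..<b}" "P p" for xs p
    using that(1)
  proof (induction xs)
    case Nil
    then show ?case using that by simp
  next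
    case (Cons i xs)
    have perm: "apply_adj_transps xs permutes {a..<b}"
      using Cons.prems by (intro permutes_apply_adj_transps) auto
    have "P (apply_adj_transps xs \<circ> p)" by (rule Cons.IH) (use Cons.prems in auto)
    then have "P (transpose i (Suc i) \<circ> (apply_adj_transps xs \<circ> p))"
      using Cons.prems by (intro swap permutes_compose[OF that(2) perm]) auto
    then show ?case by (simp add: o_def)
  qed
  have tr: "P (transpose x y \<circ> p)"
    if "x < y" "x \<in> {a..<b}" "y \<in> {a..<b}" "p permutes {a..<b}" "P p" for x y p
    using adj[of "adj_transp_seq x y" p] that
    by (simp add: adj_transp_seq_correct set_adj_transp_seq)
  show ?thesis
  proof (rule permutes_induct[OF \<sigma>])
    fix x y p assume *: "x \<in> {a..<b}" "y \<in> {a..<b}" "P p" "p permutes {a..<b}"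
    consider "x < y" | "x = y" | "y < x" by linarith
    then show "P (transpose x y \<circ> p)"
    proof cases
      case 3
      then show ?thesis using tr[of y x p] * by (simp add: transpose_commute)
    qed (use tr * in auto)
  qed (simp, rule id)
qed

text \<open>Translates the action of an adjacent transposition on positions into the exchange of two
  neighbours in a split list, the form in which all symmetry conditions are stated later.\<close>

lemma permute_list_adjacent:
  "permute_list (transpose (length l1) (Suc (length l1))) (l1 @ p # q # l2) = l1 @ q # p # l2"
  (is "permute_list ?f ?xs = ?ys")
proof (rule nth_equalityI)
  fix i assume "i < length (permute_list ?f ?xs)"
  then have i: "i < length ?xs" by simp
  then have *: "permute_list ?f ?xs ! i = ?xs ! ?f i" by (simp add: permute_list_def del: upt_Suc)
  consider "i < length l1" | "i = length l1" | "i = Suc (length l1)"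
    | j where "i = Suc (Suc (length l1)) + j"
    using le_Suc_ex[of "Suc (Suc (length l1))" i] by (metis not_less less_Suc_eq)
  then show "permute_list ?f ?xs ! i = ?ys ! i"
    unfolding * by cases (simp_all add: transpose_def nth_append)
qed simp

text \<open>Treats the sign and the trivial character together, with \<open>s\<close> the value at
  adjacent transpositions. Multiplicativity is asked for permutations only, since
  \<open>evenperm\<close> is multiplicative only on them.\<close>

definition perm_char :: "'k ring \<Rightarrow> ((nat \<Rightarrow> nat) \<Rightarrow> 'k) \<Rightarrow> 'k \<Rightarrow> bool" where
  "perm_char K \<chi> s \<longleftrightarrow> s \<in> carrier K \<and> (\<forall>p. \<chi> p \<in> carrier K) \<and> \<chi> id = \<one>\<^bsub>K\<^esub> \<and>
    (\<forall>p i. permutation p \<longrightarrow> \<chi> (transpose i (Suc i) \<circ> p) = s \<otimes>\<^bsub>K\<^esub> \<chi> p) \<and>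
    (\<forall>i. \<chi> (transpose i (Suc i)) = s)"

lemma perm_char_sgn: assumes "field K" shows "perm_char K (perm_sgn K) (neg1 K)"
proof -
  interpret field K by fact
  show ?thesis
    by (auto simp: perm_char_def perm_sgn_def evenperm_comp permutation_swap_id evenperm_swap l_minus)
qed

lemma perm_char_triv: assumes "field K" shows "perm_char K (perm_triv K) \<one>\<^bsub>K\<^esub>"
proof -
  interpret field K by fact
  show ?thesis by (auto simp: perm_char_def perm_triv_def)
qed

section \<open>Decompositions into pairwise disjoint pairs of sets\<close>

definition bdisj :: "'a bob \<Rightarrow> 'a bob \<Rightarrow> bool" where
  "bdisj C D \<longleftrightarrow> fst C \<inter> fst D = {} \<and> snd C \<inter> snd D = {}"

definition bsub :: "'a bob \<Rightarrow> 'a bob \<Rightarrow> bool" where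
  "bsub D A \<longleftrightarrow> fst D \<subseteq> fst A \<and> snd D \<subseteq> snd A"

lemma bdisj_sym: "bdisj C D \<longleftrightarrow> bdisj D C"
  by (auto simp: bdisj_def)

text \<open>With \<open>sorted_wrt\<close>, disjointness simplifies along \<open>Cons\<close> and
  append, which suits lists of factors that are split or extended. The indexed form after it suits
  permutations.\<close>

lemma is_decomp_iff:
  "is_decomp Ds A \<longleftrightarrow> (\<Union>D\<in>set Ds. fst D) = fst A \<and> (\<Union>D\<in>set Ds. snd D) = snd A \<and> sorted_wrt bdisj Ds"
  unfolding is_decomp_def sorted_wrt_iff_nth_less bdisj_def by (intro conj_cong refl) blast

lemma is_decomp_nth:
  "is_decomp Ds A \<longleftrightarrow> (\<Union>D\<in>set Ds. fst D) = fst A \<and> (\<Union>D\<in>set Ds. snd D) = snd A \<and>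
    (\<forall>i<length Ds. \<forall>j<length Ds. i \<noteq> j \<longrightarrow> bdisj (Ds ! i) (Ds ! j))"
proof -
  have "sorted_wrt bdisj Ds \<longleftrightarrow> (\<forall>i<length Ds. \<forall>j<length Ds. i \<noteq> j \<longrightarrow> bdisj (Ds ! i) (Ds ! j))"
    (is "_ = ?R")
  proof
    assume s: "sorted_wrt bdisj Ds"
    show ?R
    proof (intro allI impI)
      fix i j assume "i < length Ds" "j < length Ds" "i \<noteq> j"
      then have "bdisj (Ds ! i) (Ds ! j) \<or> bdisj (Ds ! j) (Ds ! i)"
        using s unfolding sorted_wrt_iff_nth_less by (cases i j rule: linorder_cases) auto
      then show "bdisj (Ds ! i) (Ds ! j)" using bdisj_sym by blast
    qed
  qed (auto simp: sorted_wrt_iff_nth_less)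
  then show ?thesis unfolding is_decomp_iff by simp
qed

lemma is_decomp_permute:
  "is_decomp Ds A \<Longrightarrow> \<sigma> permutes {..<length Ds} \<Longrightarrow> is_decomp (permute_list \<sigma> Ds) A"
proof -
  assume d: "is_decomp Ds A" and s: "\<sigma> permutes {..<length Ds}"
  have "\<sigma> i < length Ds" if "i < length Ds" for i using permutes_in_image[OF s, of i] that by simp
  moreover have "\<sigma> i \<noteq> \<sigma> j" if "i \<noteq> j" for i j using permutes_inj[OF s] that by (simp add: inj_eq)
  ultimately show ?thesis
    using d unfolding is_decomp_nth by (simp add: permute_list_nth[OF s] set_permute_list[OF s])
qed

lemma is_decomp_bsub: "is_decomp Ds A \<Longrightarrow> D \<in> set Ds \<Longrightarrow> bsub D A"
  by (auto simp: is_decomp_def bsub_def)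

lemma bsub_B_obj: "bsub D A \<Longrightarrow> A \<in> B_obj \<Longrightarrow> D \<in> B_obj"
  by (cases A; cases D) (auto simp: bsub_def B_obj_def intro: finite_subset)

lemma pow_terms_permute:
  "ps \<in> pow_terms F A \<Longrightarrow> \<sigma> permutes {..<length ps} \<Longrightarrow> permute_list \<sigma> ps \<in> pow_terms F A"
  by (auto simp: pow_terms_def is_decomp_permute simp flip: permute_list_map)

lemma pow_terms_swap: "l1 @ p # q # l2 \<in> pow_terms F A \<Longrightarrow> l1 @ q # p # l2 \<in> pow_terms F A"
  using pow_terms_permute[of "l1 @ p # q # l2" F A "transpose (length l1) (Suc (length l1))"]
  by (simp add: permute_list_adjacent permutes_swap_id)

lemma pow_terms_slot:
  "l1 @ (D, v) # l2 \<in> pow_terms F A \<Longrightarrow> u \<in> carrier (kb_sp F D) \<Longrightarrow> l1 @ (D, u) # l2 \<in> pow_terms F A"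
  by (auto simp: pow_terms_def)

text \<open>
  The scalar \<open>s\<close> is the value of the character \<open>\<chi>\<close> at a transposition: the functions below are those
  that factor through the twisted coinvariants of the convolution powers.
\<close>

definition star_fun :: "'k ring \<Rightarrow> 'k \<Rightarrow> ('a, 'k, 'w) kBmod \<Rightarrow> 'a bob \<Rightarrow> ('k, 'u) module
    \<Rightarrow> (('a bob \<times> 'w) list \<Rightarrow> 'u) \<Rightarrow> bool" where
  "star_fun K s F A W g \<longleftrightarrow> (\<forall>ps\<in>pow_terms F A. g ps \<in> carrier W) \<and>
    (\<forall>l1 D v l2. l1 @ (D, v) # l2 \<in> pow_terms F A \<longrightarrow>
      (\<lambda>u. g (l1 @ (D, u) # l2)) \<in> module_hom K (kb_sp F D) W) \<and>
    (\<forall>l1 p q l2. l1 @ p # q # l2 \<in> pow_terms F A \<longrightarrow> g (l1 @ q # p # l2) = s \<odot>\<^bsub>W\<^esub> g (l1 @ p # q # l2))"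

lemma star_funD:
  assumes "star_fun K s F A W g"
  shows "ps \<in> pow_terms F A \<Longrightarrow> g ps \<in> carrier W"
    "l1 @ (D, v) # l2 \<in> pow_terms F A \<Longrightarrow> (\<lambda>u. g (l1 @ (D, u) # l2)) \<in> module_hom K (kb_sp F D) W"
    "l1 @ p # q # l2 \<in> pow_terms F A \<Longrightarrow> g (l1 @ q # p # l2) = s \<odot>\<^bsub>W\<^esub> g (l1 @ p # q # l2)"
  using assms unfolding star_fun_def by blast+

text \<open>Exchanging neighbours generates all permutations. The list is quantified inside the
  induction, because composing with a transposition changes the list to which the induction
  hypothesis is applied.\<close>

lemma star_fun_permute:
  assumes \<chi>: "perm_char K \<chi> s" and W: "vectorspace K W" and g: "star_fun K s F A W g"
    and ps: "ps \<in> pow_terms F A" and \<sigma>: "\<sigma> permutes {..<length ps}"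
  shows "g (permute_list \<sigma> ps) = \<chi> \<sigma> \<odot>\<^bsub>W\<^esub> g ps"
proof -
  interpret W: vectorspace K W by fact
  define d where "d = length ps"
  have "\<sigma> permutes {0..<d}" using \<sigma> by (simp add: d_def atLeast0LessThan)
  then have "\<forall>ps\<in>pow_terms F A. length ps = d \<longrightarrow> g (permute_list \<sigma> ps) = \<chi> \<sigma> \<odot>\<^bsub>W\<^esub> g ps"
  proof (induction rule: perm_adjacent_induct)
    case id
    then show ?case using \<chi> star_funD(1)[OF g] by (simp add: perm_char_def id_def)
  next
    case (swap i p)
    show ?case
    proof (intro ballI impI)
      fix ps assume ps: "ps \<in> pow_terms F A" and d: "length ps = d"
      define l1 l2 u v where "l1 = take i ps" "l2 = drop (Suc (Suc i)) ps" "u = ps ! i" "v = ps ! Suc i"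
      have i: "i = length l1" using swap d by (simp add: l1_l2_u_v_def)
      have s: "ps = l1 @ u # v # l2" unfolding l1_l2_u_v_def using swap(2) d
        by (simp add: Cons_nth_drop_Suc)
      have "permute_list (transpose i (Suc i)) ps = l1 @ v # u # l2"
        unfolding s i by (rule permute_list_adjacent)
      \<comment> \<open>Permuting by a composite applies the left factor to the list before the
        right one, so the two neighbours are exchanged before \<open>p\<close> acts.\<close>
      then have "permute_list (transpose i (Suc i) \<circ> p) ps = permute_list p (l1 @ v # u # l2)"
        using swap(3) d by (simp add: permute_list_compose atLeast0LessThan)
      moreover have sw: "l1 @ v # u # l2 \<in> pow_terms F A" using ps unfolding s by (rule pow_terms_swap)
      ultimately have "g (permute_list (transpose i (Suc i) \<circ> p) ps) = \<chi> p \<odot>\<^bsub>W\<^esub> g (l1 @ v # u # l2)"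
        using swap(4) d s by simp
      also have "g (l1 @ v # u # l2) = s \<odot>\<^bsub>W\<^esub> g ps"
        using star_funD(3)[OF g] ps unfolding s by blast
      also have "\<chi> p \<odot>\<^bsub>W\<^esub> (s \<odot>\<^bsub>W\<^esub> g ps) = (s \<otimes>\<^bsub>K\<^esub> \<chi> p) \<odot>\<^bsub>W\<^esub> g ps"
        using \<chi> star_funD(1)[OF g ps] by (simp add: perm_char_def W.m_comm flip: W.smult_assoc1)
      also have "permutation p" using swap(3) permutes_imp_permutation[of "{0..<d}"] by simp
      then have "s \<otimes>\<^bsub>K\<^esub> \<chi> p = \<chi> (transpose i (Suc i) \<circ> p)"
        using \<chi> by (simp add: perm_char_def)
      finally show "g (permute_list (transpose i (Suc i) \<circ> p) ps) = \<chi> (transpose i (Suc i) \<circ> p) \<odot>\<^bsub>W\<^esub> g ps" .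
    qed
  qed
  then show ?thesis using ps d_def by blast
qed

section \<open>Exterior and symmetric powers\<close>

locale star_ctx =
  fixes K :: "'k ring" and \<chi> :: "(nat \<Rightarrow> nat) \<Rightarrow> 'k" and s :: 'k and F :: "('a, 'k, 'w) kBmod"
  assumes K: "field K" and F: "kB_module K F" and \<chi>: "perm_char K \<chi> s"
begin

lemma vs_F: "bsub D A \<Longrightarrow> A \<in> B_obj \<Longrightarrow> vectorspace K (kb_sp F D)"
  using kB_module.space[OF F] bsub_B_obj by blast

context
  fixes A :: "'a bob"
  assumes A: "A \<in> B_obj"
begin

lemma vs_parts: "Ds \<in> decomps d A \<Longrightarrow> V \<in> set (map (kb_sp F) Ds) \<Longrightarrow> vectorspace K V"
  using vs_F[OF _ A] by (auto simp: decomps_def dest: is_decomp_bsub)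

lemma vs_pow_summand: "Ds \<in> decomps d A \<Longrightarrow> vectorspace K (pow_summand K F Ds)"
  unfolding pow_summand_def by (rule vs_ltensor[OF K vs_parts])

lemma vs_pow: "vectorspace K (pow_sp K F d A)"
  unfolding pow_sp_def by (rule vs_dsum[OF K vs_pow_summand])

lemma pow_incl_hom:
  "Ds \<in> decomps d A \<Longrightarrow> dsum_incl (decomps d A) (pow_summand K F) Ds
    \<in> module_hom K (pow_summand K F Ds) (pow_sp K F d A)"
  unfolding pow_sp_def by (rule dsum_incl_hom[OF K]) (auto intro: vs_pow_summand)

lemma pow_terms_lcarrier:
  assumes "ps \<in> pow_terms F A"
  shows "map fst ps \<in> decomps (length ps) A" "map snd ps \<in> lcarrier (map (kb_sp F) (map fst ps))"
  using assms by (auto simp: pow_terms_def decomps_def lcarrier_def list_all2_conv_all_nth split_beta)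

text \<open>A term is a list of pairs, whereas a convolution power is indexed by the list of first
  components and its summands consist of tensors of second components. Zipping passes from the
  latter to the former.\<close>

lemma lcarrier_pow_terms:
  assumes "Ds \<in> decomps d A" "vs \<in> lcarrier (map (kb_sp F) Ds)"
  shows "zip Ds vs \<in> pow_terms F A" "map fst (zip Ds vs) = Ds" "map snd (zip Ds vs) = vs"
    "length (zip Ds vs) = d"
proof -
  have l: "length vs = length Ds" using assms(2) by (simp add: lcarrier_def list_all2_conv_all_nth)
  show "map fst (zip Ds vs) = Ds" "map snd (zip Ds vs) = vs" "length (zip Ds vs) = d"
    using l assms(1) by (simp_all add: decomps_def)
  with l show "zip Ds vs \<in> pow_terms F A"
    using assms by (auto simp: pow_terms_def decomps_def lcarrier_def list_all2_conv_all_nth set_zip)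
qed

lemma pow_elt_closed: "ps \<in> pow_terms F A \<Longrightarrow> pow_elt K F A ps \<in> carrier (pow_sp K F (length ps) A)"
proof -
  assume ps: "ps \<in> pow_terms F A"
  note d = pow_terms_lcarrier[OF ps]
  have "pure_ltensor K (map (kb_sp F) (map fst ps)) (map snd ps) \<in> carrier (pow_summand K F (map fst ps))"
    using pure_ltensor_multilin[OF K vs_parts[OF d(1)]] d(2)
    unfolding multilin_def pow_summand_def by blast
  then show ?thesis unfolding pow_elt_def
    by (rule hom_closed[OF pow_incl_hom[OF d(1)]])
qed

lemma pow_elt_slot:
  assumes ps: "l1 @ (D, v) # l2 \<in> pow_terms F A"
  shows "(\<lambda>u. pow_elt K F A (l1 @ (D, u) # l2))
    \<in> module_hom K (kb_sp F D) (pow_sp K F (Suc (length l1 + length l2)) A)"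
proof -
  let ?ps = "l1 @ (D, v) # l2"
  let ?Vs = "map (kb_sp F) (map fst ?ps)"
  note d = pow_terms_lcarrier[OF ps]
  have "(\<lambda>u. pure_ltensor K ?Vs ((map snd ?ps)[length l1 := u]))
      \<in> module_hom K (?Vs ! length l1) (ltensor K ?Vs)"
    using pure_ltensor_multilin[OF K vs_parts[OF d(1)]] d(2)
    unfolding multilin_def by force
  moreover have "?Vs ! length l1 = kb_sp F D" by (simp add: nth_append)
  ultimately have "(\<lambda>u. pure_ltensor K ?Vs ((map snd ?ps)[length l1 := u]))
      \<in> module_hom K (kb_sp F D) (pow_summand K F (map fst ?ps))"
    unfolding pow_summand_def by simp
  from hom_comp[OF this pow_incl_hom[OF d(1)]]
  show ?thesis by (simp add: pow_elt_def list_update_append)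
qed

lemma spanning_pow: "spanning K (pow_sp K F d A) (pow_elt K F A ` {ps \<in> pow_terms F A. length ps = d})"
proof -
  have "spanning K (pow_sp K F d A) (\<Union>Ds\<in>decomps d A. dsum_incl (decomps d A) (pow_summand K F) Ds `
      pure_ltensor K (map (kb_sp F) Ds) ` lcarrier (map (kb_sp F) Ds))"
    unfolding pow_sp_def
  proof (rule spanning_dsum[OF K vs_pow_summand])
    fix Ds assume "Ds \<in> decomps d A"
    then show "spanning K (pow_summand K F Ds) (pure_ltensor K (map (kb_sp F) Ds) ` lcarrier (map (kb_sp F) Ds))"
      unfolding pow_summand_def by (intro spanning_ltensor[OF K vs_parts])
  qed
  moreover have "(\<Union>Ds\<in>decomps d A. dsum_incl (decomps d A) (pow_summand K F) Ds `
      pure_ltensor K (map (kb_sp F) Ds) ` lcarrier (map (kb_sp F) Ds))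
      \<subseteq> pow_elt K F A ` {ps \<in> pow_terms F A. length ps = d}" (is "?L \<subseteq> ?R")
  proof
    fix x assume "x \<in> ?L"
    then obtain Ds vs where *: "Ds \<in> decomps d A" "vs \<in> lcarrier (map (kb_sp F) Ds)"
      "x = dsum_incl (decomps d A) (pow_summand K F) Ds (pure_ltensor K (map (kb_sp F) Ds) vs)" by blast
    note z = lcarrier_pow_terms[OF *(1,2)]
    have "x = pow_elt K F A (zip Ds vs)" unfolding pow_elt_def z(2,3,4) *(3) ..
    with z show "x \<in> ?R" by blast
  qed
  moreover have "?R \<subseteq> carrier (pow_sp K F d A)" using pow_elt_closed by auto
  ultimately show ?thesis by (rule spanning_mono)
qed

text \<open>For a fixed decomposition \<open>g\<close> is a multilinear function of the list of
  vectors, so it extends over each tensor product; the extensions assemble over the direct sum of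
  all decompositions.\<close>

lemma pow_ext:
  assumes W: "vectorspace K W" and g: "star_fun K s F A W g"
  shows "\<exists>\<phi>\<in>module_hom K (pow_sp K F d A) W. \<forall>ps\<in>pow_terms F A. length ps = d \<longrightarrow> \<phi> (pow_elt K F A ps) = g ps"
proof -
  have "\<exists>\<phi>\<in>module_hom K (pow_summand K F Ds) W. \<forall>vs\<in>lcarrier (map (kb_sp F) Ds).
      \<phi> (pure_ltensor K (map (kb_sp F) Ds) vs) = g (zip Ds vs)" if Ds: "Ds \<in> decomps d A" for Ds
    unfolding pow_summand_def
  proof (rule ltensor_ext[OF K vs_parts[OF Ds] W])
    show "multilin K (map (kb_sp F) Ds) W (\<lambda>vs. g (zip Ds vs))" unfolding multilin_def
    proof (intro conjI ballI allI impI)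
      fix vs assume vs: "vs \<in> lcarrier (map (kb_sp F) Ds)"
      show "g (zip Ds vs) \<in> carrier W"
        using star_funD(1)[OF g lcarrier_pow_terms(1)[OF Ds vs]] .
      fix i assume i: "i < length (map (kb_sp F) Ds)"
      have l: "length vs = length Ds" using vs by (simp add: lcarrier_def list_all2_conv_all_nth)
      \<comment> \<open>Multilinearity updates the list of vectors at an index,
        \<open>star_fun\<close> replaces one entry of a split list of pairs; the equation identifies
        the two.\<close>
      have z: "zip Ds (vs[i := u]) = take i (zip Ds vs) @ (Ds ! i, u) # drop (Suc i) (zip Ds vs)" for u
      proof -
        have "zip Ds (vs[i := u]) = (zip Ds vs)[i := (Ds ! i, u)]"
          using update_zip[of Ds vs i "(Ds ! i, u)"] by simp
        also have "\<dots> = take i (zip Ds vs) @ (Ds ! i, u) # drop (Suc i) (zip Ds vs)"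
          using i l by (intro upd_conv_take_nth_drop) simp
        finally show ?thesis .
      qed
      have "take i (zip Ds vs) @ (Ds ! i, vs ! i) # drop (Suc i) (zip Ds vs) \<in> pow_terms F A"
        using lcarrier_pow_terms(1)[OF Ds vs] z[of "vs ! i"] by simp
      from star_funD(2)[OF g this] show
        "(\<lambda>v. g (zip Ds (vs[i := v]))) \<in> module_hom K (map (kb_sp F) Ds ! i) W"
        using i by (simp add: z)
    qed
  qed
  then obtain \<phi> where \<phi>: "\<And>Ds. Ds \<in> decomps d A \<Longrightarrow> \<phi> Ds \<in> module_hom K (pow_summand K F Ds) W"
    "\<And>Ds vs. Ds \<in> decomps d A \<Longrightarrow> vs \<in> lcarrier (map (kb_sp F) Ds) \<Longrightarrow>
      \<phi> Ds (pure_ltensor K (map (kb_sp F) Ds) vs) = g (zip Ds vs)" by metis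
  have "\<exists>\<psi>\<in>module_hom K (pow_sp K F d A) W.
      \<forall>Ds\<in>decomps d A. \<forall>v\<in>carrier (pow_summand K F Ds).
        \<psi> (dsum_incl (decomps d A) (pow_summand K F) Ds v) = \<phi> Ds v"
    unfolding pow_sp_def by (rule dsum_ext[OF K vs_pow_summand W \<phi>(1)])
  then obtain \<psi> where \<psi>: "\<psi> \<in> module_hom K (pow_sp K F d A) W"
    "\<forall>Ds\<in>decomps d A. \<forall>v\<in>carrier (pow_summand K F Ds).
        \<psi> (dsum_incl (decomps d A) (pow_summand K F) Ds v) = \<phi> Ds v" by blast
  have "\<psi> (pow_elt K F A ps) = g ps" if ps: "ps \<in> pow_terms F A" and d: "length ps = d" for ps
  proof -
    note l = pow_terms_lcarrier[OF ps]
    have "pure_ltensor K (map (kb_sp F) (map fst ps)) (map snd ps) \<in> carrier (pow_summand K F (map fst ps))"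
      using pure_ltensor_multilin[OF K vs_parts[OF l(1)]] l(2)
      unfolding multilin_def pow_summand_def by blast
    then have "\<psi> (pow_elt K F A ps) = \<phi> (map fst ps) (pure_ltensor K (map (kb_sp F) (map fst ps)) (map snd ps))"
      using \<psi>(2) l(1) unfolding pow_elt_def d by blast
    also have "\<dots> = g (zip (map fst ps) (map snd ps))"
      using \<phi>(2)[OF l(1)[unfolded d] l(2)] .
    finally show ?thesis by (simp add: zip_map_fst_snd)
  qed
  with \<psi>(1) show ?thesis by blast
qed

lemma coinv_gen_closed:
  "{pow_elt K F A (permute_list \<sigma> ps) \<ominus>\<^bsub>pow_sp K F d A\<^esub> \<chi> \<sigma> \<odot>\<^bsub>pow_sp K F d A\<^esub> pow_elt K F A ps |\<sigma> ps.
    ps \<in> pow_terms F A \<and> length ps = d \<and> \<sigma> permutes {..<d}} \<subseteq> carrier (pow_sp K F d A)"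
proof
  fix x assume "x \<in> {pow_elt K F A (permute_list \<sigma> ps) \<ominus>\<^bsub>pow_sp K F d A\<^esub> \<chi> \<sigma> \<odot>\<^bsub>pow_sp K F d A\<^esub> pow_elt K F A ps |\<sigma> ps.
    ps \<in> pow_terms F A \<and> length ps = d \<and> \<sigma> permutes {..<d}}"
  then obtain \<sigma> ps where *: "ps \<in> pow_terms F A" "length ps = d" "\<sigma> permutes {..<d}"
    "x = pow_elt K F A (permute_list \<sigma> ps) \<ominus>\<^bsub>pow_sp K F d A\<^esub> \<chi> \<sigma> \<odot>\<^bsub>pow_sp K F d A\<^esub> pow_elt K F A ps" by blast
  have "permute_list \<sigma> ps \<in> pow_terms F A" using pow_terms_permute * by blast
  from pow_elt_closed[OF this] pow_elt_closed[OF *(1)] *(2) show "x \<in> carrier (pow_sp K F d A)"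
    unfolding *(4) using \<chi>
    by (intro vs_minus_closed[OF vs_pow] vs_smult[OF vs_pow]) (simp_all add: perm_char_def)
qed

lemma vs_coinv: "vectorspace K (coinv_sp K \<chi> F A d)"
  unfolding coinv_sp_def coinv_sub_def
  by (rule quotient_space.vs_quot[OF quotient_span[OF vs_pow coinv_gen_closed]])

lemma vs_star: "vectorspace K (star_sp K \<chi> F A)"
  unfolding star_sp_def by (rule vs_dsum[OF K vs_coinv])

lemma star_proj_hom:
  "(\<lambda>v. dsum_incl UNIV (coinv_sp K \<chi> F A) d (a_r_coset (pow_sp K F d A) (coinv_sub K \<chi> F d A) v))
    \<in> module_hom K (pow_sp K F d A) (star_sp K \<chi> F A)"
proof (rule hom_comp)
  show "a_r_coset (pow_sp K F d A) (coinv_sub K \<chi> F d A) \<in> module_hom K (pow_sp K F d A) (coinv_sp K \<chi> F A d)"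
    unfolding coinv_sp_def coinv_sub_def
    by (rule quotient_space.quot_hom[OF quotient_span[OF vs_pow coinv_gen_closed]])
  show "dsum_incl UNIV (coinv_sp K \<chi> F A) d \<in> module_hom K (coinv_sp K \<chi> F A d) (star_sp K \<chi> F A)"
    unfolding star_sp_def by (rule dsum_incl_hom[OF K vs_coinv]) simp
qed

lemma spanning_star: "spanning K (star_sp K \<chi> F A) (star_elt K \<chi> F A ` pow_terms F A)"
proof -
  have "spanning K (coinv_sp K \<chi> F A d) (a_r_coset (pow_sp K F d A) (coinv_sub K \<chi> F d A) `
      pow_elt K F A ` {ps \<in> pow_terms F A. length ps = d})" for d
    unfolding coinv_sp_def coinv_sub_def
    by (rule quotient_space.spanning_quot[OF quotient_span[OF vs_pow coinv_gen_closed] spanning_pow])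
  then have "spanning K (star_sp K \<chi> F A) (\<Union>d\<in>UNIV. dsum_incl UNIV (coinv_sp K \<chi> F A) d `
      a_r_coset (pow_sp K F d A) (coinv_sub K \<chi> F d A) ` pow_elt K F A ` {ps \<in> pow_terms F A. length ps = d})"
    unfolding star_sp_def by (rule spanning_dsum[OF K vs_coinv])
  also have "(\<Union>d\<in>UNIV. dsum_incl UNIV (coinv_sp K \<chi> F A) d `
      a_r_coset (pow_sp K F d A) (coinv_sub K \<chi> F d A) ` pow_elt K F A ` {ps \<in> pow_terms F A. length ps = d})
    = star_elt K \<chi> F A ` pow_terms F A"
    by (auto simp: star_elt_def image_iff)
  finally show ?thesis .
qed

text \<open>Together with \<open>star_ext\<close> this makes \<open>star_elt\<close> the universal
  function among those described by \<open>star_fun\<close>: the exchange of neighbours is the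
  relation of the coinvariants for an adjacent transposition.\<close>

lemma star_elt_fun: "star_fun K s F A (star_sp K \<chi> F A) (star_elt K \<chi> F A)"
  unfolding star_fun_def
proof (intro conjI ballI allI impI)
  fix ps assume ps: "ps \<in> pow_terms F A"
  show "star_elt K \<chi> F A ps \<in> carrier (star_sp K \<chi> F A)"
    unfolding star_elt_def by (rule hom_closed[OF star_proj_hom pow_elt_closed[OF ps]])
next
  fix l1 D v l2 assume "l1 @ (D, v) # l2 \<in> pow_terms F A"
  from hom_comp[OF pow_elt_slot[OF this] star_proj_hom]
  show "(\<lambda>u. star_elt K \<chi> F A (l1 @ (D, u) # l2)) \<in> module_hom K (kb_sp F D) (star_sp K \<chi> F A)"
    by (simp add: star_elt_def)
next
  fix l1 p q l2 assume ps: "l1 @ p # q # l2 \<in> pow_terms F A"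
  let ?ps = "l1 @ p # q # l2" and ?\<sigma> = "transpose (length l1) (Suc (length l1))"
  let ?d = "length ?ps"
  let ?R = "{pow_elt K F A (permute_list \<sigma> ps) \<ominus>\<^bsub>pow_sp K F ?d A\<^esub> \<chi> \<sigma> \<odot>\<^bsub>pow_sp K F ?d A\<^esub> pow_elt K F A ps |\<sigma> ps.
    ps \<in> pow_terms F A \<and> length ps = ?d \<and> \<sigma> permutes {..<?d}}"
  have sc: "s \<in> carrier K" "\<chi> ?\<sigma> = s" using \<chi> by (auto simp: perm_char_def)
  have c: "pow_elt K F A ?ps \<in> carrier (pow_sp K F ?d A)"
    "pow_elt K F A (l1 @ q # p # l2) \<in> carrier (pow_sp K F ?d A)"
    using pow_elt_closed[OF ps] pow_elt_closed[OF pow_terms_swap[OF ps]] by simp_all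
  have "pow_elt K F A (permute_list ?\<sigma> ?ps) \<ominus>\<^bsub>pow_sp K F ?d A\<^esub> \<chi> ?\<sigma> \<odot>\<^bsub>pow_sp K F ?d A\<^esub> pow_elt K F A ?ps \<in> ?R"
    using ps by (intro CollectI exI[of _ ?\<sigma>] exI[of _ ?ps]) (simp add: permutes_swap_id)
  then have "pow_elt K F A (l1 @ q # p # l2) \<ominus>\<^bsub>pow_sp K F ?d A\<^esub> s \<odot>\<^bsub>pow_sp K F ?d A\<^esub> pow_elt K F A ?ps \<in> ?R"
    unfolding permute_list_adjacent sc .
  from coset_eqI[OF vs_pow coinv_gen_closed c(2) vs_smult[OF vs_pow sc(1) c(1)] this]
  have e: "a_r_coset (pow_sp K F ?d A) (coinv_sub K \<chi> F ?d A) (pow_elt K F A (l1 @ q # p # l2))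
    = a_r_coset (pow_sp K F ?d A) (coinv_sub K \<chi> F ?d A) (s \<odot>\<^bsub>pow_sp K F ?d A\<^esub> pow_elt K F A ?ps)"
    unfolding coinv_sub_def .
  have "star_elt K \<chi> F A (l1 @ q # p # l2) = dsum_incl UNIV (coinv_sp K \<chi> F A) ?d
    (a_r_coset (pow_sp K F ?d A) (coinv_sub K \<chi> F ?d A) (s \<odot>\<^bsub>pow_sp K F ?d A\<^esub> pow_elt K F A ?ps))"
    unfolding star_elt_def using e by simp
  also have "\<dots> = s \<odot>\<^bsub>star_sp K \<chi> F A\<^esub> star_elt K \<chi> F A ?ps"
    unfolding star_elt_def by (rule module_hom_smult[OF star_proj_hom sc(1) c(1)])
  finally show "star_elt K \<chi> F A (l1 @ q # p # l2) = s \<odot>\<^bsub>star_sp K \<chi> F A\<^esub> star_elt K \<chi> F A ?ps" .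
qed

text \<open>The extension to the convolution power descends to the coinvariants because
  \<open>star_fun_permute\<close> turns the condition on neighbours into the relation for every
  permutation.\<close>

lemma star_ext:
  assumes W: "vectorspace K W" and g: "star_fun K s F A W g"
  shows "\<exists>\<phi>\<in>module_hom K (star_sp K \<chi> F A) W. \<forall>ps\<in>pow_terms F A. \<phi> (star_elt K \<chi> F A ps) = g ps"
proof -
  have "\<exists>\<phi>\<in>module_hom K (coinv_sp K \<chi> F A d) W. \<forall>ps\<in>pow_terms F A. length ps = d \<longrightarrow>
      \<phi> (a_r_coset (pow_sp K F d A) (coinv_sub K \<chi> F d A) (pow_elt K F A ps)) = g ps" for d
  proof -
    obtain \<phi> where p: "\<phi> \<in> module_hom K (pow_sp K F d A) W"
      "\<forall>ps\<in>pow_terms F A. length ps = d \<longrightarrow> \<phi> (pow_elt K F A ps) = g ps" using pow_ext[OF W g] by blast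
    \<comment> \<open>It suffices to treat a generator of \<open>coinv_sub\<close>, which
      \<open>\<phi>\<close> sends to a difference of two equal vectors.\<close>
    have z: "\<phi> r = \<zero>\<^bsub>W\<^esub>" if r: "r \<in> coinv_sub K \<chi> F d A" for r
    proof (rule hom_vanishes_span[OF vs_pow W p(1) coinv_gen_closed _ r[unfolded coinv_sub_def]])
      fix r assume "r \<in> {pow_elt K F A (permute_list \<sigma> ps) \<ominus>\<^bsub>pow_sp K F d A\<^esub> \<chi> \<sigma> \<odot>\<^bsub>pow_sp K F d A\<^esub> pow_elt K F A ps |\<sigma> ps.
        ps \<in> pow_terms F A \<and> length ps = d \<and> \<sigma> permutes {..<d}}"
      then obtain \<sigma> ps where *: "ps \<in> pow_terms F A" "length ps = d" "\<sigma> permutes {..<d}"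
        "r = pow_elt K F A (permute_list \<sigma> ps) \<ominus>\<^bsub>pow_sp K F d A\<^esub> \<chi> \<sigma> \<odot>\<^bsub>pow_sp K F d A\<^esub> pow_elt K F A ps" by blast
      have t: "permute_list \<sigma> ps \<in> pow_terms F A" using pow_terms_permute * by blast
      have c: "\<chi> \<sigma> \<in> carrier K" using \<chi> by (simp add: perm_char_def)
      have "\<phi> r = \<phi> (pow_elt K F A (permute_list \<sigma> ps)) \<ominus>\<^bsub>W\<^esub> \<chi> \<sigma> \<odot>\<^bsub>W\<^esub> \<phi> (pow_elt K F A ps)"
        using pow_elt_closed[OF t] pow_elt_closed[OF *(1)] *(2) c unfolding *(4)
        by (simp add: hom_minus[OF vs_pow W p(1)] vs_smult[OF vs_pow] module_hom_smult[OF p(1)])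
      also have "\<dots> = g (permute_list \<sigma> ps) \<ominus>\<^bsub>W\<^esub> \<chi> \<sigma> \<odot>\<^bsub>W\<^esub> g ps"
        using p(2) t * by simp
      also have "\<dots> = \<zero>\<^bsub>W\<^esub>"
        using star_fun_permute[OF \<chi> W g *(1)] * vs_minus_self[OF W star_funD(1)[OF g t]] by simp
      finally show "\<phi> r = \<zero>\<^bsub>W\<^esub>" .
    qed
    have "\<exists>\<psi>\<in>module_hom K (coinv_sp K \<chi> F A d) W. \<forall>v\<in>carrier (pow_sp K F d A).
        \<psi> (a_r_coset (pow_sp K F d A) (coinv_sub K \<chi> F d A) v) = \<phi> v"
      unfolding coinv_sp_def coinv_sub_def
      by (rule quotient_space.quot_ext[OF quotient_span[OF vs_pow coinv_gen_closed] W p(1)])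
        (use z in \<open>simp add: coinv_sub_def\<close>)
    then obtain \<psi> where q: "\<psi> \<in> module_hom K (coinv_sp K \<chi> F A d) W" "\<forall>v\<in>carrier (pow_sp K F d A).
        \<psi> (a_r_coset (pow_sp K F d A) (coinv_sub K \<chi> F d A) v) = \<phi> v" by blast
    have "\<psi> (a_r_coset (pow_sp K F d A) (coinv_sub K \<chi> F d A) (pow_elt K F A ps)) = g ps"
      if "ps \<in> pow_terms F A" "length ps = d" for ps
      using q(2) p(2) pow_elt_closed[OF that(1)] that by simp
    with q(1) show ?thesis by blast
  qed
  then obtain \<phi> where \<phi>: "\<And>d. \<phi> d \<in> module_hom K (coinv_sp K \<chi> F A d) W"
    "\<And>d ps. ps \<in> pow_terms F A \<Longrightarrow> length ps = d \<Longrightarrow>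
      \<phi> d (a_r_coset (pow_sp K F d A) (coinv_sub K \<chi> F d A) (pow_elt K F A ps)) = g ps" by metis
  have "\<exists>\<psi>\<in>module_hom K (star_sp K \<chi> F A) W. \<forall>d\<in>UNIV. \<forall>v\<in>carrier (coinv_sp K \<chi> F A d).
      \<psi> (dsum_incl UNIV (coinv_sp K \<chi> F A) d v) = \<phi> d v"
    unfolding star_sp_def by (rule dsum_ext[OF K vs_coinv W \<phi>(1)])
  then obtain \<psi> where \<psi>: "\<psi> \<in> module_hom K (star_sp K \<chi> F A) W"
    "\<And>d v. v \<in> carrier (coinv_sp K \<chi> F A d) \<Longrightarrow> \<psi> (dsum_incl UNIV (coinv_sp K \<chi> F A) d v) = \<phi> d v" by blast
  have "\<psi> (star_elt K \<chi> F A ps) = g ps" if ps: "ps \<in> pow_terms F A" for ps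
  proof -
    have "a_r_coset (pow_sp K F (length ps) A) (coinv_sub K \<chi> F (length ps) A) (pow_elt K F A ps)
      \<in> carrier (coinv_sp K \<chi> F A (length ps))"
      unfolding coinv_sp_def coinv_sub_def
      by (rule hom_closed[OF quotient_space.quot_hom[OF quotient_span[OF vs_pow coinv_gen_closed]]
            pow_elt_closed[OF ps]])
    then show ?thesis using \<psi>(2) \<phi>(2)[OF ps refl] by (simp add: star_elt_def)
  qed
  with \<psi>(1) show ?thesis by blast
qed

end

end

section \<open>Convolution\<close>

lemma decomps2_bsub: "(A1, A2) \<in> decomps2 A \<Longrightarrow> bsub A1 A \<and> bsub A2 A"
  by (auto simp: decomps2_def dest: is_decomp_bsub)

lemma conv_terms_iff:
  "((A1, v), (A2, w)) \<in> conv_terms F G A \<longleftrightarrow>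
    (A1, A2) \<in> decomps2 A \<and> v \<in> carrier (kb_sp F A1) \<and> w \<in> carrier (kb_sp G A2)"
  by (auto simp: conv_terms_def decomps2_def)

text \<open>Only the values at pairs contained in \<open>A\<close> enter a convolution at
  \<open>A\<close>, so nothing is assumed about other pairs and no action of bijections is
  mentioned.\<close>

locale conv_ctx =
  fixes K :: "'k ring" and F :: "('a, 'k, 'v) kBmod" and G :: "('a, 'k, 'w) kBmod" and A :: "'a bob"
  assumes K: "field K" and vF: "\<And>D. bsub D A \<Longrightarrow> vectorspace K (kb_sp F D)"
    and vG: "\<And>D. bsub D A \<Longrightarrow> vectorspace K (kb_sp G D)"
begin

lemma vs_summand: "i \<in> decomps2 A \<Longrightarrow> vectorspace K (conv_summand K F G i)"
  using decomps2_bsub[of "fst i" "snd i" A]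
  by (auto simp: conv_summand_def split_beta intro!: vs_tensor[OF K] vF vG)

lemma vs_conv: "vectorspace K (conv_sp K F G A)"
  unfolding conv_sp_def by (rule vs_dsum[OF K vs_summand])

lemma conv_incl_hom:
  assumes "(A1, A2) \<in> decomps2 A"
  shows "dsum_incl (decomps2 A) (conv_summand K F G) (A1, A2)
    \<in> module_hom K (tensor K (kb_sp F A1) (kb_sp G A2)) (conv_sp K F G A)"
proof -
  have "dsum_incl (decomps2 A) (conv_summand K F G) (A1, A2)
    \<in> module_hom K (conv_summand K F G (A1, A2)) (conv_sp K F G A)"
    unfolding conv_sp_def by (rule dsum_incl_hom[OF K]) (auto intro: vs_summand assms)
  then show ?thesis by (simp add: conv_summand_def)
qed

lemma conv_elt_bilin:
  assumes "(A1, A2) \<in> decomps2 A"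
  shows "bilin K (kb_sp F A1) (kb_sp G A2) (conv_sp K F G A) (\<lambda>v w. conv_elt K F G A (A1, v) (A2, w))"
proof -
  have s: "bsub A1 A" "bsub A2 A" using decomps2_bsub[OF assms] by auto
  have b: "bilin K (kb_sp F A1) (kb_sp G A2) (tensor K (kb_sp F A1) (kb_sp G A2))
      (pure_tensor K (kb_sp F A1) (kb_sp G A2))"
    by (rule pure_tensor_bilin[OF K vF[OF s(1)] vG[OF s(2)]])
  show ?thesis unfolding bilin_def conv_elt_def fst_conv snd_conv
    by (intro conjI ballI hom_comp[OF _ conv_incl_hom[OF assms]]) (use b in \<open>simp_all add: bilin_def\<close>)
qed

lemma conv_elt_closed:
  "(A1, A2) \<in> decomps2 A \<Longrightarrow> v \<in> carrier (kb_sp F A1) \<Longrightarrow> w \<in> carrier (kb_sp G A2)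
    \<Longrightarrow> conv_elt K F G A (A1, v) (A2, w) \<in> carrier (conv_sp K F G A)"
  using conv_elt_bilin[of A1 A2] unfolding bilin_def by (auto dest: hom_closed)

text \<open>Bilinearity of \<open>conv_elt\<close> allows both factors to be expanded in generators.
  Applied with the elements \<open>star_elt\<close>, it shows that products of exterior and
  symmetric terms span.\<close>

lemma spanning_conv_gen:
  assumes EF: "\<And>D. bsub D A \<Longrightarrow> spanning K (kb_sp F D) (EF D)"
    and EG: "\<And>D. bsub D A \<Longrightarrow> spanning K (kb_sp G D) (EG D)"
  shows "spanning K (conv_sp K F G A) {conv_elt K F G A (A1, v) (A2, w) |A1 v A2 w.
    (A1, A2) \<in> decomps2 A \<and> v \<in> EF A1 \<and> w \<in> EG A2}" (is "spanning _ _ ?E")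
proof -
  have "spanning K (conv_sp K F G A) (\<Union>i\<in>decomps2 A. dsum_incl (decomps2 A) (conv_summand K F G) i `
      (\<lambda>(v, w). pure_tensor K (kb_sp F (fst i)) (kb_sp G (snd i)) v w) `
        (carrier (kb_sp F (fst i)) \<times> carrier (kb_sp G (snd i))))" (is "spanning _ _ ?E'")
    unfolding conv_sp_def
  proof (rule spanning_dsum[OF K vs_summand])
    fix i assume i: "i \<in> decomps2 A"
    then have s: "bsub (fst i) A" "bsub (snd i) A" using decomps2_bsub[of "fst i" "snd i"] by auto
    show "spanning K (conv_summand K F G i) ((\<lambda>(v, w). pure_tensor K (kb_sp F (fst i)) (kb_sp G (snd i)) v w) `
        (carrier (kb_sp F (fst i)) \<times> carrier (kb_sp G (snd i))))"
      using spanning_tensor[OF K vF[OF s(1)] vG[OF s(2)]] by (simp add: conv_summand_def split_beta)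
  qed
  moreover have "?E' \<subseteq> lspan K (conv_sp K F G A) ?E"
  proof
    fix x assume "x \<in> ?E'"
    then obtain A1 A2 v w where *: "(A1, A2) \<in> decomps2 A" "v \<in> carrier (kb_sp F A1)"
      "w \<in> carrier (kb_sp G A2)" "x = conv_elt K F G A (A1, v) (A2, w)"
      by (auto simp: conv_elt_def)
    note s = decomps2_bsub[OF *(1)]
    \<comment> \<open>Expansion of the second factor, with a generator in the first place; expanding
      the first factor afterwards reduces to this case.\<close>
    have b: "conv_elt K F G A (A1, v) (A2, w) \<in> lspan K (conv_sp K F G A) ?E"
      if v: "v \<in> EF A1" and w: "w \<in> carrier (kb_sp G A2)" for v w
    proof (rule lspan_image[OF vG vs_conv, where E = "EG A2" and \<phi> = "\<lambda>w. conv_elt K F G A (A1, v) (A2, w)"])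
      have "v \<in> carrier (kb_sp F A1)" using v EF[of A1] s by (auto simp: spanning_def)
      then show "(\<lambda>w. conv_elt K F G A (A1, v) (A2, w)) \<in> module_hom K (kb_sp G A2) (conv_sp K F G A)"
        using conv_elt_bilin[OF *(1)] by (simp add: bilin_def)
      show "w \<in> lspan K (kb_sp G A2) (EG A2)" "EG A2 \<subseteq> carrier (kb_sp G A2)"
        using w EG[of A2] s by (auto simp: spanning_def)
      show "(\<lambda>w. conv_elt K F G A (A1, v) (A2, w)) ` EG A2 \<subseteq> lspan K (conv_sp K F G A) ?E"
        using v *(1) by (blast intro: lspan.gen)
    qed (use s in simp)
    show "x \<in> lspan K (conv_sp K F G A) ?E" unfolding *(4)
    proof (rule lspan_image[OF vF vs_conv, where E = "EF A1" and \<phi> = "\<lambda>v. conv_elt K F G A (A1, v) (A2, w)"])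
      show "(\<lambda>v. conv_elt K F G A (A1, v) (A2, w)) \<in> module_hom K (kb_sp F A1) (conv_sp K F G A)"
        using conv_elt_bilin[OF *(1)] *(3) by (simp add: bilin_def)
      show "v \<in> lspan K (kb_sp F A1) (EF A1)" "EF A1 \<subseteq> carrier (kb_sp F A1)"
        using *(2) EF[of A1] s by (auto simp: spanning_def)
      show "(\<lambda>v. conv_elt K F G A (A1, v) (A2, w)) ` EF A1 \<subseteq> lspan K (conv_sp K F G A) ?E"
        using b *(3) by blast
    qed (use s in simp)
  qed
  moreover have "?E \<subseteq> carrier (conv_sp K F G A)"
  proof
    fix x assume "x \<in> ?E"
    then obtain A1 A2 v w where *: "(A1, A2) \<in> decomps2 A" "v \<in> EF A1"
      "w \<in> EG A2" "x = conv_elt K F G A (A1, v) (A2, w)" by blast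
    note s = decomps2_bsub[OF *(1)]
    have "v \<in> carrier (kb_sp F A1)" "w \<in> carrier (kb_sp G A2)"
      using * EF[of A1] EG[of A2] s by (auto simp: spanning_def)
    then show "x \<in> carrier (conv_sp K F G A)" unfolding *(4) by (rule conv_elt_closed[OF *(1)])
  qed
  ultimately show ?thesis by (rule spanning_trans)
qed

lemma conv_ext:
  assumes W: "vectorspace K W"
    and b: "\<And>A1 A2. (A1, A2) \<in> decomps2 A \<Longrightarrow> bilin K (kb_sp F A1) (kb_sp G A2) W (\<beta> A1 A2)"
  shows "\<exists>\<phi>\<in>module_hom K (conv_sp K F G A) W. \<forall>A1 A2 v w. (A1, A2) \<in> decomps2 A \<and>
    v \<in> carrier (kb_sp F A1) \<and> w \<in> carrier (kb_sp G A2) \<longrightarrow>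
    \<phi> (conv_elt K F G A (A1, v) (A2, w)) = \<beta> A1 A2 v w"
proof -
  have "\<exists>\<phi>\<in>module_hom K (conv_summand K F G i) W.
      \<forall>v\<in>carrier (kb_sp F (fst i)). \<forall>w\<in>carrier (kb_sp G (snd i)).
        \<phi> (pure_tensor K (kb_sp F (fst i)) (kb_sp G (snd i)) v w) = \<beta> (fst i) (snd i) v w"
    if i: "i \<in> decomps2 A" for i
  proof -
    have s: "bsub (fst i) A" "bsub (snd i) A" using decomps2_bsub[of "fst i" "snd i"] i by auto
    show ?thesis unfolding conv_summand_def split_beta
      by (rule tensor_ext[OF K vF[OF s(1)] vG[OF s(2)] W b]) (use i in simp)
  qed
  then obtain \<phi> where \<phi>: "\<And>i. i \<in> decomps2 A \<Longrightarrow> \<phi> i \<in> module_hom K (conv_summand K F G i) W"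
    "\<And>i v w. i \<in> decomps2 A \<Longrightarrow> v \<in> carrier (kb_sp F (fst i)) \<Longrightarrow> w \<in> carrier (kb_sp G (snd i)) \<Longrightarrow>
        \<phi> i (pure_tensor K (kb_sp F (fst i)) (kb_sp G (snd i)) v w) = \<beta> (fst i) (snd i) v w" by metis
  have "\<exists>\<psi>\<in>module_hom K (conv_sp K F G A) W.
      \<forall>i\<in>decomps2 A. \<forall>v\<in>carrier (conv_summand K F G i).
        \<psi> (dsum_incl (decomps2 A) (conv_summand K F G) i v) = \<phi> i v"
    unfolding conv_sp_def by (rule dsum_ext[OF K vs_summand W \<phi>(1)])
  then obtain \<psi> where \<psi>: "\<psi> \<in> module_hom K (conv_sp K F G A) W"
    "\<forall>i\<in>decomps2 A. \<forall>v\<in>carrier (conv_summand K F G i).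
        \<psi> (dsum_incl (decomps2 A) (conv_summand K F G) i v) = \<phi> i v" by blast
  have "\<psi> (conv_elt K F G A (A1, v) (A2, w)) = \<beta> A1 A2 v w"
    if *: "(A1, A2) \<in> decomps2 A" "v \<in> carrier (kb_sp F A1)" "w \<in> carrier (kb_sp G A2)" for A1 A2 v w
  proof -
    note s = decomps2_bsub[OF *(1)]
    have "pure_tensor K (kb_sp F A1) (kb_sp G A2) v w \<in> carrier (conv_summand K F G (A1, A2))"
      using pure_tensor_bilin[OF K vF vG, of A1 A2] * s
      unfolding bilin_def by (auto simp: conv_summand_def dest: hom_closed)
    then show ?thesis using \<psi>(2) \<phi>(2)[of "(A1, A2)" v w] * by (simp add: conv_elt_def)
  qed
  with \<psi>(1) show ?thesis by blast
qed

end

text \<open>The extension is made in two stages. For fixed \<open>ws\<close> the function of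
  \<open>as\<close> extends linearly; for a fixed vector \<open>v\<close> of the first space the
  resulting function of \<open>ws\<close> is again a \<open>star_fun\<close>, so it extends as well.
  Linearity in \<open>v\<close> is then verified on the terms of the second space.\<close>

lemma star_bilin_ext:
  fixes F :: "('a, 'k, 'v) kBmod" and G :: "('a, 'k, 'w) kBmod"
  assumes "star_ctx K \<chi> s F" "star_ctx K \<chi>' s' G" "A1 \<in> B_obj" "A2 \<in> B_obj" "vectorspace K W"
    and g1: "\<And>ws. ws \<in> pow_terms G A2 \<Longrightarrow> star_fun K s F A1 W (\<lambda>as. g as ws)"
    and g2: "\<And>as. as \<in> pow_terms F A1 \<Longrightarrow> star_fun K s' G A2 W (g as)"
  shows "\<exists>\<beta>. bilin K (star_sp K \<chi> F A1) (star_sp K \<chi>' G A2) W \<beta> \<and>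
    (\<forall>as\<in>pow_terms F A1. \<forall>ws\<in>pow_terms G A2. \<beta> (star_elt K \<chi> F A1 as) (star_elt K \<chi>' G A2 ws) = g as ws)"
proof -
  interpret F: star_ctx K \<chi> s F by fact
  interpret G: star_ctx K \<chi>' s' G by fact
  interpret W: vectorspace K W by fact
  note W = \<open>vectorspace K W\<close>
  let ?V = "star_sp K \<chi> F A1" and ?U = "star_sp K \<chi>' G A2"
  let ?e = "star_elt K \<chi> F A1" and ?f = "star_elt K \<chi>' G A2"
  have V: "vectorspace K ?V" by (rule F.vs_star[OF assms(3)])
  have U: "vectorspace K ?U" by (rule G.vs_star[OF assms(4)])
  have eq1: "\<alpha> v = \<alpha>' v" if "\<alpha> \<in> module_hom K ?V W" "\<alpha>' \<in> module_hom K ?V W"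
    "\<And>as. as \<in> pow_terms F A1 \<Longrightarrow> \<alpha> (?e as) = \<alpha>' (?e as)" "v \<in> carrier ?V" for \<alpha> \<alpha>' v
    by (rule spanning_hom_eq[OF V W F.spanning_star[OF assms(3)] that(1,2) _ that(4)]) (use that(3) in auto)
  have eq2: "\<alpha> v = \<alpha>' v" if "\<alpha> \<in> module_hom K ?U W" "\<alpha>' \<in> module_hom K ?U W"
    "\<And>ws. ws \<in> pow_terms G A2 \<Longrightarrow> \<alpha> (?f ws) = \<alpha>' (?f ws)" "v \<in> carrier ?U" for \<alpha> \<alpha>' v
    by (rule spanning_hom_eq[OF U W G.spanning_star[OF assms(4)] that(1,2) _ that(4)]) (use that(3) in auto)
  have "\<exists>\<phi>\<in>module_hom K ?V W. \<forall>as\<in>pow_terms F A1. \<phi> (?e as) = g as ws"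
    if "ws \<in> pow_terms G A2" for ws
    by (rule F.star_ext[OF assms(3) W g1[OF that]])
  then obtain \<phi> where \<phi>: "\<And>ws. ws \<in> pow_terms G A2 \<Longrightarrow> \<phi> ws \<in> module_hom K ?V W"
    "\<And>ws as. ws \<in> pow_terms G A2 \<Longrightarrow> as \<in> pow_terms F A1 \<Longrightarrow> \<phi> ws (?e as) = g as ws" by metis
  have sc: "s' \<in> carrier K" using G.\<chi> by (simp add: perm_char_def)
  \<comment> \<open>Here \<open>v\<close> is an arbitrary vector and not a term. The required
    equations in \<open>ws\<close> are equations of linear maps in \<open>v\<close>, so
    \<open>eq1\<close> reduces them to terms, where they are the hypotheses on
    \<open>g\<close>.\<close>
  have "star_fun K s' G A2 W (\<lambda>ws. \<phi> ws v)" if v: "v \<in> carrier ?V" for v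
    unfolding star_fun_def
  proof (intro conjI ballI allI impI)
    fix ws assume "ws \<in> pow_terms G A2"
    then show "\<phi> ws v \<in> carrier W" using hom_closed[OF \<phi>(1) v] by blast
  next
    fix l1 D w l2 assume ws: "l1 @ (D, w) # l2 \<in> pow_terms G A2"
    note sl = pow_terms_slot[OF ws]
    have D: "vectorspace K (kb_sp G D)"
      by (rule G.vs_F[OF is_decomp_bsub assms(4)]) (use ws in \<open>auto simp: pow_terms_def\<close>)
    have h: "(\<lambda>u. g as (l1 @ (D, u) # l2)) \<in> module_hom K (kb_sp G D) W" if "as \<in> pow_terms F A1" for as
      using star_funD(2)[OF g2[OF that] ws] .
    show "(\<lambda>u. \<phi> (l1 @ (D, u) # l2) v) \<in> module_hom K (kb_sp G D) W"
    proof (rule homI)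
      fix u assume "u \<in> carrier (kb_sp G D)"
      then show "\<phi> (l1 @ (D, u) # l2) v \<in> carrier W" using hom_closed[OF \<phi>(1) v] sl by blast
    next
      fix u u' assume u: "u \<in> carrier (kb_sp G D)" "u' \<in> carrier (kb_sp G D)"
      note u'' = vs_add[OF D u]
      show "\<phi> (l1 @ (D, u \<oplus>\<^bsub>kb_sp G D\<^esub> u') # l2) v = \<phi> (l1 @ (D, u) # l2) v \<oplus>\<^bsub>W\<^esub> \<phi> (l1 @ (D, u') # l2) v"
        by (rule eq1[OF \<phi>(1)[OF sl[OF u'']] hom_add_fun[OF W \<phi>(1)[OF sl[OF u(1)]] \<phi>(1)[OF sl[OF u(2)]]] _ v])
          (simp add: \<phi>(2) sl u u'' module_hom_add[OF h])
    next
      fix c u assume c: "c \<in> carrier K" and u: "u \<in> carrier (kb_sp G D)"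
      note u'' = vs_smult[OF D c u]
      show "\<phi> (l1 @ (D, c \<odot>\<^bsub>kb_sp G D\<^esub> u) # l2) v = c \<odot>\<^bsub>W\<^esub> \<phi> (l1 @ (D, u) # l2) v"
        by (rule eq1[OF \<phi>(1)[OF sl[OF u'']] hom_smult_fun[OF W \<phi>(1)[OF sl[OF u]] c] _ v])
          (simp add: \<phi>(2) sl u u'' c module_hom_smult[OF h])
    qed
  next
    fix l1 p q l2 assume ws: "l1 @ p # q # l2 \<in> pow_terms G A2"
    note ws' = pow_terms_swap[OF ws]
    show "\<phi> (l1 @ q # p # l2) v = s' \<odot>\<^bsub>W\<^esub> \<phi> (l1 @ p # q # l2) v"
      by (rule eq1[OF \<phi>(1)[OF ws'] hom_smult_fun[OF W \<phi>(1)[OF ws] sc] _ v])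
        (simp add: \<phi>(2) ws ws' star_funD(3)[OF g2 ws])
  qed
  then have "\<exists>\<psi>\<in>module_hom K ?U W. \<forall>ws\<in>pow_terms G A2. \<psi> (?f ws) = \<phi> ws v" if "v \<in> carrier ?V" for v
    using G.star_ext[OF assms(4) W] that by blast
  then obtain \<beta> where \<beta>: "\<And>v. v \<in> carrier ?V \<Longrightarrow> \<beta> v \<in> module_hom K ?U W"
    "\<And>v ws. v \<in> carrier ?V \<Longrightarrow> ws \<in> pow_terms G A2 \<Longrightarrow> \<beta> v (?f ws) = \<phi> ws v" by metis
  have "bilin K ?V ?U W \<beta>" unfolding bilin_def
  proof (intro conjI ballI)
    fix w assume w: "w \<in> carrier ?U"
    show "(\<lambda>v. \<beta> v w) \<in> module_hom K ?V W"
    proof (rule homI)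
      fix v assume "v \<in> carrier ?V" then show "\<beta> v w \<in> carrier W" using hom_closed[OF \<beta>(1) w] by blast
    next
      fix u v assume u: "u \<in> carrier ?V" and v: "v \<in> carrier ?V"
      note uv = vs_add[OF V u v]
      show "\<beta> (u \<oplus>\<^bsub>?V\<^esub> v) w = \<beta> u w \<oplus>\<^bsub>W\<^esub> \<beta> v w"
        by (rule eq2[OF \<beta>(1)[OF uv] hom_add_fun[OF W \<beta>(1)[OF u] \<beta>(1)[OF v]] _ w])
          (simp add: \<beta>(2) u v uv module_hom_add[OF \<phi>(1)])
    next
      fix c v assume c: "c \<in> carrier K" and v: "v \<in> carrier ?V"
      note cv = vs_smult[OF V c v]
      show "\<beta> (c \<odot>\<^bsub>?V\<^esub> v) w = c \<odot>\<^bsub>W\<^esub> \<beta> v w"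
        by (rule eq2[OF \<beta>(1)[OF cv] hom_smult_fun[OF W \<beta>(1)[OF v] c] _ w])
          (simp add: \<beta>(2) v cv c module_hom_smult[OF \<phi>(1)])
    qed
  qed (rule \<beta>(1))
  moreover have "\<beta> (?e as) (?f ws) = g as ws" if "as \<in> pow_terms F A1" "ws \<in> pow_terms G A2" for as ws
    using \<beta>(2) \<phi>(2) star_funD(1)[OF F.star_elt_fun[OF assms(3)]] that by simp
  ultimately show ?thesis by blast
qed

section \<open>Functoriality\<close>

text \<open>Allowing \<open>\<theta>\<close> to move the pairs of sets covers transport along
  bijections; with \<open>\<theta>\<close> the identity the same statement covers morphisms of
  \<open>kB\<close>-modules.\<close>

lemma star_fun_map:
  assumes g: "star_fun K s G B W g"
    and t: "\<And>ps. ps \<in> pow_terms F A \<Longrightarrow> map (\<lambda>(D, v). (\<theta> D, \<eta> D v)) ps \<in> pow_terms G B"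
    and h: "\<And>D. bsub D A \<Longrightarrow> \<eta> D \<in> module_hom K (kb_sp F D) (kb_sp G (\<theta> D))"
  shows "star_fun K s F A W (\<lambda>ps. g (map (\<lambda>(D, v). (\<theta> D, \<eta> D v)) ps))"
  unfolding star_fun_def
proof (intro conjI ballI allI impI)
  fix ps assume "ps \<in> pow_terms F A"
  then show "g (map (\<lambda>(D, v). (\<theta> D, \<eta> D v)) ps) \<in> carrier W" using star_funD(1)[OF g] t by blast
next
  fix l1 D v l2 assume ps: "l1 @ (D, v) # l2 \<in> pow_terms F A"
  have D: "bsub D A" by (rule is_decomp_bsub) (use ps in \<open>auto simp: pow_terms_def\<close>)
  show "(\<lambda>u. g (map (\<lambda>(D, v). (\<theta> D, \<eta> D v)) (l1 @ (D, u) # l2))) \<in> module_hom K (kb_sp F D) W"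
    using hom_comp[OF h[OF D] star_funD(2)[OF g]] t[OF ps] by simp
next
  fix l1 p q l2 assume ps: "l1 @ p # q # l2 \<in> pow_terms F A"
  show "g (map (\<lambda>(D, v). (\<theta> D, \<eta> D v)) (l1 @ q # p # l2)) =
    s \<odot>\<^bsub>W\<^esub> g (map (\<lambda>(D, v). (\<theta> D, \<eta> D v)) (l1 @ p # q # l2))"
    using star_funD(3)[OF g] t[OF ps] by simp
qed

text \<open>One proof that the descriptions in \<open>star\<close> and in \<open>star_map\<close>
  have solutions: pulling back the universal function \<open>star_elt\<close> along a map of factors
  gives a \<open>star_fun\<close>.\<close>

lemma star_lin_ext:
  assumes "star_ctx K \<chi> s F" "star_ctx K \<chi> s G" "A \<in> B_obj" "B \<in> B_obj"
    and t: "\<And>ps. ps \<in> pow_terms F A \<Longrightarrow> map (\<lambda>(D, v). (\<theta> D, \<eta> D v)) ps \<in> pow_terms G B"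
    and h: "\<And>D. bsub D A \<Longrightarrow> \<eta> D \<in> module_hom K (kb_sp F D) (kb_sp G (\<theta> D))"
    and P: "P = {(star_elt K \<chi> F A ps, star_elt K \<chi> G B (map (\<lambda>(D, v). (\<theta> D, \<eta> D v)) ps)) |ps.
      ps \<in> pow_terms F A}"
  shows "lin_ext K (star_sp K \<chi> F A) (star_sp K \<chi> G B) P \<in> module_hom K (star_sp K \<chi> F A) (star_sp K \<chi> G B)"
    "\<And>ps. ps \<in> pow_terms F A \<Longrightarrow> lin_ext K (star_sp K \<chi> F A) (star_sp K \<chi> G B) P (star_elt K \<chi> F A ps) =
      star_elt K \<chi> G B (map (\<lambda>(D, v). (\<theta> D, \<eta> D v)) ps)"
proof -
  interpret F: star_ctx K \<chi> s F by fact
  interpret G: star_ctx K \<chi> s G by fact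
  have P': "P = (\<lambda>ps. (star_elt K \<chi> F A ps, star_elt K \<chi> G B (map (\<lambda>(D, v). (\<theta> D, \<eta> D v)) ps))) ` pow_terms F A"
    unfolding P by blast
  note ex = F.star_ext[OF assms(3) G.vs_star[OF assms(4)]
      star_fun_map[OF G.star_elt_fun[OF assms(4)] t h]]
  note le = lin_ext_family[OF F.vs_star[OF assms(3)] G.vs_star[OF assms(4)] F.spanning_star[OF assms(3)] _ P']
  show "lin_ext K (star_sp K \<chi> F A) (star_sp K \<chi> G B) P \<in> module_hom K (star_sp K \<chi> F A) (star_sp K \<chi> G B)"
    by (rule le(1)[OF ex])
  show "lin_ext K (star_sp K \<chi> F A) (star_sp K \<chi> G B) P (star_elt K \<chi> F A ps) =
      star_elt K \<chi> G B (map (\<lambda>(D, v). (\<theta> D, \<eta> D v)) ps)" if "ps \<in> pow_terms F A" for ps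
    by (rule le(2)[OF ex that])
qed

text \<open>The analogue for convolutions, covering \<open>conv\<close> and \<open>conv_map\<close>;
  maps of the two factors turn a bilinear function into a bilinear function.\<close>

lemma conv_lin_ext:
  assumes "conv_ctx K F G A" "conv_ctx K F' G' B"
    and t: "\<And>A1 A2. (A1, A2) \<in> decomps2 A \<Longrightarrow> (\<theta> A1, \<theta> A2) \<in> decomps2 B"
    and h: "\<And>D. bsub D A \<Longrightarrow> \<eta> D \<in> module_hom K (kb_sp F D) (kb_sp F' (\<theta> D))"
    and k: "\<And>D. bsub D A \<Longrightarrow> \<zeta> D \<in> module_hom K (kb_sp G D) (kb_sp G' (\<theta> D))"
    and P: "P = {(conv_elt K F G A (A1, v) (A2, w), conv_elt K F' G' B (\<theta> A1, \<eta> A1 v) (\<theta> A2, \<zeta> A2 w)) |A1 v A2 w.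
      ((A1, v), (A2, w)) \<in> conv_terms F G A}"
  shows "lin_ext K (conv_sp K F G A) (conv_sp K F' G' B) P \<in> module_hom K (conv_sp K F G A) (conv_sp K F' G' B)"
    "\<And>A1 A2 v w. (A1, A2) \<in> decomps2 A \<Longrightarrow> v \<in> carrier (kb_sp F A1) \<Longrightarrow> w \<in> carrier (kb_sp G A2) \<Longrightarrow>
      lin_ext K (conv_sp K F G A) (conv_sp K F' G' B) P (conv_elt K F G A (A1, v) (A2, w)) =
      conv_elt K F' G' B (\<theta> A1, \<eta> A1 v) (\<theta> A2, \<zeta> A2 w)"
proof -
  interpret F: conv_ctx K F G A by fact
  interpret G: conv_ctx K F' G' B by fact
  define e where "e = (\<lambda>((A1, v), (A2, w)). conv_elt K F G A (A1, v) (A2, w))"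
  define e' where "e' = (\<lambda>((A1, v), (A2, w)). conv_elt K F' G' B (\<theta> A1, \<eta> A1 v) (\<theta> A2, \<zeta> A2 w))"
  have P': "P = (\<lambda>x. (e x, e' x)) ` conv_terms F G A"
  proof -
    have "P = {(e x, e' x) |x. x \<in> conv_terms F G A}"
      unfolding P e_def e'_def by (simp only: split_paired_Ex split)
    then show ?thesis by blast
  qed
  have "spanning K (conv_sp K F G A) {conv_elt K F G A (A1, v) (A2, w) |A1 v A2 w.
      (A1, A2) \<in> decomps2 A \<and> v \<in> carrier (kb_sp F A1) \<and> w \<in> carrier (kb_sp G A2)}"
    by (rule F.spanning_conv_gen) (auto simp: spanning_def intro: lspan.gen)
  moreover have "{conv_elt K F G A (A1, v) (A2, w) |A1 v A2 w.
      (A1, A2) \<in> decomps2 A \<and> v \<in> carrier (kb_sp F A1) \<and> w \<in> carrier (kb_sp G A2)} = e ` conv_terms F G A"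
  proof -
    have "e ` conv_terms F G A = {e x |x. x \<in> conv_terms F G A}" by blast
    then show ?thesis unfolding e_def by (simp only: split_paired_Ex split conv_terms_iff)
  qed
  ultimately have sp: "spanning K (conv_sp K F G A) (e ` conv_terms F G A)" by simp
  have b: "bilin K (kb_sp F A1) (kb_sp G A2) (conv_sp K F' G' B)
      (\<lambda>v w. conv_elt K F' G' B (\<theta> A1, \<eta> A1 v) (\<theta> A2, \<zeta> A2 w))" if *: "(A1, A2) \<in> decomps2 A" for A1 A2
  proof -
    note s = decomps2_bsub[OF *]
    have b: "bilin K (kb_sp F' (\<theta> A1)) (kb_sp G' (\<theta> A2)) (conv_sp K F' G' B)
      (\<lambda>v w. conv_elt K F' G' B (\<theta> A1, v) (\<theta> A2, w))" by (rule G.conv_elt_bilin[OF t[OF *]])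
    have hk: "\<eta> A1 \<in> module_hom K (kb_sp F A1) (kb_sp F' (\<theta> A1))"
      "\<zeta> A2 \<in> module_hom K (kb_sp G A2) (kb_sp G' (\<theta> A2))" using h k s by auto
    show ?thesis unfolding bilin_def
    proof (intro conjI ballI)
      fix v assume "v \<in> carrier (kb_sp F A1)"
      then show "(\<lambda>w. conv_elt K F' G' B (\<theta> A1, \<eta> A1 v) (\<theta> A2, \<zeta> A2 w))
          \<in> module_hom K (kb_sp G A2) (conv_sp K F' G' B)"
        using b hom_closed[OF hk(1)] by (intro hom_comp[OF hk(2)]) (simp add: bilin_def)
    next
      fix w assume "w \<in> carrier (kb_sp G A2)"
      then have "(\<lambda>v. conv_elt K F' G' B (\<theta> A1, v) (\<theta> A2, \<zeta> A2 w))
          \<in> module_hom K (kb_sp F' (\<theta> A1)) (conv_sp K F' G' B)"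
        using b hom_closed[OF hk(2)] by (simp add: bilin_def)
      then show "(\<lambda>v. conv_elt K F' G' B (\<theta> A1, \<eta> A1 v) (\<theta> A2, \<zeta> A2 w))
          \<in> module_hom K (kb_sp F A1) (conv_sp K F' G' B)" by (rule hom_comp[OF hk(1)])
    qed
  qed
  have ex: "\<exists>\<phi>\<in>module_hom K (conv_sp K F G A) (conv_sp K F' G' B). \<forall>x\<in>conv_terms F G A. \<phi> (e x) = e' x"
  proof -
    have "\<exists>\<phi>\<in>module_hom K (conv_sp K F G A) (conv_sp K F' G' B). \<forall>A1 A2 v w. (A1, A2) \<in> decomps2 A \<and>
      v \<in> carrier (kb_sp F A1) \<and> w \<in> carrier (kb_sp G A2) \<longrightarrow>
      \<phi> (conv_elt K F G A (A1, v) (A2, w)) = conv_elt K F' G' B (\<theta> A1, \<eta> A1 v) (\<theta> A2, \<zeta> A2 w)"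
      by (rule F.conv_ext[OF G.vs_conv b])
    then obtain \<phi> where p: "\<phi> \<in> module_hom K (conv_sp K F G A) (conv_sp K F' G' B)"
      "\<forall>A1 A2 v w. (A1, A2) \<in> decomps2 A \<and> v \<in> carrier (kb_sp F A1) \<and> w \<in> carrier (kb_sp G A2) \<longrightarrow>
      \<phi> (conv_elt K F G A (A1, v) (A2, w)) = conv_elt K F' G' B (\<theta> A1, \<eta> A1 v) (\<theta> A2, \<zeta> A2 w)"
      by blast
    have "\<phi> (e x) = e' x" if "x \<in> conv_terms F G A" for x
    proof -
      obtain A1 v A2 w where x: "x = ((A1, v), (A2, w))" by (metis surj_pair)
      show ?thesis using p(2) that unfolding x e_def e'_def split conv_terms_iff by blast
    qed
    with p(1) show ?thesis by blast
  qed
  note le = lin_ext_family[OF F.vs_conv G.vs_conv sp ex P']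
  show "lin_ext K (conv_sp K F G A) (conv_sp K F' G' B) P \<in> module_hom K (conv_sp K F G A) (conv_sp K F' G' B)"
    by (rule le(1))
  show "lin_ext K (conv_sp K F G A) (conv_sp K F' G' B) P (conv_elt K F G A (A1, v) (A2, w)) =
      conv_elt K F' G' B (\<theta> A1, \<eta> A1 v) (\<theta> A2, \<zeta> A2 w)"
    if "(A1, A2) \<in> decomps2 A" "v \<in> carrier (kb_sp F A1)" "w \<in> carrier (kb_sp G A2)" for A1 A2 v w
    using le(2)[of "((A1, v), (A2, w))"] that by (simp add: conv_terms_iff e_def e'_def)
qed

section \<open>Transport along bijections\<close>

lemma FB_hom_restrict: "f \<in> FB_hom X Y \<Longrightarrow> Z \<subseteq> X \<Longrightarrow> restrict f Z \<in> FB_hom Z (f ` Z)"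
  by (auto simp: FB_hom_def bij_betw_def inj_on_def)

lemma FB_hom_compose: "f \<in> FB_hom X Y \<Longrightarrow> g \<in> FB_hom Y Z \<Longrightarrow> compose X g f \<in> FB_hom X Z"
  by (auto simp: FB_hom_def compose_def bij_betw_def inj_on_def)

lemma FB_hom_finite: "f \<in> FB_hom X Y \<Longrightarrow> finite X \<longleftrightarrow> finite Y"
  by (auto simp: FB_hom_def bij_betw_finite)

lemma B_image_total: "h \<in> B_hom A B \<Longrightarrow> B_image h A = B"
  by (auto simp: B_hom_def B_image_def FB_hom_def bij_betw_def mem_Times_iff prod_eq_iff)

lemma B_hom_bsub:
  assumes "h \<in> B_hom A B" "bsub D A"
  shows "B_restrict h D \<in> B_hom D (B_image h D)" "bsub (B_image h D) B"
proof -
  show "B_restrict h D \<in> B_hom D (B_image h D)"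
    using assms FB_hom_restrict[of "fst h" "fst A" "fst B" "fst D"] FB_hom_restrict[of "snd h" "snd A" "snd B" "snd D"]
    by (simp add: B_hom_def B_restrict_def B_image_def bsub_def mem_Times_iff)
  show "bsub (B_image h D) B"
    using assms(2) unfolding B_image_total[OF assms(1), symmetric]
    by (simp add: bsub_def B_image_def image_mono)
qed

lemma bdisj_image:
  assumes "h \<in> B_hom A B" "bsub C A" "bsub D A" "bdisj C D"
  shows "bdisj (B_image h C) (B_image h D)"
proof -
  have "inj_on (fst h) (fst A)" "inj_on (snd h) (snd A)"
    using assms(1) by (auto simp: B_hom_def FB_hom_def bij_betw_def mem_Times_iff)
  then show ?thesis using assms(2-4) unfolding bdisj_def bsub_def B_image_def fst_conv snd_conv
    by (metis inj_on_image_Int image_empty)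
qed

lemma is_decomp_image:
  assumes h: "h \<in> B_hom A B" and d: "is_decomp Ds A"
  shows "is_decomp (map (B_image h) Ds) B"
proof -
  have "bdisj (B_image h (Ds ! i)) (B_image h (Ds ! j))"
    if "i < length Ds" "j < length Ds" "i \<noteq> j" for i j
    using bdisj_image[OF h] is_decomp_bsub[OF d] d that by (simp add: is_decomp_nth)
  moreover have "fst h ` fst A = fst B" "snd h ` snd A = snd B"
    using B_image_total[OF h] by (auto simp: B_image_def prod_eq_iff)
  ultimately show ?thesis using d unfolding is_decomp_nth
    by (auto simp: B_image_def simp flip: image_UN)
qed

lemma kB_act_hom:
  "kB_module K F \<Longrightarrow> A \<in> B_obj \<Longrightarrow> B \<in> B_obj \<Longrightarrow> h \<in> B_hom A B \<Longrightarrow> bsub D A \<Longrightarrow>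
    kb_act F D (B_image h D) (B_restrict h D) \<in> module_hom K (kb_sp F D) (kb_sp F (B_image h D))"
  using B_hom_bsub[of h A B D] bsub_B_obj by (intro kB_module.hom) blast+

lemma transport_pow_terms:
  assumes F: "kB_module K F" and AB: "A \<in> B_obj" "B \<in> B_obj" and h: "h \<in> B_hom A B"
    and ps: "ps \<in> pow_terms F A"
  shows "map (transport F h) ps \<in> pow_terms F B"
proof -
  have d: "is_decomp (map fst ps) A" using ps by (simp add: pow_terms_def)
  have mf: "map fst (map (transport F h) ps) = map (B_image h) (map fst ps)"
    by (simp add: transport_def split_beta)
  have "snd (transport F h p) \<in> carrier (kb_sp F (fst (transport F h p)))" if "p \<in> set ps" for p
  proof -
    have "bsub (fst p) A" using is_decomp_bsub[OF d] that by simp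
    moreover have "snd p \<in> carrier (kb_sp F (fst p))" using ps that by (auto simp: pow_terms_def)
    ultimately show ?thesis using hom_closed[OF kB_act_hom[OF F AB h]] by (simp add: transport_def split_beta)
  qed
  then show ?thesis using is_decomp_image[OF h d]
    unfolding pow_terms_def mem_Collect_eq mf by (auto simp: split_beta)
qed

lemma pow_terms_memD:
  assumes "ps \<in> pow_terms F A" "(D, v) \<in> set ps"
  shows "bsub D A \<and> v \<in> carrier (kb_sp F D)"
proof -
  have "D \<in> set (map fst ps)" using assms(2) by force
  moreover have "is_decomp (map fst ps) A" using assms(1) by (simp add: pow_terms_def)
  ultimately have "bsub D A" using is_decomp_bsub by blast
  with assms show ?thesis by (auto simp: pow_terms_def)
qed

lemma transport_id:
  assumes "kB_module K F" "A \<in> B_obj" "bsub D A" "v \<in> carrier (kb_sp F D)"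
  shows "transport F (B_id A) (D, v) = (D, v)"
proof -
  have *: "B_image (B_id A) D = D" "B_restrict (B_id A) D = B_id D"
    using assms(3) by (auto simp: B_image_def B_id_def B_restrict_def bsub_def prod_eq_iff fun_eq_iff restrict_def subset_iff image_iff)
  show ?thesis unfolding transport_def split * using kB_module.ident[OF assms(1) bsub_B_obj[OF assms(3,2)] assms(4)] by simp
qed

lemma transport_comp:
  assumes F: "kB_module K F" and obj: "A \<in> B_obj" "B \<in> B_obj" "C \<in> B_obj"
    and f: "f \<in> B_hom A B" and g: "g \<in> B_hom B C" and D: "bsub D A" and v: "v \<in> carrier (kb_sp F D)"
  shows "transport F (B_comp A g f) (D, v) = transport F g (transport F f (D, v))"
proof -
  have *: "B_image (B_comp A g f) D = B_image g (B_image f D)"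
    "B_restrict (B_comp A g f) D = B_comp D (B_restrict g (B_image f D)) (B_restrict f D)"
    using D by (auto simp: B_image_def B_comp_def B_restrict_def bsub_def prod_eq_iff fun_eq_iff
        restrict_def compose_def subset_iff image_iff)
  note fD = B_hom_bsub[OF f D]
  note gD = B_hom_bsub[OF g fD(2)]
  show ?thesis unfolding transport_def split *
    using kB_module.comp[OF F bsub_B_obj[OF D obj(1)] bsub_B_obj[OF fD(2) obj(2)] bsub_B_obj[OF gD(2) obj(3)] fD(1) gD(1) v]
    by simp
qed

lemma B_comp_hom: "f \<in> B_hom A B \<Longrightarrow> g \<in> B_hom B C \<Longrightarrow> B_comp A g f \<in> B_hom A C"
  by (auto simp: B_hom_def B_comp_def intro: FB_hom_compose)

lemma B_id_hom: "B_id A \<in> B_hom A A"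
  by (auto simp: B_hom_def B_id_def B_restrict_def FB_hom_def)

lemma (in star_ctx) star_act:
  assumes "A \<in> B_obj" "B \<in> B_obj" "h \<in> B_hom A B"
  shows "kb_act (star K \<chi> F) A B h \<in> module_hom K (star_sp K \<chi> F A) (star_sp K \<chi> F B)"
    "\<And>ps. ps \<in> pow_terms F A \<Longrightarrow>
      kb_act (star K \<chi> F) A B h (star_elt K \<chi> F A ps) = star_elt K \<chi> F B (map (transport F h) ps)"
proof -
  have t: "map (\<lambda>(D, v). (B_image h D, (\<lambda>D. kb_act F D (B_image h D) (B_restrict h D)) D v)) ps \<in> pow_terms F B"
    if "ps \<in> pow_terms F A" for ps
    using transport_pow_terms[OF F assms that] by (simp add: transport_def)
  note * = star_lin_ext[OF star_ctx_axioms star_ctx_axioms assms(1,2) t kB_act_hom[OF F assms] refl]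
  show "kb_act (star K \<chi> F) A B h \<in> module_hom K (star_sp K \<chi> F A) (star_sp K \<chi> F B)"
    unfolding star_def kBmod.simps transport_def by (rule *(1))
  show "kb_act (star K \<chi> F) A B h (star_elt K \<chi> F A ps) = star_elt K \<chi> F B (map (transport F h) ps)"
    if "ps \<in> pow_terms F A" for ps
    unfolding star_def kBmod.simps transport_def by (rule *(2)[OF _ _ that])
qed

text \<open>Both laws are equations of linear maps. On terms they hold factor by factor, because
  transport of each factor by restrictions of a bijection is functorial.\<close>

lemma (in star_ctx) kB_module_star: "kB_module K (star K \<chi> F)"
proof (rule kB_module.intro)
  fix A :: "'a bob" assume A: "A \<in> B_obj"
  have sp: "kb_sp (star K \<chi> F) B = star_sp K \<chi> F B" for B by (simp add: star_def)
  show vs: "vectorspace K (kb_sp (star K \<chi> F) A)" unfolding sp by (rule vs_star[OF A])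
  note tA = pow_terms_memD
  show "kb_act (star K \<chi> F) A A (B_id A) v = v" if "v \<in> carrier (kb_sp (star K \<chi> F) A)" for v
  proof (rule spanning_hom_eq[OF vs vs _ _ hom_ident _ that])
    show "spanning K (kb_sp (star K \<chi> F) A) (star_elt K \<chi> F A ` pow_terms F A)"
      unfolding sp by (rule spanning_star[OF A])
    show "kb_act (star K \<chi> F) A A (B_id A) \<in> module_hom K (kb_sp (star K \<chi> F) A) (kb_sp (star K \<chi> F) A)"
      unfolding sp by (rule star_act(1)[OF A A B_id_hom])
    fix v assume "v \<in> star_elt K \<chi> F A ` pow_terms F A"
    then obtain ps where ps: "ps \<in> pow_terms F A" "v = star_elt K \<chi> F A ps" by blast
    have "map (transport F (B_id A)) ps = ps"
      by (rule map_idI) (use tA[OF ps(1)] transport_id[OF F A] in auto)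
    then show "kb_act (star K \<chi> F) A A (B_id A) v = v"
      using star_act(2)[OF A A B_id_hom ps(1)] ps(2) by simp
  qed
  fix B :: "'a bob" and h assume B: "B \<in> B_obj"
  show "kb_act (star K \<chi> F) A B h \<in> module_hom K (kb_sp (star K \<chi> F) A) (kb_sp (star K \<chi> F) B)" if "h \<in> B_hom A B"
    unfolding sp by (rule star_act(1)[OF A B that])
  fix C :: "'a bob" and f g v
  assume C: "C \<in> B_obj" and f: "f \<in> B_hom A B" and g: "g \<in> B_hom B C" and v: "v \<in> carrier (kb_sp (star K \<chi> F) A)"
  note gf = B_comp_hom[OF f g]
  show "kb_act (star K \<chi> F) A C (B_comp A g f) v = kb_act (star K \<chi> F) B C g (kb_act (star K \<chi> F) A B f v)"
  proof (rule spanning_hom_eq[OF vs_star[OF A] vs_star[OF C] spanning_star[OF A] star_act(1)[OF A C gf]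
        hom_comp[OF star_act(1)[OF A B f] star_act(1)[OF B C g]]])
    show "v \<in> carrier (star_sp K \<chi> F A)" using v unfolding sp .
    fix v assume "v \<in> star_elt K \<chi> F A ` pow_terms F A"
    then obtain ps where ps: "ps \<in> pow_terms F A" "v = star_elt K \<chi> F A ps" by blast
    have m: "map (transport F (B_comp A g f)) ps = map (transport F g) (map (transport F f) ps)"
      unfolding map_map by (rule map_cong[OF refl]) (use tA[OF ps(1)] transport_comp[OF F A B C f g] in auto)
    show "kb_act (star K \<chi> F) A C (B_comp A g f) v = kb_act (star K \<chi> F) B C g (kb_act (star K \<chi> F) A B f v)"
      unfolding ps(2) star_act(2)[OF A C gf ps(1)] star_act(2)[OF A B f ps(1)]
        star_act(2)[OF B C g transport_pow_terms[OF F A B f ps(1)]] m ..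
  qed
qed

lemma decomps2_image: "h \<in> B_hom A B \<Longrightarrow> (A1, A2) \<in> decomps2 A \<Longrightarrow> (B_image h A1, B_image h A2) \<in> decomps2 B"
  using is_decomp_image[of h A B "[A1, A2]"] by (simp add: decomps2_def)

lemma conv_ctxI: "field K \<Longrightarrow> kB_module K F \<Longrightarrow> kB_module K G \<Longrightarrow> A \<in> B_obj \<Longrightarrow> conv_ctx K F G A"
  by (auto simp: conv_ctx_def intro!: kB_module.space elim: bsub_B_obj)

lemma conv_act:
  assumes K: "field K" and F: "kB_module K F" and G: "kB_module K G"
    and AB: "A \<in> B_obj" "B \<in> B_obj" "h \<in> B_hom A B"
  shows "kb_act (conv K F G) A B h \<in> module_hom K (conv_sp K F G A) (conv_sp K F G B)"
    "\<And>A1 A2 v w. (A1, A2) \<in> decomps2 A \<Longrightarrow> v \<in> carrier (kb_sp F A1) \<Longrightarrow> w \<in> carrier (kb_sp G A2) \<Longrightarrow>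
      kb_act (conv K F G) A B h (conv_elt K F G A (A1, v) (A2, w)) =
      conv_elt K F G B (transport F h (A1, v)) (transport G h (A2, w))"
proof -
  have P: "{(conv_elt K F G A p q, conv_elt K F G B (transport F h p) (transport G h q)) |p q.
        (p, q) \<in> conv_terms F G A} = 
    {(conv_elt K F G A (A1, v) (A2, w),
      conv_elt K F G B (B_image h A1, (\<lambda>D. kb_act F D (B_image h D) (B_restrict h D)) A1 v)
        (B_image h A2, (\<lambda>D. kb_act G D (B_image h D) (B_restrict h D)) A2 w)) |A1 v A2 w.
      ((A1, v), (A2, w)) \<in> conv_terms F G A}"
    unfolding transport_def by (simp only: split_paired_Ex split)
  note * = conv_lin_ext[OF conv_ctxI[OF K F G AB(1)] conv_ctxI[OF K F G AB(2)]
      decomps2_image[OF AB(3)] kB_act_hom[OF F AB] kB_act_hom[OF G AB] P]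
  show "kb_act (conv K F G) A B h \<in> module_hom K (conv_sp K F G A) (conv_sp K F G B)"
    unfolding conv_def kBmod.simps by (rule *(1))
  show "kb_act (conv K F G) A B h (conv_elt K F G A (A1, v) (A2, w)) =
      conv_elt K F G B (transport F h (A1, v)) (transport G h (A2, w))"
    if t: "(A1, A2) \<in> decomps2 A" "v \<in> carrier (kb_sp F A1)" "w \<in> carrier (kb_sp G A2)" for A1 A2 v w
    unfolding conv_def kBmod.simps by (subst *(2)[OF _ _ _ t]) (simp_all add: transport_def)
qed

lemma conv_elt_transport_closed:
  assumes F: "kB_module K F" and AB: "A \<in> B_obj" "B \<in> B_obj" "h \<in> B_hom A B"
    and D: "bsub D A" "v \<in> carrier (kb_sp F D)"
  shows "snd (transport F h (D, v)) \<in> carrier (kb_sp F (B_image h D))"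
  using hom_closed[OF kB_act_hom[OF F AB D(1)] D(2)] by (simp add: transport_def)

lemma kB_module_conv:
  fixes F :: "('a, 'k, 'v) kBmod" and G :: "('a, 'k, 'w) kBmod"
  assumes K: "field K" and F: "kB_module K F" and G: "kB_module K G"
  shows "kB_module K (conv K F G)"
proof (rule kB_module.intro)
  fix A :: "'a bob" assume A: "A \<in> B_obj"
  interpret A: conv_ctx K F G A by (rule conv_ctxI[OF K F G A])
  have sp: "kb_sp (conv K F G) B = conv_sp K F G B" for B by (simp add: conv_def)
  show vs: "vectorspace K (kb_sp (conv K F G) A)" unfolding sp by (rule A.vs_conv)
  have span: "spanning K (conv_sp K F G A) {conv_elt K F G A (A1, v) (A2, w) |A1 v A2 w.
      (A1, A2) \<in> decomps2 A \<and> v \<in> carrier (kb_sp F A1) \<and> w \<in> carrier (kb_sp G A2)}"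
    by (rule A.spanning_conv_gen) (auto simp: spanning_def intro: lspan.gen)
  show "kb_act (conv K F G) A A (B_id A) v = v" if "v \<in> carrier (kb_sp (conv K F G) A)" for v
  proof (rule spanning_hom_eq[OF A.vs_conv A.vs_conv span conv_act(1)[OF K F G A A B_id_hom] hom_ident])
    show "v \<in> carrier (conv_sp K F G A)" using that unfolding sp .
    fix v assume "v \<in> {conv_elt K F G A (A1, v) (A2, w) |A1 v A2 w.
      (A1, A2) \<in> decomps2 A \<and> v \<in> carrier (kb_sp F A1) \<and> w \<in> carrier (kb_sp G A2)}"
    then obtain A1 A2 x w where *: "(A1, A2) \<in> decomps2 A" "x \<in> carrier (kb_sp F A1)" "w \<in> carrier (kb_sp G A2)"
      "v = conv_elt K F G A (A1, x) (A2, w)" by blast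
    note s = decomps2_bsub[OF *(1)]
    show "kb_act (conv K F G) A A (B_id A) v = v"
      unfolding *(4) using s * by (simp add: conv_act(2)[OF K F G A A B_id_hom *(1-3)] transport_id[OF F A] transport_id[OF G A])
  qed
  fix B :: "'a bob" and h assume B: "B \<in> B_obj"
  show "kb_act (conv K F G) A B h \<in> module_hom K (kb_sp (conv K F G) A) (kb_sp (conv K F G) B)" if "h \<in> B_hom A B"
    unfolding sp by (rule conv_act(1)[OF K F G A B that])
  fix C :: "'a bob" and f g v
  assume C: "C \<in> B_obj" and f: "f \<in> B_hom A B" and g: "g \<in> B_hom B C" and v: "v \<in> carrier (kb_sp (conv K F G) A)"
  interpret C: conv_ctx K F G C by (rule conv_ctxI[OF K F G C])
  note gf = B_comp_hom[OF f g]
  show "kb_act (conv K F G) A C (B_comp A g f) v = kb_act (conv K F G) B C g (kb_act (conv K F G) A B f v)"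
  proof (rule spanning_hom_eq[OF A.vs_conv C.vs_conv span conv_act(1)[OF K F G A C gf]
        hom_comp[OF conv_act(1)[OF K F G A B f] conv_act(1)[OF K F G B C g]]])
    show "v \<in> carrier (conv_sp K F G A)" using v unfolding sp .
    fix v assume "v \<in> {conv_elt K F G A (A1, v) (A2, w) |A1 v A2 w.
      (A1, A2) \<in> decomps2 A \<and> v \<in> carrier (kb_sp F A1) \<and> w \<in> carrier (kb_sp G A2)}"
    then obtain A1 A2 x w where *: "(A1, A2) \<in> decomps2 A" "x \<in> carrier (kb_sp F A1)" "w \<in> carrier (kb_sp G A2)"
      "v = conv_elt K F G A (A1, x) (A2, w)" by blast
    note s = decomps2_bsub[OF *(1)]
    obtain x' where x': "transport F f (A1, x) = (B_image f A1, x')" "x' \<in> carrier (kb_sp F (B_image f A1))"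
      using conv_elt_transport_closed[OF F A B f _ *(2)] s by (simp add: transport_def)
    obtain w' where w': "transport G f (A2, w) = (B_image f A2, w')" "w' \<in> carrier (kb_sp G (B_image f A2))"
      using conv_elt_transport_closed[OF G A B f _ *(3)] s by (simp add: transport_def)
    show "kb_act (conv K F G) A C (B_comp A g f) v = kb_act (conv K F G) B C g (kb_act (conv K F G) A B f v)"
      unfolding *(4) conv_act(2)[OF K F G A C gf *(1-3)] conv_act(2)[OF K F G A B f *(1-3)]
        x' w' conv_act(2)[OF K F G B C g decomps2_image[OF f *(1)] x'(2) w'(2)]
      using s * by (simp add: transport_comp[OF F A B C f g] transport_comp[OF G A B C f g] x' w')
  qed
qed

section \<open>Contractions and \<open>D_minus\<close>-modules\<close>

lemma bij_betw_map_sum: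
  assumes "\<sigma> permutes {1..n}" shows "bij_betw (map_sum id \<sigma>) (adjoin X n) (adjoin X n)"
proof (rule bij_betw_byWitness[where f' = "map_sum id (inv_into UNIV \<sigma>)"])
  note i = permutes_inverses[OF assms]
  show "\<forall>a\<in>adjoin X n. map_sum id (inv_into UNIV \<sigma>) (map_sum id \<sigma> a) = a"
    "\<forall>a\<in>adjoin X n. map_sum id \<sigma> (map_sum id (inv_into UNIV \<sigma>) a) = a"
    using i by (auto elim!: PlusE)
  show "map_sum id \<sigma> ` adjoin X n \<subseteq> adjoin X n" "map_sum id (inv_into UNIV \<sigma>) ` adjoin X n \<subseteq> adjoin X n"
    using permutes_in_image[OF assms] permutes_in_image[OF permutes_inv[OF assms]]
    by (auto simp del: atLeastAtMost_iff elim!: PlusE)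
qed

lemma uwb_twist_FB:
  assumes "\<sigma> permutes {1..n}" "f \<in> FB_hom (adjoin X n) U"
  shows "uwb_twist X n \<sigma> f \<in> FB_hom (adjoin X n) U"
proof -
  have "bij_betw (f \<circ> map_sum id \<sigma>) (adjoin X n) U"
    using bij_betw_trans[OF bij_betw_map_sum[OF assms(1)]] assms(2) by (auto simp: FB_hom_def)
  then show ?thesis unfolding FB_hom_def uwb_twist_def by simp
qed

lemma uwb_maps_twist:
  "\<sigma> permutes {1..uwb_deg A B} \<Longrightarrow> (f, g) \<in> uwb_maps A B \<Longrightarrow>
    (uwb_twist (fst A) (uwb_deg A B) \<sigma> f, uwb_twist (snd A) (uwb_deg A B) \<sigma> g) \<in> uwb_maps A B"
  by (simp add: uwb_maps_def uwb_twist_FB del: One_nat_def)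

text \<open>\<open>uwb_deg\<close> is a truncated subtraction. The existence of a map in
  \<open>uwb_maps\<close> guarantees that it is the true difference of cardinalities.\<close>

lemma uwb_maps_card:
  assumes "h \<in> uwb_maps A B" "A \<in> B_obj" "B \<in> B_obj"
  shows "card (fst B) = card (fst A) + uwb_deg A B"
proof -
  have "bij_betw (fst h) (adjoin (fst A) (uwb_deg A B)) (fst B)"
    using assms(1) by (auto simp: uwb_maps_def FB_hom_def)
  then have "card (fst B) = card (adjoin (fst A) (uwb_deg A B))" by (simp add: bij_betw_same_card)
  then show ?thesis using assms(2) by (auto simp: B_obj_def card_Plus)
qed

context
  fixes K :: "'k ring" and A B :: "'a bob"
  assumes K: "field K"
begin

lemma uwb_rel_closed:
  "{basis_vec K (uwb_maps A B) (uwb_twist (fst A) (uwb_deg A B) \<sigma> f, uwb_twist (snd A) (uwb_deg A B) \<sigma> g)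
      \<ominus>\<^bsub>free_space K (uwb_maps A B)\<^esub> perm_sgn K \<sigma> \<odot>\<^bsub>free_space K (uwb_maps A B)\<^esub> basis_vec K (uwb_maps A B) (f, g) |\<sigma> f g.
         \<sigma> permutes {1..uwb_deg A B} \<and> (f, g) \<in> uwb_maps A B} \<subseteq> carrier (free_space K (uwb_maps A B))"
  using perm_char_sgn[OF K]
  by (auto simp: perm_char_def simp del: One_nat_def intro!: vs_minus_closed[OF vs_free_space[OF K]]
      vs_smult[OF vs_free_space[OF K]] basis_vec_closed[OF K] uwb_maps_twist)

lemma vs_uwb_hom: "vectorspace K (uwb_hom K A B)"
  and spanning_uwb_hom: "spanning K (uwb_hom K A B) (uwb_cls K A B ` uwb_maps A B)"
  using spanning_free_quot[OF K uwb_rel_closed]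
  by (simp_all add: uwb_hom_def uwb_cls_def uwb_sub_def Let_def image_def)

lemma uwb_cls_closed: "h \<in> uwb_maps A B \<Longrightarrow> uwb_cls K A B h \<in> carrier (uwb_hom K A B)"
  using spanning_uwb_hom by (auto simp: spanning_def)

lemma uwb_cls_twist:
  assumes "\<sigma> permutes {1..uwb_deg A B}" "(f, g) \<in> uwb_maps A B"
  shows "uwb_cls K A B (uwb_twist (fst A) (uwb_deg A B) \<sigma> f, uwb_twist (snd A) (uwb_deg A B) \<sigma> g) =
    perm_sgn K \<sigma> \<odot>\<^bsub>uwb_hom K A B\<^esub> uwb_cls K A B (f, g)"
proof -
  let ?S = "uwb_maps A B"
  let ?F = "free_space K ?S"
  let ?R = "{basis_vec K ?S (uwb_twist (fst A) (uwb_deg A B) \<sigma> f, uwb_twist (snd A) (uwb_deg A B) \<sigma> g)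
      \<ominus>\<^bsub>?F\<^esub> perm_sgn K \<sigma> \<odot>\<^bsub>?F\<^esub> basis_vec K ?S (f, g) |\<sigma> f g.
         \<sigma> permutes {1..uwb_deg A B} \<and> (f, g) \<in> ?S}"
  note F = vs_free_space[OF K, of ?S]
  interpret Q: quotient_space K ?F "module.span K ?F ?R"
    by (rule quotient_span[OF F uwb_rel_closed])
  have s: "perm_sgn K \<sigma> \<in> carrier K" using perm_char_sgn[OF K] by (simp add: perm_char_def)
  note b = basis_vec_closed[OF K]
  have "basis_vec K ?S (uwb_twist (fst A) (uwb_deg A B) \<sigma> f, uwb_twist (snd A) (uwb_deg A B) \<sigma> g)
      \<ominus>\<^bsub>?F\<^esub> perm_sgn K \<sigma> \<odot>\<^bsub>?F\<^esub> basis_vec K ?S (f, g) \<in> ?R" using assms by blast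
  from coset_eqI[OF F uwb_rel_closed b[OF uwb_maps_twist[OF assms]] vs_smult[OF F s b[OF assms(2)]] this]
  show ?thesis using Q.smult_quot[OF s b[OF assms(2)]]
    unfolding uwb_hom_def uwb_cls_def uwb_sub_def Let_def by simp
qed

text \<open>Linear maps out of a space of morphisms are functions of pairs of bijections that change
  by the sign under a simultaneous relabelling of the adjoined points. Every definition on morphisms
  below goes through this property.\<close>

lemma uwb_ext:
  assumes W: "vectorspace K W" and g: "\<And>h. h \<in> uwb_maps A B \<Longrightarrow> g h \<in> carrier W"
    and t: "\<And>\<sigma> f f'. \<sigma> permutes {1..uwb_deg A B} \<Longrightarrow> (f, f') \<in> uwb_maps A B \<Longrightarrow>
      g (uwb_twist (fst A) (uwb_deg A B) \<sigma> f, uwb_twist (snd A) (uwb_deg A B) \<sigma> f') = perm_sgn K \<sigma> \<odot>\<^bsub>W\<^esub> g (f, f')"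
  shows "\<exists>\<phi>\<in>module_hom K (uwb_hom K A B) W. \<forall>h\<in>uwb_maps A B. \<phi> (uwb_cls K A B h) = g h"
  unfolding uwb_hom_def uwb_cls_def uwb_sub_def Let_def
proof (rule free_quot_ext[OF K W uwb_rel_closed g])
  let ?S = "uwb_maps A B"
  let ?F = "free_space K ?S"
  note F = vs_free_space[OF K, of ?S]
  fix \<phi> r assume p: "\<phi> \<in> module_hom K ?F W" and e: "\<And>s. s \<in> ?S \<Longrightarrow> \<phi> (basis_vec K ?S s) = g s"
    and r: "r \<in> {basis_vec K ?S (uwb_twist (fst A) (uwb_deg A B) \<sigma> f, uwb_twist (snd A) (uwb_deg A B) \<sigma> g)
      \<ominus>\<^bsub>?F\<^esub> perm_sgn K \<sigma> \<odot>\<^bsub>?F\<^esub> basis_vec K ?S (f, g) |\<sigma> f g.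
         \<sigma> permutes {1..uwb_deg A B} \<and> (f, g) \<in> ?S}"
  have s: "perm_sgn K \<sigma> \<in> carrier K" for \<sigma> using perm_char_sgn[OF K] by (simp add: perm_char_def)
  obtain \<sigma> f f' where *: "\<sigma> permutes {1..uwb_deg A B}" "(f, f') \<in> ?S"
    "r = basis_vec K ?S (uwb_twist (fst A) (uwb_deg A B) \<sigma> f, uwb_twist (snd A) (uwb_deg A B) \<sigma> f')
      \<ominus>\<^bsub>?F\<^esub> perm_sgn K \<sigma> \<odot>\<^bsub>?F\<^esub> basis_vec K ?S (f, f')" using r by blast
  note b = basis_vec_closed[OF K, of _ ?S]
  note b1 = b[OF uwb_maps_twist[OF *(1,2)]]
  note b2 = vs_smult[OF F s b[OF *(2)], of \<sigma>]
  show "\<phi> r = \<zero>\<^bsub>W\<^esub>"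
    unfolding *(3) hom_minus[OF F W p b1 b2] module_hom_smult[OF p s b[OF *(2)]] e[OF *(2)] e[OF uwb_maps_twist[OF *(1,2)]]
      t[OF *(1,2)]
    by (rule vs_minus_self[OF W vs_smult[OF W s g[OF *(2)]]])
qed

end

subsection \<open>Iterated contractions\<close>

text \<open>For a pair of bijections \<open>f\<close> from \<open>A\<close> with \<open>n\<close>
  adjoined points to \<open>B\<close>, the action goes from \<open>B\<close> to \<open>A\<close>.
  The largest label is contracted before the others; when no labels are left, the remaining
  bijection acts by its inverse. The map \<open>f\<close> is passed on unchanged, as later stages
  only look at it on smaller labels.\<close>

primrec uwb_act :: "('a, 'k, 'w) kBmod \<Rightarrow> ('a set \<Rightarrow> 'a set \<Rightarrow> 'a \<Rightarrow> 'a \<Rightarrow> 'w \<Rightarrow> 'w)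
    \<Rightarrow> nat \<Rightarrow> 'a bob \<Rightarrow> 'a bob \<Rightarrow> 'a umor \<Rightarrow> 'w \<Rightarrow> 'w" where
  "uwb_act F c 0 A B f v = kb_act F B A (B_inv A B
     (restrict (\<lambda>x. fst f (Inl x)) (fst A), restrict (\<lambda>y. snd f (Inl y)) (snd A))) v"
| "uwb_act F c (Suc n) A B f v =
    uwb_act F c n A (fst B - {fst f (Inr (Suc n))}, snd B - {snd f (Inr (Suc n))}) f
      (c (fst B - {fst f (Inr (Suc n))}) (snd B - {snd f (Inr (Suc n))})
        (fst f (Inr (Suc n))) (snd f (Inr (Suc n))) v)"

text \<open>Bijectivity without extensionality, so that the same \<open>f\<close> remains admissible
  after its last label has been contracted.\<close>

definition ubij :: "nat \<Rightarrow> 'a bob \<Rightarrow> 'a bob \<Rightarrow> 'a umor \<Rightarrow> bool" where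
  "ubij n A B f \<longleftrightarrow> bij_betw (fst f) (adjoin (fst A) n) (fst B) \<and> bij_betw (snd f) (adjoin (snd A) n) (snd B)"

lemma uwb_maps_ubij: "f \<in> uwb_maps A B \<Longrightarrow> ubij (uwb_deg A B) A B f"
  by (auto simp: uwb_maps_def ubij_def FB_hom_def)

lemma adjoin_Suc: "adjoin X (Suc n) = insert (Inr (Suc n)) (adjoin X n)" "Inr (Suc n) \<notin> adjoin X n"
  by auto

lemma Inr_adjoin: "Inr (Suc n) \<in> adjoin X (Suc n)"
  by auto

lemma adjoin_mono: "t \<in> adjoin X n \<Longrightarrow> t \<in> adjoin X (Suc n)"
  by auto

lemma bij_adjoin_Suc:
  assumes "bij_betw f (adjoin X (Suc n)) U"
  shows "f (Inr (Suc n)) \<in> U" "bij_betw f (adjoin X n) (U - {f (Inr (Suc n))})"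
proof -
  show s: "f (Inr (Suc n)) \<in> U" by (rule bspec[OF bij_betwE[OF assms] Inr_adjoin])
  have "bij_betw f {Inr (Suc n)} {f (Inr (Suc n))}" by (simp add: bij_betw_def)
  from bij_betw_DiffI[OF assms this]
  have "bij_betw f (adjoin X (Suc n) - {Inr (Suc n)}) (U - {f (Inr (Suc n))})"
    using s Inr_adjoin[of n X] by (simp del: One_nat_def)
  moreover have "adjoin X (Suc n) - {Inr (Suc n)} = adjoin X n"
    unfolding adjoin_Suc(1) by (rule Diff_insert_absorb[OF adjoin_Suc(2)])
  ultimately show "bij_betw f (adjoin X n) (U - {f (Inr (Suc n))})" by simp
qed

lemma ubij_Suc:
  assumes "ubij (Suc n) A B f"
  shows "fst f (Inr (Suc n)) \<in> fst B" "snd f (Inr (Suc n)) \<in> snd B"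
    "ubij n A (fst B - {fst f (Inr (Suc n))}, snd B - {snd f (Inr (Suc n))}) f"
  using assms bij_adjoin_Suc by (auto simp: ubij_def)

lemma ubij_base:
  assumes "ubij 0 A B f"
  shows "(restrict (\<lambda>x. fst f (Inl x)) (fst A), restrict (\<lambda>y. snd f (Inl y)) (snd A)) \<in> B_hom A B"
proof -
  have "restrict (\<lambda>x. g (Inl x)) X \<in> FB_hom X U" if "bij_betw g (adjoin X 0) U" for g :: "'a + nat \<Rightarrow> 'a" and X U
    using that by (auto simp: FB_hom_def bij_betw_def inj_on_def Plus_def)
  then show ?thesis using assms by (simp add: ubij_def B_hom_def)
qed

lemma FB_inv: "f \<in> FB_hom X Y \<Longrightarrow> restrict (inv_into X f) Y \<in> FB_hom Y X"
  by (auto simp: FB_hom_def bij_betw_inv_into cong: bij_betw_cong)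

lemma B_inv_hom: "h \<in> B_hom A B \<Longrightarrow> B_inv A B h \<in> B_hom B A"
  by (auto simp: B_hom_def B_inv_def intro: FB_inv)

lemma FB_inv_comp:
  assumes "f \<in> FB_hom X Y" "g \<in> FB_hom Y Z"
  shows "compose Z (restrict (inv_into X f) Y) (restrict (inv_into Y g) Z) = restrict (inv_into X (compose X g f)) Z"
proof
  fix z
  show "compose Z (restrict (inv_into X f) Y) (restrict (inv_into Y g) Z) z = restrict (inv_into X (compose X g f)) Z z"
  proof (cases "z \<in> Z")
    case True
    then obtain y where y: "y \<in> Y" "z = g y" using assms(2) by (auto simp: FB_hom_def bij_betw_def)
    then obtain x where x: "x \<in> X" "y = f x" using assms(1) by (auto simp: FB_hom_def bij_betw_def)
    have i: "inj_on f X" "inj_on g Y" "inj_on (compose X g f) X"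
      using assms FB_hom_compose[OF assms] by (auto simp: FB_hom_def bij_betw_def)
    have "z = compose X g f x" using x y by (simp add: compose_def)
    then have "inv_into X (compose X g f) z = x" using i x by (simp add: inv_into_f_f)
    moreover have "inv_into X f (inv_into Y g z) = x" using i x y by (simp add: inv_into_f_f)
    moreover have "inv_into Y g z = y" using i y by (simp add: inv_into_f_f)
    ultimately show ?thesis using True y by (simp add: compose_def)
  qed (simp add: compose_def)
qed

lemma B_inv_comp:
  "f \<in> B_hom A B \<Longrightarrow> g \<in> B_hom B C \<Longrightarrow> B_comp C (B_inv A B f) (B_inv B C g) = B_inv A C (B_comp A g f)"
  by (auto simp: B_hom_def B_comp_def B_inv_def FB_inv_comp)

lemma FB_inv_restrict:
  assumes "f \<in> FB_hom X Y" "X' \<subseteq> X"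
  shows "restrict (restrict (inv_into X f) Y) (f ` X') = restrict (inv_into X' (restrict f X')) (f ` X')"
proof (rule restrict_ext)
  fix z assume "z \<in> f ` X'"
  then obtain x where x: "x \<in> X'" "z = f x" by blast
  have i: "inj_on f X" "inj_on (restrict f X') X'" "f ` X = Y"
    using assms by (auto simp: FB_hom_def bij_betw_def inj_on_def)
  have "inv_into X' (restrict f X') z = x" using x i(2) inv_into_f_f[of "restrict f X'" X' x] by simp
  moreover have "inv_into X f z = x" using x i assms(2) by (auto simp: inv_into_f_f)
  moreover have "z \<in> Y" using x i(3) assms(2) by blast
  ultimately show "restrict (inv_into X f) Y z = inv_into X' (restrict f X') z" by simp
qed

text \<open>Morphisms of degree zero act by inverses, whereas naturality of contractions restricts
  bijections. This equation exchanges the two operations.\<close>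

lemma B_inv_restrict:
  assumes "h \<in> B_hom A B" "bsub D A"
  shows "B_restrict (B_inv A B h) (B_image h D) = B_inv D (B_image h D) (B_restrict h D)"
  using assms FB_inv_restrict[of "fst h" "fst A" "fst B" "fst D"] FB_inv_restrict[of "snd h" "snd A" "snd B" "snd D"]
  by (simp add: B_hom_def B_restrict_def B_inv_def B_image_def bsub_def mem_Times_iff)

lemma B_inv_id: fixes A :: "'a bob" shows "B_inv A A (B_id A) = B_id A"
proof -
  have "restrict (inv_into X (restrict id X)) X = restrict id X" for X :: "'a set"
    by (rule restrict_ext) (metis id_apply inj_on_id inj_on_restrict_eq inv_into_f_f restrict_apply')
  then show ?thesis by (simp add: B_inv_def B_id_def B_restrict_def)
qed

text \<open>\<open>uwb_twist\<close> without the restriction of the domain. Without it, twisting by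
  a composite is literally an iterated twist, and \<open>uwb_act\<close> does not see the
  difference.\<close>

definition tw :: "(nat \<Rightarrow> nat) \<Rightarrow> 'a umor \<Rightarrow> 'a umor" where
  "tw \<sigma> f = (fst f \<circ> map_sum id \<sigma>, snd f \<circ> map_sum id \<sigma>)"

lemma ubij_tw: "\<sigma> permutes {1..n} \<Longrightarrow> ubij n A B f \<Longrightarrow> ubij n A B (tw \<sigma> f)"
  by (auto simp: ubij_def tw_def simp del: One_nat_def intro: bij_betw_trans[OF bij_betw_map_sum])

lemma tw_comp: fixes f :: "'a umor" shows "tw (\<sigma> \<circ> \<tau>) f = tw \<tau> (tw \<sigma> f)"
proof -
  have "map_sum id (\<sigma> \<circ> \<tau>) x = map_sum id \<sigma> (map_sum id \<tau> x)" for x :: "'a + nat" by (cases x) simp_all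
  then show ?thesis by (simp add: tw_def fun_eq_iff)
qed

lemma uwb_act_cong:
  assumes "\<And>t. t \<in> adjoin (fst A) n \<Longrightarrow> fst f t = fst g t" "\<And>t. t \<in> adjoin (snd A) n \<Longrightarrow> snd f t = snd g t"
  shows "uwb_act F c n A B f v = uwb_act F c n A B g v"
  using assms
proof (induction n arbitrary: B v)
  case 0
  have "restrict (\<lambda>x. fst f (Inl x)) (fst A) = restrict (\<lambda>x. fst g (Inl x)) (fst A)"
    "restrict (\<lambda>x. snd f (Inl x)) (snd A) = restrict (\<lambda>x. snd g (Inl x)) (snd A)"
    using 0 by (auto intro!: restrict_ext)
  then show ?case by simp
next
  case (Suc n)
  have "fst f (Inr (Suc n)) = fst g (Inr (Suc n))" "snd f (Inr (Suc n)) = snd g (Inr (Suc n))"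
    using Suc.prems Inr_adjoin by metis+
  moreover have "uwb_act F c n A B' f w = uwb_act F c n A B' g w" for B' w
    by (rule Suc.IH) (use Suc.prems adjoin_mono in metis)+
  ultimately show ?case by simp
qed

locale contr_sys =
  fixes K :: "'k ring" and F :: "('a, 'k, 'w) kBmod"
    and c :: "'a set \<Rightarrow> 'a set \<Rightarrow> 'a \<Rightarrow> 'a \<Rightarrow> 'w \<Rightarrow> 'w"
  assumes K: "field K" and F: "kB_module K F"
    and c_hom: "\<And>X Y x y. finite X \<Longrightarrow> finite Y \<Longrightarrow> x \<notin> X \<Longrightarrow> y \<notin> Y \<Longrightarrow>
      c X Y x y \<in> module_hom K (kb_sp F (insert x X, insert y Y)) (kb_sp F (X, Y))"
    and c_nat: "\<And>X Y x y X' Y' x' y' h v. finite X \<Longrightarrow> finite Y \<Longrightarrow> x \<notin> X \<Longrightarrow> y \<notin> Y \<Longrightarrow> x' \<notin> X' \<Longrightarrow> y' \<notin> Y' \<Longrightarrow>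
      h \<in> B_hom (insert x X, insert y Y) (insert x' X', insert y' Y') \<Longrightarrow> fst h x = x' \<Longrightarrow> snd h y = y' \<Longrightarrow>
      v \<in> carrier (kb_sp F (insert x X, insert y Y)) \<Longrightarrow>
      c X' Y' x' y' (kb_act F (insert x X, insert y Y) (insert x' X', insert y' Y') h v) =
      kb_act F (X, Y) (X', Y') (B_restrict h (X, Y)) (c X Y x y v)"
    and c_anti: "\<And>X Y x y x' y' v. finite X \<Longrightarrow> finite Y \<Longrightarrow> x \<notin> X \<Longrightarrow> x' \<notin> X \<Longrightarrow> x \<noteq> x' \<Longrightarrow>
      y \<notin> Y \<Longrightarrow> y' \<notin> Y \<Longrightarrow> y \<noteq> y' \<Longrightarrow> v \<in> carrier (kb_sp F (insert x (insert x' X), insert y (insert y' Y))) \<Longrightarrow>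
      c X Y x y (c (insert x X) (insert y Y) x' y' v) =
      neg1 K \<odot>\<^bsub>kb_sp F (X, Y)\<^esub> c X Y x' y' (c (insert x' X) (insert y' Y) x y v)"
begin

lemma vsF: "A \<in> B_obj \<Longrightarrow> vectorspace K (kb_sp F A)"
  by (rule kB_module.space[OF F])

lemma B_obj_diff: "B \<in> B_obj \<Longrightarrow> (fst B - X, snd B - Y) \<in> B_obj"
  by (cases B) (auto simp: B_obj_def)

lemma c_hom':
  assumes "B \<in> B_obj" "x \<in> fst B" "y \<in> snd B"
  shows "c (fst B - {x}) (snd B - {y}) x y \<in> module_hom K (kb_sp F B) (kb_sp F (fst B - {x}, snd B - {y}))"
proof -
  have "(insert x (fst B - {x}), insert y (snd B - {y})) = B" using assms(2,3) by (auto simp: prod_eq_iff)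
  then show ?thesis using c_hom[of "fst B - {x}" "snd B - {y}" x y] assms(1) by (auto simp: B_obj_def split_beta)
qed

lemma uwb_act_hom:
  assumes "A \<in> B_obj" "B \<in> B_obj" "ubij n A B f"
  shows "uwb_act F c n A B f \<in> module_hom K (kb_sp F B) (kb_sp F A)"
  using assms(2,3)
proof (induction n arbitrary: B)
  case 0
  have "kb_act F B A (B_inv A B (restrict (\<lambda>x. fst f (Inl x)) (fst A), restrict (\<lambda>y. snd f (Inl y)) (snd A)))
      \<in> module_hom K (kb_sp F B) (kb_sp F A)"
    using 0 assms(1) by (intro kB_module.hom[OF F] B_inv_hom ubij_base)
  then show ?case by (rule hom_cong[OF vsF[OF 0(1)]]) simp
next
  case (Suc n)
  note u = ubij_Suc[OF Suc.prems(2)]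
  show ?case
    by (rule hom_cong[OF vsF[OF Suc.prems(1)] hom_comp[OF c_hom'[OF Suc.prems(1) u(1,2)]
            Suc.IH[OF B_obj_diff[OF Suc.prems(1)] u(3)]]]) simp
qed

text \<open>If both labels lie below the largest one, the outermost contraction is unaffected and
  induction applies. Otherwise they are the two labels that are contracted at the outset, and the
  claim is \<open>c_anti\<close>.\<close>

lemma uwb_act_adjacent:
  assumes "A \<in> B_obj" "B \<in> B_obj" "ubij n A B f" "1 \<le> i" "Suc i \<le> n" "v \<in> carrier (kb_sp F B)"
  shows "uwb_act F c n A B (tw (transpose i (Suc i)) f) v = neg1 K \<odot>\<^bsub>kb_sp F A\<^esub> uwb_act F c n A B f v"
  using assms(2-)
proof (induction n arbitrary: B v)
  case 0
  then show ?case by simp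
next
  case (Suc m)
  let ?f = "tw (transpose i (Suc i)) f"
  note u = ubij_Suc[OF Suc.prems(2)]
  show ?case
  proof (cases "Suc i \<le> m")
    case True
    then have e: "fst ?f (Inr (Suc m)) = fst f (Inr (Suc m))" "snd ?f (Inr (Suc m)) = snd f (Inr (Suc m))"
      by (simp_all add: tw_def transpose_def)
    show ?thesis unfolding uwb_act.simps e
      by (rule Suc.IH[OF B_obj_diff[OF Suc.prems(1)] u(3) Suc.prems(3) True
            hom_closed[OF c_hom'[OF Suc.prems(1) u(1,2)] Suc.prems(5)]])
  next
    case False
    then obtain k where k: "m = Suc k" "i = Suc k" using Suc.prems by (cases m) (auto simp: le_Suc_eq)
    define x1 y1 x2 y2 where xy: "x1 = fst f (Inr (Suc k))" "y1 = snd f (Inr (Suc k))"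
      "x2 = fst f (Inr (Suc (Suc k)))" "y2 = snd f (Inr (Suc (Suc k)))"
    note u' = ubij_Suc[OF u(3)[unfolded k]]
    define X Y where XY: "X = fst B - {x2} - {x1}" "Y = snd B - {y2} - {y1}"
    have in1: "x1 \<in> fst B" "x1 \<noteq> x2" "y1 \<in> snd B" "y1 \<noteq> y2" "x2 \<in> fst B" "y2 \<in> snd B"
      using u' u(1,2) by (auto simp: xy k)
    have sets: "fst B - {x2} = insert x1 X" "snd B - {y2} = insert y1 Y" "fst B - {x1} = insert x2 X"
      "snd B - {y1} = insert y2 Y" "fst B - {x1} - {x2} = X" "snd B - {y1} - {y2} = Y"
      and B: "B = (insert x1 (insert x2 X), insert y1 (insert y2 Y))"
      using in1 by (auto simp: XY prod_eq_iff)
    have nin: "x1 \<notin> X" "x2 \<notin> X" "y1 \<notin> Y" "y2 \<notin> Y" by (auto simp: XY)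
    have dels: "insert x1 X - {x1} = X" "insert x2 X - {x2} = X" "insert y1 Y - {y1} = Y" "insert y2 Y - {y2} = Y"
      using nin by auto
    have fin: "finite X" "finite Y" using Suc.prems(1) by (auto simp: XY B_obj_def split_beta)
    have XYo: "(X, Y) \<in> B_obj" using fin by (simp add: B_obj_def)
    have ub: "ubij k A (X, Y) f" using u'(3) by (simp add: XY xy k)
    have e: "fst ?f (Inr (Suc (Suc k))) = x1" "snd ?f (Inr (Suc (Suc k))) = y1"
      "fst ?f (Inr (Suc k)) = x2" "snd ?f (Inr (Suc k)) = y2" by (simp_all add: tw_def xy k)
    \<comment> \<open>The transposition concerns only the labels \<open>k + 1\<close> and
      \<open>k + 2\<close>, so the remaining iterated contraction does not change.\<close>
    have cg: "uwb_act F c k A (X, Y) ?f w = uwb_act F c k A (X, Y) f w" for w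
      by (rule uwb_act_cong) (auto simp: tw_def k transpose_def elim!: PlusE)
    have v: "v \<in> carrier (kb_sp F (insert x2 (insert x1 X), insert y2 (insert y1 Y)))"
      using Suc.prems(5) by (simp add: B insert_commute)
    have v': "v \<in> carrier (kb_sp F (insert x1 (insert x2 X), insert y1 (insert y2 Y)))"
      using Suc.prems(5) by (simp add: B)
    have cc: "c X Y x1 y1 (c (insert x1 X) (insert y1 Y) x2 y2 v) \<in> carrier (kb_sp F (X, Y))"
      by (intro hom_closed[OF c_hom] fin nin finite.insertI v) (use in1 nin in auto)
    have m: "neg1 K \<in> carrier K" using perm_char_sgn[OF K] by (simp add: perm_char_def)
    have "uwb_act F c (Suc m) A B ?f v = uwb_act F c k A (X, Y) f (c X Y x2 y2 (c (insert x2 X) (insert y2 Y) x1 y1 v))"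
      unfolding k(1) uwb_act.simps e fst_conv snd_conv sets(1-4) dels cg ..
    also have "c X Y x2 y2 (c (insert x2 X) (insert y2 Y) x1 y1 v) =
        neg1 K \<odot>\<^bsub>kb_sp F (X, Y)\<^esub> c X Y x1 y1 (c (insert x1 X) (insert y1 Y) x2 y2 v)"
      by (rule c_anti[OF fin nin(2,1) _ nin(4,3) _ v]) (use in1 in auto)
    also have "uwb_act F c k A (X, Y) f \<dots> = neg1 K \<odot>\<^bsub>kb_sp F A\<^esub>
        uwb_act F c k A (X, Y) f (c X Y x1 y1 (c (insert x1 X) (insert y1 Y) x2 y2 v))"
      by (rule module_hom_smult[OF uwb_act_hom[OF assms(1) XYo ub] m cc])
    also have "uwb_act F c k A (X, Y) f (c X Y x1 y1 (c (insert x1 X) (insert y1 Y) x2 y2 v)) =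
        uwb_act F c (Suc m) A B f v"
      unfolding k(1) uwb_act.simps xy[symmetric] fst_conv snd_conv sets(1-4) dels ..
    finally show ?thesis .
  qed
qed

text \<open>This is what makes the action of a class independent of its representative. The pair
  \<open>f\<close> is quantified in the induction, since the hypothesis for \<open>p\<close> is
  applied to the pair already twisted by the transposition.\<close>

lemma uwb_act_tw:
  assumes "A \<in> B_obj" "B \<in> B_obj" "ubij n A B f" "\<sigma> permutes {1..n}" "v \<in> carrier (kb_sp F B)"
  shows "uwb_act F c n A B (tw \<sigma> f) v = perm_sgn K \<sigma> \<odot>\<^bsub>kb_sp F A\<^esub> uwb_act F c n A B f v"
proof -
  interpret VA: vectorspace K "kb_sp F A" by (rule vsF[OF assms(1)])
  note ch = perm_char_sgn[OF K]
  have "\<sigma> permutes {1..<Suc n}" using assms(4) by (simp add: atLeastLessThanSuc_atLeastAtMost del: One_nat_def)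
  then have "\<forall>f. ubij n A B f \<longrightarrow> uwb_act F c n A B (tw \<sigma> f) v = perm_sgn K \<sigma> \<odot>\<^bsub>kb_sp F A\<^esub> uwb_act F c n A B f v"
  proof (induction rule: perm_adjacent_induct)
    case id
    have tw: "tw id f = f" for f :: "'a umor" by (simp add: tw_def map_sum.id)
    have sg: "perm_sgn K id = \<one>\<^bsub>K\<^esub>" by (simp add: perm_sgn_def)
    show ?case unfolding tw sg
      using VA.smult_one[OF hom_closed[OF uwb_act_hom[OF assms(1,2)] assms(5)]] by metis
  next
    case (swap i p)
    have p: "p permutes {1..n}" using swap(3) by (simp add: atLeastLessThanSuc_atLeastAtMost del: One_nat_def)
    show ?case
    proof (intro allI impI)
      fix f assume f: "ubij n A B f"
      let ?t = "transpose i (Suc i)"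
      have t: "?t permutes {1..n}" using swap by (intro permutes_swap_id) auto
      have cl: "uwb_act F c n A B f v \<in> carrier (kb_sp F A)" by (rule hom_closed[OF uwb_act_hom[OF assms(1,2) f] assms(5)])
      have s: "perm_sgn K p \<in> carrier K" "neg1 K \<in> carrier K" using ch by (auto simp: perm_char_def)
      have "uwb_act F c n A B (tw (?t \<circ> p) f) v = perm_sgn K p \<odot>\<^bsub>kb_sp F A\<^esub> uwb_act F c n A B (tw ?t f) v"
        unfolding tw_comp using swap(4) ubij_tw[OF t f] by blast
      also have "uwb_act F c n A B (tw ?t f) v = neg1 K \<odot>\<^bsub>kb_sp F A\<^esub> uwb_act F c n A B f v"
        by (rule uwb_act_adjacent[OF assms(1,2) f _ _ assms(5)]) (use swap in auto)
      also have "perm_sgn K p \<odot>\<^bsub>kb_sp F A\<^esub> \<dots> = ((neg1 K) \<otimes>\<^bsub>K\<^esub> perm_sgn K p) \<odot>\<^bsub>kb_sp F A\<^esub> uwb_act F c n A B f v"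
        using s cl by (simp only: VA.smult_assoc1[symmetric] VA.m_comm)
      also have "permutation p" using p permutes_imp_permutation by blast
      then have "(neg1 K) \<otimes>\<^bsub>K\<^esub> perm_sgn K p = perm_sgn K (?t \<circ> p)"
        using ch by (simp add: perm_char_def)
      finally show "uwb_act F c n A B (tw (?t \<circ> p) f) v = perm_sgn K (?t \<circ> p) \<odot>\<^bsub>kb_sp F A\<^esub> uwb_act F c n A B f v" .
    qed
  qed
  then show ?thesis using assms(3) by blast
qed

text \<open>A bijection that acts before the contractions can be absorbed into the pair of maps.
  Each contraction is passed by \<open>c_nat\<close>, which leaves a bijection of the smaller sets;
  at the end two inverses are composed.\<close>

lemma uwb_act_nat:
  assumes "A \<in> B_obj" "B \<in> B_obj" "C \<in> B_obj" "ubij n A B f" "h \<in> B_hom B C" "v \<in> carrier (kb_sp F C)"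
  shows "uwb_act F c n A B f (kb_act F C B (B_inv B C h) v) =
    uwb_act F c n A C (\<lambda>t. fst h (fst f t), \<lambda>t. snd h (snd f t)) v"
  using assms(2-)
proof (induction n arbitrary: B C h v)
  case 0
  let ?f = "(restrict (\<lambda>x. fst f (Inl x)) (fst A), restrict (\<lambda>y. snd f (Inl y)) (snd A))"
  note f = ubij_base[OF 0(3)]
  have "kb_act F B A (B_inv A B ?f) (kb_act F C B (B_inv B C h) v) = kb_act F C A (B_comp C (B_inv A B ?f) (B_inv B C h)) v"
    by (rule kB_module.comp[OF F 0(2,1) assms(1) B_inv_hom[OF 0(4)] B_inv_hom[OF f] 0(5), symmetric])
  also have "B_comp C (B_inv A B ?f) (B_inv B C h) = B_inv A C (B_comp A h ?f)"
    by (rule B_inv_comp[OF f 0(4)])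
  also have "B_comp A h ?f = (restrict (\<lambda>x. fst h (fst f (Inl x))) (fst A), restrict (\<lambda>y. snd h (snd f (Inl y))) (snd A))"
    by (auto simp: B_comp_def compose_def intro!: restrict_ext)
  finally show ?case unfolding uwb_act.simps fst_conv snd_conv .
next
  case (Suc n)
  note u = ubij_Suc[OF Suc.prems(3)]
  define x y where xy: "x = fst f (Inr (Suc n))" "y = snd f (Inr (Suc n))"
  define x' y' where xy': "x' = fst h x" "y' = snd h y"
  let ?B = "(fst B - {x}, snd B - {y})" and ?C = "(fst C - {x'}, snd C - {y'})"
  have Bo: "?B \<in> B_obj" "?C \<in> B_obj" using Suc.prems(1,2) by (auto intro: B_obj_diff)
  have xin: "x \<in> fst B" "y \<in> snd B" using u by (simp_all add: xy)
  have bj: "bij_betw (fst h) (fst B) (fst C)" "bij_betw (snd h) (snd B) (snd C)"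
    using Suc.prems(4) by (auto simp: B_hom_def FB_hom_def)
  have xin': "x' \<in> fst C" "y' \<in> snd C" using bj xin by (auto simp: xy' bij_betw_def)
  have img: "B_image h ?B = ?C"
    using bj xin inj_on_image_set_diff[of "fst h" "fst B" "fst B" "{x}"]
      inj_on_image_set_diff[of "snd h" "snd B" "snd B" "{y}"]
    by (simp add: B_image_def xy' bij_betw_def)
  have bs: "bsub ?B B" by (auto simp: bsub_def)
  note hr = B_hom_bsub(1)[OF Suc.prems(4) bs, unfolded img]
  note hi = B_inv_hom[OF Suc.prems(4)]
  have BC: "(insert x (fst B - {x}), insert y (snd B - {y})) = B" "(insert x' (fst C - {x'}), insert y' (snd C - {y'})) = C"
    using xin xin' by (auto simp: prod_eq_iff)
  have ix: "fst (B_inv B C h) x' = x" "snd (B_inv B C h) y' = y"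
    using bj xin xin' by (auto simp: B_inv_def xy' bij_betw_def inv_into_f_f)
  have "c (fst B - {x}) (snd B - {y}) x y (kb_act F C B (B_inv B C h) v) =
      kb_act F ?C ?B (B_restrict (B_inv B C h) ?C) (c (fst C - {x'}) (snd C - {y'}) x' y' v)"
    using c_nat[of "fst C - {x'}" "snd C - {y'}" x' y' x "fst B - {x}" y "snd B - {y}" "B_inv B C h" v]
      Bo hi ix Suc.prems(5) unfolding BC by (simp add: B_obj_def)
  also have "B_restrict (B_inv B C h) ?C = B_inv ?B ?C (B_restrict h ?B)"
    using B_inv_restrict[OF Suc.prems(4) bs] unfolding img .
  finally have cn: "c (fst B - {x}) (snd B - {y}) x y (kb_act F C B (B_inv B C h) v) =
      kb_act F ?C ?B (B_inv ?B ?C (B_restrict h ?B)) (c (fst C - {x'}) (snd C - {y'}) x' y' v)" .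
  have cl: "c (fst C - {x'}) (snd C - {y'}) x' y' v \<in> carrier (kb_sp F ?C)"
    by (rule hom_closed[OF c_hom'[OF Suc.prems(2) xin'] Suc.prems(5)])
  have "uwb_act F c (Suc n) A B f (kb_act F C B (B_inv B C h) v) =
      uwb_act F c n A ?B f (kb_act F ?C ?B (B_inv ?B ?C (B_restrict h ?B)) (c (fst C - {x'}) (snd C - {y'}) x' y' v))"
    using cn by (simp add: xy)
  also have "\<dots> = uwb_act F c n A ?C (\<lambda>t. fst (B_restrict h ?B) (fst f t), \<lambda>t. snd (B_restrict h ?B) (snd f t))
      (c (fst C - {x'}) (snd C - {y'}) x' y' v)"
    by (rule Suc.IH[OF Bo u(3)[folded xy] hr cl])
  also have "\<dots> = uwb_act F c n A ?C (\<lambda>t. fst h (fst f t), \<lambda>t. snd h (snd f t))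
      (c (fst C - {x'}) (snd C - {y'}) x' y' v)"
    by (rule uwb_act_cong)
      (use u(3)[folded xy] in \<open>auto simp: ubij_def B_restrict_def dest: bij_betwE\<close>)
  also have "\<dots> = uwb_act F c (Suc n) A C (\<lambda>t. fst h (fst f t), \<lambda>t. snd h (snd f t)) v"
    by (simp add: xy xy')
  finally show ?case .
qed

text \<open>Composition law at the level of representatives. Gluing gives the labels of
  \<open>g\<close> the numbers above \<open>n\<close>, so stripping the largest labels of the glued
  map strips those of \<open>g\<close>. Once none is left, the bijection that remains of
  \<open>g\<close> has to pass the contractions of \<open>f\<close>, which is
  \<open>uwb_act_nat\<close>.\<close>

lemma uwb_act_glue:
  assumes "A \<in> B_obj" "B \<in> B_obj" "C \<in> B_obj" "ubij n A B f" "ubij r B C g" "v \<in> carrier (kb_sp F C)"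
  shows "uwb_act F c (n + r) A C (uwb_glue (fst A) n r (fst g) (fst f), uwb_glue (snd A) n r (snd g) (snd f)) v =
    uwb_act F c n A B f (uwb_act F c r B C g v)"
  using assms(3,5,6)
proof (induction r arbitrary: C v)
  case 0
  let ?g = "(restrict (\<lambda>x. fst g (Inl x)) (fst B), restrict (\<lambda>y. snd g (Inl y)) (snd B))"
  have bj: "fst f t \<in> fst B" if "t \<in> adjoin (fst A) n" for t using assms(4) that by (auto simp: ubij_def dest: bij_betwE)
  have bj': "snd f t \<in> snd B" if "t \<in> adjoin (snd A) n" for t using assms(4) that by (auto simp: ubij_def dest: bij_betwE)
  have "uwb_act F c n A B f (uwb_act F c 0 B C g v) =
      uwb_act F c n A C (\<lambda>t. fst ?g (fst f t), \<lambda>t. snd ?g (snd f t)) v"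
    unfolding uwb_act.simps by (rule uwb_act_nat[OF assms(1,2) 0(1) assms(4) ubij_base[OF 0(2)] 0(3)])
  also have "\<dots> = uwb_act F c n A C (uwb_glue (fst A) n 0 (fst g) (fst f), uwb_glue (snd A) n 0 (snd g) (snd f)) v"
  proof (rule uwb_act_cong)
    fix t assume t: "t \<in> adjoin (fst A) n"
    show "fst (\<lambda>t. fst ?g (fst f t), \<lambda>t. snd ?g (snd f t)) t =
      fst (uwb_glue (fst A) n 0 (fst g) (fst f), uwb_glue (snd A) n 0 (snd g) (snd f)) t"
      using bj[OF t] t by (cases t) (auto simp: uwb_glue_def elim!: PlusE)
  next
    fix t assume t: "t \<in> adjoin (snd A) n"
    show "snd (\<lambda>t. fst ?g (fst f t), \<lambda>t. snd ?g (snd f t)) t =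
      snd (uwb_glue (fst A) n 0 (fst g) (fst f), uwb_glue (snd A) n 0 (snd g) (snd f)) t"
      using bj'[OF t] t by (cases t) (auto simp: uwb_glue_def elim!: PlusE)
  qed
  finally show ?case by simp
next
  case (Suc r)
  note u = ubij_Suc[OF Suc.prems(2)]
  let ?x = "fst g (Inr (Suc r))" and ?y = "snd g (Inr (Suc r))"
  let ?C = "(fst C - {?x}, snd C - {?y})"
  let ?G = "(uwb_glue (fst A) n (Suc r) (fst g) (fst f), uwb_glue (snd A) n (Suc r) (snd g) (snd f))"
  let ?H = "(uwb_glue (fst A) n r (fst g) (fst f), uwb_glue (snd A) n r (snd g) (snd f))"
  have e: "fst ?G (Inr (Suc (n + r))) = ?x" "snd ?G (Inr (Suc (n + r))) = ?y"
    by (auto simp: uwb_glue_def)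
  have "uwb_act F c (n + Suc r) A C ?G v = uwb_act F c (n + r) A ?C ?G (c (fst ?C) (snd ?C) ?x ?y v)"
    unfolding add_Suc_right uwb_act.simps e by simp
  also have "\<dots> = uwb_act F c (n + r) A ?C ?H (c (fst ?C) (snd ?C) ?x ?y v)"
    by (rule uwb_act_cong) (auto simp: uwb_glue_def elim!: PlusE)
  also have "\<dots> = uwb_act F c n A B f (uwb_act F c r B ?C g (c (fst ?C) (snd ?C) ?x ?y v))"
    by (rule Suc.IH[OF B_obj_diff[OF Suc.prems(1)] u(3)])
      (use hom_closed[OF c_hom'[OF Suc.prems(1) u(1,2)] Suc.prems(3)] in simp)
  finally show ?case by simp
qed

end

subsection \<open>Composition in the category\<close>

text \<open>The bilinear counterpart of \<open>lin_ext_works\<close>: agreement on pairs of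
  generators is extended in one variable and then in the other, while extensionality in both
  arguments pins down the function.\<close>

lemma bilin_ext_works:
  assumes V: "vectorspace K V" and W: "vectorspace K W" and U: "vectorspace K U"
    and E: "spanning K V E" and E': "spanning K W E'"
    and P: "\<And>v w. v \<in> E \<Longrightarrow> w \<in> E' \<Longrightarrow> \<exists>u. ((v, w), u) \<in> P"
      "\<And>v w u. ((v, w), u) \<in> P \<Longrightarrow> v \<in> carrier V \<and> w \<in> carrier W"
    and b: "bilin K V W U \<beta>" and bP: "\<And>v w u. ((v, w), u) \<in> P \<Longrightarrow> \<beta> v w = u"
  shows "\<And>v w. v \<in> carrier V \<Longrightarrow> w \<in> carrier W \<Longrightarrow> bilin_ext K V W U P v w = \<beta> v w"
proof -
  let ?Q = "\<lambda>\<phi>. (\<forall>v\<in>carrier V. \<phi> v \<in> module_hom K W U \<and> \<phi> v \<in> extensional (carrier W)) \<and>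
         (\<forall>w\<in>carrier W. (\<lambda>v. \<phi> v w) \<in> module_hom K V U) \<and> \<phi> \<in> extensional (carrier V) \<and>
         (\<forall>((v, w), u)\<in>P. \<phi> v w = u)"
  define \<gamma> where "\<gamma> = (\<lambda>v\<in>carrier V. restrict (\<beta> v) (carrier W))"
  have b1: "\<beta> v \<in> module_hom K W U" if "v \<in> carrier V" for v using b that by (simp add: bilin_def)
  have b2: "(\<lambda>v. \<beta> v w) \<in> module_hom K V U" if "w \<in> carrier W" for w using b that by (simp add: bilin_def)
  have "\<gamma> v \<in> module_hom K W U \<and> \<gamma> v \<in> extensional (carrier W)" if v: "v \<in> carrier V" for v
    using hom_cong[OF W b1[OF v], of "\<gamma> v"] v by (simp add: \<gamma>_def)
  moreover have "(\<lambda>v. \<gamma> v w) \<in> module_hom K V U" if w: "w \<in> carrier W" for w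
    by (rule hom_cong[OF V b2[OF w]]) (simp add: \<gamma>_def w)
  moreover have "\<gamma> \<in> extensional (carrier V)" by (simp add: \<gamma>_def)
  moreover have "\<forall>((v, w), u)\<in>P. \<gamma> v w = u" using P(2) bP by (auto simp: \<gamma>_def)
  ultimately have ex: "?Q \<gamma>" by blast
  have uniq: "\<phi> = \<psi>" if p: "?Q \<phi>" and q: "?Q \<psi>" for \<phi> \<psi>
  proof (rule extensionalityI[where A = "carrier V"])
    fix v assume v: "v \<in> carrier V"
    show "\<phi> v = \<psi> v"
    proof (rule extensionalityI[where A = "carrier W"])
      fix w assume w: "w \<in> carrier W"
      have base: "\<phi> v w = \<psi> v w" if vw: "v \<in> E" "w \<in> E'" for v w
      proof -
        obtain u where u: "((v, w), u) \<in> P" using P(1)[OF vw] by blast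
        have "\<phi> v w = u" "\<psi> v w = u"
          using bspec[OF p[THEN conjunct2, THEN conjunct2, THEN conjunct2] u]
            bspec[OF q[THEN conjunct2, THEN conjunct2, THEN conjunct2] u] by simp_all
        then show ?thesis by simp
      qed
      have Ec: "E \<subseteq> carrier V" using E by (simp add: spanning_def)
      have ph: "\<phi> v \<in> module_hom K W U" "\<psi> v \<in> module_hom K W U" if "v \<in> carrier V" for v
        using p q that by blast+
      have ph': "(\<lambda>v. \<phi> v w) \<in> module_hom K V U" "(\<lambda>v. \<psi> v w) \<in> module_hom K V U"
        using p q w by blast+
      have "\<phi> v w = \<psi> v w" if v: "v \<in> E" for v
        using spanning_hom_eq[OF W U E' ph(1) ph(2) base[OF v] w] v Ec by blast
      then show "\<phi> v w = \<psi> v w"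
        by (rule spanning_hom_eq[OF V U E ph' _ v])
    qed (use p q v in blast)+
  qed (use p q in blast)+
  have "bilin_ext K V W U P = \<gamma>"
    unfolding bilin_ext_def by (rule the_equality[where P = ?Q, OF ex]) (use uniq ex in blast)
  then show "bilin_ext K V W U P v w = \<beta> v w" if "v \<in> carrier V" "w \<in> carrier W" for v w
    using that by (simp add: \<gamma>_def)
qed

definition uglue :: "'a bob \<Rightarrow> nat \<Rightarrow> nat \<Rightarrow> 'a umor \<Rightarrow> 'a umor \<Rightarrow> 'a umor" where
  "uglue A n r g f = (uwb_glue (fst A) n r (fst g) (fst f), uwb_glue (snd A) n r (snd g) (snd f))"

text \<open>The glued map is a composite of \<open>g\<close> with a renumbering that consumes the
  labels of \<open>f\<close>, hence a bijection.\<close>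

lemma uwb_glue_FB:
  assumes f: "f \<in> FB_hom (adjoin X n) U" and g: "g \<in> FB_hom (adjoin U r) W"
  shows "uwb_glue X n r g f \<in> FB_hom (adjoin X (n + r)) W"
proof -
  \<comment> \<open>The map from \<open>X\<close> with \<open>n + r\<close> points to
    \<open>U\<close> with \<open>r\<close> points: \<open>f\<close> is applied to everything up to
    label \<open>n\<close>, and the labels above \<open>n\<close> are shifted down.\<close>
  define k :: "'a + nat \<Rightarrow> 'a + nat" where "k t = (case t of Inl x \<Rightarrow> Inl (f (Inl x))
    | Inr i \<Rightarrow> if i \<le> n then Inl (f (Inr i)) else Inr (i - n))" for t
  have bf: "bij_betw f (adjoin X n) U" and bg: "bij_betw g (adjoin U r) W"
    using f g by (auto simp: FB_hom_def)
  have "bij_betw (Inl \<circ> f) (adjoin X n) (Inl ` U :: ('a + nat) set)"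
    using bf by (auto simp: bij_betw_def inj_on_def)
  moreover have "k t = (Inl \<circ> f) t" if "t \<in> adjoin X n" for t using that by (auto simp: k_def)
  ultimately have k1: "bij_betw k (adjoin X n) (Inl ` U)" using bij_betw_cong[of "adjoin X n" k] by metis
  have k2: "bij_betw k (Inr ` {n<..n + r}) (Inr ` {1..r})"
  proof (rule bij_betw_byWitness[where f' = "\<lambda>t. case t of Inl x \<Rightarrow> Inl x | Inr i \<Rightarrow> Inr (i + n)"])
    show "k ` Inr ` {n<..n + r} \<subseteq> Inr ` {1..r}" by (auto simp: k_def intro!: imageI) presburger+
    show "(\<lambda>t. case t of Inl x \<Rightarrow> Inl x | Inr i \<Rightarrow> Inr (i + n)) ` Inr ` {1..r} \<subseteq> Inr ` {n<..n + r}"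
      by auto
  qed (auto simp: k_def)
  have "bij_betw k (adjoin X n \<union> Inr ` {n<..n + r}) (Inl ` U \<union> Inr ` {1..r})"
    by (rule bij_betw_combine[OF k1 k2]) auto
  moreover have "{1..n} \<union> {n<..n + r} = {1..n + r}" by auto
  then have "adjoin X n \<union> Inr ` {n<..n + r} = adjoin X (n + r)"
    by (simp only: Plus_def Un_assoc flip: image_Un)
  ultimately have "bij_betw k (adjoin X (n + r)) (adjoin U r)" by (simp add: Plus_def)
  from bij_betw_trans[OF this bg] have "bij_betw (g \<circ> k) (adjoin X (n + r)) W" .
  moreover have "uwb_glue X n r g f = restrict (g \<circ> k) (adjoin X (n + r))"
    unfolding uwb_glue_def by (rule restrict_ext) (auto simp: k_def split: sum.splits)
  ultimately show ?thesis by (simp add: FB_hom_def del: One_nat_def)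
qed

lemma uwb_glue_twist_right:
  assumes "\<sigma> permutes {1..n}"
  shows "uwb_glue X n r g (uwb_twist X n \<sigma> f) = uwb_twist X (n + r) \<sigma> (uwb_glue X n r g f)"
proof
  fix t
  have s: "1 \<le> \<sigma> i \<and> \<sigma> i \<le> n" if "1 \<le> i" "i \<le> n" for i using permutes_in_image[OF assms, of i] that by simp
  have s': "\<sigma> i = i" if "n < i" for i using permutes_not_in[OF assms, of i] that by simp
  show "uwb_glue X n r g (uwb_twist X n \<sigma> f) t = uwb_twist X (n + r) \<sigma> (uwb_glue X n r g f) t"
  proof (cases "t \<in> adjoin X (n + r)")
    case False
    then show ?thesis by (simp add: uwb_glue_def uwb_twist_def del: One_nat_def)
  next
    case True
    show ?thesis
    proof (cases t)
      case (Inl x)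
      then show ?thesis using True by (auto simp: uwb_glue_def uwb_twist_def)
    next
      case (Inr i)
      then have i: "1 \<le> i" "i \<le> n + r" using True by auto
      show ?thesis
      proof (cases "i \<le> n")
        case True
        then show ?thesis using Inr i s[OF i(1) True] by (auto simp: uwb_glue_def uwb_twist_def)
      next
        case False
        then show ?thesis using Inr i s'[of i] by (auto simp: uwb_glue_def uwb_twist_def)
      qed
    qed
  qed
qed

text \<open>The labels of \<open>g\<close> sit above \<open>n\<close> in the glued map. Hence a
  permutation of them becomes its conjugate under the shift by \<open>n\<close>, which fixes the
  labels up to \<open>n\<close> and has the same sign.\<close>

lemma uwb_glue_twist_left:
  assumes p: "\<tau> permutes {1..r}" and f: "f \<in> FB_hom (adjoin X n) U"
  shows "uwb_glue X n r (uwb_twist U r \<tau> g) f =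
    uwb_twist X (n + r) (map_permutation {1..r} (\<lambda>i. i + n) \<tau>) (uwb_glue X n r g f)"
proof
  fix t
  let ?m = "map_permutation {1..r} (\<lambda>i. i + n) \<tau>"
  have pm: "?m permutes (\<lambda>i. i + n) ` {1..r}"
    by (rule map_permutation_permutes[OF _ p]) (simp add: bij_betw_def)
  have s: "1 \<le> \<tau> i \<and> \<tau> i \<le> r" if "1 \<le> i" "i \<le> r" for i using permutes_in_image[OF p, of i] that by simp
  have m1: "?m i = \<tau> (i - n) + n" if "n < i" "i \<le> n + r" for i
  proof -
    have "?m ((\<lambda>i. i + n) (i - n)) = (\<lambda>i. i + n) (\<tau> (i - n))"
      by (rule map_permutation_apply) (use that in auto)
    then show ?thesis using that by simp
  qed
  have m2: "?m i = i" if "i \<le> n" for i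
    by (rule permutes_not_in[OF pm]) (use that in auto)
  have fU: "f t \<in> U" if "t \<in> adjoin X n" for t
    using f that by (auto simp: FB_hom_def dest: bij_betwE)
  show "uwb_glue X n r (uwb_twist U r \<tau> g) f t = uwb_twist X (n + r) ?m (uwb_glue X n r g f) t"
  proof (cases "t \<in> adjoin X (n + r)")
    case False
    then show ?thesis by (simp add: uwb_glue_def uwb_twist_def del: One_nat_def)
  next
    case True
    show ?thesis
    proof (cases t)
      case (Inl x)
      then have "f (Inl x) \<in> U" using True fU by auto
      then show ?thesis using Inl True by (auto simp: uwb_glue_def uwb_twist_def)
    next
      case (Inr i)
      then have i: "1 \<le> i" "i \<le> n + r" using True by auto
      show ?thesis
      proof (cases "i \<le> n")
        case True
        then have "Inr i \<in> adjoin X n" using i by auto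
        then have "f (Inr i) \<in> U" by (rule fU)
        then show ?thesis using True Inr i m2[OF True] by (auto simp: uwb_glue_def uwb_twist_def)
      next
        case False
        then have "i - n \<in> {1..r}" using i by auto
        moreover have "?m i = \<tau> (i - n) + n" using m1 False i by simp
        ultimately show ?thesis using False Inr i s[of "i - n"] by (auto simp: uwb_glue_def uwb_twist_def)
      qed
    qed
  qed
qed

lemma uwb_maps_deg_comp:
  assumes "A \<in> B_obj" "B \<in> B_obj" "C \<in> B_obj" "f \<in> uwb_maps A B" "g \<in> uwb_maps B C"
  shows "uwb_deg A C = uwb_deg A B + uwb_deg B C"
  using uwb_maps_card[OF assms(4,1,2)] uwb_maps_card[OF assms(5,2,3)] by (simp add: uwb_deg_def)

lemma uglue_maps:
  assumes "A \<in> B_obj" "B \<in> B_obj" "C \<in> B_obj" "f \<in> uwb_maps A B" "g \<in> uwb_maps B C"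
  shows "uglue A (uwb_deg A B) (uwb_deg B C) g f \<in> uwb_maps A C"
  using assms(4,5) unfolding uglue_def uwb_maps_def uwb_maps_deg_comp[OF assms]
  by (auto simp del: One_nat_def intro: uwb_glue_FB)

context
  fixes K :: "'k ring" and A B C :: "'a bob"
  assumes K: "field K" and obj: "A \<in> B_obj" "B \<in> B_obj" "C \<in> B_obj"
begin

text \<open>Gluing of representatives must respect the sign relations in both arguments. It is
  extended linearly in \<open>g\<close> for fixed \<open>f\<close>, and afterwards in
  \<open>f\<close> for an arbitrary morphism in place of \<open>g\<close>.\<close>

lemma uwb_comp_ex:
  "\<exists>\<beta>. bilin K (uwb_hom K B C) (uwb_hom K A B) (uwb_hom K A C) \<beta> \<and>
    (\<forall>g\<in>uwb_maps B C. \<forall>f\<in>uwb_maps A B. \<beta> (uwb_cls K B C g) (uwb_cls K A B f) =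
      uwb_cls K A C (uglue A (uwb_deg A B) (uwb_deg B C) g f))"
proof -
  let ?n = "uwb_deg A B" and ?r = "uwb_deg B C"
  note V = vs_uwb_hom[OF K, of B C] and U = vs_uwb_hom[OF K, of A B] and W = vs_uwb_hom[OF K, of A C]
  have sg: "perm_sgn K \<sigma> \<in> carrier K" for \<sigma> using perm_char_sgn[OF K] by (simp add: perm_char_def)
  have tl: "uwb_cls K A C (uglue A ?n ?r (uwb_twist (fst B) ?r \<tau> g, uwb_twist (snd B) ?r \<tau> g') f) =
      perm_sgn K \<tau> \<odot>\<^bsub>uwb_hom K A C\<^esub> uwb_cls K A C (uglue A ?n ?r (g, g') f)"
    if f: "f \<in> uwb_maps A B" and g: "(g, g') \<in> uwb_maps B C" and t: "\<tau> permutes {1..?r}" for \<tau> f g g'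
  proof -
    let ?m = "map_permutation {1..?r} (\<lambda>i. i + ?n) \<tau>"
    have d: "uwb_deg A C = ?n + ?r" by (rule uwb_maps_deg_comp[OF obj f g])
    have "?m permutes (\<lambda>i. i + ?n) ` {1..?r}" by (rule map_permutation_permutes[OF _ t]) (simp add: bij_betw_def)
    then have m: "?m permutes {1..uwb_deg A C}" by (rule permutes_subset) (auto simp: d)
    have ff: "fst f \<in> FB_hom (adjoin (fst A) ?n) (fst B)" "snd f \<in> FB_hom (adjoin (snd A) ?n) (snd B)"
      using f by (auto simp: uwb_maps_def)
    have "evenperm ?m = evenperm \<tau>" by (rule evenperm_map_permutation) (use t in auto)
    then have s: "perm_sgn K ?m = perm_sgn K \<tau>" by (simp add: perm_sgn_def)
    show ?thesis
      using uwb_cls_twist[OF K m, of "fst (uglue A ?n ?r (g, g') f)" "snd (uglue A ?n ?r (g, g') f)"]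
        uglue_maps[OF obj f g]
      unfolding s by (simp add: uglue_def uwb_glue_twist_left[OF t ff(1)] uwb_glue_twist_left[OF t ff(2)] d del: One_nat_def)
  qed
  have tr: "uwb_cls K A C (uglue A ?n ?r g (uwb_twist (fst A) ?n \<sigma> f, uwb_twist (snd A) ?n \<sigma> f')) =
      perm_sgn K \<sigma> \<odot>\<^bsub>uwb_hom K A C\<^esub> uwb_cls K A C (uglue A ?n ?r g (f, f'))"
    if f: "(f, f') \<in> uwb_maps A B" and g: "g \<in> uwb_maps B C" and t: "\<sigma> permutes {1..?n}" for \<sigma> f f' g
  proof -
    have d: "uwb_deg A C = ?n + ?r" by (rule uwb_maps_deg_comp[OF obj f g])
    have m: "\<sigma> permutes {1..uwb_deg A C}" using t by (rule permutes_subset) (auto simp: d)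
    show ?thesis
      using uwb_cls_twist[OF K m, of "fst (uglue A ?n ?r g (f, f'))" "snd (uglue A ?n ?r g (f, f'))"]
        uglue_maps[OF obj f g]
      by (simp add: uglue_def uwb_glue_twist_right[OF t] d del: One_nat_def)
  qed
  have "\<exists>\<phi>\<in>module_hom K (uwb_hom K B C) (uwb_hom K A C). \<forall>g\<in>uwb_maps B C.
      \<phi> (uwb_cls K B C g) = uwb_cls K A C (uglue A ?n ?r g f)" if f: "f \<in> uwb_maps A B" for f
    by (rule uwb_ext[OF K W uwb_cls_closed[OF K uglue_maps[OF obj f]]]) (use tl[OF f] in auto)
  then obtain \<phi> where \<phi>: "\<And>f. f \<in> uwb_maps A B \<Longrightarrow> \<phi> f \<in> module_hom K (uwb_hom K B C) (uwb_hom K A C)"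
    "\<And>f g. f \<in> uwb_maps A B \<Longrightarrow> g \<in> uwb_maps B C \<Longrightarrow>
      \<phi> f (uwb_cls K B C g) = uwb_cls K A C (uglue A ?n ?r g f)" by metis
  have eq1: "\<alpha> v = \<alpha>' v" if "\<alpha> \<in> module_hom K (uwb_hom K B C) (uwb_hom K A C)"
    "\<alpha>' \<in> module_hom K (uwb_hom K B C) (uwb_hom K A C)"
    "\<And>g. g \<in> uwb_maps B C \<Longrightarrow> \<alpha> (uwb_cls K B C g) = \<alpha>' (uwb_cls K B C g)" "v \<in> carrier (uwb_hom K B C)" for \<alpha> \<alpha>' v
    by (rule spanning_hom_eq[OF V W spanning_uwb_hom[OF K] that(1,2) _ that(4)]) (use that(3) in auto)
  have eq2: "\<alpha> v = \<alpha>' v" if "\<alpha> \<in> module_hom K (uwb_hom K A B) (uwb_hom K A C)"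
    "\<alpha>' \<in> module_hom K (uwb_hom K A B) (uwb_hom K A C)"
    "\<And>g. g \<in> uwb_maps A B \<Longrightarrow> \<alpha> (uwb_cls K A B g) = \<alpha>' (uwb_cls K A B g)" "v \<in> carrier (uwb_hom K A B)" for \<alpha> \<alpha>' v
    by (rule spanning_hom_eq[OF U W spanning_uwb_hom[OF K] that(1,2) _ that(4)]) (use that(3) in auto)
  have "\<exists>\<psi>\<in>module_hom K (uwb_hom K A B) (uwb_hom K A C). \<forall>f\<in>uwb_maps A B. \<psi> (uwb_cls K A B f) = \<phi> f v"
    if v: "v \<in> carrier (uwb_hom K B C)" for v
  proof (rule uwb_ext[OF K W])
    fix h assume "h \<in> uwb_maps A B" then show "\<phi> h v \<in> carrier (uwb_hom K A C)" using hom_closed[OF \<phi>(1) v] by blast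
  next
    fix \<sigma> f f' assume t: "\<sigma> permutes {1..?n}" and f: "(f, f') \<in> uwb_maps A B"
    note tf = uwb_maps_twist[OF t f]
    show "\<phi> (uwb_twist (fst A) ?n \<sigma> f, uwb_twist (snd A) ?n \<sigma> f') v = perm_sgn K \<sigma> \<odot>\<^bsub>uwb_hom K A C\<^esub> \<phi> (f, f') v"
      by (rule eq1[OF \<phi>(1)[OF tf] hom_smult_fun[OF W \<phi>(1)[OF f] sg] _ v])
        (simp add: \<phi>(2)[OF tf] \<phi>(2)[OF f] tr[OF f _ t])
  qed
  then obtain \<beta> where \<beta>: "\<And>v. v \<in> carrier (uwb_hom K B C) \<Longrightarrow> \<beta> v \<in> module_hom K (uwb_hom K A B) (uwb_hom K A C)"
    "\<And>v f. v \<in> carrier (uwb_hom K B C) \<Longrightarrow> f \<in> uwb_maps A B \<Longrightarrow> \<beta> v (uwb_cls K A B f) = \<phi> f v" by metis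
  have "bilin K (uwb_hom K B C) (uwb_hom K A B) (uwb_hom K A C) \<beta>" unfolding bilin_def
  proof (intro conjI ballI)
    fix w assume w: "w \<in> carrier (uwb_hom K A B)"
    show "(\<lambda>v. \<beta> v w) \<in> module_hom K (uwb_hom K B C) (uwb_hom K A C)"
    proof (rule homI)
      fix v assume "v \<in> carrier (uwb_hom K B C)"
      then show "\<beta> v w \<in> carrier (uwb_hom K A C)" using hom_closed[OF \<beta>(1) w] by blast
    next
      fix u v assume u: "u \<in> carrier (uwb_hom K B C)" and v: "v \<in> carrier (uwb_hom K B C)"
      note uv = vs_add[OF V u v]
      show "\<beta> (u \<oplus>\<^bsub>uwb_hom K B C\<^esub> v) w = \<beta> u w \<oplus>\<^bsub>uwb_hom K A C\<^esub> \<beta> v w"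
        by (rule eq2[OF \<beta>(1)[OF uv] hom_add_fun[OF W \<beta>(1)[OF u] \<beta>(1)[OF v]] _ w])
          (simp add: \<beta>(2) u v uv module_hom_add[OF \<phi>(1)])
    next
      fix c v assume c: "c \<in> carrier K" and v: "v \<in> carrier (uwb_hom K B C)"
      note cv = vs_smult[OF V c v]
      show "\<beta> (c \<odot>\<^bsub>uwb_hom K B C\<^esub> v) w = c \<odot>\<^bsub>uwb_hom K A C\<^esub> \<beta> v w"
        by (rule eq2[OF \<beta>(1)[OF cv] hom_smult_fun[OF W \<beta>(1)[OF v] c] _ w])
          (simp add: \<beta>(2) v cv c module_hom_smult[OF \<phi>(1)])
    qed
  qed (rule \<beta>(1))
  moreover have "\<beta> (uwb_cls K B C g) (uwb_cls K A B f) = uwb_cls K A C (uglue A ?n ?r g f)"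
    if "g \<in> uwb_maps B C" "f \<in> uwb_maps A B" for g f
    using \<beta>(2) \<phi>(2) uwb_cls_closed[OF K that(1)] that by simp
  ultimately show ?thesis by blast
qed

lemma uwb_comp_works:
  obtains \<beta> where "bilin K (uwb_hom K B C) (uwb_hom K A B) (uwb_hom K A C) \<beta>"
    "\<And>v w. v \<in> carrier (uwb_hom K B C) \<Longrightarrow> w \<in> carrier (uwb_hom K A B) \<Longrightarrow> uwb_comp K A B C v w = \<beta> v w"
    "\<And>g f. g \<in> uwb_maps B C \<Longrightarrow> f \<in> uwb_maps A B \<Longrightarrow> \<beta> (uwb_cls K B C g) (uwb_cls K A B f) =
      uwb_cls K A C (uglue A (uwb_deg A B) (uwb_deg B C) g f)"
proof -
  obtain \<beta> where b: "bilin K (uwb_hom K B C) (uwb_hom K A B) (uwb_hom K A C) \<beta>"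
    and e: "\<forall>g\<in>uwb_maps B C. \<forall>f\<in>uwb_maps A B. \<beta> (uwb_cls K B C g) (uwb_cls K A B f) =
      uwb_cls K A C (uglue A (uwb_deg A B) (uwb_deg B C) g f)" using uwb_comp_ex by blast
  let ?P = "{((uwb_cls K B C (g1, g2), uwb_cls K A B (f1, f2)),
        uwb_cls K A C (uwb_glue (fst A) (uwb_deg A B) (uwb_deg B C) g1 f1,
                       uwb_glue (snd A) (uwb_deg A B) (uwb_deg B C) g2 f2)) |g1 g2 f1 f2.
       (g1, g2) \<in> uwb_maps B C \<and> (f1, f2) \<in> uwb_maps A B}"
  have "uwb_comp K A B C v w = \<beta> v w" if "v \<in> carrier (uwb_hom K B C)" "w \<in> carrier (uwb_hom K A B)" for v w
    unfolding uwb_comp_def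
  proof (rule bilin_ext_works[OF vs_uwb_hom[OF K] vs_uwb_hom[OF K] vs_uwb_hom[OF K]
        spanning_uwb_hom[OF K] spanning_uwb_hom[OF K] _ _ b _ that])
    fix v w assume "v \<in> uwb_cls K B C ` uwb_maps B C" "w \<in> uwb_cls K A B ` uwb_maps A B"
    then obtain g f where "v = uwb_cls K B C g" "g \<in> uwb_maps B C" "w = uwb_cls K A B f" "f \<in> uwb_maps A B"
      by blast
    moreover obtain g1 g2 where "g = (g1, g2)" by (cases g)
    moreover obtain f1 f2 where "f = (f1, f2)" by (cases f)
    ultimately show "\<exists>u. ((v, w), u) \<in> ?P" by blast
  next
    fix v w u assume "((v, w), u) \<in> ?P"
    then show "v \<in> carrier (uwb_hom K B C) \<and> w \<in> carrier (uwb_hom K A B)" using uwb_cls_closed[OF K] by blast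
  next
    fix v w u assume "((v, w), u) \<in> ?P"
    then obtain g1 g2 f1 f2 where *: "(g1, g2) \<in> uwb_maps B C" "(f1, f2) \<in> uwb_maps A B"
      "v = uwb_cls K B C (g1, g2)" "w = uwb_cls K A B (f1, f2)"
      "u = uwb_cls K A C (uwb_glue (fst A) (uwb_deg A B) (uwb_deg B C) g1 f1,
                       uwb_glue (snd A) (uwb_deg A B) (uwb_deg B C) g2 f2)" by blast
    show "\<beta> v w = u" using bspec[OF bspec[OF e *(1)] *(2)] unfolding *(3-5) uglue_def fst_conv snd_conv .
  qed
  with b e that show ?thesis by blast
qed

end

subsection \<open>Module structures from contractions\<close>

lemma D_minus_simps: "Obj (D_minus K) = B_obj" "Hom (D_minus K) A B = uwb_hom K B A"
  "Ident (D_minus K) A = uwb_zero K A A (B_id A)" "Comp (D_minus K) A B C g f = uwb_comp K C B A f g"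
  by (simp_all add: D_minus_def opposite_def uwb_def)

lemma uwb_zero_maps:
  assumes "A \<in> B_obj" "h \<in> B_hom A B"
  shows "uwb_deg A B = 0"
    "(restrict (case_sum (fst h) undefined) (adjoin (fst A) 0), restrict (case_sum (snd h) undefined) (adjoin (snd A) 0))
      \<in> uwb_maps A B"
proof -
  have b: "bij_betw (fst h) (fst A) (fst B)" "bij_betw (snd h) (snd A) (snd B)"
    using assms(2) by (auto simp: B_hom_def FB_hom_def)
  show d: "uwb_deg A B = 0" using bij_betw_same_card[OF b(1)] by (simp add: uwb_deg_def)
  have "restrict (case_sum f undefined) (adjoin X 0) \<in> FB_hom (adjoin X 0) Y" if "bij_betw f X Y" for f :: "'a \<Rightarrow> 'a" and X Y
    using that by (auto simp: FB_hom_def Plus_def bij_betw_def inj_on_def image_image)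
  then show "(restrict (case_sum (fst h) undefined) (adjoin (fst A) 0), restrict (case_sum (snd h) undefined) (adjoin (snd A) 0))
      \<in> uwb_maps A B" using b by (simp add: uwb_maps_def d)
qed

lemma uwb_act_zero:
  assumes "h \<in> B_hom A B"
  shows "uwb_act F c 0 A B (restrict (case_sum (fst h) undefined) (adjoin (fst A) 0),
    restrict (case_sum (snd h) undefined) (adjoin (snd A) 0)) v = kb_act F B A (B_inv A B h) v"
proof -
  have "restrict (\<lambda>x. restrict (case_sum f undefined) (adjoin X 0) (Inl x)) X = f" if "f \<in> extensional X" for f :: "'a \<Rightarrow> 'a" and X
    using that by (auto simp: fun_eq_iff extensional_def)
  then show ?thesis using assms by (simp add: B_hom_def FB_hom_def mem_Times_iff)
qed

lemma contr_maps:
  assumes "x \<notin> X" "y \<notin> Y" "finite X" "finite Y"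
  shows "uwb_deg (X, Y) (insert x X, insert y Y) = 1"
    "(restrict (case_sum id (\<lambda>_. x)) (adjoin X 1), restrict (case_sum id (\<lambda>_. y)) (adjoin Y 1))
      \<in> uwb_maps (X, Y) (insert x X, insert y Y)"
proof -
  show d: "uwb_deg (X, Y) (insert x X, insert y Y) = 1" using assms by (simp add: uwb_deg_def)
  have "restrict (case_sum id (\<lambda>_. z)) (adjoin Z 1) \<in> FB_hom (adjoin Z 1) (insert z Z)" if "z \<notin> Z" for z :: 'a and Z
    using that by (auto simp: FB_hom_def Plus_def bij_betw_def inj_on_def image_Un image_image)
  then show "(restrict (case_sum id (\<lambda>_. x)) (adjoin X 1), restrict (case_sum id (\<lambda>_. y)) (adjoin Y 1))
      \<in> uwb_maps (X, Y) (insert x X, insert y Y)" using assms by (simp add: uwb_maps_def d)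
qed

text \<open>After one contraction the bijection left over is the identity, so the action of
  \<open>contr\<close> is the given contraction itself.\<close>

lemma uwb_act_contr:
  fixes F :: "('a, 'k, 'w) kBmod"
  assumes "kB_module K F" "x \<notin> X" "y \<notin> Y" "finite X" "finite Y" "c X Y x y v \<in> carrier (kb_sp F (X, Y))"
  shows "uwb_act F c 1 (X, Y) (insert x X, insert y Y)
    (restrict (case_sum id (\<lambda>_. x)) (adjoin X 1), restrict (case_sum id (\<lambda>_. y)) (adjoin Y 1)) v = c X Y x y v"
proof -
  have r: "restrict (\<lambda>x. restrict (case_sum id (\<lambda>_. z)) (Z <+> {Suc 0..Suc 0}) (Inl x)) Z = restrict id Z"
    for z :: 'a and Z by (rule restrict_ext) auto
  have i: "restrict (case_sum id (\<lambda>_. z)) (Z <+> {Suc 0..Suc 0}) (Inr (Suc 0)) = z" for z :: 'a and Z by auto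
  have d: "insert x X - {x} = X" "insert y Y - {y} = Y" using assms by auto
  have o: "(X, Y) \<in> B_obj" using assms by (simp add: B_obj_def)
  have "kb_act F (X, Y) (X, Y) (B_inv (X, Y) (X, Y) (B_id (X, Y))) (c X Y x y v) = c X Y x y v"
    unfolding B_inv_id by (rule kB_module.ident[OF assms(1) o assms(6)])
  then show ?thesis
    unfolding One_nat_def uwb_act.simps fst_conv snd_conv r i d B_id_def B_restrict_def .
qed

text \<open>Iterated contractions respect the sign relation by \<open>uwb_act_tw\<close>, hence
  extend linearly to all morphisms. Linearity in the vector and the composition law are then
  equations of linear maps in the morphisms, checked on classes.\<close>

lemma (in contr_sys) D_structure_ex:
  "\<exists>act. D_structure K F act \<and> (\<forall>X Y x y. \<forall>v\<in>carrier (kb_sp F (insert x X, insert y Y)).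
    finite X \<longrightarrow> finite Y \<longrightarrow> x \<notin> X \<longrightarrow> y \<notin> Y \<longrightarrow>
    act (insert x X, insert y Y) (X, Y) (contr K X Y x y) v = c X Y x y v)"
proof -
  let ?T = "\<lambda>A B. uwb_act F c (uwb_deg A B) A B"
  have sg: "perm_sgn K \<sigma> \<in> carrier K" for \<sigma> using perm_char_sgn[OF K] by (simp add: perm_char_def)
  have Th: "?T A B f \<in> module_hom K (kb_sp F B) (kb_sp F A)" if "A \<in> B_obj" "B \<in> B_obj" "f \<in> uwb_maps A B" for A B f
    by (rule uwb_act_hom[OF that(1,2) uwb_maps_ubij[OF that(3)]])
  have "\<exists>\<phi>\<in>module_hom K (uwb_hom K A B) (kb_sp F A). \<forall>f\<in>uwb_maps A B. \<phi> (uwb_cls K A B f) = ?T A B f v"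
    if o: "A \<in> B_obj" "B \<in> B_obj" and v: "v \<in> carrier (kb_sp F B)" for A B v
  proof (rule uwb_ext[OF K vsF[OF o(1)]])
    fix h assume "h \<in> uwb_maps A B" then show "?T A B h v \<in> carrier (kb_sp F A)" using hom_closed[OF Th[OF o] v] by blast
  next
    fix \<sigma> f f' assume t: "\<sigma> permutes {1..uwb_deg A B}" and f: "(f, f') \<in> uwb_maps A B"
    have "?T A B (uwb_twist (fst A) (uwb_deg A B) \<sigma> f, uwb_twist (snd A) (uwb_deg A B) \<sigma> f') v = ?T A B (tw \<sigma> (f, f')) v"
      by (rule uwb_act_cong) (simp_all add: uwb_twist_def tw_def del: One_nat_def)
    also have "\<dots> = perm_sgn K \<sigma> \<odot>\<^bsub>kb_sp F A\<^esub> ?T A B (f, f') v"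
      by (rule uwb_act_tw[OF o uwb_maps_ubij[OF f] t v])
    finally show "?T A B (uwb_twist (fst A) (uwb_deg A B) \<sigma> f, uwb_twist (snd A) (uwb_deg A B) \<sigma> f') v =
      perm_sgn K \<sigma> \<odot>\<^bsub>kb_sp F A\<^esub> ?T A B (f, f') v" .
  qed
  \<comment> \<open>The conditions on \<open>A\<close>, \<open>B\<close> and \<open>v\<close> are
    moved under the quantifier so that a single choice function of all three arguments
    results.\<close>
  then have "\<exists>\<phi>. A \<in> B_obj \<and> B \<in> B_obj \<and> v \<in> carrier (kb_sp F B) \<longrightarrow>
      \<phi> \<in> module_hom K (uwb_hom K A B) (kb_sp F A) \<and> (\<forall>f\<in>uwb_maps A B. \<phi> (uwb_cls K A B f) = ?T A B f v)" for A B v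
    by blast
  then obtain \<Phi> where \<Phi>: "\<And>A B v. A \<in> B_obj \<and> B \<in> B_obj \<and> v \<in> carrier (kb_sp F B) \<longrightarrow>
      \<Phi> A B v \<in> module_hom K (uwb_hom K A B) (kb_sp F A) \<and> (\<forall>f\<in>uwb_maps A B. \<Phi> A B v (uwb_cls K A B f) = ?T A B f v)"
    by metis
  define act where "act A B \<phi> v = \<Phi> B A v \<phi>" for A B \<phi> v
  have h1: "(\<lambda>\<phi>. act B A \<phi> v) \<in> module_hom K (uwb_hom K A B) (kb_sp F A)"
    if "A \<in> B_obj" "B \<in> B_obj" "v \<in> carrier (kb_sp F B)" for A B v
    using \<Phi>[of A B v] that unfolding act_def by simp
  have ac: "act B A (uwb_cls K A B f) v = ?T A B f v"
    if "A \<in> B_obj" "B \<in> B_obj" "v \<in> carrier (kb_sp F B)" "f \<in> uwb_maps A B" for A B f v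
    using \<Phi>[of A B v] that unfolding act_def by simp
  have eq: "\<alpha> \<phi> = \<alpha>' \<phi>" if "\<alpha> \<in> module_hom K (uwb_hom K A B) (kb_sp F D)"
    "\<alpha>' \<in> module_hom K (uwb_hom K A B) (kb_sp F D)" "D \<in> B_obj"
    "\<And>g. g \<in> uwb_maps A B \<Longrightarrow> \<alpha> (uwb_cls K A B g) = \<alpha>' (uwb_cls K A B g)" "\<phi> \<in> carrier (uwb_hom K A B)" for \<alpha> \<alpha>' A B D \<phi>
    by (rule spanning_hom_eq[OF vs_uwb_hom[OF K] vsF[OF that(3)] spanning_uwb_hom[OF K] that(1,2) _ that(5)]) (use that(4) in auto)
  have h2: "act B A \<phi> \<in> module_hom K (kb_sp F B) (kb_sp F A)"
    if o: "A \<in> B_obj" "B \<in> B_obj" and p: "\<phi> \<in> carrier (uwb_hom K A B)" for A B \<phi>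
  proof (rule homI)
    fix v assume "v \<in> carrier (kb_sp F B)"
    then show "act B A \<phi> v \<in> carrier (kb_sp F A)" using hom_closed[OF h1[OF o] p] by blast
  next
    fix u v assume u: "u \<in> carrier (kb_sp F B)" and v: "v \<in> carrier (kb_sp F B)"
    note uv = vs_add[OF vsF[OF o(2)] u v]
    show "act B A \<phi> (u \<oplus>\<^bsub>kb_sp F B\<^esub> v) = act B A \<phi> u \<oplus>\<^bsub>kb_sp F A\<^esub> act B A \<phi> v"
      by (rule eq[OF h1[OF o uv] hom_add_fun[OF vsF[OF o(1)] h1[OF o u] h1[OF o v]] o(1) _ p])
        (simp add: ac o u v uv module_hom_add[OF Th])
  next
    fix c v assume c: "c \<in> carrier K" and v: "v \<in> carrier (kb_sp F B)"
    note cv = vs_smult[OF vsF[OF o(2)] c v]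
    show "act B A \<phi> (c \<odot>\<^bsub>kb_sp F B\<^esub> v) = c \<odot>\<^bsub>kb_sp F A\<^esub> act B A \<phi> v"
      by (rule eq[OF h1[OF o cv] hom_smult_fun[OF vsF[OF o(1)] h1[OF o v] c] o(1) _ p])
        (simp add: ac o v c cv module_hom_smult[OF Th])
  qed
  have z: "act B A (uwb_zero K A B h) v = kb_act F B A (B_inv A B h) v"
    if "A \<in> B_obj" "B \<in> B_obj" "h \<in> B_hom A B" "v \<in> carrier (kb_sp F B)" for A B h v
    unfolding uwb_zero_def ac[OF that(1,2,4) uwb_zero_maps(2)[OF that(1,3)]] uwb_zero_maps(1)[OF that(1,3)]
    by (rule uwb_act_zero[OF that(3)])
  have "lin_module K (D_minus K) (kb_sp F) act"
  proof (rule lin_module.intro; unfold D_minus_simps)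
    fix A :: "'a bob" assume A: "A \<in> B_obj"
    show "vectorspace K (kb_sp F A)" by (rule vsF[OF A])
    show "act A A (uwb_zero K A A (B_id A)) v = v" if "v \<in> carrier (kb_sp F A)" for v
      unfolding z[OF A A B_id_hom that] B_inv_id by (rule kB_module.ident[OF F A that])
    fix B :: "'a bob" assume B: "B \<in> B_obj"
    show "act A B f \<in> module_hom K (kb_sp F A) (kb_sp F B)" if "f \<in> carrier (uwb_hom K B A)" for f
      by (rule h2[OF B A that])
    show "act A B (f \<oplus>\<^bsub>uwb_hom K B A\<^esub> g) v = act A B f v \<oplus>\<^bsub>kb_sp F B\<^esub> act A B g v"
      if "f \<in> carrier (uwb_hom K B A)" "g \<in> carrier (uwb_hom K B A)" "v \<in> carrier (kb_sp F A)" for f g v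
      using module_hom_add[OF h1[OF B A that(3)] that(1,2)] .
    show "act A B (c \<odot>\<^bsub>uwb_hom K B A\<^esub> f) v = c \<odot>\<^bsub>kb_sp F B\<^esub> act A B f v"
      if "f \<in> carrier (uwb_hom K B A)" "c \<in> carrier K" "v \<in> carrier (kb_sp F A)" for f c v
      using module_hom_smult[OF h1[OF B A that(3)] that(2,1)] .
    fix D :: "'a bob" and f g v
    assume D: "D \<in> B_obj" and f: "f \<in> carrier (uwb_hom K B A)" and g: "g \<in> carrier (uwb_hom K D B)"
      and v: "v \<in> carrier (kb_sp F A)"
    obtain \<beta> where b: "bilin K (uwb_hom K B A) (uwb_hom K D B) (uwb_hom K D A) \<beta>"
      "\<And>v w. v \<in> carrier (uwb_hom K B A) \<Longrightarrow> w \<in> carrier (uwb_hom K D B) \<Longrightarrow> uwb_comp K D B A v w = \<beta> v w"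
      "\<And>g f. g \<in> uwb_maps B A \<Longrightarrow> f \<in> uwb_maps D B \<Longrightarrow> \<beta> (uwb_cls K B A g) (uwb_cls K D B f) =
        uwb_cls K D A (uglue D (uwb_deg D B) (uwb_deg B A) g f)" by (rule uwb_comp_works[OF K D B A]) blast
    have b1: "\<beta> u \<in> module_hom K (uwb_hom K D B) (uwb_hom K D A)" if "u \<in> carrier (uwb_hom K B A)" for u
      using b(1) that by (simp add: bilin_def)
    have b2: "(\<lambda>u. \<beta> u w) \<in> module_hom K (uwb_hom K B A) (uwb_hom K D A)" if "w \<in> carrier (uwb_hom K D B)" for w
      using b(1) that by (simp add: bilin_def)
    have fv: "act A B u v \<in> carrier (kb_sp F B)" if "u \<in> carrier (uwb_hom K B A)" for u
      by (rule hom_closed[OF h2[OF B A that] v])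
    \<comment> \<open>The composition law for two classes. It is afterwards extended linearly in the
      morphism that acts last, and then in the one that acts before it.\<close>
    have base: "act A D (\<beta> (uwb_cls K B A s) (uwb_cls K D B t)) v = act B D (uwb_cls K D B t) (act A B (uwb_cls K B A s) v)"
      if s: "s \<in> uwb_maps B A" and t: "t \<in> uwb_maps D B" for s t
    proof -
      have "act A D (\<beta> (uwb_cls K B A s) (uwb_cls K D B t)) v =
          uwb_act F c (uwb_deg D B + uwb_deg B A) D A (uglue D (uwb_deg D B) (uwb_deg B A) s t) v"
        unfolding b(3)[OF s t] ac[OF D A v uglue_maps[OF D B A t s]] uwb_maps_deg_comp[OF D B A t s] ..
      also have "\<dots> = ?T D B t (?T B A s v)"
        unfolding uglue_def by (rule uwb_act_glue[OF D B A uwb_maps_ubij[OF t] uwb_maps_ubij[OF s] v])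
      finally show ?thesis
        using ac[OF B A v s] ac[OF D B _ t] fv[OF uwb_cls_closed[OF K s]] by simp
    qed
    have step: "act A D (\<beta> (uwb_cls K B A s) g) v = act B D g (act A B (uwb_cls K B A s) v)"
      if s: "s \<in> uwb_maps B A" for s
      by (rule eq[OF hom_comp[OF b1[OF uwb_cls_closed[OF K s]] h1[OF D A v]]
            h1[OF D B fv[OF uwb_cls_closed[OF K s]]] D base[OF s] g])
    have "act A D (\<beta> f g) v = act B D g (act A B f v)"
      by (rule eq[OF hom_comp[OF b2[OF g] h1[OF D A v]] hom_comp[OF h1[OF B A v] h2[OF D B g]] D step f])
    then show "act A D (uwb_comp K D B A f g) v = act B D g (act A B f v)"
      using b(2)[OF f g] by simp
  qed
  then have "D_structure K F act" unfolding D_structure_def using F z by blast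
  moreover have "act (insert x X, insert y Y) (X, Y) (contr K X Y x y) v = c X Y x y v"
    if "v \<in> carrier (kb_sp F (insert x X, insert y Y))" "finite X" "finite Y" "x \<notin> X" "y \<notin> Y" for X Y x y v
  proof -
    have o: "(X, Y) \<in> B_obj" "(insert x X, insert y Y) \<in> B_obj" using that by (auto simp: B_obj_def)
    note m = contr_maps[OF that(4,5,2,3)]
    show ?thesis unfolding contr_def ac[OF o that(1) m(2)] m(1)
      by (rule uwb_act_contr[OF F that(4,5,2,3)]) (rule hom_closed[OF c_hom[OF that(2-5)] that(1)])
  qed
  ultimately show ?thesis by blast
qed

text \<open>The precise form of generation: whatever the structure, a class acts by iterating the
  contractions of that very structure. A pair of positive degree factors through the contraction of
  its last label, and a pair of degree zero comes from bijections.\<close>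

lemma D_structure_cls:
  fixes K :: "'k ring" and F :: "('a, 'k, 'w) kBmod"
  assumes K: "field K" and act: "D_structure K F act"
    and o: "A \<in> B_obj" "B \<in> B_obj" and f: "f \<in> uwb_maps A B" and v: "v \<in> carrier (kb_sp F B)"
  shows "act B A (uwb_cls K A B f) v =
    uwb_act F (\<lambda>X Y x y. act (insert x X, insert y Y) (X, Y) (contr K X Y x y)) (uwb_deg A B) A B f v"
proof -
  let ?c = "\<lambda>X Y x y. act (insert x X, insert y Y) (X, Y) (contr K X Y x y)"
  have F: "kB_module K F" and L: "lin_module K (D_minus K) (kb_sp F) act"
    and z: "\<And>A B h v. A \<in> B_obj \<Longrightarrow> B \<in> B_obj \<Longrightarrow> h \<in> B_hom A B \<Longrightarrow> v \<in> carrier (kb_sp F B) \<Longrightarrow>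
      act B A (uwb_zero K A B h) v = kb_act F B A (B_inv A B h) v"
    using act unfolding D_structure_def by blast+
  have "act B A (uwb_cls K A B f) v = uwb_act F ?c n A B f v" if "uwb_deg A B = n" for n
    using o(2) f v that
  proof (induction n arbitrary: B f v)
    case 0
    let ?h = "(restrict (\<lambda>x. fst f (Inl x)) (fst A), restrict (\<lambda>y. snd f (Inl y)) (snd A))"
    have u: "ubij 0 A B f" using uwb_maps_ubij[OF 0(2)] 0(4) by simp
    note h = ubij_base[OF u]
    have e: "restrict (case_sum (restrict (\<lambda>x. g (Inl x)) X) undefined) (adjoin X 0) = g"
      if "g \<in> extensional (adjoin X 0)" for g :: "'a + nat \<Rightarrow> 'a" and X
      using that by (intro extensionalityI[where A = "adjoin X 0"]) (auto simp del: One_nat_def)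
    have "f = (restrict (case_sum (fst ?h) undefined) (adjoin (fst A) 0), restrict (case_sum (snd ?h) undefined) (adjoin (snd A) 0))"
      using 0(2) e[of "fst f" "fst A"] e[of "snd f" "snd A"]
      unfolding uwb_maps_def 0(4) FB_hom_def by (simp add: mem_Times_iff prod_eq_iff)
    then have "uwb_cls K A B f = uwb_zero K A B ?h" unfolding uwb_zero_def by simp
    then have "act B A (uwb_cls K A B f) v = kb_act F B A (B_inv A B ?h) v"
      using z[OF o(1) 0(1) h 0(3)] by simp
    then show ?case unfolding uwb_act.simps .
  next
    case (Suc n)
    note B = Suc.prems(1) and f = Suc.prems(2) and v = Suc.prems(3) and d = Suc.prems(4)
    define x y where xy: "x = fst f (Inr (Suc n))" "y = snd f (Inr (Suc n))"
    define X Y where XY: "X = fst B - {x}" "Y = snd B - {y}"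
    have u: "ubij (Suc n) A B f" using uwb_maps_ubij[OF f] d by simp
    note us = ubij_Suc[OF u, folded xy]
    have fin: "finite X" "finite Y" using B by (auto simp: XY B_obj_def split_beta)
    have nin: "x \<notin> X" "y \<notin> Y" by (auto simp: XY)
    have Beq: "B = (insert x X, insert y Y)" using us by (auto simp: XY prod_eq_iff)
    have B'o: "(X, Y) \<in> B_obj" using fin by (simp add: B_obj_def)
    define f' where "f' = (restrict (fst f) (adjoin (fst A) n), restrict (snd f) (adjoin (snd A) n))"
    have d': "uwb_deg A (X, Y) = n"
      using d us(1) by (simp add: uwb_deg_def XY)
    have fm: "f' \<in> uwb_maps A (X, Y)"
      using us(3)[folded XY] unfolding uwb_maps_def d' f'_def ubij_def FB_hom_def fst_conv snd_conv
      by (simp add: bij_betw_restrict_eq del: One_nat_def)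
    note cm = contr_maps[OF nin fin, folded Beq]
    let ?g = "(restrict (case_sum id (\<lambda>_. x)) (adjoin X 1), restrict (case_sum id (\<lambda>_. y)) (adjoin Y 1))"
    \<comment> \<open>Restricting \<open>h\<close> to the labels up to \<open>n\<close> and gluing
      on a single contraction at the value of the last label gives back \<open>h\<close>;
      extensionality of \<open>h\<close> is needed for equality of functions.\<close>
    have gl: "uwb_glue Z n 1 (restrict (case_sum id (\<lambda>_. h (Inr (Suc n)))) (adjoin U 1)) (restrict h (adjoin Z n)) = h"
      if "h \<in> extensional (adjoin Z (Suc n))" "bij_betw h (adjoin Z n) U" for h :: "'a + nat \<Rightarrow> 'a" and Z U
    proof (rule extensionalityI[where A = "adjoin Z (Suc n)"])
      fix t assume t: "t \<in> adjoin Z (Suc n)"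
      have hU: "h s \<in> U" if "s \<in> adjoin Z n" for s using \<open>bij_betw h (adjoin Z n) U\<close> that by (auto dest: bij_betwE)
      show "uwb_glue Z n 1 (restrict (case_sum id (\<lambda>_. h (Inr (Suc n)))) (adjoin U 1)) (restrict h (adjoin Z n)) t = h t"
      proof (cases "t \<in> adjoin Z n")
        case True
        then show ?thesis using hU[OF True] by (auto simp: uwb_glue_def elim!: PlusE)
      next
        case False
        then have "t = Inr (Suc n)" using t by (auto simp: adjoin_Suc)
        then show ?thesis by (auto simp: uwb_glue_def)
      qed
    qed (use that(1) in \<open>auto simp: uwb_glue_def\<close>)
    have fe: "fst f \<in> extensional (adjoin (fst A) (Suc n))" "snd f \<in> extensional (adjoin (snd A) (Suc n))"
      using f by (auto simp: uwb_maps_def FB_hom_def d)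
    have glf: "uglue A n 1 ?g f' = f"
      unfolding uglue_def f'_def xy
      using gl[OF fe(1), of X] gl[OF fe(2), of Y] us(3) by (simp add: ubij_def XY xy prod_eq_iff del: One_nat_def)
    obtain \<beta> where b: "bilin K (uwb_hom K (X, Y) B) (uwb_hom K A (X, Y)) (uwb_hom K A B) \<beta>"
      "\<And>v w. v \<in> carrier (uwb_hom K (X, Y) B) \<Longrightarrow> w \<in> carrier (uwb_hom K A (X, Y)) \<Longrightarrow> uwb_comp K A (X, Y) B v w = \<beta> v w"
      "\<And>g f. g \<in> uwb_maps (X, Y) B \<Longrightarrow> f \<in> uwb_maps A (X, Y) \<Longrightarrow> \<beta> (uwb_cls K (X, Y) B g) (uwb_cls K A (X, Y) f) =
        uwb_cls K A B (uglue A (uwb_deg A (X, Y)) (uwb_deg (X, Y) B) g f)" by (rule uwb_comp_works[OF K o(1) B'o B]) blast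
    note cc = uwb_cls_closed[OF K cm(2)] and cf = uwb_cls_closed[OF K fm]
    have "uwb_cls K A B f = uwb_comp K A (X, Y) B (contr K X Y x y) (uwb_cls K A (X, Y) f')"
      using b(2)[OF cc cf] b(3)[OF cm(2) fm] glf unfolding contr_def Beq[symmetric] d' cm(1) by simp
    then have "act B A (uwb_cls K A B f) v = act (X, Y) A (uwb_cls K A (X, Y) f') (act B (X, Y) (contr K X Y x y) v)"
      using lin_module.comp[OF L, unfolded D_minus_simps, OF B B'o o(1) cc cf v]
      unfolding contr_def Beq[symmetric] by simp
    also have "\<dots> = uwb_act F ?c n A (X, Y) f' (act B (X, Y) (contr K X Y x y) v)"
    proof (rule Suc.IH[OF B'o fm _ d'])
      show "act B (X, Y) (contr K X Y x y) v \<in> carrier (kb_sp F (X, Y))"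
        unfolding contr_def Beq[symmetric]
        by (rule hom_closed[OF lin_module.hom[OF L, unfolded D_minus_simps, OF B B'o cc] v])
    qed
    also have "\<dots> = uwb_act F ?c n A (X, Y) f (act B (X, Y) (contr K X Y x y) v)"
      by (rule uwb_act_cong) (simp_all add: f'_def del: One_nat_def)
    also have "\<dots> = uwb_act F ?c (Suc n) A B f v"
      unfolding uwb_act.simps xy[symmetric] XY[symmetric] Beq[symmetric] ..
    finally show ?case .
  qed
  then show ?thesis by simp
qed

text \<open>For a fixed vector both sides are linear in the morphism, which reduces the claim to
  classes. There \<open>D_structure_cls\<close> rewrites both actions as iterated contractions, and
  \<open>\<eta>\<close> passes through these one at a time.\<close>

lemma D_structure_hom:
  fixes K :: "'k ring" and F :: "('a, 'k, 'w) kBmod" and G :: "('a, 'k, 'u) kBmod"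
  assumes K: "field K" and act: "D_structure K F act" and act': "D_structure K G act'"
    and \<eta>: "\<And>A. A \<in> B_obj \<Longrightarrow> \<eta> A \<in> module_hom K (kb_sp F A) (kb_sp G A)"
    and \<eta>B: "\<And>A B h v. A \<in> B_obj \<Longrightarrow> B \<in> B_obj \<Longrightarrow> h \<in> B_hom A B \<Longrightarrow> v \<in> carrier (kb_sp F A) \<Longrightarrow>
      \<eta> B (kb_act F A B h v) = kb_act G A B h (\<eta> A v)"
    and c: "\<And>X Y x y v. finite X \<Longrightarrow> finite Y \<Longrightarrow> x \<notin> X \<Longrightarrow> y \<notin> Y \<Longrightarrow>
      v \<in> carrier (kb_sp F (insert x X, insert y Y)) \<Longrightarrow>
      \<eta> (X, Y) (act (insert x X, insert y Y) (X, Y) (contr K X Y x y) v) =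
      act' (insert x X, insert y Y) (X, Y) (contr K X Y x y) (\<eta> (insert x X, insert y Y) v)"
  shows "lin_module_hom K (D_minus K) (kb_sp F) act (kb_sp G) act' \<eta>"
proof -
  let ?c = "\<lambda>X Y x y. act (insert x X, insert y Y) (X, Y) (contr K X Y x y)"
  let ?c' = "\<lambda>X Y x y. act' (insert x X, insert y Y) (X, Y) (contr K X Y x y)"
  have F: "kB_module K F" and L: "lin_module K (D_minus K) (kb_sp F) act"
    and G: "kB_module K G" and L': "lin_module K (D_minus K) (kb_sp G) act'"
    using act act' unfolding D_structure_def by blast+
  have base: "\<eta> A (uwb_act F ?c n A B f v) = uwb_act G ?c' n A B f (\<eta> B v)"
    if "A \<in> B_obj" "B \<in> B_obj" "ubij n A B f" "v \<in> carrier (kb_sp F B)" for A B f v n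
    using that(2-)
  proof (induction n arbitrary: B v)
    case 0
    then show ?case unfolding uwb_act.simps
      by (intro \<eta>B that(1) B_inv_hom ubij_base)
  next
    case (Suc n)
    define x y where xy: "x = fst f (Inr (Suc n))" "y = snd f (Inr (Suc n))"
    define X Y where XY: "X = fst B - {x}" "Y = snd B - {y}"
    note us = ubij_Suc[OF Suc.prems(2), folded xy]
    have fin: "finite X" "finite Y" using Suc.prems(1) by (auto simp: XY B_obj_def split_beta)
    have nin: "x \<notin> X" "y \<notin> Y" by (auto simp: XY)
    have Beq: "B = (insert x X, insert y Y)" using us by (auto simp: XY prod_eq_iff)
    have o: "(X, Y) \<in> B_obj" using fin by (simp add: B_obj_def)
    have cc: "contr K X Y x y \<in> carrier (uwb_hom K (X, Y) B)"
      unfolding contr_def Beq by (rule uwb_cls_closed[OF K contr_maps(2)[OF nin fin]])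
    have cl: "act B (X, Y) (contr K X Y x y) v \<in> carrier (kb_sp F (X, Y))"
      by (rule hom_closed[OF lin_module.hom[OF L, unfolded D_minus_simps, OF Suc.prems(1) o cc] Suc.prems(3)])
    have "\<eta> A (uwb_act F ?c (Suc n) A B f v) = \<eta> A (uwb_act F ?c n A (X, Y) f (act B (X, Y) (contr K X Y x y) v))"
      unfolding uwb_act.simps xy[symmetric] XY[symmetric] Beq[symmetric] ..
    also have "\<dots> = uwb_act G ?c' n A (X, Y) f (\<eta> (X, Y) (act B (X, Y) (contr K X Y x y) v))"
      by (rule Suc.IH[OF o us(3)[folded XY] cl])
    also have "\<eta> (X, Y) (act B (X, Y) (contr K X Y x y) v) = act' B (X, Y) (contr K X Y x y) (\<eta> B v)"
      using c[OF fin nin, of v] Suc.prems(3) by (simp add: Beq)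
    also have "uwb_act G ?c' n A (X, Y) f (act' B (X, Y) (contr K X Y x y) (\<eta> B v)) =
        uwb_act G ?c' (Suc n) A B f (\<eta> B v)"
      unfolding uwb_act.simps xy[symmetric] XY[symmetric] Beq[symmetric] ..
    finally show ?case .
  qed
  show ?thesis unfolding lin_module_hom_def D_minus_simps
  proof (intro conjI ballI)
    fix A B :: "'a bob" and \<phi> v assume A: "A \<in> B_obj" and B: "B \<in> B_obj"
      and p: "\<phi> \<in> carrier (uwb_hom K B A)" and v: "v \<in> carrier (kb_sp F A)"
    have h: "(\<lambda>\<phi>. act A B \<phi> v) \<in> module_hom K (uwb_hom K B A) (kb_sp F B)"
      using lin_module.hom[OF L, unfolded D_minus_simps, OF A B] v
        lin_module.add[OF L, unfolded D_minus_simps, OF A B] lin_module.smult[OF L, unfolded D_minus_simps, OF A B]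
      by (intro homI) (blast intro: hom_closed)+
    have h': "(\<lambda>\<phi>. act' A B \<phi> (\<eta> A v)) \<in> module_hom K (uwb_hom K B A) (kb_sp G B)"
      using lin_module.hom[OF L', unfolded D_minus_simps, OF A B] hom_closed[OF \<eta>[OF A] v]
        lin_module.add[OF L', unfolded D_minus_simps, OF A B] lin_module.smult[OF L', unfolded D_minus_simps, OF A B]
      by (intro homI) (blast intro: hom_closed)+
    show "\<eta> B (act A B \<phi> v) = act' A B \<phi> (\<eta> A v)"
    proof (rule spanning_hom_eq[OF vs_uwb_hom[OF K] kB_module.space[OF G B] spanning_uwb_hom[OF K]
          hom_comp[OF h \<eta>[OF B]] h' _ p])
      fix x assume "x \<in> uwb_cls K B A ` uwb_maps B A"
      then obtain f where f: "f \<in> uwb_maps B A" "x = uwb_cls K B A f" by blast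
      show "\<eta> B (act A B x v) = act' A B x (\<eta> A v)"
        unfolding f(2) D_structure_cls[OF K act B A f(1) v]
          D_structure_cls[OF K act' B A f(1) hom_closed[OF \<eta>[OF A] v]]
        by (rule base[OF B A uwb_maps_ubij[OF f(1)] v])
    qed
  qed (rule \<eta>)
qed

text \<open>Two structures agree exactly when the identity is a morphism between them, so this is an
  instance of \<open>D_structure_hom\<close>.\<close>

lemma D_structure_unique:
  assumes K: "field K" and act: "D_structure K F act" and act': "D_structure K F act'"
    and c: "\<And>X Y x y v. finite X \<Longrightarrow> finite Y \<Longrightarrow> x \<notin> X \<Longrightarrow> y \<notin> Y \<Longrightarrow>
      v \<in> carrier (kb_sp F (insert x X, insert y Y)) \<Longrightarrow>
      act (insert x X, insert y Y) (X, Y) (contr K X Y x y) v = act' (insert x X, insert y Y) (X, Y) (contr K X Y x y) v"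
  shows "same_action (D_minus K) (kb_sp F) act act'"
proof -
  have "lin_module_hom K (D_minus K) (kb_sp F) act (kb_sp F) act' (\<lambda>_ v. v)"
    by (rule D_structure_hom[OF K act act' hom_ident]) (simp_all add: c)
  then show ?thesis unfolding lin_module_hom_def same_action_def by blast
qed

section \<open>Operads\<close>

lemma vs_zero_space: assumes "field K" shows "vectorspace K (zero_space z)"
proof -
  interpret field K by fact
  have "module K (zero_space z)"
    by (rule module_criteria) (auto simp: zero_space_def is_cring)
  then show ?thesis by (simp add: vectorspace_def assms)
qed

lemma pointed_simps:
  "pointed X - {None} = Some ` X" "Some ` X \<union> pointed Y = pointed (X \<union> Y)"
  "(pointed X - {Some x}) \<union> Some ` Z = pointed ((X - {x}) \<union> Z)"
  "(Some ` X - {Some x}) \<union> Some ` Z = Some ` ((X - {x}) \<union> Z)"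
  by auto

abbreviation olift :: "('a \<Rightarrow> 'a) \<Rightarrow> 'a option set \<Rightarrow> 'a option \<Rightarrow> 'a option" where
  "olift f S \<equiv> restrict (map_option f) S"

lemma olift_FB:
  assumes "inj_on f X"
  shows "olift f (Some ` X) \<in> FB_hom (Some ` X) (Some ` f ` X)" "olift f (pointed X) \<in> FB_hom (pointed X) (pointed (f ` X))"
  using assms by (auto simp: FB_hom_def bij_betw_def inj_on_def image_image)

lemma olift_comp:
  assumes "f ` X \<subseteq> U"
  shows "compose (Some ` X) (olift g (Some ` U)) (olift f (Some ` X)) = olift (\<lambda>x. g (f x)) (Some ` X)"
    "compose (pointed X) (olift g (pointed U)) (olift f (pointed X)) = olift (\<lambda>x. g (f x)) (pointed X)"
  using assms unfolding compose_def by (auto intro!: restrict_ext)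

lemma olift_cong:
  assumes "\<And>x. x \<in> X \<Longrightarrow> f x = g x"
  shows "olift f (Some ` X) = olift g (Some ` X)" "olift f (pointed X) = olift g (pointed X)"
  using assms by (auto intro!: restrict_ext)

text \<open>The relabelling behind \<open>delta_mark\<close>: the input \<open>x\<close> becomes the
  distinguished point \<open>None\<close> and all other labels stay.\<close>

definition omark :: "'a \<Rightarrow> 'a set \<Rightarrow> 'a option \<Rightarrow> 'a option" where
  "omark x Z = restrict (\<lambda>t. if t = Some x then None else t) (Some ` Z)"

lemma omark_FB: "x \<in> Z \<Longrightarrow> omark x Z \<in> FB_hom (Some ` Z) (pointed (Z - {x}))"
  by (auto simp: omark_def FB_hom_def bij_betw_def inj_on_def image_iff split: if_splits)

section \<open>Composition in an operad at ordinary and at distinguished inputs\<close>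

locale op_ctx =
  fixes K :: "'k ring" and P :: "('a option, 'k, 'v) operad"
  assumes K: "field K" and P: "nonunital_operad K P"
begin

abbreviation "OP S \<equiv> op_sp P (Some ` S)"
abbreviation "OPp S \<equiv> op_sp P (pointed S)"

lemma vs_OP: "finite S \<Longrightarrow> vectorspace K (OP S)" "finite S \<Longrightarrow> vectorspace K (OPp S)"
  using nonunital_operad.space[OF P] by auto

definition oc :: "'a set \<Rightarrow> 'a \<Rightarrow> 'a set \<Rightarrow> 'v \<Rightarrow> 'v \<Rightarrow> 'v" where
  "oc S x Z a b = op_comp P (Some ` S) (Some x) (Some ` Z) a b"

definition dc :: "'a set \<Rightarrow> 'a \<Rightarrow> 'a set \<Rightarrow> 'v \<Rightarrow> 'v \<Rightarrow> 'v" where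
  "dc S x Z a b = op_comp P (pointed S) (Some x) (Some ` Z) a b"

text \<open>The composite occurring in the relations of \<open>delta\<close>. The distinguished
  point of \<open>a\<close> is consumed, and that of \<open>b\<close> becomes the distinguished
  point of the result.\<close>

definition nc :: "'a set \<Rightarrow> 'a set \<Rightarrow> 'v \<Rightarrow> 'v \<Rightarrow> 'v" where
  "nc X Y a b = op_comp P (pointed X) None (pointed Y) a b"

definition okc :: "'a set \<Rightarrow> 'a \<Rightarrow> 'a set \<Rightarrow> bool" where
  "okc S x Z \<longleftrightarrow> finite S \<and> finite Z \<and> x \<in> S \<and> (S - {x}) \<inter> Z = {}"

lemma composable_oc:
  "okc S x Z \<Longrightarrow> composable (Some ` S) (Some x) (Some ` Z)"
  "okc S x Z \<Longrightarrow> composable (pointed S) (Some x) (Some ` Z)"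
  "finite X \<Longrightarrow> finite Y \<Longrightarrow> X \<inter> Y = {} \<Longrightarrow> composable (pointed X) None (pointed Y)"
  by (auto simp: composable_def okc_def)

lemma oc_homs:
  assumes "okc S x Z"
  shows "a \<in> carrier (OP S) \<Longrightarrow> oc S x Z a \<in> module_hom K (OP Z) (OP ((S - {x}) \<union> Z))"
    "b \<in> carrier (OP Z) \<Longrightarrow> (\<lambda>a. oc S x Z a b) \<in> module_hom K (OP S) (OP ((S - {x}) \<union> Z))"
  using nonunital_operad.comp_right[OF P composable_oc(1)[OF assms]]
    nonunital_operad.comp_left[OF P composable_oc(1)[OF assms]]
  unfolding oc_def pointed_simps by auto

lemma dc_homs:
  assumes "okc S x Z"
  shows "a \<in> carrier (OPp S) \<Longrightarrow> dc S x Z a \<in> module_hom K (OP Z) (OPp ((S - {x}) \<union> Z))"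
    "b \<in> carrier (OP Z) \<Longrightarrow> (\<lambda>a. dc S x Z a b) \<in> module_hom K (OPp S) (OPp ((S - {x}) \<union> Z))"
  using nonunital_operad.comp_right[OF P composable_oc(2)[OF assms]]
    nonunital_operad.comp_left[OF P composable_oc(2)[OF assms]]
  unfolding dc_def pointed_simps by auto

lemma nc_closed:
  assumes "finite X" "finite Y" "X \<inter> Y = {}" "a \<in> carrier (OPp X)" "b \<in> carrier (OPp Y)"
  shows "nc X Y a b \<in> carrier (OPp (X \<union> Y))"
  using hom_closed[OF nonunital_operad.comp_right[OF P composable_oc(3)[OF assms(1-3)] assms(4)] assms(5)]
  unfolding nc_def pointed_simps .

lemma oc_closed: "okc S x Z \<Longrightarrow> a \<in> carrier (OP S) \<Longrightarrow> b \<in> carrier (OP Z) \<Longrightarrow> oc S x Z a b \<in> carrier (OP ((S - {x}) \<union> Z))"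
  by (rule hom_closed[OF oc_homs(1)])

lemma dc_closed: "okc S x Z \<Longrightarrow> a \<in> carrier (OPp S) \<Longrightarrow> b \<in> carrier (OP Z) \<Longrightarrow> dc S x Z a b \<in> carrier (OPp ((S - {x}) \<union> Z))"
  by (rule hom_closed[OF dc_homs(1)])

lemma oc_seq:
  assumes "okc S x Z" "y \<in> Z" "okc ((S - {x}) \<union> Z) y W"
    "a \<in> carrier (OP S)" "b \<in> carrier (OP Z)" "c \<in> carrier (OP W)"
  shows "oc ((S - {x}) \<union> Z) y W (oc S x Z a b) c = oc S x ((Z - {y}) \<union> W) a (oc Z y W b c)"
  using nonunital_operad.assoc_sequential[OF P composable_oc(1)[OF assms(1)], of "Some y" "Some ` W" a b c]
    assms composable_oc(1)[OF assms(3)]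
  unfolding oc_def pointed_simps by auto

lemma oc_par:
  assumes "x \<noteq> y" "okc S x Z" "okc S y W" "Z \<inter> W = {}"
    "a \<in> carrier (OP S)" "b \<in> carrier (OP Z)" "c \<in> carrier (OP W)"
  shows "oc ((S - {x}) \<union> Z) y W (oc S x Z a b) c = oc ((S - {y}) \<union> W) x Z (oc S y W a c) b"
  using nonunital_operad.assoc_parallel[OF P _ composable_oc(1)[OF assms(2)] composable_oc(1)[OF assms(3)], of a b c]
    assms unfolding oc_def pointed_simps by auto

lemma dc_seq:
  assumes "okc S x Z" "y \<in> Z" "okc ((S - {x}) \<union> Z) y W"
    "a \<in> carrier (OPp S)" "b \<in> carrier (OP Z)" "c \<in> carrier (OP W)"
  shows "dc ((S - {x}) \<union> Z) y W (dc S x Z a b) c = dc S x ((Z - {y}) \<union> W) a (oc Z y W b c)"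
  using nonunital_operad.assoc_sequential[OF P composable_oc(2)[OF assms(1)], of "Some y" "Some ` W" a b c]
    assms composable_oc(2)[OF assms(3)]
  unfolding oc_def dc_def pointed_simps by auto

lemma dc_par:
  assumes "x \<noteq> y" "okc S x Z" "okc S y W" "Z \<inter> W = {}"
    "a \<in> carrier (OPp S)" "b \<in> carrier (OP Z)" "c \<in> carrier (OP W)"
  shows "dc ((S - {x}) \<union> Z) y W (dc S x Z a b) c = dc ((S - {y}) \<union> W) x Z (dc S y W a c) b"
  using nonunital_operad.assoc_parallel[OF P _ composable_oc(2)[OF assms(2)] composable_oc(2)[OF assms(3)], of a b c]
    assms unfolding dc_def pointed_simps by auto

lemma nc_dc_left:
  assumes "finite X" "finite Y" "X \<inter> Y = {}" "okc X x Z" "Y \<inter> Z = {}"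
    "a \<in> carrier (OPp X)" "b \<in> carrier (OPp Y)" "c \<in> carrier (OP Z)"
  shows "dc (X \<union> Y) x Z (nc X Y a b) c = nc ((X - {x}) \<union> Z) Y (dc X x Z a c) b"
  using nonunital_operad.assoc_parallel[OF P _ composable_oc(3)[OF assms(1-3)] composable_oc(2)[OF assms(4)], of a b c]
    assms unfolding dc_def nc_def pointed_simps by auto

text \<open>Here \<open>x\<close> is an input of the inserted operation \<open>b\<close>, so
  sequential associativity applies; in \<open>nc_dc_left\<close> it is another input of
  \<open>a\<close>, which is the parallel case. The two sides of a relation in \<open>delta\<close>
  need one case each.\<close>

lemma nc_dc_right:
  assumes "finite X" "finite Y" "X \<inter> Y = {}" "okc Y x Z" "X \<inter> Z = {}"
    "a \<in> carrier (OPp X)" "b \<in> carrier (OPp Y)" "c \<in> carrier (OP Z)"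
  shows "dc (X \<union> Y) x Z (nc X Y a b) c = nc X ((Y - {x}) \<union> Z) a (dc Y x Z b c)"
proof -
  have "okc (X \<union> Y) x Z" using assms by (auto simp: okc_def)
  then show ?thesis
    using nonunital_operad.assoc_sequential[OF P composable_oc(3)[OF assms(1-3)], of "Some x" "Some ` Z" a b c]
      composable_oc(2)[of "X \<union> Y" x Z] assms unfolding dc_def nc_def pointed_simps by (auto simp: okc_def)
qed

subsection \<open>The operad as a \<open>kB\<close>-module\<close>

definition ract :: "('a \<Rightarrow> 'a) \<Rightarrow> 'a set \<Rightarrow> 'v \<Rightarrow> 'v" where
  "ract f S a = op_act P (Some ` S) (Some ` f ` S) (olift f (Some ` S)) a"

definition pact :: "('a \<Rightarrow> 'a) \<Rightarrow> 'a set \<Rightarrow> 'v \<Rightarrow> 'v" where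
  "pact f S a = op_act P (pointed S) (pointed (f ` S)) (olift f (pointed S)) a"

lemma ract_hom: "finite S \<Longrightarrow> inj_on f S \<Longrightarrow> ract f S \<in> module_hom K (OP S) (OP (f ` S))"
  using nonunital_operad.hom[OF P _ _ olift_FB(1), of S f] unfolding ract_def[abs_def] by auto

lemma pact_hom: "finite S \<Longrightarrow> inj_on f S \<Longrightarrow> pact f S \<in> module_hom K (OPp S) (OPp (f ` S))"
  using nonunital_operad.hom[OF P _ _ olift_FB(2), of S f] unfolding pact_def[abs_def] by auto

lemma ract_id: "finite S \<Longrightarrow> a \<in> carrier (OP S) \<Longrightarrow> (\<And>x. x \<in> S \<Longrightarrow> f x = x) \<Longrightarrow> ract f S a = a"
proof -
  assume *: "finite S" "a \<in> carrier (OP S)" "\<And>x. x \<in> S \<Longrightarrow> f x = x"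
  have "olift f (Some ` S) = restrict id (Some ` S)" "f ` S = S" using *(3) by (auto intro!: restrict_ext)
  then show ?thesis using nonunital_operad.ident[OF P, of "Some ` S" a] * by (simp add: ract_def)
qed

lemma pact_id: "finite S \<Longrightarrow> a \<in> carrier (OPp S) \<Longrightarrow> (\<And>x. x \<in> S \<Longrightarrow> f x = x) \<Longrightarrow> pact f S a = a"
proof -
  assume *: "finite S" "a \<in> carrier (OPp S)" "\<And>x. x \<in> S \<Longrightarrow> f x = x"
  have "olift f (pointed S) = restrict id (pointed S)" "f ` S = S" using *(3) by (auto intro!: restrict_ext)
  then show ?thesis using nonunital_operad.ident[OF P, of "pointed S" a] * by (simp add: pact_def)
qed

lemma ract_comp:
  assumes "finite S" "inj_on f S" "inj_on g (f ` S)" "a \<in> carrier (OP S)"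
  shows "ract g (f ` S) (ract f S a) = ract (\<lambda>x. g (f x)) S a"
  using nonunital_operad.functorial[OF P _ _ _ olift_FB(1)[OF assms(2)] olift_FB(1)[OF assms(3)] assms(4),
      unfolded olift_comp(1)[OF subset_refl]] assms(1)
  by (simp add: ract_def image_image)

lemma pact_comp:
  assumes "finite S" "inj_on f S" "inj_on g (f ` S)" "a \<in> carrier (OPp S)"
  shows "pact g (f ` S) (pact f S a) = pact (\<lambda>x. g (f x)) S a"
  using nonunital_operad.functorial[OF P _ _ _ olift_FB(2)[OF assms(2)] olift_FB(2)[OF assms(3)] assms(4),
      unfolded olift_comp(2)[OF subset_refl]] assms(1)
  by (simp add: pact_def image_image)

lemma ract_cong: "(\<And>x. x \<in> S \<Longrightarrow> f x = g x) \<Longrightarrow> ract f S a = ract g S a"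
  using olift_cong(1)[of S f g] image_cong[of S S f g] unfolding ract_def by simp

lemma pact_cong: "(\<And>x. x \<in> S \<Longrightarrow> f x = g x) \<Longrightarrow> pact f S a = pact g S a"
  using olift_cong(2)[of S f g] image_cong[of S S f g] unfolding pact_def by simp

lemma okc_image:
  assumes "okc S x Z" "inj_on f (S \<union> Z)" "x \<notin> Z"
  shows "okc (f ` S) (f x) (f ` Z)" "(f ` S - {f x}) \<union> f ` Z = f ` ((S - {x}) \<union> Z)"
proof -
  have "f ` (S - {x}) = f ` S - {f x}"
    using inj_on_image_set_diff[of f "S \<union> Z" S "{x}"] assms(1,2) by (auto simp: okc_def)
  moreover have "f ` (S - {x}) \<inter> f ` Z = f ` ((S - {x}) \<inter> Z)"
    by (rule inj_on_image_Int[OF assms(2), symmetric]) auto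
  ultimately show "okc (f ` S) (f x) (f ` Z)" "(f ` S - {f x}) \<union> f ` Z = f ` ((S - {x}) \<union> Z)"
    using assms(1) by (auto simp: okc_def image_Un)
qed

text \<open>Equivariance of the operad allows separate bijections on the two operands. A single
  \<open>f\<close> serves for both once it is injective on all labels involved and the consumed
  input \<open>x\<close> does not recur in \<open>Z\<close>.\<close>

lemma oc_ract:
  assumes o: "okc S x Z" and f: "inj_on f (S \<union> Z)" "x \<notin> Z" and a: "a \<in> carrier (OP S)" and b: "b \<in> carrier (OP Z)"
  shows "ract f ((S - {x}) \<union> Z) (oc S x Z a b) = oc (f ` S) (f x) (f ` Z) (ract f S a) (ract f Z b)"
proof -
  note ok = okc_image[OF o f]
  have i: "inj_on f S" "inj_on f Z" using f(1) by (auto simp: inj_on_def)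
  have x: "olift f (Some ` S) (Some x) = Some (f x)" using o by (simp add: okc_def)
  have r: "restrict (\<lambda>t. if t \<in> Some ` Z then olift f (Some ` Z) t else olift f (Some ` S) t) (Some ` ((S - {x}) \<union> Z)) =
      olift f (Some ` ((S - {x}) \<union> Z))" by (rule restrict_ext) auto
  show ?thesis
    using nonunital_operad.equivariant[OF P composable_oc(1)[OF o] _ olift_FB(1)[OF i(1)] olift_FB(1)[OF i(2)] a b]
      composable_oc(1)[OF ok(1)]
    unfolding x pointed_simps r oc_def ract_def ok(2) by simp
qed

lemma dc_pact:
  assumes o: "okc S x Z" and f: "inj_on f (S \<union> Z)" "x \<notin> Z" and a: "a \<in> carrier (OPp S)" and b: "b \<in> carrier (OP Z)"
  shows "pact f ((S - {x}) \<union> Z) (dc S x Z a b) = dc (f ` S) (f x) (f ` Z) (pact f S a) (ract f Z b)"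
proof -
  note ok = okc_image[OF o f]
  have i: "inj_on f S" "inj_on f Z" using f(1) by (auto simp: inj_on_def)
  have x: "olift f (pointed S) (Some x) = Some (f x)" using o by (simp add: okc_def)
  have r: "restrict (\<lambda>t. if t \<in> Some ` Z then olift f (Some ` Z) t else olift f (pointed S) t) (pointed ((S - {x}) \<union> Z)) =
      olift f (pointed ((S - {x}) \<union> Z))" by (rule restrict_ext) auto
  show ?thesis
    using nonunital_operad.equivariant[OF P composable_oc(2)[OF o] _ olift_FB(2)[OF i(1)] olift_FB(1)[OF i(2)] a b]
      composable_oc(2)[OF ok(1)]
    unfolding x pointed_simps r dc_def pact_def ract_def ok(2) by simp
qed

lemma nc_pact:
  assumes o: "finite X" "finite Y" "X \<inter> Y = {}" and f: "inj_on f (X \<union> Y)"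
    and a: "a \<in> carrier (OPp X)" and b: "b \<in> carrier (OPp Y)"
  shows "pact f (X \<union> Y) (nc X Y a b) = nc (f ` X) (f ` Y) (pact f X a) (pact f Y b)"
proof -
  have i: "inj_on f X" "inj_on f Y" using f by (auto simp: inj_on_def)
  have d: "f ` X \<inter> f ` Y = {}" using inj_on_image_Int[OF f, of X Y] o(3) by simp
  have x: "olift f (pointed X) None = None" by simp
  have r: "restrict (\<lambda>t. if t \<in> pointed Y then olift f (pointed Y) t else olift f (pointed X) t) (pointed (X \<union> Y)) =
      olift f (pointed (X \<union> Y))" by (rule restrict_ext) auto
  show ?thesis
    using nonunital_operad.equivariant[OF P composable_oc(3)[OF o] _ olift_FB(2)[OF i(1)] olift_FB(2)[OF i(2)] a b]
      composable_oc(3)[OF _ _ d] o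
    unfolding x pointed_simps r nc_def pact_def by (simp add: image_Un)
qed

lemma op_kB_sp: "kb_sp (op_kB P) (X, Y) = (if card Y = 1 then OP X else zero_space \<zero>\<^bsub>op_sp P {}\<^esub>)"
  by (simp add: op_kB_def)

lemma op_kB_act:
  assumes "h \<in> B_hom (X, Y) (U, V)" "card Y = 1"
  shows "kb_act (op_kB P) (X, Y) (U, V) h a = ract (fst h) X a"
proof -
  obtain f g where h: "h = (f, g)" by (cases h)
  have "f ` X = U" using assms(1) by (auto simp: h B_hom_def FB_hom_def bij_betw_def)
  then show ?thesis using assms(2) by (simp add: op_kB_def ract_def h)
qed

lemma B_hom_card: "h \<in> B_hom (X, Y) (U, V) \<Longrightarrow> card Y = card V" "h \<in> B_hom (X, Y) (U, V) \<Longrightarrow> Y = {} \<longleftrightarrow> V = {}"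
  by (auto simp: B_hom_def FB_hom_def mem_Times_iff bij_betw_same_card bij_betw_def)

lemma B_hom_inj: "h \<in> B_hom (X, Y) (U, V) \<Longrightarrow> inj_on (fst h) X \<and> fst h ` X = U"
  by (auto simp: B_hom_def FB_hom_def mem_Times_iff bij_betw_def)

lemma op_kB_module: "kB_module K (op_kB P)"
proof (rule kB_module.intro)
  fix A :: "'a bob" assume A: "A \<in> B_obj"
  obtain X Y where AB: "A = (X, Y)" by (metis surj_pair)
  have fin: "finite X" using A by (auto simp: AB B_obj_def)
  show "vectorspace K (kb_sp (op_kB P) A)"
    using vs_OP(1)[OF fin(1)] by (simp add: AB op_kB_sp vs_zero_space[OF K])
  show "kb_act (op_kB P) A A (B_id A) v = v" if "v \<in> carrier (kb_sp (op_kB P) A)" for v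
  proof (cases "card Y = 1")
    case True
    have "kb_act (op_kB P) (X, Y) (X, Y) (B_id (X, Y)) v = ract (fst (B_id (X, Y))) X v"
      by (rule op_kB_act[OF B_id_hom True])
    also have "\<dots> = v" by (rule ract_id) (use fin that True in \<open>auto simp: AB op_kB_sp B_id_def B_restrict_def\<close>)
    finally show ?thesis by (simp add: AB)
  next
    case False
    then show ?thesis by (simp add: AB op_kB_def B_id_def B_restrict_def)
  qed
  fix B :: "'a bob" and h assume B: "B \<in> B_obj" and hh: "h \<in> B_hom A B"
  obtain U V where B': "B = (U, V)" by (metis surj_pair)
  have h: "h \<in> B_hom (X, Y) (U, V)" using hh by (simp add: AB B')
  show "kb_act (op_kB P) A B h \<in> module_hom K (kb_sp (op_kB P) A) (kb_sp (op_kB P) B)"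
  proof (cases "card Y = 1")
    case True
    then have "card V = 1" using B_hom_card(1)[OF h] by simp
    moreover have "kb_act (op_kB P) (X, Y) (U, V) h = ract (fst h) X" by (rule ext) (rule op_kB_act[OF h True])
    ultimately show ?thesis
      using True ract_hom[of X "fst h"] B_hom_inj[OF h] fin by (simp add: AB B' op_kB_sp)
  next
    case False
    then have "card V \<noteq> 1" using B_hom_card(1)[OF h] by simp
    with False show ?thesis by (cases h) (simp add: AB B' op_kB_def hom_ident)
  qed
next
  fix A B C :: "'a bob" and f g v
  assume A: "A \<in> B_obj" and B: "B \<in> B_obj" and C: "C \<in> B_obj"
    and f: "f \<in> B_hom A B" and g: "g \<in> B_hom B C" and v: "v \<in> carrier (kb_sp (op_kB P) A)"
  obtain X Y U V S T where AB: "A = (X, Y)" "B = (U, V)" "C = (S, T)" by (metis surj_pair)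
  have fin: "finite X" using A by (auto simp: AB B_obj_def)
  note f' = f[unfolded AB] and g' = g[unfolded AB]
  note gf = B_comp_hom[OF f' g']
  show "kb_act (op_kB P) A C (B_comp A g f) v = kb_act (op_kB P) B C g (kb_act (op_kB P) A B f v)"
  proof (cases "card Y = 1")
    case True
    then have V: "card V = 1" using B_hom_card(1)[OF f'] by simp
    have "ract (fst g) (fst f ` X) (ract (fst f) X v) = ract (\<lambda>x. fst g (fst f x)) X v"
      using B_hom_inj[OF f'] B_hom_inj[OF g'] fin v True by (intro ract_comp) (auto simp: AB op_kB_sp)
    also have "\<dots> = ract (fst (B_comp (X, Y) g f)) X v"
      by (rule ract_cong) (simp add: B_comp_def compose_def)
    finally show ?thesis
      unfolding AB op_kB_act[OF gf True] op_kB_act[OF f' True] op_kB_act[OF g' V]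
      using B_hom_inj[OF f'] by simp
  next
    case False
    then have "card V \<noteq> 1" using B_hom_card(1)[OF f'] by simp
    with False show ?thesis by (cases f; cases g) (simp add: AB op_kB_def B_comp_def)
  qed
qed

subsection \<open>The module \<open>delta\<close>\<close>

lemma delta_gen_closed:
  assumes "finite X"
  shows "{op_comp P (pointed X1) None (pointed X2) a b
         \<ominus>\<^bsub>op_sp P (pointed X)\<^esub> op_comp P (pointed X2) None (pointed X1) b a |X1 X2 a b.
       X1 \<union> X2 = X \<and> X1 \<inter> X2 = {} \<and>
       a \<in> carrier (op_sp P (pointed X1)) \<and> b \<in> carrier (op_sp P (pointed X2))} \<subseteq> carrier (OPp X)"
proof
  fix r assume "r \<in> {op_comp P (pointed X1) None (pointed X2) a b
         \<ominus>\<^bsub>op_sp P (pointed X)\<^esub> op_comp P (pointed X2) None (pointed X1) b a |X1 X2 a b.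
       X1 \<union> X2 = X \<and> X1 \<inter> X2 = {} \<and>
       a \<in> carrier (op_sp P (pointed X1)) \<and> b \<in> carrier (op_sp P (pointed X2))}"
  then obtain X1 X2 a b where *: "X1 \<union> X2 = X" "X1 \<inter> X2 = {}" "a \<in> carrier (OPp X1)" "b \<in> carrier (OPp X2)"
    "r = nc X1 X2 a b \<ominus>\<^bsub>OPp X\<^esub> nc X2 X1 b a" unfolding nc_def by blast
  have f: "finite X1" "finite X2" using *(1) assms by auto
  have "nc X1 X2 a b \<in> carrier (OPp X)" using nc_closed[OF f *(2,3,4)] *(1) by simp
  moreover have "nc X2 X1 b a \<in> carrier (OPp X)"
    using nc_closed[OF f(2,1) _ *(4,3)] *(1,2) by (simp add: Un_commute Int_commute)
  ultimately show "r \<in> carrier (OPp X)" unfolding *(5) by (rule vs_minus_closed[OF vs_OP(2)[OF assms]])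
qed

lemma vs_delta: "finite X \<Longrightarrow> vectorspace K (delta_sp K P X)"
  unfolding delta_sp_def delta_sub_def
  by (rule quotient_space.vs_quot[OF quotient_span[OF vs_OP(2) delta_gen_closed]])

lemma delta_cls_hom: "finite X \<Longrightarrow> delta_cls K P X \<in> module_hom K (OPp X) (delta_sp K P X)"
  unfolding delta_sp_def delta_sub_def delta_cls_def[abs_def]
  by (rule quotient_space.quot_hom[OF quotient_span[OF vs_OP(2) delta_gen_closed]])

lemma carrier_delta: "finite X \<Longrightarrow> carrier (delta_sp K P X) = delta_cls K P X ` carrier (OPp X)"
  unfolding delta_sp_def delta_sub_def delta_cls_def[abs_def]
  by (rule quotient_space.carrier_quot[OF quotient_span[OF vs_OP(2) delta_gen_closed]])

lemma spanning_delta: "finite X \<Longrightarrow> spanning K (delta_sp K P X) (delta_cls K P X ` carrier (OPp X))"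
  using carrier_delta by (auto simp: spanning_def intro: lspan.gen)

lemma delta_cls_rel:
  assumes X: "finite X1" "finite X2" "X1 \<inter> X2 = {}" and ab: "a \<in> carrier (OPp X1)" "b \<in> carrier (OPp X2)"
  shows "delta_cls K P (X1 \<union> X2) (nc X1 X2 a b) = delta_cls K P (X1 \<union> X2) (nc X2 X1 b a)"
proof -
  let ?X = "X1 \<union> X2"
  have f: "finite ?X" using X by simp
  have 1: "nc X1 X2 a b \<in> carrier (OPp ?X)" by (rule nc_closed[OF X ab])
  have 2: "nc X2 X1 b a \<in> carrier (OPp ?X)"
    using nc_closed[OF X(2,1) _ ab(2,1)] X(3) by (simp add: Un_commute Int_commute)
  show ?thesis unfolding delta_cls_def delta_sub_def
    by (rule coset_eqI[OF vs_OP(2)[OF f] delta_gen_closed[OF f] 1 2]) (use X ab in \<open>unfold nc_def, blast\<close>)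
qed

text \<open>The universal property of \<open>delta_sp\<close>, stated for the very descriptions used
  in \<open>delta\<close>, \<open>delta_act\<close> and \<open>delta_map\<close>: a linear map must
  give the same value on the two orders of composition at the distinguished points.\<close>

lemma delta_lin_ext:
  assumes X: "finite X" and W: "vectorspace K W" and p: "\<psi> \<in> module_hom K (OPp X) W"
    and r: "\<And>X1 X2 a b. X1 \<union> X2 = X \<Longrightarrow> X1 \<inter> X2 = {} \<Longrightarrow> a \<in> carrier (OPp X1) \<Longrightarrow> b \<in> carrier (OPp X2) \<Longrightarrow>
      \<psi> (nc X1 X2 a b) = \<psi> (nc X2 X1 b a)"
  shows "lin_ext K (delta_sp K P X) W {(delta_cls K P X c, \<psi> c) |c. c \<in> carrier (OPp X)} \<in> module_hom K (delta_sp K P X) W"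
    "\<And>c. c \<in> carrier (OPp X) \<Longrightarrow>
      lin_ext K (delta_sp K P X) W {(delta_cls K P X c, \<psi> c) |c. c \<in> carrier (OPp X)} (delta_cls K P X c) = \<psi> c"
proof -
  have z: "\<psi> v = \<zero>\<^bsub>W\<^esub>" if v: "v \<in> delta_sub K P X" for v
  proof (rule hom_vanishes_span[OF vs_OP(2)[OF X] W p delta_gen_closed[OF X] _ v[unfolded delta_sub_def]])
    fix v assume "v \<in> {op_comp P (pointed X1) None (pointed X2) a b
         \<ominus>\<^bsub>op_sp P (pointed X)\<^esub> op_comp P (pointed X2) None (pointed X1) b a |X1 X2 a b.
       X1 \<union> X2 = X \<and> X1 \<inter> X2 = {} \<and>
       a \<in> carrier (op_sp P (pointed X1)) \<and> b \<in> carrier (op_sp P (pointed X2))}"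
    then obtain X1 X2 a b where *: "X1 \<union> X2 = X" "X1 \<inter> X2 = {}" "a \<in> carrier (OPp X1)" "b \<in> carrier (OPp X2)"
      "v = nc X1 X2 a b \<ominus>\<^bsub>OPp X\<^esub> nc X2 X1 b a" unfolding nc_def by blast
    have f: "finite X1" "finite X2" using *(1) X by auto
    have 1: "nc X1 X2 a b \<in> carrier (OPp X)" using nc_closed[OF f *(2,3,4)] *(1) by simp
    have 2: "nc X2 X1 b a \<in> carrier (OPp X)"
      using nc_closed[OF f(2,1) _ *(4,3)] *(1,2) by (simp add: Un_commute Int_commute)
    show "\<psi> v = \<zero>\<^bsub>W\<^esub>"
      unfolding *(5) hom_minus[OF vs_OP(2)[OF X] W p 1 2] r[OF *(1-4)]
      by (rule vs_minus_self[OF W hom_closed[OF p 2]])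
  qed
  have "\<exists>\<phi>\<in>module_hom K (delta_sp K P X) W. \<forall>c\<in>carrier (OPp X). \<phi> (delta_cls K P X c) = \<psi> c"
    unfolding delta_sp_def delta_sub_def delta_cls_def[abs_def]
    by (rule quotient_space.quot_ext[OF quotient_span[OF vs_OP(2)[OF X] delta_gen_closed[OF X]] W p])
      (use z in \<open>simp add: delta_sub_def\<close>)
  note ex = this
  have im: "{(delta_cls K P X c, \<psi> c) |c. c \<in> carrier (OPp X)} = (\<lambda>c. (delta_cls K P X c, \<psi> c)) ` carrier (OPp X)"
    by blast
  note le = lin_ext_family[OF vs_delta[OF X] W spanning_delta[OF X] ex im]
  show "lin_ext K (delta_sp K P X) W {(delta_cls K P X c, \<psi> c) |c. c \<in> carrier (OPp X)} \<in> module_hom K (delta_sp K P X) W"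
    by (rule le(1))
  show "lin_ext K (delta_sp K P X) W {(delta_cls K P X c, \<psi> c) |c. c \<in> carrier (OPp X)} (delta_cls K P X c) = \<psi> c"
    if "c \<in> carrier (OPp X)" for c by (rule le(2)[OF that])
qed

lemma delta_hom_eq:
  assumes "finite X" "vectorspace K W" "\<phi> \<in> module_hom K (delta_sp K P X) W" "\<psi> \<in> module_hom K (delta_sp K P X) W"
    "\<And>c. c \<in> carrier (OPp X) \<Longrightarrow> \<phi> (delta_cls K P X c) = \<psi> (delta_cls K P X c)" "w \<in> carrier (delta_sp K P X)"
  shows "\<phi> w = \<psi> w"
  using assms(5,6) unfolding carrier_delta[OF assms(1)] by auto

definition dact :: "('a \<Rightarrow> 'a) \<Rightarrow> 'a set \<Rightarrow> 'v set \<Rightarrow> 'v set" where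
  "dact f S = lin_ext K (delta_sp K P S) (delta_sp K P (f ` S))
    {(delta_cls K P S c, delta_cls K P (f ` S) (pact f S c)) |c. c \<in> carrier (OPp S)}"

text \<open>Relabelling commutes with composition at the distinguished points by
  \<open>nc_pact\<close>, hence it sends relations to relations.\<close>

lemma dact:
  assumes "finite S" "inj_on f S"
  shows "dact f S \<in> module_hom K (delta_sp K P S) (delta_sp K P (f ` S))"
    "\<And>c. c \<in> carrier (OPp S) \<Longrightarrow> dact f S (delta_cls K P S c) = delta_cls K P (f ` S) (pact f S c)"
proof -
  have fS: "finite (f ` S)" using assms(1) by simp
  have r: "delta_cls K P (f ` S) (pact f S (nc X1 X2 a b)) = delta_cls K P (f ` S) (pact f S (nc X2 X1 b a))"
    if *: "X1 \<union> X2 = S" "X1 \<inter> X2 = {}" "a \<in> carrier (OPp X1)" "b \<in> carrier (OPp X2)" for X1 X2 a b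
  proof -
    have fin: "finite X1" "finite X2" using *(1) assms(1) by auto
    have i: "inj_on f X1" "inj_on f X2" "inj_on f (X1 \<union> X2)" "inj_on f (X2 \<union> X1)"
      using *(1) assms(2) by (auto simp: inj_on_def)
    have d: "f ` X1 \<inter> f ` X2 = {}" using inj_on_image_Int[OF i(3), of X1 X2] *(2) by simp
    have d': "X2 \<inter> X1 = {}" using *(2) by auto
    have "pact f S (nc X1 X2 a b) = nc (f ` X1) (f ` X2) (pact f X1 a) (pact f X2 b)"
      using nc_pact[OF fin *(2) i(3) *(3,4)] *(1) by simp
    moreover have "pact f S (nc X2 X1 b a) = nc (f ` X2) (f ` X1) (pact f X2 b) (pact f X1 a)"
      using nc_pact[OF fin(2,1) d' i(4) *(4,3)] *(1) by (simp add: Un_commute)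
    moreover have "f ` S = f ` X1 \<union> f ` X2" using *(1) by auto
    ultimately show ?thesis
      using delta_cls_rel[OF _ _ d hom_closed[OF pact_hom[OF fin(1) i(1)] *(3)] hom_closed[OF pact_hom[OF fin(2) i(2)] *(4)]]
        fin by simp
  qed
  note * = delta_lin_ext[OF assms(1) vs_delta[OF fS] hom_comp[OF pact_hom[OF assms] delta_cls_hom[OF fS]] r]
  show "dact f S \<in> module_hom K (delta_sp K P S) (delta_sp K P (f ` S))" unfolding dact_def by (rule *(1))
  show "dact f S (delta_cls K P S c) = delta_cls K P (f ` S) (pact f S c)" if "c \<in> carrier (OPp S)" for c
    unfolding dact_def by (rule *(2)[OF _ _ _ _ that])
qed

lemma delta_kB_sp: "kb_sp (delta K P) (X, Y) = (if Y = {} then delta_sp K P X else zero_space {})"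
  by (simp add: delta_def)

lemma delta_kB_act:
  assumes "h \<in> B_hom (X, {}) (U, V)"
  shows "kb_act (delta K P) (X, {}) (U, V) h = dact (fst h) X"
proof -
  obtain f g where h: "h = (f, g)" by (cases h)
  have "f ` X = U" using assms(1) by (auto simp: h B_hom_def FB_hom_def bij_betw_def)
  then show ?thesis by (auto simp: delta_def dact_def pact_def h)
qed

lemma dact_cong: assumes "\<And>x. x \<in> S \<Longrightarrow> f x = g x" shows "dact f S = dact g S"
  using pact_cong[OF assms, of S] image_cong[OF refl assms, of S] unfolding dact_def by simp

lemma delta_kB_module: "kB_module K (delta K P)"
proof (rule kB_module.intro)
  fix A :: "'a bob" assume A: "A \<in> B_obj"
  obtain X Y where AB: "A = (X, Y)" by (metis surj_pair)
  have fin: "finite X" using A by (auto simp: AB B_obj_def)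
  show vs: "vectorspace K (kb_sp (delta K P) A)"
    using vs_delta[OF fin(1)] by (simp add: AB delta_kB_sp vs_zero_space[OF K])
  show "kb_act (delta K P) A A (B_id A) v = v" if v: "v \<in> carrier (kb_sp (delta K P) A)" for v
  proof (cases "Y = {}")
    case True
    have i: "inj_on (fst (B_id (X, Y))) X" "fst (B_id (X, Y)) ` X = X" using B_hom_inj[OF B_id_hom[of "(X, Y)"]] by auto
    have "dact (fst (B_id (X, Y))) X v = v"
    proof (rule delta_hom_eq[OF fin(1) vs_delta[OF fin(1)] _ hom_ident])
      show "dact (fst (B_id (X, Y))) X \<in> module_hom K (delta_sp K P X) (delta_sp K P X)"
        using dact(1)[OF fin(1) i(1)] i(2) by simp
      show "v \<in> carrier (delta_sp K P X)" using v True by (simp add: AB delta_kB_sp)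
      fix c assume c: "c \<in> carrier (OPp X)"
      have "pact (fst (B_id (X, Y))) X c = c"
        by (rule pact_id[OF fin(1) c]) (simp add: B_id_def B_restrict_def)
      then show "dact (fst (B_id (X, Y))) X (delta_cls K P X c) = delta_cls K P X c"
        using dact(2)[OF fin(1) i(1) c] i(2) by simp
    qed
    then show ?thesis using delta_kB_act[of "B_id (X, {})" X X "{}"] B_id_hom[of "(X, {})"] True by (simp add: AB)
  next
    case False
    then show ?thesis by (simp add: AB delta_def B_id_def B_restrict_def)
  qed
  fix B :: "'a bob" and h assume B: "B \<in> B_obj" and hh: "h \<in> B_hom A B"
  obtain U V where B': "B = (U, V)" by (metis surj_pair)
  have h: "h \<in> B_hom (X, Y) (U, V)" using hh by (simp add: AB B')
  show "kb_act (delta K P) A B h \<in> module_hom K (kb_sp (delta K P) A) (kb_sp (delta K P) B)"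
  proof (cases "Y = {}")
    case True
    then have V: "V = {}" using B_hom_card(2)[OF h] by simp
    show ?thesis
      using True V dact(1)[of X "fst h"] B_hom_inj[OF h] h fin delta_kB_act[of h X U V]
      by (simp add: AB B' delta_kB_sp)
  next
    case False
    then have "V \<noteq> {}" using B_hom_card(2)[OF h] by simp
    with False show ?thesis by (cases h) (simp add: AB B' delta_def hom_ident)
  qed
next
  fix A B C :: "'a bob" and f g v
  assume A: "A \<in> B_obj" and B: "B \<in> B_obj" and C: "C \<in> B_obj"
    and f: "f \<in> B_hom A B" and g: "g \<in> B_hom B C" and v: "v \<in> carrier (kb_sp (delta K P) A)"
  obtain X Y U V S T where AB: "A = (X, Y)" "B = (U, V)" "C = (S, T)" by (metis surj_pair)
  have fin: "finite X" "finite U" "finite S" using A B C by (auto simp: AB B_obj_def)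
  note f' = f[unfolded AB] and g' = g[unfolded AB]
  note gf = B_comp_hom[OF f' g']
  show "kb_act (delta K P) A C (B_comp A g f) v = kb_act (delta K P) B C g (kb_act (delta K P) A B f v)"
  proof (cases "Y = {}")
    case True
    then have V: "V = {}" using B_hom_card(2)[OF f'] by simp
    let ?h = "fst (B_comp (X, Y) g f)"
    have i: "inj_on (fst f) X" "fst f ` X = U" "inj_on (fst g) U" "fst g ` U = S" "inj_on ?h X" "?h ` X = S"
      using B_hom_inj[OF f'] B_hom_inj[OF g'] B_hom_inj[OF gf] by auto
    have "dact ?h X v = dact (fst g) U (dact (fst f) X v)"
    proof (rule delta_hom_eq[OF fin(1) vs_delta[OF fin(3)], where \<psi> = "\<lambda>v. dact (fst g) U (dact (fst f) X v)"])
      show "dact ?h X \<in> module_hom K (delta_sp K P X) (delta_sp K P S)"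
        using dact(1)[OF fin(1) i(5)] i(6) by simp
      show "(\<lambda>v. dact (fst g) U (dact (fst f) X v)) \<in> module_hom K (delta_sp K P X) (delta_sp K P S)"
        by (rule hom_comp[OF dact(1)[OF fin(1) i(1), unfolded i(2)] dact(1)[OF fin(2) i(3), unfolded i(4)]])
      show "v \<in> carrier (delta_sp K P X)" using v True by (simp add: AB delta_kB_sp)
      fix c assume c: "c \<in> carrier (OPp X)"
      have c': "pact (fst f) X c \<in> carrier (OPp U)" using hom_closed[OF pact_hom[OF fin(1) i(1)] c] i(2) by simp
      have "pact ?h X c = pact (\<lambda>x. fst g (fst f x)) X c"
        by (rule pact_cong) (simp add: B_comp_def compose_def)
      also have "\<dots> = pact (fst g) U (pact (fst f) X c)"
        using pact_comp[OF fin(1) i(1) _ c, of "fst g"] i by simp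
      finally show "dact ?h X (delta_cls K P X c) = dact (fst g) U (dact (fst f) X (delta_cls K P X c))"
        using dact(2)[OF fin(1) i(5) c] dact(2)[OF fin(1) i(1) c] dact(2)[OF fin(2) i(3) c'] i by simp
    qed
    then show ?thesis
      using delta_kB_act[of f X U V] delta_kB_act[of g U S T] delta_kB_act[of "B_comp (X, {}) g f" X S T] f' g' gf True V
      by (simp add: AB)
  next
    case False
    then have "V \<noteq> {}" using B_hom_card(2)[OF f'] by simp
    with False show ?thesis by (cases f; cases g) (simp add: AB delta_def B_comp_def)
  qed
qed

subsection \<open>The action of the operad on \<open>delta\<close>\<close>

text \<open>Well-definedness: in a relation \<open>x\<close> belongs to exactly one of the two
  operations. Inserting \<open>b\<close> at \<open>x\<close> modifies that operation and leaves the
  shape of the relation intact, so the result is again a relation.\<close>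

lemma delta_act:
  assumes o: "okc X x Z" and b: "b \<in> carrier (OP Z)"
  shows "(\<lambda>w. delta_act K P X x Z w b) \<in> module_hom K (delta_sp K P X) (delta_sp K P ((X - {x}) \<union> Z))"
    "\<And>c. c \<in> carrier (OPp X) \<Longrightarrow>
      delta_act K P X x Z (delta_cls K P X c) b = delta_cls K P ((X - {x}) \<union> Z) (dc X x Z c b)"
proof -
  let ?X = "(X - {x}) \<union> Z"
  have fX: "finite X" "finite ?X" "finite Z" "x \<in> X" "(X - {x}) \<inter> Z = {}" using o by (auto simp: okc_def)
  \<comment> \<open>The case where \<open>x\<close> is an input of the operation on
    \<open>X1\<close>; the other case follows by exchanging the roles of the two operations.\<close>
  have r: "delta_cls K P ?X (dc X x Z (nc X1 X2 a a') b) = delta_cls K P ?X (dc X x Z (nc X2 X1 a' a) b)"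
    if *: "X1 \<union> X2 = X" "X1 \<inter> X2 = {}" "a \<in> carrier (OPp X1)" "a' \<in> carrier (OPp X2)" and x: "x \<in> X1" for X1 X2 a a'
  proof -
    have fin: "finite X1" "finite X2" using *(1) fX(1) by auto
    have ok: "okc X1 x Z" and dj: "X2 \<inter> Z = {}" "X2 \<inter> X1 = {}" "((X1 - {x}) \<union> Z) \<inter> X2 = {}"
      and eq: "?X = ((X1 - {x}) \<union> Z) \<union> X2"
      using *(1,2) x fX by (auto simp: okc_def)
    have "dc X x Z (nc X1 X2 a a') b = nc ((X1 - {x}) \<union> Z) X2 (dc X1 x Z a b) a'"
      using nc_dc_left[OF fin *(2) ok dj(1) *(3,4) b] *(1) by simp
    moreover have "dc X x Z (nc X2 X1 a' a) b = nc X2 ((X1 - {x}) \<union> Z) a' (dc X1 x Z a b)"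
      using nc_dc_right[OF fin(2,1) dj(2) ok dj(1) *(4,3) b] *(1) by (simp add: Un_commute)
    ultimately show ?thesis
      unfolding eq using delta_cls_rel[OF _ fin(2) dj(3) dc_closed[OF ok *(3) b] *(4)] fin fX by simp
  qed
  have r': "delta_cls K P ?X (dc X x Z (nc X1 X2 a a') b) = delta_cls K P ?X (dc X x Z (nc X2 X1 a' a) b)"
    if *: "X1 \<union> X2 = X" "X1 \<inter> X2 = {}" "a \<in> carrier (OPp X1)" "a' \<in> carrier (OPp X2)" for X1 X2 a a'
  proof (cases "x \<in> X1")
    case True
    then show ?thesis using r[OF *] by simp
  next
    case False
    then have "x \<in> X2" using fX(4) *(1) by auto
    then show ?thesis using r[OF _ _ *(4,3)] *(1,2) by (simp add: Un_commute Int_commute)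
  qed
  note * = delta_lin_ext[OF fX(1) vs_delta[OF fX(2)] hom_comp[OF dc_homs(2)[OF o b] delta_cls_hom[OF fX(2)]] r']
  show "(\<lambda>w. delta_act K P X x Z w b) \<in> module_hom K (delta_sp K P X) (delta_sp K P ?X)"
    unfolding delta_act_def dc_def[symmetric] by (rule *(1))
  show "delta_act K P X x Z (delta_cls K P X c) b = delta_cls K P ((X - {x}) \<union> Z) (dc X x Z c b)"
    if "c \<in> carrier (OPp X)" for c
    unfolding delta_act_def dc_def[symmetric] by (rule *(2)[OF _ _ _ _ that])
qed

lemma delta_act_hom2:
  assumes o: "okc X x Z" and w: "w \<in> carrier (delta_sp K P X)"
  shows "delta_act K P X x Z w \<in> module_hom K (OP Z) (delta_sp K P ((X - {x}) \<union> Z))"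
proof -
  have fX: "finite X" "finite ((X - {x}) \<union> Z)" "finite Z" using o by (auto simp: okc_def)
  obtain c where c: "c \<in> carrier (OPp X)" "w = delta_cls K P X c" using w carrier_delta[OF fX(1)] by auto
  show ?thesis
    by (rule hom_cong[OF vs_OP(1)[OF fX(3)] hom_comp[OF dc_homs(1)[OF o c(1)] delta_cls_hom[OF fX(2)]]])
      (simp add: c(2) delta_act(2)[OF o _ c(1)])
qed

lemma delta_act_closed:
  "okc X x Z \<Longrightarrow> w \<in> carrier (delta_sp K P X) \<Longrightarrow> b \<in> carrier (OP Z) \<Longrightarrow>
    delta_act K P X x Z w b \<in> carrier (delta_sp K P ((X - {x}) \<union> Z))"
  by (rule hom_closed[OF delta_act_hom2])

lemma delta_act_par:
  assumes xy: "x \<noteq> y" and o1: "okc S x Z" and o2: "okc S y W" and d: "Z \<inter> W = {}"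
    and o3: "okc ((S - {x}) \<union> Z) y W" and o4: "okc ((S - {y}) \<union> W) x Z"
    and w: "w \<in> carrier (delta_sp K P S)" and b: "b \<in> carrier (OP Z)" and c: "c \<in> carrier (OP W)"
  shows "delta_act K P ((S - {x}) \<union> Z) y W (delta_act K P S x Z w b) c =
    delta_act K P ((S - {y}) \<union> W) x Z (delta_act K P S y W w c) b"
proof -
  have fS: "finite S" using o1 by (simp add: okc_def)
  obtain a where a: "a \<in> carrier (OPp S)" "w = delta_cls K P S a" using w carrier_delta[OF fS] by auto
  have "((S - {x}) \<union> Z) - {y} \<union> W = ((S - {y}) \<union> W) - {x} \<union> Z"
    using o3 o4 o1 o2 xy d by (auto simp: okc_def)
  then show ?thesis
    unfolding a(2) delta_act(2)[OF o1 b a(1)] delta_act(2)[OF o2 c a(1)]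
      delta_act(2)[OF o3 c dc_closed[OF o1 a(1) b]] delta_act(2)[OF o4 b dc_closed[OF o2 a(1) c]]
      dc_par[OF xy o1 o2 d a(1) b c] by simp
qed

lemma delta_act_seq:
  assumes o1: "okc S x Z" and y: "y \<in> Z" and o2: "okc ((S - {x}) \<union> Z) y W" and o3: "okc Z y W"
    and o4: "okc S x ((Z - {y}) \<union> W)"
    and w: "w \<in> carrier (delta_sp K P S)" and b: "b \<in> carrier (OP Z)" and c: "c \<in> carrier (OP W)"
  shows "delta_act K P ((S - {x}) \<union> Z) y W (delta_act K P S x Z w b) c =
    delta_act K P S x ((Z - {y}) \<union> W) w (oc Z y W b c)"
proof -
  have fS: "finite S" using o1 by (simp add: okc_def)
  obtain a where a: "a \<in> carrier (OPp S)" "w = delta_cls K P S a" using w carrier_delta[OF fS] by auto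
  have "((S - {x}) \<union> Z) - {y} \<union> W = (S - {x}) \<union> ((Z - {y}) \<union> W)"
    using o1 y by (auto simp: okc_def)
  then show ?thesis
    unfolding a(2) delta_act(2)[OF o1 b a(1)] delta_act(2)[OF o2 c dc_closed[OF o1 a(1) b]]
      delta_act(2)[OF o4 oc_closed[OF o3 b c] a(1)] dc_seq[OF o1 y o2 a(1) b c] by simp
qed

section \<open>Marking an input and its interaction with composition\<close>

definition mk :: "'a \<Rightarrow> 'a set \<Rightarrow> 'v \<Rightarrow> 'v" where
  "mk x Z b = op_act P (Some ` Z) (pointed (Z - {x})) (omark x Z) b"

lemma delta_mark_mk: "delta_mark K P Z x b = delta_cls K P (Z - {x}) (mk x Z b)"
  by (simp add: delta_mark_def mk_def omark_def)

lemma mk_hom: "finite Z \<Longrightarrow> x \<in> Z \<Longrightarrow> mk x Z \<in> module_hom K (OP Z) (OPp (Z - {x}))"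
  unfolding mk_def[abs_def] by (rule nonunital_operad.hom[OF P _ _ omark_FB]) auto

lemma delta_mark_hom: "finite Z \<Longrightarrow> x \<in> Z \<Longrightarrow> delta_mark K P Z x \<in> module_hom K (OP Z) (delta_sp K P (Z - {x}))"
  unfolding delta_mark_mk[abs_def] by (rule hom_comp[OF mk_hom delta_cls_hom]) auto

text \<open>Marking \<open>x\<close> and inserting at a different input \<open>y\<close> commute:
  this is equivariance for the relabelling of \<open>x\<close> on \<open>Z\<close> and the identity
  on \<open>W\<close>.\<close>

lemma delta_mark_act:
  assumes o: "okc Z y W" and x: "x \<in> Z" "x \<noteq> y" "x \<notin> W" and b: "b \<in> carrier (OP Z)" and c: "c \<in> carrier (OP W)"
  shows "delta_mark K P ((Z - {y}) \<union> W) x (oc Z y W b c) = delta_act K P (Z - {x}) y W (delta_mark K P Z x b) c"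
proof -
  have o': "okc (Z - {x}) y W" and f: "finite Z" "finite W" using o x by (auto simp: okc_def)
  have s: "((Z - {y}) \<union> W) - {x} = ((Z - {x}) - {y}) \<union> W" using x by auto
  have c1: "composable (pointed (Z - {x})) (omark x Z (Some y)) (Some ` W)"
    using composable_oc(2)[OF o'] x o by (simp add: omark_def okc_def)
  have r: "restrict (\<lambda>t. if t \<in> Some ` W then restrict id (Some ` W) t else omark x Z t) (Some ` ((Z - {y}) \<union> W)) =
      omark x ((Z - {y}) \<union> W)"
    unfolding omark_def
    by (rule restrict_ext) (use x o in \<open>auto simp: okc_def split: if_splits\<close>)
  have my: "omark x Z (Some y) = Some y" using x o by (simp add: omark_def okc_def)
  have idW: "restrict id (Some ` W) \<in> FB_hom (Some ` W) (Some ` W)" by (auto simp: FB_hom_def)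
  have "mk x ((Z - {y}) \<union> W) (oc Z y W b c) = dc (Z - {x}) y W (mk x Z b) c"
    using nonunital_operad.equivariant[OF P composable_oc(1)[OF o] c1 omark_FB[OF x(1)] idW b c]
      nonunital_operad.ident[OF P _ c] f
    unfolding pointed_simps r my by (simp add: mk_def oc_def dc_def s)
  then show ?thesis
    unfolding delta_mark_mk delta_act(2)[OF o' c hom_closed[OF mk_hom[OF f(1) x(1)] b]] s by simp
qed

text \<open>The case of two operations contracted with each other crosswise. Marking turns each of
  the two composites into a composite at distinguished points, and these are the two sides of one
  relation of \<open>delta\<close>.\<close>

lemma delta_mark_comm:
  assumes o: "okc Z y W" and o': "okc W x Z" and d: "Z \<inter> W = {}"
    and b: "b \<in> carrier (OP Z)" and c: "c \<in> carrier (OP W)"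
  shows "delta_mark K P ((Z - {y}) \<union> W) x (oc Z y W b c) = delta_mark K P ((W - {x}) \<union> Z) y (oc W x Z c b)"
proof -
  \<comment> \<open>Equivariance with \<open>y\<close> renamed to the distinguished point in
    \<open>Z\<close> and \<open>x\<close> renamed to it in \<open>W\<close>. The point of
    \<open>Z\<close> is consumed by the composition, so only the mark at \<open>x\<close>
    survives.\<close>
  have *: "mk x ((Z - {y}) \<union> W) (oc Z y W b c) = nc (Z - {y}) (W - {x}) (mk y Z b) (mk x W c)"
    if o: "okc Z y W" and o': "okc W x Z" and d: "Z \<inter> W = {}" and b: "b \<in> carrier (OP Z)" and c: "c \<in> carrier (OP W)"
    for Z y W x b c
  proof -
    have f: "finite Z" "finite W" "y \<in> Z" "x \<in> W" using o o' by (auto simp: okc_def)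
    have s: "((Z - {y}) \<union> W) - {x} = (Z - {y}) \<union> (W - {x})" using f d by auto
    have my: "omark y Z (Some y) = None" using f by (simp add: omark_def)
    have c1: "composable (pointed (Z - {y})) (omark y Z (Some y)) (pointed (W - {x}))"
      unfolding my by (rule composable_oc(3)) (use f d in auto)
    have r: "restrict (\<lambda>t. if t \<in> Some ` W then omark x W t else omark y Z t) (Some ` ((Z - {y}) \<union> W)) =
      omark x ((Z - {y}) \<union> W)"
      unfolding omark_def
      by (rule restrict_ext) (use d f in \<open>auto split: if_splits\<close>)
    show ?thesis
      using nonunital_operad.equivariant[OF P composable_oc(1)[OF o] c1 omark_FB[OF f(3)] omark_FB[OF f(4)] b c]
      unfolding pointed_simps my r by (simp add: mk_def oc_def nc_def s)
  qed
  have f: "finite Z" "finite W" "y \<in> Z" "x \<in> W" "W \<inter> Z = {}" using o o' d by (auto simp: okc_def)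
  have s: "((Z - {y}) \<union> W) - {x} = (Z - {y}) \<union> (W - {x})" "((W - {x}) \<union> Z) - {y} = (Z - {y}) \<union> (W - {x})"
    using f d by auto
  show ?thesis
    unfolding delta_mark_mk *[OF o o' d b c] *[OF o' o f(5) c b] s
    by (rule delta_cls_rel[OF _ _ _ hom_closed[OF mk_hom[OF f(1,3)] b] hom_closed[OF mk_hom[OF f(2,4)] c]])
      (use f in auto)
qed

lemma delta_act_dact:
  assumes o: "okc S x Z" and f: "inj_on f (S \<union> Z)" "x \<notin> Z"
    and w: "w \<in> carrier (delta_sp K P S)" and b: "b \<in> carrier (OP Z)"
  shows "dact f ((S - {x}) \<union> Z) (delta_act K P S x Z w b) = delta_act K P (f ` S) (f x) (f ` Z) (dact f S w) (ract f Z b)"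
proof -
  have fS: "finite S" "finite Z" "finite ((S - {x}) \<union> Z)" using o by (auto simp: okc_def)
  have i: "inj_on f S" "inj_on f Z" "inj_on f ((S - {x}) \<union> Z)" using f(1) by (auto simp: inj_on_def)
  note ok = okc_image[OF o f]
  obtain a where a: "a \<in> carrier (OPp S)" "w = delta_cls K P S a" using w carrier_delta[OF fS(1)] by auto
  show ?thesis
    unfolding a(2) delta_act(2)[OF o b a(1)] dact(2)[OF fS(1) i(1) a(1)] dact(2)[OF fS(3) i(3) dc_closed[OF o a(1) b]]
      delta_act(2)[OF ok(1) hom_closed[OF ract_hom[OF fS(2) i(2)] b] hom_closed[OF pact_hom[OF fS(1) i(1)] a(1)]]
      dc_pact[OF o f a(1) b] ok(2) ..
qed

lemma delta_mark_dact:
  assumes "finite Z" "x \<in> Z" "inj_on f Z" "b \<in> carrier (OP Z)"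
  shows "dact f (Z - {x}) (delta_mark K P Z x b) = delta_mark K P (f ` Z) (f x) (ract f Z b)"
proof -
  have i: "inj_on f (Z - {x})" using assms(3) by (auto simp: inj_on_def)
  have fz: "finite (Z - {x})" "finite (f ` Z)" "f x \<in> f ` Z" using assms by auto
  have s: "f ` Z - {f x} = f ` (Z - {x})" using inj_on_image_set_diff[of f Z Z "{x}"] assms by auto
  have 1: "compose (Some ` Z) (olift f (pointed (Z - {x}))) (omark x Z) = compose (Some ` Z) (omark (f x) (f ` Z)) (olift f (Some ` Z))"
    unfolding compose_def
    by (rule restrict_ext) (use assms(2,3) in \<open>auto simp: omark_def inj_on_eq_iff\<close>)
  have "pact f (Z - {x}) (mk x Z b) = mk (f x) (f ` Z) (ract f Z b)"
    using nonunital_operad.functorial[OF P _ _ _ omark_FB[OF assms(2)] olift_FB(2)[OF i] assms(4)]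
      nonunital_operad.functorial[OF P _ _ _ olift_FB(1)[OF assms(3)] omark_FB[OF fz(3)] assms(4)] assms(1) 1
    unfolding pact_def mk_def ract_def s by simp
  then show ?thesis
    unfolding delta_mark_mk dact(2)[OF fz(1) i hom_closed[OF mk_hom[OF assms(1,2)] assms(4)]] s by simp
qed

end

section \<open>Terms of the exterior and symmetric parts\<close>

lemma is_decomp_mset: "mset Ds = mset Es \<Longrightarrow> is_decomp Ds A \<Longrightarrow> is_decomp Es A"
  by (metis is_decomp_permute mset_eq_permutation)

lemma is_decomp_total: "is_decomp (map fst ps) A \<Longrightarrow> A = total ps"
  by (auto simp: is_decomp_def total_def prod_eq_iff)

lemma pow_terms_total: "ps \<in> pow_terms F A \<Longrightarrow> total ps = A"
  using is_decomp_total unfolding pow_terms_def by blast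

text \<open>A term is decomposed as one flat list of blocks, a convolution as a pair followed by a
  decomposition of each half. The totals of the two lists provide the pair.\<close>

lemma is_decomp_append:
  "is_decomp (map fst ps @ map fst qs) A \<longleftrightarrow>
    is_decomp (map fst ps) (total ps) \<and> is_decomp (map fst qs) (total qs) \<and> is_decomp [total ps, total qs] A"
proof -
  have "(\<forall>x\<in>set (map fst ps). \<forall>y\<in>set (map fst qs). bdisj x y) \<longleftrightarrow> bdisj (total ps) (total qs)"
    by (auto simp: bdisj_def total_def)
  then show ?thesis
    by (auto simp: is_decomp_iff sorted_wrt_append total_def)
qed

lemma total_perm: "mset ps = mset qs \<Longrightarrow> total ps = total qs"
  by (metis total_def set_mset_mset)

sublocale op_ctx \<subseteq> L: star_ctx K "perm_sgn K" "neg1 K" "op_kB P"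
  by (rule star_ctx.intro[OF K op_kB_module perm_char_sgn[OF K]])

sublocale op_ctx \<subseteq> S: star_ctx K "perm_triv K" "\<one>\<^bsub>K\<^esub>" "delta K P"
  by (rule star_ctx.intro[OF K delta_kB_module perm_char_triv[OF K]])

context op_ctx
begin

abbreviation "LamF \<equiv> Lambda_star K (op_kB P)"
abbreviation "SymF \<equiv> Sym_star K (delta K P)"
abbreviation "LamS \<equiv> star_sp K (perm_sgn K) (op_kB P)"
abbreviation "SymS \<equiv> star_sp K (perm_triv K) (delta K P)"
abbreviation "LSV \<equiv> kb_sp (LS K P)"
abbreviation "LamV \<equiv> kb_sp (Lam K P)"
abbreviation "lel \<equiv> star_elt K (perm_sgn K) (op_kB P)"
abbreviation "sel \<equiv> star_elt K (perm_triv K) (delta K P)"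
abbreviation "cel \<equiv> conv_elt K LamF SymF"
abbreviation "LST \<equiv> LS_term K P"
abbreviation "apow \<equiv> pow_terms (op_kB P)"
abbreviation "wpow \<equiv> pow_terms (delta K P)"
abbreviation "atr \<equiv> transport (op_kB P)"
abbreviation "wtr \<equiv> transport (delta K P)"
abbreviation "prj \<equiv> LS_proj K P"

lemma kB_module_Lam: "kB_module K (Lam K P)"
  unfolding Lam_def by (rule L.kB_module_star)

lemma kB_module_LS: "kB_module K (LS K P)"
  unfolding LS_def by (rule kB_module_conv[OF K L.kB_module_star S.kB_module_star])

lemma LS_ctx: "A \<in> B_obj \<Longrightarrow> conv_ctx K (LamF) (SymF) A"
  by (rule conv_ctxI[OF K L.kB_module_star S.kB_module_star])

lemma star_sp_simp: "kb_sp (star K \<chi> F) = star_sp K \<chi> F"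
  by (simp add: star_def)

lemma LS_sp: "LSV A = conv_sp K (LamF) (SymF) A"
  by (simp add: LS_def conv_def)

lemma vs_LS: "A \<in> B_obj \<Longrightarrow> vectorspace K (LSV A)"
  by (rule kB_module.space[OF kB_module_LS])

lemma decomps2_obj: "A \<in> B_obj \<Longrightarrow> (A1, A2) \<in> decomps2 A \<Longrightarrow> A1 \<in> B_obj \<and> A2 \<in> B_obj"
  using decomps2_bsub bsub_B_obj by blast

text \<open>Combines bilinear extension for exterior and symmetric terms with the universal property
  of the convolution. Terms with factors from zero spaces are still included here;
  \<open>LS_ext\<close> removes them.\<close>

lemma LS_ext0:
  assumes A: "A \<in> B_obj" and W: "vectorspace K W"
    and g1: "\<And>A1 A2 ws. (A1, A2) \<in> decomps2 A \<Longrightarrow> ws \<in> wpow A2 \<Longrightarrow>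
      star_fun K (neg1 K) (op_kB P) A1 W (\<lambda>as. g as ws)"
    and g2: "\<And>A1 A2 as. (A1, A2) \<in> decomps2 A \<Longrightarrow> as \<in> apow A1 \<Longrightarrow>
      star_fun K \<one>\<^bsub>K\<^esub> (delta K P) A2 W (g as)"
  shows "\<exists>\<phi>\<in>module_hom K (LSV A) W. \<forall>A1 A2 as ws. (A1, A2) \<in> decomps2 A \<and>
    as \<in> apow A1 \<and> ws \<in> wpow A2 \<longrightarrow> \<phi> (LST A as ws) = g as ws"
proof -
  have "\<exists>\<beta>. bilin K (LamS A1) (SymS A2) W \<beta> \<and>
    (\<forall>as\<in>apow A1. \<forall>ws\<in>wpow A2.
      \<beta> (lel A1 as) (sel A2 ws) = g as ws)"
    if d: "(A1, A2) \<in> decomps2 A" for A1 A2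
    by (rule star_bilin_ext[OF L.star_ctx_axioms S.star_ctx_axioms _ _ W g1[OF d] g2[OF d]])
      (use decomps2_obj[OF A d] in auto)
  then have "\<exists>\<beta>. (A1, A2) \<in> decomps2 A \<longrightarrow>
    bilin K (LamS A1) (SymS A2) W \<beta> \<and>
    (\<forall>as\<in>apow A1. \<forall>ws\<in>wpow A2.
      \<beta> (lel A1 as) (sel A2 ws) = g as ws)" for A1 A2
    by blast
  then obtain \<beta> where b: "\<And>A1 A2. (A1, A2) \<in> decomps2 A \<longrightarrow>
    bilin K (LamS A1) (SymS A2) W (\<beta> A1 A2) \<and>
    (\<forall>as\<in>apow A1. \<forall>ws\<in>wpow A2.
      \<beta> A1 A2 (lel A1 as) (sel A2 ws) = g as ws)"
    by metis
  obtain \<phi> where p: "\<phi> \<in> module_hom K (LSV A) W"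
    "\<forall>A1 A2 v w. (A1, A2) \<in> decomps2 A \<and> v \<in> carrier (LamS A1) \<and>
      w \<in> carrier (SymS A2) \<longrightarrow>
      \<phi> (cel A (A1, v) (A2, w)) = \<beta> A1 A2 v w"
    using conv_ctx.conv_ext[OF LS_ctx[OF A] W, of \<beta>] b unfolding LS_sp star_sp_simp by blast
  have "\<phi> (LST A as ws) = g as ws"
    if d: "(A1, A2) \<in> decomps2 A" and as: "as \<in> apow A1" and ws: "ws \<in> wpow A2"
    for A1 A2 as ws
  proof -
    have t: "total as = A1" "total ws = A2" using pow_terms_total[OF as] pow_terms_total[OF ws] by simp_all
    have o: "A1 \<in> B_obj" "A2 \<in> B_obj" using decomps2_obj[OF A d] by auto
    have "\<phi> (LST A as ws) = \<beta> A1 A2 (lel A1 as) (sel A2 ws)"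
      unfolding LS_term_def t
      using p(2) d star_funD(1)[OF L.star_elt_fun[OF o(1)] as] star_funD(1)[OF S.star_elt_fun[OF o(2)] ws] by blast
    then show ?thesis using b[of A1 A2] d as ws by simp
  qed
  with p(1) show ?thesis by blast
qed

text \<open>
  In a good term every factor lives in a nonzero component, i.e. no factor of the zero spaces occurs
  that \<open>op_kB\<close> and \<open>delta\<close> have off their supports.
\<close>

definition good_as :: "('a bob \<times> 'v) list \<Rightarrow> bool" where
  "good_as as \<longleftrightarrow> (\<forall>(D, a)\<in>set as. \<exists>S t. D = (S, {t}) \<and> a \<in> carrier (OP S))"

definition good_ws :: "('a bob \<times> 'v set) list \<Rightarrow> bool" where
  "good_ws ws \<longleftrightarrow> (\<forall>(D, w)\<in>set ws. \<exists>S. D = (S, {}) \<and> w \<in> carrier (delta_sp K P S))"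

text \<open>The side conditions of \<open>contr_rule\<close> on a term, collected in one predicate;
  the factor that is to be contracted is one of the entries of \<open>as\<close>.\<close>

definition LSg :: "'a bob \<Rightarrow> ('a bob \<times> 'v) list \<Rightarrow> ('a bob \<times> 'v set) list \<Rightarrow> bool" where
  "LSg A as ws \<longleftrightarrow> A \<in> B_obj \<and> is_decomp (map fst as @ map fst ws) A \<and> good_as as \<and> good_ws ws"

lemma good_simps [simp]:
  "good_as []" "good_as (as @ as') \<longleftrightarrow> good_as as \<and> good_as as'" 
  "good_as (p # as) \<longleftrightarrow> (\<exists>S t a. p = ((S, {t}), a) \<and> a \<in> carrier (OP S)) \<and> good_as as"
  "good_ws []" "good_ws (ws @ ws') \<longleftrightarrow> good_ws ws \<and> good_ws ws'"
  "good_ws (q # ws) \<longleftrightarrow> (\<exists>S w. q = ((S, {}), w) \<and> w \<in> carrier (delta_sp K P S)) \<and> good_ws ws"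
  unfolding good_as_def good_ws_def by (simp_all add: ball_Un split_beta) (metis prod.collapse fst_conv snd_conv)+

lemma LSg_perm: "LSg A as ws \<Longrightarrow> mset as = mset as' \<Longrightarrow> mset ws = mset ws' \<Longrightarrow> LSg A as' ws'"
proof -
  assume g: "LSg A as ws" and m: "mset as = mset as'" "mset ws = mset ws'"
  have "mset (map fst as @ map fst ws) = mset (map fst as' @ map fst ws')" using m by simp
  then have "is_decomp (map fst as' @ map fst ws') A" using g is_decomp_mset unfolding LSg_def by blast
  moreover have "set as = set as'" "set ws = set ws'" using m mset_eq_setD by blast+
  ultimately show ?thesis using g by (simp add: LSg_def good_as_def good_ws_def)
qed

lemma good_carrier:
  "good_as as \<Longrightarrow> (D, a) \<in> set as \<Longrightarrow> a \<in> carrier (kb_sp (op_kB P) D)"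
  "good_ws ws \<Longrightarrow> (E, w) \<in> set ws \<Longrightarrow> w \<in> carrier (kb_sp (delta K P) E)"
  by (auto simp: good_as_def good_ws_def op_kB_sp delta_kB_sp dest!: bspec)

lemma LSg_pow:
  assumes "LSg A as ws"
  shows "(total as, total ws) \<in> decomps2 A" "as \<in> apow (total as)"
    "ws \<in> wpow (total ws)" "total as \<in> B_obj" "total ws \<in> B_obj"
proof -
  note d = assms[unfolded LSg_def is_decomp_append]
  show dd: "(total as, total ws) \<in> decomps2 A" using d by (simp add: decomps2_def)
  show "as \<in> apow (total as)" using d good_carrier(1)[of as] by (auto simp: pow_terms_def)
  show "ws \<in> wpow (total ws)" using d good_carrier(2)[of ws] by (auto simp: pow_terms_def)
  show "total as \<in> B_obj" "total ws \<in> B_obj" using decomps2_obj[OF _ dd] d by auto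
qed

lemma LS_term_closed: assumes g: "LSg A as ws" shows "LST A as ws \<in> carrier (LSV A)"
proof -
  note l = LSg_pow[OF g]
  have A: "A \<in> B_obj" using g by (simp add: LSg_def)
  show ?thesis unfolding LS_term_def LS_sp
    by (rule conv_ctx.conv_elt_closed[OF LS_ctx[OF A] l(1)])
      (use star_funD(1)[OF L.star_elt_fun[OF l(4)] l(2)] star_funD(1)[OF S.star_elt_fun[OF l(5)] l(3)] in
        \<open>simp_all add: star_sp_simp\<close>)
qed

lemma total_slot: "total (l1 @ (D, u) # l2) = total (l1 @ (D, v) # l2)"
  by (simp add: total_def)

lemma LS_term_slot_gen:
  assumes A: "A \<in> B_obj" and d: "(A1, total ws) \<in> decomps2 A" "total (l1 @ (D, a) # l2) = A1"
    and as: "l1 @ (D, a) # l2 \<in> apow A1" and ws: "ws \<in> wpow (total ws)"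
  shows "(\<lambda>u. LST A (l1 @ (D, u) # l2) ws) \<in> module_hom K (kb_sp (op_kB P) D) (LSV A)"
proof -
  have o: "A1 \<in> B_obj" "total ws \<in> B_obj" using decomps2_obj[OF A d(1)] by auto
  have t: "total (l1 @ (D, u) # l2) = A1" for u using d(2) total_slot by metis
  have "sel (total ws) ws \<in> carrier (kb_sp (SymF) (total ws))"
    using star_funD(1)[OF S.star_elt_fun[OF o(2)] ws] by (simp add: star_sp_simp)
  then have "(\<lambda>v. cel A (A1, v)
      (total ws, sel (total ws) ws))
      \<in> module_hom K (LamS A1) (LSV A)"
    using conv_ctx.conv_elt_bilin[OF LS_ctx[OF A] d(1)] unfolding bilin_def LS_sp star_sp_simp by blast
  from hom_comp[OF star_funD(2)[OF L.star_elt_fun[OF o(1)] as] this]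
  show ?thesis unfolding LS_term_def t .
qed

lemma LS_term_slot_w_gen:
  assumes A: "A \<in> B_obj" and d: "(total as, A2) \<in> decomps2 A" "total (l1 @ (D, w) # l2) = A2"
    and as: "as \<in> apow (total as)" and ws: "l1 @ (D, w) # l2 \<in> wpow A2"
  shows "(\<lambda>u. LST A as (l1 @ (D, u) # l2)) \<in> module_hom K (kb_sp (delta K P) D) (LSV A)"
proof -
  have o: "total as \<in> B_obj" "A2 \<in> B_obj" using decomps2_obj[OF A d(1)] by auto
  have t: "total (l1 @ (D, u) # l2) = A2" for u using d(2) total_slot by metis
  have "lel (total as) as \<in> carrier (kb_sp (LamF) (total as))"
    using star_funD(1)[OF L.star_elt_fun[OF o(1)] as] by (simp add: star_sp_simp)
  then have "(\<lambda>v. cel A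
      (total as, lel (total as) as) (A2, v))
      \<in> module_hom K (SymS A2) (LSV A)"
    using conv_ctx.conv_elt_bilin[OF LS_ctx[OF A] d(1)] unfolding bilin_def LS_sp star_sp_simp by blast
  from hom_comp[OF star_funD(2)[OF S.star_elt_fun[OF o(2)] ws] this]
  show ?thesis unfolding LS_term_def t .
qed

lemma LS_term_slot:
  assumes g: "LSg A (l1 @ ((S, {t}), a) # l2) ws"
  shows "(\<lambda>u. LST A (l1 @ ((S, {t}), u) # l2) ws) \<in> module_hom K (OP S) (LSV A)"
  using LS_term_slot_gen[OF _ LSg_pow(1)[OF g] refl LSg_pow(2,3)[OF g]] g by (simp add: LSg_def op_kB_sp)

lemma LS_term_slot_w:
  assumes g: "LSg A as (l1 @ ((S, {}), w) # l2)"
  shows "(\<lambda>u. LST A as (l1 @ ((S, {}), u) # l2)) \<in> module_hom K (delta_sp K P S) (LSV A)"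
  using LS_term_slot_w_gen[OF _ LSg_pow(1)[OF g] refl LSg_pow(2,3)[OF g]] g by (simp add: LSg_def delta_kB_sp)

lemma LS_term_swap:
  assumes g: "LSg A (l1 @ p # q # l2) ws"
  shows "LST A (l1 @ q # p # l2) ws = neg1 K \<odot>\<^bsub>LSV A\<^esub> LST A (l1 @ p # q # l2) ws"
proof -
  note l = LSg_pow[OF g]
  have A: "A \<in> B_obj" using g by (simp add: LSg_def)
  let ?A1 = "total (l1 @ p # q # l2)"
  have t: "total (l1 @ q # p # l2) = ?A1" by (rule total_perm) simp
  have c: "neg1 K \<in> carrier K" using perm_char_sgn[OF K] by (simp add: perm_char_def)
  have "sel (total ws) ws \<in> carrier (kb_sp (SymF) (total ws))"
    using star_funD(1)[OF S.star_elt_fun[OF l(5)] l(3)] by (simp add: star_sp_simp)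
  then have h: "(\<lambda>v. cel A (?A1, v)
      (total ws, sel (total ws) ws))
      \<in> module_hom K (LamS ?A1) (LSV A)"
    using conv_ctx.conv_elt_bilin[OF LS_ctx[OF A] l(1)] unfolding bilin_def LS_sp star_sp_simp by blast
  show ?thesis unfolding LS_term_def t star_funD(3)[OF L.star_elt_fun[OF l(4)] l(2)]
    by (rule module_hom_smult[OF h c star_funD(1)[OF L.star_elt_fun[OF l(4)] l(2)]])
qed

lemma LS_term_swap_w:
  assumes g: "LSg A as (l1 @ p # q # l2)"
  shows "LST A as (l1 @ q # p # l2) = LST A as (l1 @ p # q # l2)"
proof -
  note l = LSg_pow[OF g]
  let ?A2 = "total (l1 @ p # q # l2)"
  have t: "total (l1 @ q # p # l2) = ?A2" by (rule total_perm) simp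
  have vs: "vectorspace K (SymS ?A2)" by (rule S.vs_star[OF l(5)])
  have "\<one>\<^bsub>K\<^esub> \<odot>\<^bsub>SymS ?A2\<^esub> sel ?A2 (l1 @ p # q # l2)
      = sel ?A2 (l1 @ p # q # l2)"
    using vs star_funD(1)[OF S.star_elt_fun[OF l(5)] l(3)] by (simp add: vectorspace_def module.smult_one)
  then show ?thesis unfolding LS_term_def t star_funD(3)[OF S.star_elt_fun[OF l(5)] l(3)] by simp
qed

lemma card_Suc0_iff: "card (snd D) = 1 \<longleftrightarrow> (\<exists>S t. D = (S, {t}))"
  by (cases D) (auto simp: card_1_singleton_iff)

text \<open>Maps out of the convolution may be defined on good terms alone. The conditions on slots
  and neighbours survive extension by zero, because the shape of the blocks decides whether a term
  made of vectors of the right spaces is good.\<close>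

lemma LS_ext:
  fixes W :: "('k, 'w) module"
  assumes A: "A \<in> B_obj" and W: "vectorspace K W"
    and cl: "\<And>as ws. LSg A as ws \<Longrightarrow> g as ws \<in> carrier W"
    and sa: "\<And>l1 S t a l2 ws. LSg A (l1 @ ((S, {t}), a) # l2) ws \<Longrightarrow>
      (\<lambda>u. g (l1 @ ((S, {t}), u) # l2) ws) \<in> module_hom K (OP S) W"
    and sw: "\<And>as l1 S w l2. LSg A as (l1 @ ((S, {}), w) # l2) \<Longrightarrow>
      (\<lambda>u. g as (l1 @ ((S, {}), u) # l2)) \<in> module_hom K (delta_sp K P S) W"
    and ta: "\<And>l1 p q l2 ws. LSg A (l1 @ p # q # l2) ws \<Longrightarrow>
      g (l1 @ q # p # l2) ws = neg1 K \<odot>\<^bsub>W\<^esub> g (l1 @ p # q # l2) ws"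
    and tw: "\<And>as l1 p q l2. LSg A as (l1 @ p # q # l2) \<Longrightarrow> g as (l1 @ q # p # l2) = g as (l1 @ p # q # l2)"
  shows "\<exists>\<phi>\<in>module_hom K (LSV A) W. \<forall>as ws. LSg A as ws \<longrightarrow> \<phi> (LST A as ws) = g as ws"
proof -
  interpret W: vectorspace K W by fact
  \<comment> \<open>Extension by zero to terms with a factor off the support; such terms vanish in
    the convolution anyway.\<close>
  define g' where "g' as ws = (if good_as as \<and> good_ws ws then g as ws else \<zero>\<^bsub>W\<^esub>)" for as ws
  have m1: "neg1 K \<in> carrier K" by simp
  have lsg: "LSg A as ws" if "(A1, A2) \<in> decomps2 A" "as \<in> apow A1" "ws \<in> wpow A2"
    "good_as as" "good_ws ws" for A1 A2 as ws
  proof -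
    have "total as = A1" "total ws = A2" using pow_terms_total[OF that(2)] pow_terms_total[OF that(3)] by simp_all
    then show ?thesis using that A by (simp add: LSg_def is_decomp_append pow_terms_def decomps2_def)
  qed
  have g'c: "g' as ws \<in> carrier W" if "(A1, A2) \<in> decomps2 A" "as \<in> apow A1" "ws \<in> wpow A2" for A1 A2 as ws
    using cl[OF lsg[OF that]] by (simp add: g'_def)
  have "\<exists>\<phi>\<in>module_hom K (LSV A) W. \<forall>A1 A2 as ws. (A1, A2) \<in> decomps2 A \<and>
    as \<in> apow A1 \<and> ws \<in> wpow A2 \<longrightarrow> \<phi> (LST A as ws) = g' as ws"
  proof (rule LS_ext0[OF A W])
    fix A1 A2 ws assume d: "(A1, A2) \<in> decomps2 A" and ws: "ws \<in> wpow A2"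
    show "star_fun K (neg1 K) (op_kB P) A1 W (\<lambda>as. g' as ws)" unfolding star_fun_def
    proof (intro conjI ballI allI impI)
      fix as assume "as \<in> apow A1" then show "g' as ws \<in> carrier W" by (rule g'c[OF d _ ws])
    next
      fix l1 D a l2 assume as: "l1 @ (D, a) # l2 \<in> apow A1"
      have vD: "vectorspace K (kb_sp (op_kB P) D)"
        by (rule L.vs_F[OF is_decomp_bsub]) (use as decomps2_obj[OF A d] in \<open>auto simp: pow_terms_def\<close>)
      show "(\<lambda>u. g' (l1 @ (D, u) # l2) ws) \<in> module_hom K (kb_sp (op_kB P) D) W"
      proof (cases "good_as l1 \<and> good_as l2 \<and> good_ws ws \<and> card (snd D) = 1")
        case False
        then have "(\<lambda>u. g' (l1 @ (D, u) # l2) ws) = (\<lambda>u. \<zero>\<^bsub>W\<^esub>)"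
          by (auto simp: g'_def fun_eq_iff card_Suc0_iff)
        then show ?thesis using hom_const_zero[OF W] by simp
      next
        case True
        then obtain S t where D: "D = (S, {t})" unfolding card_Suc0_iff by blast
        have sp: "kb_sp (op_kB P) D = OP S" by (simp add: D op_kB_sp)
        have "good_as (l1 @ (D, a) # l2)" using True as by (auto simp: D pow_terms_def op_kB_sp)
        then have "LSg A (l1 @ ((S, {t}), a) # l2) ws" using lsg[OF d as ws] True by (simp add: D)
        from sa[OF this] show ?thesis unfolding sp
          by (rule hom_cong[OF vD[unfolded sp]]) (use True in \<open>simp add: g'_def D\<close>)
      qed
    next
      fix l1 p q l2 assume as: "l1 @ p # q # l2 \<in> apow A1"
      show "g' (l1 @ q # p # l2) ws = neg1 K \<odot>\<^bsub>W\<^esub> g' (l1 @ p # q # l2) ws"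
      proof (cases "good_as (l1 @ p # q # l2) \<and> good_ws ws")
        case True
        then show ?thesis using ta[OF lsg[OF d as ws]] by (auto simp: g'_def)
      next
        case False
        then have "g' (l1 @ q # p # l2) ws = \<zero>\<^bsub>W\<^esub>" "g' (l1 @ p # q # l2) ws = \<zero>\<^bsub>W\<^esub>"
          unfolding g'_def good_simps by (simp_all only: if_False) auto
        then show ?thesis using W.rmult_0[OF m1] by simp
      qed
    qed
  next
    fix A1 A2 as assume d: "(A1, A2) \<in> decomps2 A" and as: "as \<in> apow A1"
    show "star_fun K \<one>\<^bsub>K\<^esub> (delta K P) A2 W (g' as)" unfolding star_fun_def
    proof (intro conjI ballI allI impI)
      fix ws assume "ws \<in> wpow A2" then show "g' as ws \<in> carrier W" by (rule g'c[OF d as])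
    next
      fix l1 D w l2 assume ws: "l1 @ (D, w) # l2 \<in> wpow A2"
      have vD: "vectorspace K (kb_sp (delta K P) D)"
        by (rule S.vs_F[OF is_decomp_bsub]) (use ws decomps2_obj[OF A d] in \<open>auto simp: pow_terms_def\<close>)
      show "(\<lambda>u. g' as (l1 @ (D, u) # l2)) \<in> module_hom K (kb_sp (delta K P) D) W"
      proof (cases "good_ws l1 \<and> good_ws l2 \<and> good_as as \<and> snd D = {}")
        case False
        then have "(\<lambda>u. g' as (l1 @ (D, u) # l2)) = (\<lambda>u. \<zero>\<^bsub>W\<^esub>)"
          by (auto simp: g'_def fun_eq_iff)
        then show ?thesis using hom_const_zero[OF W] by simp
      next
        case True
        then obtain S where D: "D = (S, {})" by (cases D) auto
        have sp: "kb_sp (delta K P) D = delta_sp K P S" by (simp add: D delta_kB_sp)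
        have "good_ws (l1 @ (D, w) # l2)" using True ws by (auto simp: D pow_terms_def delta_kB_sp)
        then have "LSg A as (l1 @ ((S, {}), w) # l2)" using lsg[OF d as ws] True by (simp add: D)
        from sw[OF this] show ?thesis unfolding sp
          by (rule hom_cong[OF vD[unfolded sp]]) (use True in \<open>simp add: g'_def D\<close>)
      qed
    next
      fix l1 p q l2 assume ws: "l1 @ p # q # l2 \<in> wpow A2"
      have c: "g' as (l1 @ p # q # l2) \<in> carrier W" by (rule g'c[OF d as ws])
      have "g' as (l1 @ q # p # l2) = g' as (l1 @ p # q # l2)"
      proof (cases "good_ws (l1 @ p # q # l2) \<and> good_as as")
        case True
        then show ?thesis using tw[OF lsg[OF d as ws]] by (auto simp: g'_def)
      next
        case False
        then show ?thesis unfolding g'_def good_simps by auto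
      qed
      then show "g' as (l1 @ q # p # l2) = \<one>\<^bsub>K\<^esub> \<odot>\<^bsub>W\<^esub> g' as (l1 @ p # q # l2)" using W.smult_one[OF c] by simp
    qed
  qed
  then obtain \<phi> where p: "\<phi> \<in> module_hom K (LSV A) W"
    "\<And>A1 A2 as ws. (A1, A2) \<in> decomps2 A \<Longrightarrow> as \<in> apow A1 \<Longrightarrow> ws \<in> wpow A2 \<Longrightarrow>
      \<phi> (LST A as ws) = g' as ws" by blast
  have "\<phi> (LST A as ws) = g as ws" if "LSg A as ws" for as ws
    using p(2)[OF LSg_pow(1-3)[OF that]] that by (simp add: g'_def LSg_def)
  with p(1) show ?thesis by blast
qed

text \<open>A factor off the support lies in a zero space, hence is zero, and the term is linear in
  that slot.\<close>

lemma LS_term_bad_zero: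
  assumes A: "A \<in> B_obj" and d: "(A1, A2) \<in> decomps2 A"
    and as: "as \<in> apow A1" and ws: "ws \<in> wpow A2"
    and bad: "\<not> (good_as as \<and> good_ws ws)"
  shows "LST A as ws = \<zero>\<^bsub>LSV A\<^esub>"
proof -
  have t: "total as = A1" "total ws = A2" using pow_terms_total[OF as] pow_terms_total[OF ws] by simp_all
  have o: "A1 \<in> B_obj" "A2 \<in> B_obj" using decomps2_obj[OF A d] by auto
  show ?thesis
  proof (cases "good_as as")
    case False
    then obtain D a where Da: "(D, a) \<in> set as" "\<nexists>S t. D = (S, {t}) \<and> a \<in> carrier (OP S)"
      by (auto simp: good_as_def)
    then obtain l1 l2 where sp: "as = l1 @ (D, a) # l2" using split_list by metis
    note m = pow_terms_memD[OF as Da(1)]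
    have "card (snd D) \<noteq> 1"
    proof
      assume "card (snd D) = 1"
      then obtain S t where "D = (S, {t})" unfolding card_Suc0_iff by blast
      then show False using Da(2) m by (simp add: op_kB_sp)
    qed
    then have "a = \<zero>\<^bsub>kb_sp (op_kB P) D\<^esub>" using m by (cases D) (simp add: op_kB_sp zero_space_def)
    then show ?thesis
      using hom_zero[OF L.vs_F[OF conjunct1[OF m] o(1)] vs_LS[OF A] LS_term_slot_gen[OF A, of A1 ws l1 D a l2]]
        d t as ws unfolding sp by simp
  next
    case True
    then obtain D w where Da: "(D, w) \<in> set ws" "\<nexists>S. D = (S, {}) \<and> w \<in> carrier (delta_sp K P S)"
      using bad by (auto simp: good_ws_def)
    then obtain l1 l2 where sp: "ws = l1 @ (D, w) # l2" using split_list by metis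
    note m = pow_terms_memD[OF ws Da(1)]
    have "snd D \<noteq> {}" using Da(2) m by (cases D) (auto simp: delta_kB_sp)
    then have "w = \<zero>\<^bsub>kb_sp (delta K P) D\<^esub>" using m by (cases D) (simp add: delta_kB_sp zero_space_def)
    then show ?thesis
      using hom_zero[OF S.vs_F[OF conjunct1[OF m] o(2)] vs_LS[OF A] LS_term_slot_w_gen[OF A, of as A2 l1 D w l2]]
        d t as ws unfolding sp by simp
  qed
qed

text \<open>Products of generators of the two powers are terms; those that are not good vanish and
  can be omitted.\<close>

lemma spanning_LS:
  assumes A: "A \<in> B_obj"
  shows "spanning K (LSV A) {LST A as ws |as ws. LSg A as ws}"
proof -
  let ?E = "{LST A as ws |as ws. LSg A as ws}"
  have "spanning K (conv_sp K (LamF) (SymF) A)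
    {cel A (A1, v) (A2, w) |A1 v A2 w.
      (A1, A2) \<in> decomps2 A \<and> v \<in> lel A1 ` apow A1 \<and>
      w \<in> sel A2 ` wpow A2}" (is "spanning K _ ?D")
    by (rule conv_ctx.spanning_conv_gen[OF LS_ctx[OF A]])
      (use L.spanning_star S.spanning_star bsub_B_obj[OF _ A] in \<open>auto simp: star_sp_simp\<close>)
  then show ?thesis unfolding LS_sp[symmetric]
  proof (rule spanning_trans)
    show "?E \<subseteq> carrier (LSV A)" using LS_term_closed by blast
    show "?D \<subseteq> lspan K (LSV A) ?E"
    proof
      fix x assume "x \<in> ?D"
      then obtain A1 A2 as ws where *: "(A1, A2) \<in> decomps2 A" "as \<in> apow A1" "ws \<in> wpow A2"
        "x = cel A
          (A1, lel A1 as) (A2, sel A2 ws)" by blast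
      have t: "total as = A1" "total ws = A2" using pow_terms_total[OF *(2)] pow_terms_total[OF *(3)] by simp_all
      have x: "x = LST A as ws" by (simp add: *(4) LS_term_def t)
      show "x \<in> lspan K (LSV A) ?E"
      proof (cases "good_as as \<and> good_ws ws")
        case True
        then have "LSg A as ws" using *(1-3) A t by (simp add: LSg_def is_decomp_append pow_terms_def decomps2_def)
        then show ?thesis unfolding x by (blast intro: lspan.gen)
      next
        case False
        show ?thesis unfolding x LS_term_bad_zero[OF A *(1-3) False] by (rule lspan.zero)
      qed
    qed
  qed
qed

subsection \<open>Transport of terms\<close>

lemma transport_restrict:
  "bsub D A1 \<Longrightarrow> transport F (B_restrict h A1) (D, v) = transport F h (D, v)"
proof -
  assume D: "bsub D A1"
  have "B_image (B_restrict h A1) D = B_image h D" "B_restrict (B_restrict h A1) D = B_restrict h D"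
    using D by (auto simp: B_image_def B_restrict_def bsub_def prod_eq_iff image_iff restrict_def fun_eq_iff subset_iff)
  then show ?thesis by (simp add: transport_def)
qed

text \<open>The convolution transports each half by a restriction of \<open>h\<close>, and each
  power restricts once more to the single blocks. Restricting twice is restricting once, so
  \<open>h\<close> itself may be used on every factor.\<close>

lemma LS_act_gen:
  assumes A: "A \<in> B_obj" and B: "B \<in> B_obj" and h: "h \<in> B_hom A B" and d: "(A1, A2) \<in> decomps2 A"
    and as: "as \<in> apow A1" and ws: "ws \<in> wpow A2"
  shows "kb_act (LS K P) A B h (LST A as ws) =
    LST B (map (atr h) as) (map (wtr h) ws)"
proof -
  have t: "total as = A1" "total ws = A2" using pow_terms_total[OF as] pow_terms_total[OF ws] by simp_all
  have o: "A1 \<in> B_obj" "A2 \<in> B_obj" using decomps2_obj[OF A d] by auto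
  have s: "bsub A1 A" "bsub A2 A" using decomps2_bsub[OF d] by auto
  note r1 = B_hom_bsub[OF h s(1)] and r2 = B_hom_bsub[OF h s(2)]
  note i1 = bsub_B_obj[OF r1(2) B] and i2 = bsub_B_obj[OF r2(2) B]
  have e1: "map (atr (B_restrict h A1)) as = map (atr h) as"
    by (rule map_cong[OF refl]) (metis pow_terms_memD[OF as] transport_restrict surj_pair)
  have e2: "map (wtr (B_restrict h A2)) ws = map (wtr h) ws"
    by (rule map_cong[OF refl]) (metis pow_terms_memD[OF ws] transport_restrict surj_pair)
  have t1: "total (map (atr h) as) = B_image h A1"
    using pow_terms_total[OF transport_pow_terms[OF op_kB_module o(1) i1 r1(1) as]] unfolding e1 .
  have t2: "total (map (wtr h) ws) = B_image h A2"
    using pow_terms_total[OF transport_pow_terms[OF delta_kB_module o(2) i2 r2(1) ws]] unfolding e2 .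
  have T1: "transport (LamF) h (A1, lel A1 as) =
      (B_image h A1, lel (B_image h A1) (map (atr h) as))"
    unfolding transport_def[of "LamF"] split L.star_act(2)[OF o(1) i1 r1(1) as] e1 ..
  have T2: "transport (SymF) h (A2, sel A2 ws) =
      (B_image h A2, sel (B_image h A2) (map (wtr h) ws))"
    unfolding transport_def[of "SymF"] split S.star_act(2)[OF o(2) i2 r2(1) ws] e2 ..
  have c1: "lel A1 as \<in> carrier (kb_sp (LamF) A1)"
    using star_funD(1)[OF L.star_elt_fun[OF o(1)] as] by (simp add: star_sp_simp)
  have c2: "sel A2 ws \<in> carrier (kb_sp (SymF) A2)"
    using star_funD(1)[OF S.star_elt_fun[OF o(2)] ws] by (simp add: star_sp_simp)
  show ?thesis
    unfolding LS_term_def t t1 t2 unfolding LS_def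
      conv_act(2)[OF K L.kB_module_star S.kB_module_star A B h d c1 c2] T1 T2 ..
qed

lemma LS_act:
  "A \<in> B_obj \<Longrightarrow> B \<in> B_obj \<Longrightarrow> h \<in> B_hom A B \<Longrightarrow> LSg A as ws \<Longrightarrow>
    kb_act (LS K P) A B h (LST A as ws) =
    LST B (map (atr h) as) (map (wtr h) ws)"
  by (rule LS_act_gen[OF _ _ _ LSg_pow(1-3)])

lemma transport_op:
  assumes "h \<in> B_hom A B" "bsub (S, {t}) A"
  shows "atr h ((S, {t}), a) = ((fst h ` S, {snd h t}), ract (fst h) S a)"
proof -
  have "B_restrict h (S, {t}) \<in> B_hom (S, {t}) (fst h ` S, {snd h t})"
    using B_hom_bsub(1)[OF assms] by (simp add: B_image_def)
  from op_kB_act[OF this] have "kb_act (op_kB P) (S, {t}) (fst h ` S, {snd h t}) (B_restrict h (S, {t})) a = ract (fst h) S a"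
    using ract_cong[of S "fst (B_restrict h (S, {t}))" "fst h" a] by (simp add: B_restrict_def)
  then show ?thesis by (simp add: transport_def B_image_def)
qed

lemma transport_delta:
  assumes "h \<in> B_hom A B" "bsub (S, {}) A"
  shows "wtr h ((S, {}), w) = ((fst h ` S, {}), dact (fst h) S w)"
proof -
  have "B_restrict h (S, {}) \<in> B_hom (S, {}) (fst h ` S, {})"
    using B_hom_bsub(1)[OF assms] by (simp add: B_image_def)
  from delta_kB_act[OF this] have "kb_act (delta K P) (S, {}) (fst h ` S, {}) (B_restrict h (S, {})) w = dact (fst h) S w"
    using dact_cong[of S "fst (B_restrict h (S, {}))" "fst h"] by (simp add: B_restrict_def)
  then show ?thesis by (simp add: transport_def B_image_def)
qed

end

section \<open>The contraction\<close>

definition ins_blk :: "'a \<Rightarrow> 'a set \<Rightarrow> 'a bob \<Rightarrow> 'a bob" where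
  "ins_blk x Z D = (if x \<in> fst D then ((fst D - {x}) \<union> Z, snd D) else D)"

lemma is_decomp_contr:
  assumes d: "is_decomp (Ds @ [(Z, {y})]) (insert x X, insert y Y)" and n: "x \<notin> X" "y \<notin> Y"
  shows "x \<in> Z \<Longrightarrow> is_decomp ((Z - {x}, {}) # Ds) (X, Y)"
    "x \<notin> Z \<Longrightarrow> is_decomp (map (ins_blk x Z) Ds) (X, Y)"
proof -
  have d': "(\<Union>D\<in>set (Ds @ [(Z, {y})]). fst D) = insert x X" "(\<Union>D\<in>set (Ds @ [(Z, {y})]). snd D) = insert y Y"
    "sorted_wrt bdisj (Ds @ [(Z, {y})])"
    using d unfolding is_decomp_iff fst_conv snd_conv by blast+
  have u: "(\<Union>D\<in>set Ds. fst D) \<union> Z = insert x X" "(\<Union>D\<in>set Ds. snd D) \<union> {y} = insert y Y"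
    unfolding d'(1,2)[symmetric] by auto
  have s: "sorted_wrt bdisj Ds" and z: "\<And>D. D \<in> set Ds \<Longrightarrow> fst D \<inter> Z = {}" "\<And>D. D \<in> set Ds \<Longrightarrow> y \<notin> snd D"
    using d'(3) by (auto simp: sorted_wrt_append bdisj_def)
  have *: "A = B" if "A \<union> {v} = insert v B" "v \<notin> A" "v \<notin> B" for A B :: "'a set" and v using that by (simp add: insert_ident)
  have uy: "(\<Union>D\<in>set Ds. snd D) = Y" by (rule *[OF u(2) _ n(2)]) (use z(2) in blast)
  show "is_decomp ((Z - {x}, {}) # Ds) (X, Y)" if x: "x \<in> Z"
  proof -
    have "(Z - {x}) \<union> (\<Union>D\<in>set Ds. fst D) = ((\<Union>D\<in>set Ds. fst D) \<union> Z) - {x}" using x z(1) by auto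
    then have "(Z - {x}) \<union> (\<Union>D\<in>set Ds. fst D) = X" unfolding u(1) using n(1) by simp
    moreover have "\<forall>D\<in>set Ds. bdisj (Z - {x}, {}) D" using z(1) by (auto simp: bdisj_def)
    ultimately show ?thesis using s uy by (simp add: is_decomp_iff)
  qed
  show "is_decomp (map (ins_blk x Z) Ds) (X, Y)" if x: "x \<notin> Z"
  proof -
    have "x \<in> (\<Union>D\<in>set Ds. fst D) \<union> Z" unfolding u(1) by simp
    then obtain D0 where D0: "D0 \<in> set Ds" "x \<in> fst D0" using x by blast
    have "(\<Union>D\<in>set Ds. fst (ins_blk x Z D)) = X"
    proof (intro equalityI subsetI)
      fix v assume "v \<in> (\<Union>D\<in>set Ds. fst (ins_blk x Z D))"
      then have "v \<in> (\<Union>D\<in>set Ds. fst D) \<union> Z" "v \<noteq> x" using x by (auto simp: ins_blk_def split: if_splits)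
      then show "v \<in> X" unfolding u(1) by simp
    next
      fix v assume v: "v \<in> X"
      show "v \<in> (\<Union>D\<in>set Ds. fst (ins_blk x Z D))"
      proof (cases "v \<in> Z")
        case True
        then have "v \<in> fst (ins_blk x Z D0)" using D0 by (simp add: ins_blk_def)
        then show ?thesis using D0 by blast
      next
        case False
        have "v \<in> (\<Union>D\<in>set Ds. fst D) \<union> Z" unfolding u(1) using v by simp
        with False obtain D where D: "D \<in> set Ds" "v \<in> fst D" by blast
        then have "v \<in> fst (ins_blk x Z D)" using v n(1) by (auto simp: ins_blk_def)
        then show ?thesis using D by blast
      qed
    qed
    moreover have "sorted_wrt (\<lambda>D E. bdisj (ins_blk x Z D) (ins_blk x Z E)) Ds"
    proof (rule sorted_wrt_mono_rel[OF _ s])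
      fix D E assume "D \<in> set Ds" "E \<in> set Ds" "bdisj D E"
      then show "bdisj (ins_blk x Z D) (ins_blk x Z E)"
        using z(1)[of D] z(1)[of E] by (auto simp: ins_blk_def bdisj_def)
    qed
    moreover have "snd (ins_blk x Z D) = snd D" for D by (simp add: ins_blk_def)
    ultimately show ?thesis using uy by (simp add: is_decomp_iff sorted_wrt_map)
  qed
qed

lemma sorted_bdisj_mid:
  "sorted_wrt bdisj (L @ D # R) \<Longrightarrow> x \<in> fst D \<Longrightarrow> E \<in> set L \<union> set R \<Longrightarrow> x \<notin> fst E"
  by (auto simp: sorted_wrt_append bdisj_def)

context op_ctx
begin

text \<open>Written so that it may be mapped over all factors: only the factor with \<open>x\<close>
  among its inputs changes. The position of that factor never has to be computed.\<close>

definition ins_a :: "'a \<Rightarrow> 'a set \<Rightarrow> 'v \<Rightarrow> 'a bob \<times> 'v \<Rightarrow> 'a bob \<times> 'v" where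
  "ins_a x Z b p = (ins_blk x Z (fst p), if x \<in> fst (fst p) then oc (fst (fst p)) x Z (snd p) b else snd p)"

definition ins_w :: "'a \<Rightarrow> 'a set \<Rightarrow> 'v \<Rightarrow> 'a bob \<times> 'v set \<Rightarrow> 'a bob \<times> 'v set" where
  "ins_w x Z b q = (ins_blk x Z (fst q), if x \<in> fst (fst q) then delta_act K P (fst (fst q)) x Z (snd q) b else snd q)"

text \<open>The right-hand side of the contraction rule at \<open>A\<close>, for a factor \<open>b\<close> on \<open>Z\<close> in last position.\<close>

definition contr_val :: "'a bob \<Rightarrow> 'a \<Rightarrow> 'a set \<Rightarrow> 'v \<Rightarrow> ('a bob \<times> 'v) list \<Rightarrow> ('a bob \<times> 'v set) list
    \<Rightarrow> ('a, 'k, ('a, 'k, 'v) star, ('a, 'k, 'v set) star) cnv" where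
  "contr_val A x Z b as ws =
    (if x \<in> Z then LST A as (((Z - {x}, {}), delta_mark K P Z x b) # ws)
     else LST A (map (ins_a x Z b) as) (map (ins_w x Z b) ws))"

text \<open>The factor \<open>b\<close> is kept apart from \<open>as\<close>, which lists what is
  left over after its removal; the term itself has \<open>b\<close> in last position.\<close>

definition ctr :: "'a set \<Rightarrow> 'a set \<Rightarrow> 'a \<Rightarrow> 'a \<Rightarrow> ('a bob \<times> 'v) list \<Rightarrow> 'a set \<Rightarrow> 'v \<Rightarrow> ('a bob \<times> 'v set) list \<Rightarrow> bool" where
  "ctr X Y x y as Z b ws \<longleftrightarrow> x \<notin> X \<and> y \<notin> Y \<and> LSg (insert x X, insert y Y) (as @ [((Z, {y}), b)]) ws"

lemma ctrI:
  "x \<notin> X \<Longrightarrow> y \<notin> Y \<Longrightarrow> LSg (insert x X, insert y Y) (l1 @ ((Z, {y}), b) # l2) ws \<Longrightarrow> ctr X Y x y (l1 @ l2) Z b ws"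
  unfolding ctr_def by (intro conjI) (auto elim: LSg_perm)

lemma ctr_basic:
  assumes "ctr X Y x y as Z b ws"
  shows "finite X" "finite Y" "x \<notin> X" "y \<notin> Y" "finite Z" "b \<in> carrier (OP Z)" "(X, Y) \<in> B_obj" "Z \<subseteq> insert x X"
    "good_as as" "good_ws ws" "is_decomp ((map fst as @ map fst ws) @ [(Z, {y})]) (insert x X, insert y Y)"
proof -
  have g: "x \<notin> X" "y \<notin> Y" "finite X" "finite Y" "is_decomp (map fst (as @ [((Z, {y}), b)]) @ map fst ws) (insert x X, insert y Y)"
      "good_as (as @ [((Z, {y}), b)])" "good_ws ws"
    using assms by (auto simp: ctr_def LSg_def B_obj_def)
  show d: "is_decomp ((map fst as @ map fst ws) @ [(Z, {y})]) (insert x X, insert y Y)"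
    by (rule is_decomp_mset[OF _ g(5)]) simp
  show Z: "Z \<subseteq> insert x X" using d by (auto simp: is_decomp_iff)
  show "finite Z" by (rule finite_subset[OF Z]) (simp add: g)
  show "finite X" "finite Y" "x \<notin> X" "y \<notin> Y" "b \<in> carrier (OP Z)" "(X, Y) \<in> B_obj" "good_as as" "good_ws ws"
    using g by (auto simp: B_obj_def)
qed

lemma ctr_a:
  assumes c: "ctr X Y x y as Z b ws" and p: "((S, T), a) \<in> set as"
  shows "finite S" "S \<inter> Z = {}" "y \<notin> T" "S \<subseteq> insert x X" "a \<in> carrier (OP S)" "\<exists>t. T = {t}" "x \<in> S \<Longrightarrow> okc S x Z"
proof -
  note b = ctr_basic[OF c]
  have m: "(S, T) \<in> set (map fst as @ map fst ws)" using p by force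
  have "\<forall>D\<in>set (map fst as @ map fst ws). bdisj D (Z, {y})"
    using b(11) unfolding is_decomp_iff sorted_wrt_append by simp
  moreover have "bsub (S, T) (insert x X, insert y Y)" by (rule is_decomp_bsub[OF b(11)]) (use m in auto)
  ultimately show s: "S \<inter> Z = {}" "y \<notin> T" "S \<subseteq> insert x X" using bspec[OF _ m, of "\<lambda>D. bdisj D (Z, {y})"] by (simp_all add: bdisj_def bsub_def)
  show f: "finite S" by (rule finite_subset[OF s(3)]) (simp add: b)
  show "a \<in> carrier (OP S)" "\<exists>t. T = {t}" using b(9) p unfolding good_as_def by blast+
  show "x \<in> S \<Longrightarrow> okc S x Z" using s f b by (auto simp: okc_def)
qed

lemma ctr_w:
  assumes c: "ctr X Y x y as Z b ws" and p: "((S, T), w) \<in> set ws"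
  shows "finite S" "S \<inter> Z = {}" "S \<subseteq> insert x X" "w \<in> carrier (delta_sp K P S)" "T = {}" "x \<in> S \<Longrightarrow> okc S x Z"
proof -
  note b = ctr_basic[OF c]
  have m: "(S, T) \<in> set (map fst as @ map fst ws)" using p by force
  have "\<forall>D\<in>set (map fst as @ map fst ws). bdisj D (Z, {y})"
    using b(11) unfolding is_decomp_iff sorted_wrt_append by simp
  moreover have "bsub (S, T) (insert x X, insert y Y)" by (rule is_decomp_bsub[OF b(11)]) (use m in auto)
  ultimately show s: "S \<inter> Z = {}" "S \<subseteq> insert x X" using bspec[OF _ m, of "\<lambda>D. bdisj D (Z, {y})"] by (simp_all add: bdisj_def bsub_def)
  show f: "finite S" by (rule finite_subset[OF s(2)]) (simp add: b)
  show "w \<in> carrier (delta_sp K P S)" "T = {}" using b(10) p unfolding good_ws_def by blast+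
  show "x \<in> S \<Longrightarrow> okc S x Z" using s f b by (auto simp: okc_def)
qed

lemma ins_simps:
  "x \<in> S \<Longrightarrow> ins_a x Z b ((S, T), a) = (((S - {x}) \<union> Z, T), oc S x Z a b)"
  "x \<notin> S \<Longrightarrow> ins_a x Z b ((S, T), a) = ((S, T), a)"
  "x \<in> S \<Longrightarrow> ins_w x Z b ((S, T), w) = (((S - {x}) \<union> Z, T), delta_act K P S x Z w b)"
  "x \<notin> S \<Longrightarrow> ins_w x Z b ((S, T), w) = ((S, T), w)"
  by (simp_all add: ins_a_def ins_w_def ins_blk_def)

lemma map_fst_ins:
  "map fst (map (ins_a x Z b) as) = map (ins_blk x Z) (map fst as)"
  "map fst (map (ins_w x Z b) ws) = map (ins_blk x Z) (map fst ws)"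
  by (simp_all add: ins_a_def ins_w_def)

lemma ctr_good:
  assumes c: "ctr X Y x y as Z b ws"
  shows "x \<in> Z \<Longrightarrow> LSg (X, Y) as (((Z - {x}, {}), delta_mark K P Z x b) # ws)"
    "x \<notin> Z \<Longrightarrow> LSg (X, Y) (map (ins_a x Z b) as) (map (ins_w x Z b) ws)"
proof -
  note b = ctr_basic[OF c]
  note d = is_decomp_contr[OF b(11,3,4)]
  show "LSg (X, Y) as (((Z - {x}, {}), delta_mark K P Z x b) # ws)" if x: "x \<in> Z"
  proof -
    have "is_decomp (map fst as @ map fst (((Z - {x}, {}), delta_mark K P Z x b) # ws)) (X, Y)"
      by (rule is_decomp_mset[OF _ d(1)[OF x]]) simp
    then show ?thesis using b(7,9,10) hom_closed[OF delta_mark_hom[OF b(5) x] b(6)] by (simp add: LSg_def)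
  qed
  show "LSg (X, Y) (map (ins_a x Z b) as) (map (ins_w x Z b) ws)" if x: "x \<notin> Z"
  proof -
    have "\<exists>S t. fst (ins_a x Z b p) = (S, {t}) \<and> snd (ins_a x Z b p) \<in> carrier (OP S)" if p: "p \<in> set as" for p
    proof -
      obtain S T a where e: "p = ((S, T), a)" by (metis surj_pair)
      note f = ctr_a[OF c p[unfolded e]]
      show ?thesis using f oc_closed[OF f(7) f(5) b(6)] unfolding e by (cases "x \<in> S") (auto simp: ins_simps)
    qed
    moreover have "\<exists>S. fst (ins_w x Z b p) = (S, {}) \<and> snd (ins_w x Z b p) \<in> carrier (delta_sp K P S)" if p: "p \<in> set ws" for p
    proof -
      obtain S T a where e: "p = ((S, T), a)" by (metis surj_pair)
      note f = ctr_w[OF c p[unfolded e]]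
      show ?thesis using f delta_act_closed[OF f(6) f(4) b(6)] unfolding e by (cases "x \<in> S") (auto simp: ins_simps)
    qed
    ultimately show ?thesis
      using d(2)[OF x] b(7) unfolding LSg_def map_fst_ins map_append[symmetric] good_as_def good_ws_def split_beta by simp
  qed
qed

lemma contr_val_closed: "ctr X Y x y as Z b ws \<Longrightarrow> contr_val (X, Y) x Z b as ws \<in> carrier (LSV (X, Y))"
  using ctr_good LS_term_closed unfolding contr_val_def by auto

text \<open>Blocks are disjoint, so at most one of them contains \<open>x\<close> and all other
  factors are fixed. The inserted vector \<open>u\<close> is arbitrary, as linearity in the inserted
  operation is needed later.\<close>

lemma ctr_split:
  assumes c: "ctr X Y x y as Z b ws"
  shows "as = l1 @ ((S, T), a) # l2 \<Longrightarrow> x \<in> S \<Longrightarrow>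
      x \<notin> Z \<and> map (ins_a x Z u) l1 = l1 \<and> map (ins_a x Z u) l2 = l2 \<and> map (ins_w x Z u) ws = ws"
    "ws = m1 @ ((S', T'), w) # m2 \<Longrightarrow> x \<in> S' \<Longrightarrow>
      x \<notin> Z \<and> map (ins_w x Z u) m1 = m1 \<and> map (ins_w x Z u) m2 = m2 \<and> map (ins_a x Z u) as = as"
proof -
  have s: "sorted_wrt bdisj ((map fst as @ map fst ws) @ [(Z, {y})])" using ctr_basic(11)[OF c] by (simp add: is_decomp_iff)
  have id: "map (ins_a x Z u) l = l" if "\<And>D. D \<in> fst ` set l \<Longrightarrow> x \<notin> fst D" for l
    by (rule map_idI) (use that in \<open>auto simp: ins_a_def ins_blk_def\<close>)
  have idw: "map (ins_w x Z u) l = l" if "\<And>D. D \<in> fst ` set l \<Longrightarrow> x \<notin> fst D" for l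
    by (rule map_idI) (use that in \<open>auto simp: ins_w_def ins_blk_def\<close>)
  show "x \<notin> Z \<and> map (ins_a x Z u) l1 = l1 \<and> map (ins_a x Z u) l2 = l2 \<and> map (ins_w x Z u) ws = ws"
    if *: "as = l1 @ ((S, T), a) # l2" "x \<in> S"
  proof -
    have "x \<notin> fst E" if "E \<in> set (map fst l1) \<union> set (map fst l2 @ map fst ws @ [(Z, {y})])" for E
      by (rule sorted_bdisj_mid[of "map fst l1" "(S, T)" "map fst l2 @ map fst ws @ [(Z, {y})]"]) (use s[unfolded *(1)] *(2) that in simp_all)
    note E = this
    show ?thesis
      by (intro conjI id idw) (use E[of "(Z, {y})"] in simp, (rule E, simp)+)
  qed
  show "x \<notin> Z \<and> map (ins_w x Z u) m1 = m1 \<and> map (ins_w x Z u) m2 = m2 \<and> map (ins_a x Z u) as = as"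
    if *: "ws = m1 @ ((S', T'), w) # m2" "x \<in> S'"
  proof -
    have "x \<notin> fst E" if "E \<in> set (map fst as @ map fst m1) \<union> set (map fst m2 @ [(Z, {y})])" for E
      by (rule sorted_bdisj_mid[of "map fst as @ map fst m1" "(S', T')" "map fst m2 @ [(Z, {y})]"]) (use s[unfolded *(1)] *(2) that in simp_all)
    note E = this
    show ?thesis
      by (intro conjI id idw) (use E[of "(Z, {y})"] in simp, (rule E, simp)+)
  qed
qed

lemma contr_val_split:
  assumes c: "ctr X Y x y as Z b ws"
  shows "as = l1 @ ((S, T), a) # l2 \<Longrightarrow> x \<in> S \<Longrightarrow>
      contr_val A x Z u as ws = LST A (l1 @ (((S - {x}) \<union> Z, T), oc S x Z a u) # l2) ws"
    "ws = m1 @ ((S', T'), w) # m2 \<Longrightarrow> x \<in> S' \<Longrightarrow>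
      contr_val A x Z u as ws = LST A as (m1 @ (((S' - {x}) \<union> Z, T'), delta_act K P S' x Z w u) # m2)"
  using ctr_split(1)[OF c, of l1 S T a l2 u] ctr_split(2)[OF c, of m1 S' T' w m2 u]
  by (simp_all add: contr_val_def ins_simps)

lemma ctr_cases:
  assumes c: "ctr X Y x y as Z b ws" and "x \<notin> Z"
  obtains (a) l1 S t a l2 where "as = l1 @ ((S, {t}), a) # l2" "x \<in> S" "okc S x Z" "a \<in> carrier (OP S)"
  | (w) l1 S w l2 where "ws = l1 @ ((S, {}), w) # l2" "x \<in> S" "okc S x Z" "w \<in> carrier (delta_sp K P S)"
proof -
  have "x \<in> (\<Union>D\<in>set ((map fst as @ map fst ws) @ [(Z, {y})]). fst D)"
    using ctr_basic(11)[OF c] unfolding is_decomp_iff by simp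
  then have "(\<exists>D a. (D, a) \<in> set as \<and> x \<in> fst D) \<or> (\<exists>D w. (D, w) \<in> set ws \<and> x \<in> fst D)"
    using assms(2) by force
  then consider D a where "(D, a) \<in> set as" "x \<in> fst D" | D w where "(D, w) \<in> set ws" "x \<in> fst D" by blast
  then show thesis
  proof cases
    case 1
    obtain S T where D: "D = (S, T)" by (cases D)
    note f = ctr_a[OF c 1(1)[unfolded D]]
    obtain t where t: "T = {t}" using f(6) by blast
    obtain l1 l2 where l: "as = l1 @ ((S, {t}), a) # l2" using split_list[OF 1(1)] unfolding D t by blast
    show thesis by (rule a[OF l]) (use f 1(2) D in auto)
  next
    case 2
    obtain S T where D: "D = (S, T)" by (cases D)
    note f = ctr_w[OF c 2(1)[unfolded D]]
    obtain l1 l2 where l: "ws = l1 @ ((S, {}), w) # l2" using split_list[OF 2(1)] unfolding D f(5) by blast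
    show thesis by (rule w[OF l]) (use f 2(2) D in auto)
  qed
qed

section \<open>Linearity in each factor and symmetry of the contraction rule\<close>

lemma contr_val_hom_b:
  assumes c: "ctr X Y x y as Z b ws"
  shows "(\<lambda>u. contr_val (X, Y) x Z u as ws) \<in> module_hom K (OP Z) (LSV (X, Y))"
proof (cases "x \<in> Z")
  case True
  have "(\<lambda>w. LST (X, Y) as (((Z - {x}, {}), w) # ws)) \<in> module_hom K (delta_sp K P (Z - {x})) (LSV (X, Y))"
    using LS_term_slot_w[of "(X, Y)" as "[]"] ctr_good(1)[OF c True] by simp
  from hom_comp[OF delta_mark_hom[OF ctr_basic(5)[OF c] True] this] True show ?thesis by (simp add: contr_val_def)
next
  case False
  note g = ctr_good(2)[OF c False]
  from c False show ?thesis
  proof (cases rule: ctr_cases)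
    case (a l1 S t a l2)
    have g': "LSg (X, Y) (l1 @ (((S - {x}) \<union> Z, {t}), oc S x Z a b) # l2) ws"
      using g ctr_split(1)[OF c a(1,2), of b] a(1,2) by (simp add: ins_simps)
    show ?thesis unfolding contr_val_split(1)[OF c a(1,2)]
      by (rule hom_comp[OF oc_homs(1)[OF a(3,4)] LS_term_slot[OF g']])
  next
    case (w l1 S w l2)
    have g': "LSg (X, Y) as (l1 @ (((S - {x}) \<union> Z, {}), delta_act K P S x Z w b) # l2)"
      using g ctr_split(2)[OF c w(1,2), of b] w(1,2) by (simp add: ins_simps)
    show ?thesis unfolding contr_val_split(2)[OF c w(1,2)]
      by (rule hom_comp[OF delta_act_hom2[OF w(3,4)] LS_term_slot_w[OF g']])
  qed
qed

lemma contr_val_hom_a: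
  assumes c: "ctr X Y x y (l1 @ ((S, {t}), a) # l2) Z b ws"
  shows "(\<lambda>u. contr_val (X, Y) x Z b (l1 @ ((S, {t}), u) # l2) ws) \<in> module_hom K (OP S) (LSV (X, Y))"
proof (cases "x \<in> Z")
  case True
  then show ?thesis using LS_term_slot[OF ctr_good(1)[OF c True]] by (simp add: contr_val_def)
next
  case False
  note g = ctr_good(2)[OF c False]
  have S: "x \<in> S \<Longrightarrow> okc S x Z" using ctr_a(7)[OF c, of S "{t}" a] by simp
  show ?thesis
  proof (cases "x \<in> S")
    case True
    show ?thesis
      using hom_comp[OF oc_homs(2)[OF S[OF True] ctr_basic(6)[OF c]]
        LS_term_slot[OF g[unfolded map_append list.map ins_simps(1)[OF True]]]] False True
      by (simp add: contr_val_def ins_simps)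
  next
    case False': False
    show ?thesis
      using LS_term_slot[OF g[unfolded map_append list.map ins_simps(2)[OF False']]] False False'
      by (simp add: contr_val_def ins_simps)
  qed
qed

lemma contr_val_hom_w:
  assumes c: "ctr X Y x y as Z b (l1 @ ((S, {}), w) # l2)"
  shows "(\<lambda>u. contr_val (X, Y) x Z b as (l1 @ ((S, {}), u) # l2)) \<in> module_hom K (delta_sp K P S) (LSV (X, Y))"
proof (cases "x \<in> Z")
  case True
  have g: "LSg (X, Y) as ((((Z - {x}, {}), delta_mark K P Z x b) # l1) @ ((S, {}), w) # l2)"
    using ctr_good(1)[OF c True] by simp
  show ?thesis using LS_term_slot_w[OF g] True by (simp add: contr_val_def)
next
  case False
  note g = ctr_good(2)[OF c False]
  have S: "x \<in> S \<Longrightarrow> okc S x Z" using ctr_w(6)[OF c, of S "{}" w] by simp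
  show ?thesis
  proof (cases "x \<in> S")
    case True
    show ?thesis
      using hom_comp[OF delta_act(1)[OF S[OF True] ctr_basic(6)[OF c]]
        LS_term_slot_w[OF g[unfolded map_append list.map ins_simps(3)[OF True]]]] False True
      by (simp add: contr_val_def ins_simps)
  next
    case False': False
    show ?thesis
      using LS_term_slot_w[OF g[unfolded map_append list.map ins_simps(4)[OF False']]] False False'
      by (simp add: contr_val_def ins_simps)
  qed
qed

lemma contr_val_swap:
  assumes c: "ctr X Y x y (l1 @ p # q # l2) Z b ws"
  shows "contr_val (X, Y) x Z b (l1 @ q # p # l2) ws =
    neg1 K \<odot>\<^bsub>LSV (X, Y)\<^esub> contr_val (X, Y) x Z b (l1 @ p # q # l2) ws"
proof (cases "x \<in> Z")
  case True
  then show ?thesis using LS_term_swap[OF ctr_good(1)[OF c True]] by (simp add: contr_val_def)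
next
  case False
  then show ?thesis using LS_term_swap[OF ctr_good(2)[OF c False, unfolded map_append list.map]] by (simp add: contr_val_def)
qed

lemma contr_val_swap_w:
  assumes c: "ctr X Y x y as Z b (l1 @ p # q # l2)"
  shows "contr_val (X, Y) x Z b as (l1 @ q # p # l2) = contr_val (X, Y) x Z b as (l1 @ p # q # l2)"
proof (cases "x \<in> Z")
  case True
  have g: "LSg (X, Y) as ((((Z - {x}, {}), delta_mark K P Z x b) # l1) @ p # q # l2)"
    using ctr_good(1)[OF c True] by simp
  show ?thesis using LS_term_swap_w[OF g] True by (simp add: contr_val_def)
next
  case False
  then show ?thesis using LS_term_swap_w[OF ctr_good(2)[OF c False, unfolded map_append list.map]] by (simp add: contr_val_def)
qed

section \<open>Contraction of a factor in arbitrary position, with its sign\<close>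

definition sg :: "nat \<Rightarrow> 'k" where "sg n = (if even n then \<one>\<^bsub>K\<^esub> else neg1 K)"

lemma sg_smult:
  assumes "vectorspace K V" "v \<in> carrier V"
  shows "sg n \<in> carrier K" "sg 0 \<odot>\<^bsub>V\<^esub> v = v" "neg1 K \<odot>\<^bsub>V\<^esub> (neg1 K \<odot>\<^bsub>V\<^esub> v) = v"
    "sg (Suc n) \<odot>\<^bsub>V\<^esub> v = neg1 K \<odot>\<^bsub>V\<^esub> (sg n \<odot>\<^bsub>V\<^esub> v)"
    "sg n \<odot>\<^bsub>V\<^esub> (neg1 K \<odot>\<^bsub>V\<^esub> v) = neg1 K \<odot>\<^bsub>V\<^esub> (sg n \<odot>\<^bsub>V\<^esub> v)"
proof -
  interpret V: vectorspace K V by fact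
  have "(neg1 K) \<otimes>\<^bsub>K\<^esub> (neg1 K) = \<one>\<^bsub>K\<^esub>" by (simp add: V.l_minus V.r_minus)
  then show *: "neg1 K \<odot>\<^bsub>V\<^esub> (neg1 K \<odot>\<^bsub>V\<^esub> v) = v"
    using assms(2) by (simp flip: V.smult_assoc1)
  show "sg n \<in> carrier K" "sg 0 \<odot>\<^bsub>V\<^esub> v = v" using assms(2) by (simp_all add: sg_def)
  show "sg (Suc n) \<odot>\<^bsub>V\<^esub> v = neg1 K \<odot>\<^bsub>V\<^esub> (sg n \<odot>\<^bsub>V\<^esub> v)"
    "sg n \<odot>\<^bsub>V\<^esub> (neg1 K \<odot>\<^bsub>V\<^esub> v) = neg1 K \<odot>\<^bsub>V\<^esub> (sg n \<odot>\<^bsub>V\<^esub> v)"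
    using assms(2) * by (simp_all add: sg_def)
qed

lemma sg_closed: "sg n \<in> carrier K"
  using sg_smult(1)[OF vs_zero_space[OF K, of undefined], of undefined n] by (simp add: zero_space_def)

text \<open>Searches for the factor with output \<open>y\<close>, removes it and inserts the sign
  for moving it past the factors behind it. The search makes this a total function of lists, as
  required for an application of \<open>LS_ext\<close>.\<close>

definition contr_list :: "'a set \<Rightarrow> 'a set \<Rightarrow> 'a \<Rightarrow> 'a \<Rightarrow> ('a bob \<times> 'v) list \<Rightarrow> ('a bob \<times> 'v set) list
    \<Rightarrow> ('a, 'k, ('a, 'k, 'v) star, ('a, 'k, 'v set) star) cnv" where
  "contr_list X Y x y as ws =
    (let l1 = takeWhile (\<lambda>p. y \<notin> snd (fst p)) as; r = dropWhile (\<lambda>p. y \<notin> snd (fst p)) as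
     in sg (length (tl r)) \<odot>\<^bsub>LSV (X, Y)\<^esub> contr_val (X, Y) x (fst (fst (hd r))) (snd (hd r)) (l1 @ tl r) ws)"

lemma contr_list_eq:
  assumes c: "ctr X Y x y (l1 @ l2) Z b ws"
  shows "contr_list X Y x y (l1 @ ((Z, {y}), b) # l2) ws =
    sg (length l2) \<odot>\<^bsub>LSV (X, Y)\<^esub> contr_val (X, Y) x Z b (l1 @ l2) ws"
proof -
  have "y \<notin> snd (fst p)" if "p \<in> set l1" for p
    using ctr_a(3)[OF c, of "fst (fst p)" "snd (fst p)" "snd p"] that by simp
  then show ?thesis by (simp add: contr_list_def takeWhile_append2 dropWhile_append2)
qed

text \<open>Factors from \<open>delta\<close> have no outputs and operad factors have exactly one,
  so the block that contains \<open>y\<close> is an operad factor with \<open>y\<close> as its only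
  output.\<close>

lemma block_ex:
  assumes g: "LSg A as ws" and y: "y \<in> snd A"
  obtains l1 Z b l2 where "as = l1 @ ((Z, {y}), b) # l2"
proof -
  have "y \<in> (\<Union>D\<in>set (map fst as @ map fst ws). snd D)" using g y unfolding LSg_def is_decomp_iff by simp
  then obtain D where D: "D \<in> set (map fst as @ map fst ws)" "y \<in> snd D" by blast
  have "D \<notin> set (map fst ws)" using D(2) g by (auto simp: LSg_def good_ws_def)
  then obtain b where b: "(D, b) \<in> set as" using D(1) by auto
  then obtain Z t where "D = (Z, {t})" using g unfolding LSg_def good_as_def by blast
  then have "D = (Z, {y})" using D(2) by simp
  then show thesis using split_list[OF b] that by blast
qed

lemma LSg_slot:
  "LSg A (l1 @ ((S, {t}), a) # l2) ws \<Longrightarrow> u \<in> carrier (OP S) \<Longrightarrow> LSg A (l1 @ ((S, {t}), u) # l2) ws"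
  by (simp add: LSg_def)

text \<open>Verification of the hypotheses of \<open>LS_ext\<close>. Linearity distinguishes whether
  the varied factor is the contracted one, or stands before or behind it. For the exchange of
  neighbours the sign comes from the remaining exterior term if neither is contracted, and from the
  changed position if one of them is.\<close>

lemma contr_ext:
  assumes f: "finite X" "finite Y" "x \<notin> X" "y \<notin> Y"
  shows "\<exists>\<phi>\<in>module_hom K (LSV (insert x X, insert y Y)) (LSV (X, Y)).
    \<forall>as ws. LSg (insert x X, insert y Y) as ws \<longrightarrow>
      \<phi> (LST (insert x X, insert y Y) as ws) = contr_list X Y x y as ws"
proof (rule LS_ext)
  let ?A = "(insert x X, insert y Y)" and ?W = "LSV (X, Y)"
  show "?A \<in> B_obj" using f by (simp add: B_obj_def)
  show W: "vectorspace K ?W" by (rule vs_LS) (use f in \<open>simp add: B_obj_def\<close>)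
  note ctr = ctrI[OF f(3,4)]
  show "contr_list X Y x y as ws \<in> carrier ?W" if g: "LSg ?A as ws" for as ws
  proof -
    obtain l1 Z b l2 where s: "as = l1 @ ((Z, {y}), b) # l2" by (rule block_ex[OF g, of y]) simp
    show ?thesis using contr_val_closed[OF ctr[OF g[unfolded s]]] vs_smult[OF W sg_closed]
      unfolding s contr_list_eq[OF ctr[OF g[unfolded s]]] by blast
  qed
  show "(\<lambda>u. contr_list X Y x y (l1 @ ((S, {t}), u) # l2) ws) \<in> module_hom K (OP S) ?W"
    if g: "LSg ?A (l1 @ ((S, {t}), a) # l2) ws" for l1 S t a l2 ws
  \<comment> \<open>Either the varied factor is the one that carries \<open>y\<close>, or it stays
    among the remaining factors.\<close>
  proof (cases "t = y")
    case True
    note c = ctr[OF g[unfolded True]]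
    show ?thesis
      by (rule hom_cong[OF vs_OP(1)[OF ctr_basic(5)[OF c]] hom_smult_fun[OF W contr_val_hom_b[OF c] sg_closed]])
        (simp add: True contr_list_eq[OF ctr[OF LSg_slot[OF g[unfolded True]]]])
  next
    case False
    obtain m1 Z b m2 where s: "l1 @ ((S, {t}), a) # l2 = m1 @ ((Z, {y}), b) # m2" by (rule block_ex[OF g, of y]) simp
    have fS: "finite S"
    proof -
      have "bsub (S, {t}) ?A" by (rule is_decomp_bsub) (use g in \<open>auto simp: LSg_def\<close>)
      then show ?thesis using f(1) by (auto simp: bsub_def intro: finite_subset)
    qed
    \<comment> \<open>The contracted factor stands to the left or to the right of the varied
      one.\<close>
    from s False consider n where "l1 = m1 @ ((Z, {y}), b) # n" "m2 = n @ ((S, {t}), a) # l2"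
      | n where "m1 = l1 @ ((S, {t}), a) # n" "l2 = n @ ((Z, {y}), b) # m2"
      by (auto simp: append_eq_append_conv2 Cons_eq_append_conv append_eq_Cons_conv)
    then show ?thesis
    proof cases
      case 1
      note g1 = g[unfolded 1(1), simplified append_assoc append_Cons]
      note c = ctr[OF g1]
      show ?thesis
      proof (rule hom_cong[OF vs_OP(1)[OF fS] hom_smult_fun[OF W contr_val_hom_a[of X Y x y "m1 @ n"] sg_closed]])
        show "ctr X Y x y ((m1 @ n) @ ((S, {t}), a) # l2) Z b ws" using c by simp
        fix u assume "u \<in> carrier (OP S)"
        then have "LSg ?A (m1 @ ((Z, {y}), b) # (n @ ((S, {t}), u) # l2)) ws"
          using LSg_slot[of ?A "m1 @ ((Z, {y}), b) # n" S t a l2 ws u] g1 by simp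
        from contr_list_eq[OF ctr[OF this]] show "contr_list X Y x y (l1 @ ((S, {t}), u) # l2) ws =
            sg (length (n @ ((S, {t}), a) # l2)) \<odot>\<^bsub>?W\<^esub> contr_val (X, Y) x Z b ((m1 @ n) @ ((S, {t}), u) # l2) ws"
          by (simp add: 1)
      qed
    next
      case 2
      have g1: "LSg ?A ((l1 @ ((S, {t}), a) # n) @ ((Z, {y}), b) # m2) ws" using g 2 by simp
      note c = ctr[OF g1]
      show ?thesis
      proof (rule hom_cong[OF vs_OP(1)[OF fS] hom_smult_fun[OF W contr_val_hom_a[of X Y x y "l1" S t a "n @ m2"] sg_closed]])
        show "ctr X Y x y (l1 @ ((S, {t}), a) # n @ m2) Z b ws" using c by simp
        fix u assume "u \<in> carrier (OP S)"
        then have "LSg ?A ((l1 @ ((S, {t}), u) # n) @ ((Z, {y}), b) # m2) ws"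
          using LSg_slot[OF g] 2 by simp
        from contr_list_eq[OF ctr[OF this]] show "contr_list X Y x y (l1 @ ((S, {t}), u) # l2) ws =
            sg (length m2) \<odot>\<^bsub>?W\<^esub> contr_val (X, Y) x Z b (l1 @ ((S, {t}), u) # n @ m2) ws"
          by (simp add: 2)
      qed
    qed
  qed
  show "(\<lambda>u. contr_list X Y x y as (l1 @ ((S, {}), u) # l2)) \<in> module_hom K (delta_sp K P S) ?W"
    if g: "LSg ?A as (l1 @ ((S, {}), w) # l2)" for as l1 S w l2
  proof -
    obtain m1 Z b m2 where s: "as = m1 @ ((Z, {y}), b) # m2" by (rule block_ex[OF g, of y]) simp
    note c = ctr[OF g[unfolded s]]
    show ?thesis
    proof (rule hom_cong[OF vs_delta hom_smult_fun[OF W contr_val_hom_w[OF c] sg_closed]])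
      show "finite S" using ctr_w(1)[OF c, of S "{}" w] by simp
      fix u assume "u \<in> carrier (delta_sp K P S)"
      then have "LSg ?A (m1 @ ((Z, {y}), b) # m2) (l1 @ ((S, {}), u) # l2)" using g s by (simp add: LSg_def)
      from contr_list_eq[OF ctr[OF this]] show "contr_list X Y x y as (l1 @ ((S, {}), u) # l2) =
            sg (length m2) \<odot>\<^bsub>?W\<^esub> contr_val (X, Y) x Z b (m1 @ m2) (l1 @ ((S, {}), u) # l2)"
        by (simp add: s)
    qed
  qed
  show "contr_list X Y x y (l1 @ q # p # l2) ws = neg1 K \<odot>\<^bsub>?W\<^esub> contr_list X Y x y (l1 @ p # q # l2) ws"
    if g: "LSg ?A (l1 @ p # q # l2) ws" for l1 p q l2 ws
  proof -
    have g': "LSg ?A (l1 @ q # p # l2) ws" by (rule LSg_perm[OF g]) simp_all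
    obtain m1 Z b m2 where s: "l1 @ p # q # l2 = m1 @ ((Z, {y}), b) # m2" by (rule block_ex[OF g, of y]) simp
    then consider n where "l1 = m1 @ ((Z, {y}), b) # n" "m2 = n @ p # q # l2"
      | "p = ((Z, {y}), b)" | "q = ((Z, {y}), b)"
      | n where "l2 = n @ ((Z, {y}), b) # m2" "m1 = l1 @ p # q # n"
      by (auto simp: append_eq_append_conv2 Cons_eq_append_conv append_eq_Cons_conv)
    then show ?thesis
    proof cases
      case 1
      have h: "LSg ?A (m1 @ ((Z, {y}), b) # n @ p # q # l2) ws" "LSg ?A (m1 @ ((Z, {y}), b) # n @ q # p # l2) ws"
        using g g' 1 by simp_all
      have c: "ctr X Y x y ((m1 @ n) @ p # q # l2) Z b ws" using ctr[OF h(1)] by simp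
      show ?thesis
        using contr_list_eq[OF ctr[OF h(1)]] contr_list_eq[OF ctr[OF h(2)]] contr_val_swap[OF c]
          sg_smult(5)[OF W contr_val_closed[OF c]] by (simp add: 1)
    next
      \<comment> \<open>One of the neighbours is the contracted factor. The list without it is the
        same before and after the exchange; only the number of factors behind it changes by
        one.\<close>
      case 2
      have c: "ctr X Y x y (l1 @ q # l2) Z b ws" "ctr X Y x y ((l1 @ [q]) @ l2) Z b ws"
        using ctr[OF g[unfolded 2]] by simp_all
      show ?thesis
        using contr_list_eq[OF c(1)] contr_list_eq[OF c(2)] sg_smult(3,4)[OF W] contr_val_closed[OF c(1)]
          vs_smult[OF W sg_closed] by (simp add: 2)
    next
      case 3
      have c: "ctr X Y x y (l1 @ p # l2) Z b ws" "ctr X Y x y ((l1 @ [p]) @ l2) Z b ws"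
        using ctr[OF g'[unfolded 3]] by simp_all
      show ?thesis
        using contr_list_eq[OF c(1)] contr_list_eq[OF c(2)] sg_smult(3,4)[OF W] contr_val_closed[OF c(1)]
          vs_smult[OF W sg_closed] by (simp add: 3)
    next
      case 4
      have h: "LSg ?A ((l1 @ p # q # n) @ ((Z, {y}), b) # m2) ws" "LSg ?A ((l1 @ q # p # n) @ ((Z, {y}), b) # m2) ws"
        using g g' 4 by simp_all
      have c: "ctr X Y x y (l1 @ p # q # (n @ m2)) Z b ws" using ctr[OF h(1)] by simp
      show ?thesis
        using contr_list_eq[OF ctr[OF h(1)]] contr_list_eq[OF ctr[OF h(2)]] contr_val_swap[OF c]
          sg_smult(5)[OF W contr_val_closed[OF c]] by (simp add: 4)
    qed
  qed
  show "contr_list X Y x y as (l1 @ q # p # l2) = contr_list X Y x y as (l1 @ p # q # l2)"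
    if g: "LSg ?A as (l1 @ p # q # l2)" for as l1 p q l2
  proof -
    obtain m1 Z b m2 where s: "as = m1 @ ((Z, {y}), b) # m2" by (rule block_ex[OF g, of y]) simp
    have g': "LSg ?A as (l1 @ q # p # l2)" by (rule LSg_perm[OF g]) simp_all
    show ?thesis
      unfolding s contr_list_eq[OF ctr[OF g[unfolded s]]] contr_list_eq[OF ctr[OF g'[unfolded s]]]
        contr_val_swap_w[OF ctr[OF g[unfolded s]]] ..
  qed
qed

text \<open>The choice only gives a name to the map supplied by \<open>contr_ext\<close>: good terms
  span, so the prescribed values determine it on the carrier.\<close>

definition cmap :: "'a set \<Rightarrow> 'a set \<Rightarrow> 'a \<Rightarrow> 'a \<Rightarrow> ('a, 'k, ('a, 'k, 'v) star, ('a, 'k, 'v set) star) cnv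
    \<Rightarrow> ('a, 'k, ('a, 'k, 'v) star, ('a, 'k, 'v set) star) cnv" where
  "cmap X Y x y = (SOME \<phi>. \<phi> \<in> module_hom K (LSV (insert x X, insert y Y)) (LSV (X, Y)) \<and>
    (\<forall>as ws. LSg (insert x X, insert y Y) as ws \<longrightarrow>
      \<phi> (LST (insert x X, insert y Y) as ws) = contr_list X Y x y as ws))"

lemma cmap_ex:
  assumes f: "finite X" "finite Y" "x \<notin> X" "y \<notin> Y"
  shows "cmap X Y x y \<in> module_hom K (LSV (insert x X, insert y Y)) (LSV (X, Y)) \<and>
    (\<forall>as ws. LSg (insert x X, insert y Y) as ws \<longrightarrow>
      cmap X Y x y (LST (insert x X, insert y Y) as ws) = contr_list X Y x y as ws)"
proof -
  have "\<exists>\<phi>. \<phi> \<in> module_hom K (LSV (insert x X, insert y Y)) (LSV (X, Y)) \<and>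
    (\<forall>as ws. LSg (insert x X, insert y Y) as ws \<longrightarrow>
      \<phi> (LST (insert x X, insert y Y) as ws) = contr_list X Y x y as ws)"
    using contr_ext[OF f] by blast
  then show ?thesis unfolding cmap_def by (rule someI_ex)
qed

lemma cmap_last:
  assumes c: "ctr X Y x y as Z b ws"
  shows "cmap X Y x y (LST (insert x X, insert y Y) (as @ [((Z, {y}), b)]) ws) = contr_val (X, Y) x Z b as ws"
proof -
  note b = ctr_basic[OF c]
  have "cmap X Y x y (LST (insert x X, insert y Y) (as @ [((Z, {y}), b)]) ws) = contr_list X Y x y (as @ [((Z, {y}), b)]) ws"
    using cmap_ex[OF b(1-4)] c unfolding ctr_def by blast
  also have "\<dots> = contr_val (X, Y) x Z b as ws"
    using contr_list_eq[of X Y x y as "[]" Z b ws] c sg_smult(2)[OF vs_LS[OF b(7)] contr_val_closed[OF c]] by simp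
  finally show ?thesis .
qed

lemma LS_term_move:
  assumes "LSg A (l1 @ p # l2) ws"
  shows "LST A (l1 @ p # l2) ws = sg (length l2) \<odot>\<^bsub>LSV A\<^esub> LST A (l1 @ l2 @ [p]) ws"
  using assms
proof (induction l2 arbitrary: l1)
  case Nil
  then show ?case using sg_smult(2)[OF vs_LS LS_term_closed[OF Nil]] by (simp add: LSg_def)
next
  case (Cons q l2)
  have A: "A \<in> B_obj" using Cons.prems by (simp add: LSg_def)
  have g: "LSg A (l1 @ q # p # l2) ws" "LSg A ((l1 @ [q]) @ l2 @ [p]) ws" by (rule LSg_perm[OF Cons.prems]; simp)+
  show ?case
    using LS_term_swap[OF g(1)] Cons.IH[of "l1 @ [q]"] g sg_smult(4)[OF vs_LS[OF A] LS_term_closed[OF g(2)]] by simp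
qed

text \<open>Up to a sign every good term has the factor with output \<open>y\<close> in last
  position. Identities between linear maps thus need testing only on terms to which the contraction
  rule applies literally.\<close>

lemma LS_hom_eq:
  assumes A: "A \<in> B_obj" and y: "y \<in> snd A" and W: "vectorspace K W"
    and h: "\<phi> \<in> module_hom K (LSV A) W" "\<psi> \<in> module_hom K (LSV A) W"
    and e: "\<And>as Z b ws. LSg A (as @ [((Z, {y}), b)]) ws \<Longrightarrow>
      \<phi> (LST A (as @ [((Z, {y}), b)]) ws) = \<psi> (LST A (as @ [((Z, {y}), b)]) ws)"
    and v: "v \<in> carrier (LSV A)"
  shows "\<phi> v = \<psi> v"
proof (rule spanning_hom_eq[OF vs_LS[OF A] W spanning_LS[OF A] h _ v])
  fix v assume "v \<in> {LST A as ws |as ws. LSg A as ws}"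
  then obtain as ws where v: "v = LST A as ws" and g: "LSg A as ws" by blast
  obtain l1 Z b l2 where s: "as = l1 @ ((Z, {y}), b) # l2" by (rule block_ex[OF g y])
  have g': "LSg A ((l1 @ l2) @ [((Z, {y}), b)]) ws" by (rule LSg_perm[OF g]) (simp_all add: s)
  then have c: "LST A (l1 @ l2 @ [((Z, {y}), b)]) ws \<in> carrier (LSV A)" using LS_term_closed by fastforce
  show "\<phi> v = \<psi> v"
    unfolding v s LS_term_move[OF g[unfolded s]] module_hom_smult[OF h(1) sg_closed c] module_hom_smult[OF h(2) sg_closed c]
    using e[OF g'] by simp
qed

text \<open>The version for two successive contractions, with the factors that carry
  \<open>y\<close> and \<open>y'\<close> brought to the last two places in this order.\<close>

lemma LS_hom_eq2:
  assumes A: "A \<in> B_obj" and y: "y \<in> snd A" "y' \<in> snd A" "y \<noteq> y'" and W: "vectorspace K W"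
    and h: "\<phi> \<in> module_hom K (LSV A) W" "\<psi> \<in> module_hom K (LSV A) W"
    and e: "\<And>as Z b Z' b' ws. LSg A (as @ [((Z, {y}), b), ((Z', {y'}), b')]) ws \<Longrightarrow>
      \<phi> (LST A (as @ [((Z, {y}), b), ((Z', {y'}), b')]) ws) =
      \<psi> (LST A (as @ [((Z, {y}), b), ((Z', {y'}), b')]) ws)"
    and v: "v \<in> carrier (LSV A)"
  shows "\<phi> v = \<psi> v"
proof (rule LS_hom_eq[OF A y(2) W h _ v])
  fix as Z' b' ws assume g: "LSg A (as @ [((Z', {y'}), b')]) ws"
  obtain l1 Z b l2 where s: "as @ [((Z', {y'}), b')] = l1 @ ((Z, {y}), b) # l2" by (rule block_ex[OF g y(1)])
  \<comment> \<open>As \<open>y\<close> and \<open>y'\<close> differ, the factor with output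
    \<open>y\<close> is not the last one.\<close>
  then obtain l3 where l: "as = l1 @ ((Z, {y}), b) # l3" using y(3)
    by (auto simp: append_eq_append_conv2 Cons_eq_append_conv append_eq_Cons_conv)
  let ?p = "((Z, {y}), b)" and ?q = "((Z', {y'}), b')"
  have g1: "LSg A (l1 @ ?p # l3 @ [?q]) ws" using g by (simp add: l)
  have g2: "LSg A ((l1 @ l3) @ ?p # ?q # []) ws" by (rule LSg_perm[OF g1]) simp_all
  have c: "LST A ((l1 @ l3) @ [?p, ?q]) ws \<in> carrier (LSV A)" using LS_term_closed[OF g2] by simp
  have m: "neg1 K \<in> carrier K" using perm_char_sgn[OF K] by (simp add: perm_char_def)
  note c' = vs_smult[OF vs_LS[OF A] m c]
  \<comment> \<open>Moving \<open>?p\<close> to the very end places it behind \<open>?q\<close>; one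
    more exchange restores the order, which accounts for the extra sign.\<close>
  have "LST A (as @ [?q]) ws =
    sg (length (l3 @ [?q])) \<odot>\<^bsub>LSV A\<^esub> (neg1 K \<odot>\<^bsub>LSV A\<^esub> LST A ((l1 @ l3) @ [?p, ?q]) ws)"
    using LS_term_move[OF g1] LS_term_swap[OF g2] by (simp add: l)
  then show "\<phi> (LST A (as @ [?q]) ws) = \<psi> (LST A (as @ [?q]) ws)"
    using e[OF g2] module_hom_smult[OF h(1) sg_closed c'] module_hom_smult[OF h(2) sg_closed c']
      module_hom_smult[OF h(1) m c] module_hom_smult[OF h(2) m c] by simp
qed

subsection \<open>Naturality\<close>

lemma LSg_sub:
  assumes g: "LSg A as ws"
  shows "((S, T), a) \<in> set as \<Longrightarrow> bsub (S, T) A \<and> (\<exists>t. T = {t}) \<and> a \<in> carrier (OP S) \<and> finite S"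
    "((S, T), w) \<in> set ws \<Longrightarrow> bsub (S, T) A \<and> T = {} \<and> w \<in> carrier (delta_sp K P S) \<and> finite S"
proof -
  have d: "is_decomp (map fst as @ map fst ws) A" and A: "finite (fst A)" using g by (auto simp: LSg_def B_obj_def)
  have f: "finite S" if "bsub (S, T) A" using that A by (auto simp: bsub_def intro: finite_subset)
  show "bsub (S, T) A \<and> (\<exists>t. T = {t}) \<and> a \<in> carrier (OP S) \<and> finite S" if m: "((S, T), a) \<in> set as"
  proof -
    have "bsub (S, T) A" by (rule is_decomp_bsub[OF d]) (use m in force)
    moreover have "(\<exists>t. T = {t}) \<and> a \<in> carrier (OP S)" using m g unfolding LSg_def good_as_def by blast
    ultimately show ?thesis using f by blast
  qed
  show "bsub (S, T) A \<and> T = {} \<and> w \<in> carrier (delta_sp K P S) \<and> finite S" if m: "((S, T), w) \<in> set ws"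
  proof -
    have "bsub (S, T) A" by (rule is_decomp_bsub[OF d]) (use m in force)
    moreover have "T = {} \<and> w \<in> carrier (delta_sp K P S)" using m g unfolding LSg_def good_ws_def by blast
    ultimately show ?thesis using f by blast
  qed
qed

lemma B_hom_inj_sub: "h \<in> B_hom A B \<Longrightarrow> bsub (S, T) A \<Longrightarrow> inj_on (fst h) S"
  by (auto simp: B_hom_def FB_hom_def bij_betw_def bsub_def mem_Times_iff intro: inj_on_subset)

lemma LSg_transport:
  assumes g: "LSg A as ws" and h: "h \<in> B_hom A B" and B: "B \<in> B_obj"
  shows "LSg B (map (atr h) as) (map (wtr h) ws)"
proof -
  have "is_decomp (map (B_image h) (map fst as @ map fst ws)) B"
    by (rule is_decomp_image[OF h]) (use g in \<open>simp add: LSg_def\<close>)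
  moreover have "map fst (map (atr h) as) = map (B_image h) (map fst as)"
    "map fst (map (wtr h) ws) = map (B_image h) (map fst ws)"
    by (simp_all add: transport_def split_beta)
  moreover have "good_as (map (atr h) as)" unfolding good_as_def
  proof (clarify)
    fix S' T' a' assume "((S', T'), a') \<in> set (map (atr h) as)"
    then obtain S T a where m: "((S, T), a) \<in> set as" and e: "((S', T'), a') = atr h ((S, T), a)" by auto
    note s = LSg_sub(1)[OF g m]
    then obtain t where t: "T = {t}" by blast
    have "ract (fst h) S a \<in> carrier (OP (fst h ` S))"
      using hom_closed[OF ract_hom[OF _ B_hom_inj_sub[OF h]]] s by blast
    then show "\<exists>S t. (S', T') = (S, {t}) \<and> a' \<in> carrier (OP S)" using e transport_op[OF h, of S t a] s by (simp add: t)
  qed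
  moreover have "good_ws (map (wtr h) ws)" unfolding good_ws_def
  proof (clarify)
    fix S' T' a' assume "((S', T'), a') \<in> set (map (wtr h) ws)"
    then obtain S T a where m: "((S, T), a) \<in> set ws" and e: "((S', T'), a') = wtr h ((S, T), a)" by auto
    note s = LSg_sub(2)[OF g m]
    have "dact (fst h) S a \<in> carrier (delta_sp K P (fst h ` S))"
      using hom_closed[OF dact(1)[OF _ B_hom_inj_sub[OF h]]] s by blast
    then show "\<exists>S. (S', T') = (S, {}) \<and> a' \<in> carrier (delta_sp K P S)" using e s transport_delta[OF h, of S a, OF s[THEN conjunct1, unfolded s[THEN conjunct2, THEN conjunct1]]] by simp
  qed
  ultimately show ?thesis using B by (simp add: LSg_def del: map_map)
qed

lemma LS_act_restrict:
  assumes h: "h \<in> B_hom A B" and s: "bsub A0 A" and o: "A0 \<in> B_obj" "B_image h A0 \<in> B_obj" and g: "LSg A0 as ws"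
  shows "kb_act (LS K P) A0 (B_image h A0) (B_restrict h A0) (LST A0 as ws) =
    LST (B_image h A0) (map (atr h) as) (map (wtr h) ws)"
proof -
  have e1: "map (atr (B_restrict h A0)) as = map (atr h) as"
    by (rule map_cong[OF refl]) (metis LSg_sub(1)[OF g] transport_restrict surj_pair)
  have e2: "map (wtr (B_restrict h A0)) ws = map (wtr h) ws"
    by (rule map_cong[OF refl]) (metis LSg_sub(2)[OF g] transport_restrict surj_pair)
  show ?thesis using LS_act[OF o B_hom_bsub(1)[OF h s] g] unfolding e1 e2 .
qed

text \<open>Tested on terms with the contracted factor last. Since \<open>h\<close> is injective it
  sends the block containing \<open>x\<close> to the block containing \<open>x'\<close>, so both
  sides fall under the same case of the rule, and equivariance of insertion and marking
  concludes.\<close>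

lemma cmap_nat:
  assumes f: "finite X" "finite Y" "x \<notin> X" "y \<notin> Y" "x' \<notin> X'" "y' \<notin> Y'"
    and h: "h \<in> B_hom (insert x X, insert y Y) (insert x' X', insert y' Y')" and hx: "fst h x = x'" "snd h y = y'"
    and v: "v \<in> carrier (LSV (insert x X, insert y Y))"
  shows "cmap X' Y' x' y' (kb_act (LS K P) (insert x X, insert y Y) (insert x' X', insert y' Y') h v) =
    kb_act (LS K P) (X, Y) (X', Y') (B_restrict h (X, Y)) (cmap X Y x y v)"
proof -
  let ?A = "(insert x X, insert y Y)" and ?A' = "(insert x' X', insert y' Y')"
  have inj: "inj_on (fst h) (insert x X)" "inj_on (snd h) (insert y Y)" "fst h ` insert x X = insert x' X'" "snd h ` insert y Y = insert y' Y'"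
    using h by (auto simp: B_hom_def FB_hom_def bij_betw_def mem_Times_iff)
  have im: "fst h ` X = X'" "snd h ` Y = Y'"
  proof -
    have "x' \<notin> fst h ` X" "y' \<notin> snd h ` Y" using inj(1,2) f(3,4) hx by (auto simp: inj_on_def)
    then show "fst h ` X = X'" "snd h ` Y = Y'"
      using inj(3,4) f(5,6) hx by (simp_all add: insert_ident)
  qed
  have fin: "finite X'" "finite Y'" using im f by auto
  have o: "?A \<in> B_obj" "?A' \<in> B_obj" "(X, Y) \<in> B_obj" "(X', Y') \<in> B_obj" using f fin by (auto simp: B_obj_def)
  have sub: "bsub (X, Y) ?A" and imXY: "B_image h (X, Y) = (X', Y')" using im by (auto simp: bsub_def B_image_def)
  have hr: "B_restrict h (X, Y) \<in> B_hom (X, Y) (X', Y')" using B_hom_bsub(1)[OF h sub] by (simp add: imXY)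
  note c1 = cmap_ex[OF f(1-4), THEN conjunct1] and c2 = cmap_ex[OF fin f(5,6), THEN conjunct1]
  show ?thesis
  proof (rule LS_hom_eq[OF o(1) _ vs_LS[OF o(4)] hom_comp[OF kB_module.hom[OF kB_module_LS o(1,2) h] c2]
        hom_comp[OF c1 kB_module.hom[OF kB_module_LS o(3,4) hr]] _ v, of y])
    show "y \<in> snd ?A" by simp
    fix as Z b ws assume g: "LSg ?A (as @ [((Z, {y}), b)]) ws"
    have c: "ctr X Y x y as Z b ws" using g f by (simp add: ctr_def)
    note bc = ctr_basic[OF c]
    let ?ta = "map (atr h) as" and ?tw = "map (wtr h) ws"
    let ?b = "ract (fst h) Z b" and ?Z = "fst h ` Z"
    have sZ: "bsub (Z, {y}) ?A" using bc(8) by (simp add: bsub_def)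
    have tb: "atr h ((Z, {y}), b) = ((?Z, {y'}), ?b)" using transport_op[OF h sZ] hx by simp
    have c': "ctr X' Y' x' y' ?ta ?Z ?b ?tw"
      using LSg_transport[OF g h o(2)] f(5,6) by (simp add: ctr_def tb)
    have iZ: "inj_on (fst h) Z" by (rule inj_on_subset[OF inj(1) bc(8)])
    \<comment> \<open>Injectivity of \<open>h\<close> decides which block contains \<open>x'\<close>
      after transport.\<close>
    have xS: "x' \<in> fst h ` S \<longleftrightarrow> x \<in> S" if "S \<subseteq> insert x X" for S
      using inj_on_image_mem_iff[OF inj(1) insertI1 that] hx by simp
    have L: "cmap X' Y' x' y' (kb_act (LS K P) ?A ?A' h (LST ?A (as @ [((Z, {y}), b)]) ws)) =
        contr_val (X', Y') x' ?Z ?b ?ta ?tw"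
      using LS_act[OF o(1,2) h g] cmap_last[OF c'] by (simp add: tb)
    note act = LS_act_restrict[OF h sub o(3) o(4)[folded imXY], unfolded imXY]
    have "contr_val (X', Y') x' ?Z ?b ?ta ?tw = kb_act (LS K P) (X, Y) (X', Y') (B_restrict h (X, Y)) (contr_val (X, Y) x Z b as ws)"
    proof (cases "x \<in> Z")
      case True
      have s: "bsub (Z - {x}, {}) ?A" using bc(8) by (auto simp: bsub_def)
      have "?Z - {x'} = fst h ` (Z - {x})" using inj_on_image_set_diff[OF iZ, of Z "{x}"] True hx by auto
      then have "wtr h ((Z - {x}, {}), delta_mark K P Z x b) = ((?Z - {x'}, {}), delta_mark K P ?Z x' ?b)"
        using transport_delta[OF h s] delta_mark_dact[OF bc(5) True iZ bc(6)] hx by simp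
      then show ?thesis
        using act[OF ctr_good(1)[OF c True]] True xS[OF bc(8)] by (simp add: contr_val_def)
    next
      case False
      have "atr h (ins_a x Z b p) = ins_a x' ?Z ?b (atr h p)" if p: "p \<in> set as" for p
      proof -
        obtain S T a where e: "p = ((S, T), a)" by (metis surj_pair)
        note ca = ctr_a[OF c p[unfolded e]]
        obtain t where t: "T = {t}" using ca(6) by blast
        have bs: "bsub (S, {t}) ?A" using LSg_sub(1)[OF g, of S T a] p by (simp add: e t)
        have tr: "atr h ((S, {t}), a) = ((fst h ` S, {snd h t}), ract (fst h) S a)" by (rule transport_op[OF h bs])
        show ?thesis
        proof (cases "x \<in> S")
          case True
          have i: "inj_on (fst h) (S \<union> Z)" by (rule inj_on_subset[OF inj(1)]) (use ca(4) bc(8) in blast)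
          have bs': "bsub ((S - {x}) \<union> Z, {t}) ?A" using bs sZ by (auto simp: bsub_def)
          show ?thesis
            using transport_op[OF h bs'] oc_ract[OF ca(7)[OF True] i False ca(5) bc(6)]
              okc_image(2)[OF ca(7)[OF True] i False] True xS[OF ca(4)] hx
            by (simp add: e t tr ins_simps)
        next
          case False
          then show ?thesis using xS[OF ca(4)] by (simp add: e t tr ins_simps)
        qed
      qed
      then have 1: "map (atr h) (map (ins_a x Z b) as) = map (ins_a x' ?Z ?b) ?ta" by simp
      have "wtr h (ins_w x Z b p) = ins_w x' ?Z ?b (wtr h p)" if p: "p \<in> set ws" for p
      proof -
        obtain S T a where e: "p = ((S, T), a)" by (metis surj_pair)
        note ca = ctr_w[OF c p[unfolded e]]
        have bs: "bsub (S, {}) ?A" using LSg_sub(2)[OF g, of S T a] p by (simp add: e ca(5))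
        have tr: "wtr h ((S, {}), a) = ((fst h ` S, {}), dact (fst h) S a)" by (rule transport_delta[OF h bs])
        show ?thesis
        proof (cases "x \<in> S")
          case True
          have i: "inj_on (fst h) (S \<union> Z)" by (rule inj_on_subset[OF inj(1)]) (use ca(3) bc(8) in blast)
          have bs': "bsub ((S - {x}) \<union> Z, {}) ?A" using bs sZ by (auto simp: bsub_def)
          show ?thesis
            using transport_delta[OF h bs'] delta_act_dact[OF ca(6)[OF True] i False ca(4) bc(6)]
              okc_image(2)[OF ca(6)[OF True] i False] True xS[OF ca(3)] hx
            by (simp add: e ca(5) tr ins_simps)
        next
          case False
          then show ?thesis using xS[OF ca(3)] by (simp add: e ca(5) tr ins_simps)
        qed
      qed
      then have 2: "map (wtr h) (map (ins_w x Z b) ws) = map (ins_w x' ?Z ?b) ?tw" by simp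
      show ?thesis
        using act[OF ctr_good(2)[OF c False], unfolded 1 2] False xS[OF bc(8)] by (simp add: contr_val_def)
    qed
    then show "cmap X' Y' x' y' (kb_act (LS K P) ?A ?A' h (LST ?A (as @ [((Z, {y}), b)]) ws)) =
      kb_act (LS K P) (X, Y) (X', Y') (B_restrict h (X, Y)) (cmap X Y x y (LST ?A (as @ [((Z, {y}), b)]) ws))"
      unfolding L cmap_last[OF c] .
  qed
qed

subsection \<open>Anticommutation\<close>

definition dbl :: "'a set \<Rightarrow> 'a set \<Rightarrow> ('a bob \<times> 'v) list \<Rightarrow> ('a bob \<times> 'v set) list \<Rightarrow> 'a \<Rightarrow> 'a \<Rightarrow> 'a set \<Rightarrow> 'v
    \<Rightarrow> 'a \<Rightarrow> 'a \<Rightarrow> 'a set \<Rightarrow> 'v \<Rightarrow> bool" where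
  "dbl X Y as ws x y Z b x' y' Z' b' \<longleftrightarrow> x \<notin> X \<and> x' \<notin> X \<and> x \<noteq> x' \<and> y \<notin> Y \<and> y' \<notin> Y \<and> y \<noteq> y' \<and>
    LSg (insert x (insert x' X), insert y (insert y' Y)) (as @ [((Z, {y}), b), ((Z', {y'}), b')]) ws"

lemma dbl_sym: "dbl X Y as ws x y Z b x' y' Z' b' \<Longrightarrow> dbl X Y as ws x' y' Z' b' x y Z b"
proof -
  assume d: "dbl X Y as ws x y Z b x' y' Z' b'"
  have "LSg (insert x (insert x' X), insert y (insert y' Y)) (as @ [((Z', {y'}), b'), ((Z, {y}), b)]) ws"
    by (rule LSg_perm) (use d in \<open>auto simp: dbl_def\<close>)
  then show ?thesis using d by (auto simp: dbl_def insert_commute)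
qed

lemma dbl_ctr:
  assumes d: "dbl X Y as ws x y Z b x' y' Z' b'"
  shows "ctr (insert x X) (insert y Y) x' y' (as @ [((Z, {y}), b)]) Z' b' ws" "ctr (insert x' X) (insert y' Y) x y (as @ [((Z', {y'}), b')]) Z b ws"
proof -
  have *: "ctr (insert x X) (insert y Y) x' y' (as @ [((Z, {y}), b)]) Z' b' ws"
    if "dbl X Y as ws x y Z b x' y' Z' b'" for x y Z b x' y' Z' b'
    using that by (auto simp: ctr_def dbl_def insert_commute)
  from *[OF d] *[OF dbl_sym[OF d]]
  show "ctr (insert x X) (insert y Y) x' y' (as @ [((Z, {y}), b)]) Z' b' ws" "ctr (insert x' X) (insert y' Y) x y (as @ [((Z', {y'}), b')]) Z b ws" .
qed

lemma dbl_facts: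
  assumes d: "dbl X Y as ws x y Z b x' y' Z' b'"
  shows "x \<noteq> x'" "finite Z" "finite Z'" "Z \<inter> Z' = {}" "b \<in> carrier (OP Z)" "b' \<in> carrier (OP Z')" "x' \<in> Z \<Longrightarrow> okc Z x' Z'"
    "x \<in> Z' \<Longrightarrow> okc Z' x Z"
  using d ctr_a[OF dbl_ctr(1)[OF d], of Z "{y}" b] ctr_a[OF dbl_ctr(2)[OF d], of Z' "{y'}" b']
  by (auto simp: dbl_def)

text \<open>The contraction of the primed pair is performed before that of the unprimed one, on a
  term whose last two factors are \<open>b\<close> and \<open>b'\<close>. The opposite order is
  obtained by exchanging the two groups of arguments.\<close>

definition dval where
  "dval X Y as ws x y Z b x' y' Z' b' = cmap X Y x y (contr_val (insert x X, insert y Y) x' Z' b' (as @ [((Z, {y}), b)]) ws)"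

text \<open>The three possible places of \<open>x'\<close> for the contraction performed at the
  start. In each of them the factor with output \<open>y\<close> is again last afterwards, so the
  other contraction is given by \<open>cmap_last\<close>.\<close>

lemma dval_eq:
  assumes d: "dbl X Y as ws x y Z b x' y' Z' b'"
  shows "x' \<in> Z' \<Longrightarrow> dval X Y as ws x y Z b x' y' Z' b' =
      contr_val (X, Y) x Z b as (((Z' - {x'}, {}), delta_mark K P Z' x' b') # ws)"
    "x' \<in> Z \<Longrightarrow> dval X Y as ws x y Z b x' y' Z' b' =
      contr_val (X, Y) x ((Z - {x'}) \<union> Z') (oc Z x' Z' b b') as ws"
    "x' \<notin> Z \<Longrightarrow> x' \<notin> Z' \<Longrightarrow> dval X Y as ws x y Z b x' y' Z' b' =
      contr_val (X, Y) x Z b (map (ins_a x' Z' b') as) (map (ins_w x' Z' b') ws)"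
proof -
  note c = dbl_ctr(1)[OF d]
  have n: "x \<notin> X" "y \<notin> Y" using d by (auto simp: dbl_def)
  have last: "cmap X Y x y (LST (insert x X, insert y Y) (bs @ [((W, {y}), u)]) vs) = contr_val (X, Y) x W u bs vs"
    if "LSg (insert x X, insert y Y) (bs @ [((W, {y}), u)]) vs" for bs W u vs
    by (rule cmap_last) (use that n in \<open>simp add: ctr_def\<close>)
  show "dval X Y as ws x y Z b x' y' Z' b' =
      contr_val (X, Y) x Z b as (((Z' - {x'}, {}), delta_mark K P Z' x' b') # ws)" if x': "x' \<in> Z'"
    using last[OF ctr_good(1)[OF c x']] x' by (simp add: dval_def contr_val_def)
  show "dval X Y as ws x y Z b x' y' Z' b' =
      contr_val (X, Y) x ((Z - {x'}) \<union> Z') (oc Z x' Z' b b') as ws" if x': "x' \<in> Z"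
  proof -
    note s = ctr_split(1)[OF c refl x', of b']
    have "LSg (insert x X, insert y Y) (as @ [(((Z - {x'}) \<union> Z', {y}), oc Z x' Z' b b')]) ws"
      using ctr_good(2)[OF c] s x' by (simp add: ins_simps)
    from last[OF this] show ?thesis using contr_val_split(1)[OF c refl x'] by (simp add: dval_def)
  qed
  show "dval X Y as ws x y Z b x' y' Z' b' =
      contr_val (X, Y) x Z b (map (ins_a x' Z' b') as) (map (ins_w x' Z' b') ws)" if x': "x' \<notin> Z" "x' \<notin> Z'"
    using last[OF ctr_good(2)[OF c x'(2), unfolded map_append list.map ins_simps(2)[OF x'(1)]]] x'
    by (simp add: dval_def contr_val_def ins_simps)
qed

text \<open>Each of \<open>x\<close> and \<open>x'\<close> may lie in \<open>Z\<close>, in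
  \<open>Z'\<close> or in a third factor, which makes nine configurations. The hypothesis selects
  five of them; exchanging the two pairs yields all others except the one where both lie in third
  factors.\<close>

lemma dval_comm1:
  assumes d: "dbl X Y as ws x y Z b x' y' Z' b'"
    and c: "x' \<in> Z' \<or> x' \<in> Z \<and> x \<notin> Z"
  shows "dval X Y as ws x y Z b x' y' Z' b' = dval X Y as ws x' y' Z' b' x y Z b"
proof -
  note f = dbl_facts[OF d] and c1 = dbl_ctr(1)[OF d] and c2 = dbl_ctr(2)[OF d]
  note e = dval_eq[OF d] and e' = dval_eq[OF dbl_sym[OF d]]
  have n: "x' \<in> Z' \<Longrightarrow> x' \<notin> Z" "x \<in> Z' \<Longrightarrow> x \<notin> Z" "x' \<in> Z \<Longrightarrow> x' \<notin> Z'" using f(4) by auto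
  consider (1) "x' \<in> Z'" "x \<in> Z" | (2) "x' \<in> Z'" "x \<in> Z'" | (4) "x' \<in> Z" "x \<in> Z'"
    | (5) "x' \<in> Z'" "x \<notin> Z" "x \<notin> Z'" | (7) "x' \<in> Z" "x \<notin> Z" "x \<notin> Z'"
    using c by blast
  then show ?thesis
  proof cases
    \<comment> \<open>Each operation is contracted with itself and becomes a factor of
      \<open>delta\<close>; the two orders differ by an exchange in the symmetric power.\<close>
    case 1
    have g1: "LSg (X, Y) as ([] @ ((Z - {x}, {}), delta_mark K P Z x b) # ((Z' - {x'}, {}), delta_mark K P Z' x' b') # ws)"
    proof -
      have nx: "x \<notin> X" "y \<notin> Y" using d by (auto simp: dbl_def)
      have "ctr X Y x y as Z b (((Z' - {x'}, {}), delta_mark K P Z' x' b') # ws)"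
        using ctr_good(1)[OF c1 1(1)] nx by (simp add: ctr_def)
      from ctr_good(1)[OF this 1(2)] show ?thesis by simp
    qed
    show ?thesis using e(1)[OF 1(1)] e'(1)[OF 1(2)] LS_term_swap_w[OF g1] 1 by (simp add: contr_val_def)
  next
    \<comment> \<open>The operation \<open>b'\<close> is marked at \<open>x'\<close> and receives
      \<open>b\<close> at \<open>x\<close>, in either order.\<close>
    case 2
    have s: "((Z' - {x'}) - {x}) \<union> Z = ((Z' - {x}) \<union> Z) - {x'}" using 2 f(1) n by auto
    have m: "delta_mark K P ((Z' - {x}) \<union> Z) x' (oc Z' x Z b' b) = delta_act K P (Z' - {x'}) x Z (delta_mark K P Z' x' b') b"
      by (rule delta_mark_act[OF f(8)[OF 2(2)] 2(1) _ _ f(6,5)]) (use 2 f(1) n in auto)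
    have i: "map (ins_a x Z b) as = as" "map (ins_w x Z b) ws = ws"
      using ctr_split(1)[OF c2 refl 2(2), of b] by simp_all
    show ?thesis
      using e(1)[OF 2(1)] e'(2)[OF 2(2)] 2 n f(1) m s i by (simp add: contr_val_def ins_simps)
  next
    case 4
    have s: "((Z - {x'}) \<union> Z') - {x} = ((Z' - {x}) \<union> Z) - {x'}" using 4 n f(4) by auto
    have m: "delta_mark K P ((Z - {x'}) \<union> Z') x (oc Z x' Z' b b') = delta_mark K P ((Z' - {x}) \<union> Z) x' (oc Z' x Z b' b)"
      by (rule delta_mark_comm[OF f(7)[OF 4(1)] f(8)[OF 4(2)] f(4-6)])
    show ?thesis using e(2)[OF 4(1)] e'(2)[OF 4(2)] 4 s m by (simp add: contr_val_def)
  next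
    \<comment> \<open>The marking of \<open>b'\<close> and the insertion of \<open>b\<close> into a
      third factor do not interact.\<close>
    case 5
    show ?thesis using e(1)[OF 5(1)] e'(3)[OF 5(3,2)] 5 by (simp add: contr_val_def ins_simps)
  next
    \<comment> \<open>Inserting \<open>b'\<close> into \<open>b\<close> and the result into the
      factor containing \<open>x\<close> equals inserting \<open>b\<close> there and then
      \<open>b'\<close> at the input \<open>x'\<close> that \<open>b\<close> brought along. The
      factor may come from the operad (\<open>M1\<close>) or from \<open>delta\<close>
      (\<open>M2\<close>).\<close>
    case 7
    have ok: "okc ((S - {x}) \<union> Z) x' Z'" if "okc S x Z" "S \<inter> Z' = {}" for S
      using that f 7 by (auto simp: okc_def)
    have ok': "okc S x ((Z - {x'}) \<union> Z')" if "okc S x Z" "S \<inter> Z' = {}" for S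
      using that f 7 by (auto simp: okc_def)
    have s: "((S - {x}) \<union> Z) - {x'} \<union> Z' = (S - {x}) \<union> ((Z - {x'}) \<union> Z')" if "S \<inter> Z = {}" for S
      using that 7 by auto
    have xx: "x' \<notin> S" if "S \<inter> Z = {}" for S using that 7(1) by auto
    have M1: "ins_a x ((Z - {x'}) \<union> Z') (oc Z x' Z' b b') p = ins_a x' Z' b' (ins_a x Z b p)" if p: "p \<in> set as" for p
    proof -
      obtain S T a where p': "p = ((S, T), a)" by (metis surj_pair)
      have m: "((S, T), a) \<in> set (as @ [((Z, {y}), b)])" "((S, T), a) \<in> set (as @ [((Z', {y'}), b')])" using p p' by auto
      note a1 = ctr_a[OF c1 m(1)] and a2 = ctr_a[OF c2 m(2)]
      show ?thesis
      proof (cases "x \<in> S")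
        case True
        note o = a2(7)[OF True]
        show ?thesis
          using oc_seq[OF o 7(1) ok[OF o a1(2)] a1(5) f(5,6)] s[OF a2(2)] True 7(1) by (simp add: p' ins_simps)
      next
        case False
        then show ?thesis using xx[OF a2(2)] by (simp add: p' ins_simps)
      qed
    qed
    have M2: "ins_w x ((Z - {x'}) \<union> Z') (oc Z x' Z' b b') p = ins_w x' Z' b' (ins_w x Z b p)" if p: "p \<in> set ws" for p
    proof -
      obtain S T a where p': "p = ((S, T), a)" by (metis surj_pair)
      note a1 = ctr_w[OF c1 p[unfolded p']] and a2 = ctr_w[OF c2 p[unfolded p']]
      show ?thesis
      proof (cases "x \<in> S")
        case True
        note o = a2(6)[OF True]
        show ?thesis
          using delta_act_seq[OF o 7(1) ok[OF o a1(2)] f(7)[OF 7(1)] ok'[OF o a1(2)] a1(4) f(5,6)] s[OF a2(2)] True 7(1)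
          by (simp add: p' ins_simps)
      next
        case False
        then show ?thesis using xx[OF a2(2)] by (simp add: p' ins_simps)
      qed
    qed
    have "map (ins_a x ((Z - {x'}) \<union> Z') (oc Z x' Z' b b')) as = map (ins_a x' Z' b') (map (ins_a x Z b) as)"
      "map (ins_w x ((Z - {x'}) \<union> Z') (oc Z x' Z' b b')) ws = map (ins_w x' Z' b') (map (ins_w x Z b) ws)"
      using M1 M2 by simp_all
    then show ?thesis
      unfolding e(2)[OF 7(1)] e'(3)[OF 7(3,2)] contr_val_def using 7 n(3) by (simp del: map_map)
  qed
qed

lemma dval_comm:
  assumes d: "dbl X Y as ws x y Z b x' y' Z' b'"
  shows "dval X Y as ws x y Z b x' y' Z' b' = dval X Y as ws x' y' Z' b' x y Z b"
proof -
  consider (1) "x' \<in> Z' \<or> x' \<in> Z \<and> x \<notin> Z" | (2) "x \<in> Z \<or> x \<in> Z' \<and> x' \<notin> Z'"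
    | (9) "x \<notin> Z" "x \<notin> Z'" "x' \<notin> Z" "x' \<notin> Z'" by blast
  then show ?thesis
  proof cases
    case 1
    then show ?thesis by (rule dval_comm1[OF d])
  next
    case 2
    then show ?thesis by (rule dval_comm1[OF dbl_sym[OF d], symmetric])
  next
    \<comment> \<open>Both operations are inserted into other factors. Parallel associativity is
      used only if these coincide; insertions into distinct factors commute for trivial
      reasons.\<close>
    case 9
    note f = dbl_facts[OF d] and c1 = dbl_ctr(1)[OF d] and c2 = dbl_ctr(2)[OF d]
    have ok: "okc ((S - {x'}) \<union> Z') x Z" "okc ((S - {x}) \<union> Z) x' Z'"
      "((S - {x'}) \<union> Z') - {x} \<union> Z = ((S - {x}) \<union> Z) - {x'} \<union> Z'"
      if "okc S x Z" "okc S x' Z'" for S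
      using that f 9 by (auto simp: okc_def)
    have M1: "ins_a x Z b (ins_a x' Z' b' p) = ins_a x' Z' b' (ins_a x Z b p)" if p: "p \<in> set as" for p
    proof -
      obtain S T a where p': "p = ((S, T), a)" by (metis surj_pair)
      have m: "((S, T), a) \<in> set (as @ [((Z, {y}), b)])" "((S, T), a) \<in> set (as @ [((Z', {y'}), b')])" using p p' by auto
      note a1 = ctr_a[OF c1 m(1)] and a2 = ctr_a[OF c2 m(2)]
      show ?thesis
      proof (cases "x \<in> S \<and> x' \<in> S")
        case True
        then have o: "okc S x Z" "okc S x' Z'" using a1(7) a2(7) by auto
        show ?thesis
          using oc_par[OF f(1) o f(4) a1(5) f(5,6)] ok(3)[OF o] True 9 f(1) by (simp add: p' ins_simps)
      next
        case False
        then consider "x \<in> S" "x' \<notin> S" | "x \<notin> S" "x' \<in> S" | "x \<notin> S" "x' \<notin> S" by blast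
        then show ?thesis by cases (use 9 in \<open>simp_all add: p' ins_simps\<close>)
      qed
    qed
    have M2: "ins_w x Z b (ins_w x' Z' b' p) = ins_w x' Z' b' (ins_w x Z b p)" if p: "p \<in> set ws" for p
    proof -
      obtain S T a where p': "p = ((S, T), a)" by (metis surj_pair)
      note a1 = ctr_w[OF c1 p[unfolded p']] and a2 = ctr_w[OF c2 p[unfolded p']]
      show ?thesis
      proof (cases "x \<in> S \<and> x' \<in> S")
        case True
        then have o: "okc S x Z" "okc S x' Z'" using a1(6) a2(6) by auto
        show ?thesis
          using delta_act_par[OF f(1) o f(4) ok(2,1)[OF o] a1(4) f(5,6)] ok(3)[OF o] True 9 f(1) by (simp add: p' ins_simps)
      next
        case False
        then consider "x \<in> S" "x' \<notin> S" | "x \<notin> S" "x' \<in> S" | "x \<notin> S" "x' \<notin> S" by blast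
        then show ?thesis by cases (use 9 in \<open>simp_all add: p' ins_simps\<close>)
      qed
    qed
    have "map (ins_a x Z b) (map (ins_a x' Z' b') as) = map (ins_a x' Z' b') (map (ins_a x Z b) as)"
      "map (ins_w x Z b) (map (ins_w x' Z' b') ws) = map (ins_w x' Z' b') (map (ins_w x Z b) ws)"
      using M1 M2 by simp_all
    then show ?thesis
      unfolding dval_eq(3)[OF d 9(3,4)] dval_eq(3)[OF dbl_sym[OF d] 9(2,1)] contr_val_def using 9 by (simp del: map_map)
  qed
qed

text \<open>The values of the two orders agree by \<open>dval_comm\<close>, but each order needs the
  factor contracted at the start to stand last. Exchanging the last two factors of the exterior term
  is the only source of the sign.\<close>

lemma cmap_anti:
  assumes f: "finite X" "finite Y" "x \<notin> X" "x' \<notin> X" "x \<noteq> x'" "y \<notin> Y" "y' \<notin> Y" "y \<noteq> y'"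
    and v: "v \<in> carrier (LSV (insert x (insert x' X), insert y (insert y' Y)))"
  shows "cmap X Y x y (cmap (insert x X) (insert y Y) x' y' v) =
    neg1 K \<odot>\<^bsub>LSV (X, Y)\<^esub> cmap X Y x' y' (cmap (insert x' X) (insert y' Y) x y v)"
proof -
  let ?A = "(insert x (insert x' X), insert y (insert y' Y))" and ?W = "LSV (X, Y)"
  have A: "?A \<in> B_obj" and W: "vectorspace K ?W" using f vs_LS[of "(X, Y)"] by (auto simp: B_obj_def)
  have m: "neg1 K \<in> carrier K" using perm_char_sgn[OF K] by (simp add: perm_char_def)
  have h1: "cmap X Y x y \<in> module_hom K (LSV (insert x X, insert y Y)) ?W"
    "cmap (insert x X) (insert y Y) x' y' \<in> module_hom K (LSV ?A) (LSV (insert x X, insert y Y))"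
    "cmap X Y x' y' \<in> module_hom K (LSV (insert x' X, insert y' Y)) ?W"
    "cmap (insert x' X) (insert y' Y) x y \<in> module_hom K (LSV ?A) (LSV (insert x' X, insert y' Y))"
    using cmap_ex[of X Y x y] cmap_ex[of "insert x X" "insert y Y" x' y'] cmap_ex[of X Y x' y'] cmap_ex[of "insert x' X" "insert y' Y" x y] f
    by (auto simp: insert_commute)
  show ?thesis
  proof (rule LS_hom_eq2[OF A _ _ f(8) W hom_comp[OF h1(2,1)] hom_smult_fun[OF W hom_comp[OF h1(4,3)] m] _ v])
    show "y \<in> snd ?A" "y' \<in> snd ?A" by simp_all
    fix as Z b Z' b' ws assume g: "LSg ?A (as @ [((Z, {y}), b), ((Z', {y'}), b')]) ws"
    have d: "dbl X Y as ws x y Z b x' y' Z' b'" using g f by (simp add: dbl_def)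
    note c = dbl_ctr[OF d]
    let ?t = "LST ?A (as @ [((Z, {y}), b), ((Z', {y'}), b')]) ws" and ?t' = "LST ?A (as @ [((Z', {y'}), b'), ((Z, {y}), b)]) ws"
    have t': "?t' \<in> carrier (LSV ?A)" by (rule LS_term_closed[OF LSg_perm[OF g]]) simp_all
    \<comment> \<open>Puts the term into the shape needed for contracting the unprimed pair at the
      start.\<close>
    have sw: "?t = neg1 K \<odot>\<^bsub>LSV ?A\<^esub> ?t'" 
      by (rule LS_term_swap) (rule LSg_perm[OF g]; simp)
    have 1: "cmap X Y x y (cmap (insert x X) (insert y Y) x' y' ?t) = dval X Y as ws x y Z b x' y' Z' b'"
      using cmap_last[OF c(1)] by (simp add: dval_def insert_commute)
    have 2: "cmap X Y x' y' (cmap (insert x' X) (insert y' Y) x y ?t') = dval X Y as ws x' y' Z' b' x y Z b"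
      using cmap_last[OF c(2)] by (simp add: dval_def)
    note h2 = hom_comp[OF h1(4,3)]
    have cl: "cmap X Y x' y' (cmap (insert x' X) (insert y' Y) x y ?t') \<in> carrier ?W" by (rule hom_closed[OF h2 t'])
    have "cmap X Y x' y' (cmap (insert x' X) (insert y' Y) x y ?t) =
        neg1 K \<odot>\<^bsub>?W\<^esub> cmap X Y x' y' (cmap (insert x' X) (insert y' Y) x y ?t')"
      unfolding sw by (rule module_hom_smult[OF h2 m t'])
    then show "cmap X Y x y (cmap (insert x X) (insert y Y) x' y' ?t) =
        neg1 K \<odot>\<^bsub>?W\<^esub> cmap X Y x' y' (cmap (insert x' X) (insert y' Y) x y ?t)"
      using sg_smult(3)[OF W cl] dval_comm[OF d] unfolding 1 2 by simp
  qed
qed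

lemma contr_sys_LS: "contr_sys K (LS K P) cmap"
  by (rule contr_sys.intro[OF K kB_module_LS]) (rule cmap_ex[THEN conjunct1] cmap_nat cmap_anti; assumption)+

end

lemma D_structure_act_hom:
  assumes "D_structure K F act" "A \<in> B_obj" "B \<in> B_obj" "f \<in> carrier (Hom (D_minus K) A B)"
  shows "act A B f \<in> module_hom K (kb_sp F A) (kb_sp F B)"
  using assms lin_module.hom[of K "D_minus K" "kb_sp F" act A B f] by (simp add: D_structure_def D_minus_simps)

context op_ctx
begin

section \<open>The module structures\<close>

text \<open>The rule is stated for terms with the contracted factor last. By
  \<open>LS_hom_eq\<close> these determine a linear map, so the rule is equivalent to all
  contractions acting as \<open>cmap\<close>; both existence and uniqueness of the structure rest on
  this.\<close>

lemma contr_rule_iff: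
  assumes act: "D_structure K (LS K P) act"
  shows "contr_rule K P act \<longleftrightarrow> (\<forall>X Y x y. \<forall>v\<in>carrier (LSV (insert x X, insert y Y)).
    finite X \<longrightarrow> finite Y \<longrightarrow> x \<notin> X \<longrightarrow> y \<notin> Y \<longrightarrow>
    act (insert x X, insert y Y) (X, Y) (contr K X Y x y) v = cmap X Y x y v)" (is "_ \<longleftrightarrow> ?R")
proof
  assume r: ?R
  show "contr_rule K P act" unfolding contr_rule_def Let_def
  proof (intro allI impI, elim conjE, intro conjI allI impI)
    fix X Y x y as Z b ws
    assume h: "finite X" "finite Y" "x \<notin> X" "y \<notin> Y"
      "\<forall>(D, a)\<in>set as. \<exists>S t. D = (S, {t}) \<and> a \<in> carrier (op_sp P (Some ` S))" "b \<in> carrier (op_sp P (Some ` Z))"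
      "\<forall>(D, w)\<in>set ws. \<exists>S. D = (S, {}) \<and> w \<in> carrier (delta_sp K P S)"
      "is_decomp (map fst as @ [(Z, {y})] @ map fst ws) (insert x X, insert y Y)"
    have c: "ctr X Y x y as Z b ws"
      using h by (simp add: ctr_def LSg_def B_obj_def good_as_def good_ws_def)
    have e: "act (insert x X, insert y Y) (X, Y) (contr K X Y x y)
        (LST (insert x X, insert y Y) (as @ [((Z, {y}), b)]) ws) = contr_val (X, Y) x Z b as ws"
      using r h(1-4) LS_term_closed c cmap_last[OF c] unfolding ctr_def by auto
    show "act (insert x X, insert y Y) (X, Y) (contr K X Y x y)
        (LST (insert x X, insert y Y) (as @ [((Z, {y}), b)]) ws) =
        LST (X, Y) as (((Z - {x}, {}), delta_mark K P Z x b) # ws)" if "x \<in> Z"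
      unfolding e using that by (simp add: contr_val_def)
    fix i S T
    show "act (insert x X, insert y Y) (X, Y) (contr K X Y x y)
        (LST (insert x X, insert y Y) (as @ [((Z, {y}), b)]) ws) =
      LST (X, Y) (as[i := (((S - {x}) \<union> Z, T), op_comp P (Some ` S) (Some x) (Some ` Z) a b)]) ws"
      if "i < length as" "as ! i = ((S, T), a) \<and> x \<in> S" for a
      unfolding e using contr_val_split(1)[OF c, of "take i as" S T a "drop (Suc i) as"] that id_take_nth_drop[OF that(1)]
      by (simp add: upd_conv_take_nth_drop oc_def)
    show "act (insert x X, insert y Y) (X, Y) (contr K X Y x y)
        (LST (insert x X, insert y Y) (as @ [((Z, {y}), b)]) ws) =
      LST (X, Y) as (ws[i := (((S - {x}) \<union> Z, T), delta_act K P S x Z w b)])"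
      if "i < length ws" "ws ! i = ((S, T), w) \<and> x \<in> S" for w
      unfolding e using contr_val_split(2)[OF c, of "take i ws" S T w "drop (Suc i) ws"] that id_take_nth_drop[OF that(1)]
      by (simp add: upd_conv_take_nth_drop)
  qed
next
  assume r: "contr_rule K P act"
  show ?R
  proof (intro allI ballI impI)
    fix X Y x y v assume f: "finite X" "finite Y" "x \<notin> X" "y \<notin> Y" and v: "v \<in> carrier (LSV (insert x X, insert y Y))"
    let ?A = "(insert x X, insert y Y)"
    have o: "?A \<in> B_obj" "(X, Y) \<in> B_obj" using f by (auto simp: B_obj_def)
    have h: "act ?A (X, Y) (contr K X Y x y) \<in> module_hom K (LSV ?A) (LSV (X, Y))"
      by (rule D_structure_act_hom[OF act o])
        (use uwb_cls_closed[OF K contr_maps(2)[OF f(3,4,1,2)]] in \<open>simp add: contr_def D_minus_simps\<close>)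
    show "act ?A (X, Y) (contr K X Y x y) v = cmap X Y x y v"
    proof (rule LS_hom_eq[OF o(1) _ vs_LS[OF o(2)] h cmap_ex[OF f, THEN conjunct1] _ v, of y])
      show "y \<in> snd ?A" by simp
      fix as Z b ws assume g: "LSg ?A (as @ [((Z, {y}), b)]) ws"
      have c: "ctr X Y x y as Z b ws" using g f by (simp add: ctr_def)
      let ?c = "act ?A (X, Y) (contr K X Y x y) (LST ?A (as @ [((Z, {y}), b)]) ws)"
      have r': "(x \<in> Z \<longrightarrow> ?c = LST (X, Y) as (((Z - {x}, {}), delta_mark K P Z x b) # ws)) \<and>
        (\<forall>i<length as. \<forall>S T a. as ! i = ((S, T), a) \<and> x \<in> S \<longrightarrow>
          ?c = LST (X, Y) (as[i := (((S - {x}) \<union> Z, T), op_comp P (Some ` S) (Some x) (Some ` Z) a b)]) ws) \<and>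
        (\<forall>j<length ws. \<forall>S T w. ws ! j = ((S, T), w) \<and> x \<in> S \<longrightarrow>
          ?c = LST (X, Y) as (ws[j := (((S - {x}) \<union> Z, T), delta_act K P S x Z w b)]))"
        using r[unfolded contr_rule_def Let_def, rule_format, of X Y x y as b Z ws] f g
        by (simp add: LSg_def good_as_def good_ws_def)
      have "?c = contr_val (X, Y) x Z b as ws"
      proof (cases "x \<in> Z")
        case True
        then show ?thesis using r' by (simp add: contr_val_def)
      next
        case False
        from c False show ?thesis
        proof (cases rule: ctr_cases)
          case (a l1 S t a l2)
          show ?thesis unfolding contr_val_split(1)[OF c a(1,2)]
            using r'[THEN conjunct2, THEN conjunct1, rule_format, of "length l1" S "{t}" a] a by (simp add: oc_def)
        next
          case (w l1 S w l2)
          show ?thesis unfolding contr_val_split(2)[OF c w(1,2)]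
            using r'[THEN conjunct2, THEN conjunct2, rule_format, of "length l1" S "{}" w] w by simp
        qed
      qed
      then show "?c = cmap X Y x y (LST ?A (as @ [((Z, {y}), b)]) ws)" using cmap_last[OF c] by simp
    qed
  qed
qed

lemma contr_structure_contr:
  assumes "contr_structure K P act" "finite X" "finite Y" "x \<notin> X" "y \<notin> Y"
    "v \<in> carrier (LSV (insert x X, insert y Y))"
  shows "act (insert x X, insert y Y) (X, Y) (contr K X Y x y) v = cmap X Y x y v"
  using contr_rule_iff assms by (auto simp: contr_structure_def)

lemma contr_structure_ex: "\<exists>act. contr_structure K P act"
  using contr_sys.D_structure_ex[OF contr_sys_LS] contr_rule_iff unfolding contr_structure_def by meson

lemma contr_structure_unique:
  assumes "contr_structure K P act" "contr_structure K P act'"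
  shows "same_action (D_minus K) (LSV) act act'"
  by (rule D_structure_unique[OF K])
    (use assms contr_structure_contr[OF assms(1)] contr_structure_contr[OF assms(2)] in \<open>auto simp: contr_structure_def\<close>)

subsection \<open>The projection to the exterior part\<close>

lemma Lam_sp: "LamV A = LamS A"
  by (simp add: Lam_def star_def)

lemma vs_Lam: "A \<in> B_obj \<Longrightarrow> vectorspace K (LamV A)"
  by (rule kB_module.space[OF kB_module_Lam])

text \<open>The description of the projection prescribes values on all terms, including those with
  factors from zero spaces. Hence existence is taken from \<open>LS_ext0\<close> and not from
  \<open>LS_ext\<close>, while the good terms among them already span.\<close>

lemma LS_proj:
  assumes A: "A \<in> B_obj"
  shows "prj A \<in> module_hom K (LSV A) (LamV A)"
    "\<And>as ws. LSg A as ws \<Longrightarrow> prj A (LST A as ws) = (if ws = [] then lel A as else \<zero>\<^bsub>LamV A\<^esub>)"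
proof -
  let ?W = "LamV A"
  define S where "S = {(as, ws). as \<in> apow (total as) \<and> ws \<in> wpow (total ws) \<and>
       is_decomp [total as, total ws] A}"
  define e where "e = (\<lambda>(as, ws). LST A as ws)"
  define g where "g = (\<lambda>(as, ws :: ('a bob \<times> 'v set) list). if ws = [] then lel A as else \<zero>\<^bsub>?W\<^esub>)"
  note W = vs_Lam[OF A]
  have z: "\<zero>\<^bsub>?W\<^esub> = c \<odot>\<^bsub>?W\<^esub> \<zero>\<^bsub>?W\<^esub>" if "c \<in> carrier K" for c
    using that W module.smult_r_null[of K ?W c] by (simp add: vectorspace_def)
  have m: "neg1 K \<in> carrier K" "\<one>\<^bsub>K\<^esub> \<in> carrier K"
    using perm_char_sgn[OF K] perm_char_triv[OF K] by (simp_all add: perm_char_def)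
  \<comment> \<open>Without factors from \<open>delta\<close> the second half of the decomposition
    is empty, so the exterior term lives at \<open>A\<close> itself.\<close>
  have nilA: "A1 = A" if "(A1, A2) \<in> decomps2 A" "[] \<in> wpow A2" for A1 A2
    using that pow_terms_total[OF that(2)] by (auto simp: decomps2_def is_decomp_def total_def prod_eq_iff)
  have hz: "(\<lambda>u. \<zero>\<^bsub>?W\<^esub>) \<in> module_hom K (kb_sp (op_kB P) D) ?W" "(\<lambda>u. \<zero>\<^bsub>?W\<^esub>) \<in> module_hom K (kb_sp (delta K P) D) ?W" for D
    by (rule hom_const_zero[OF W])+
  have "\<exists>\<phi>\<in>module_hom K (LSV A) ?W. \<forall>A1 A2 as ws. (A1, A2) \<in> decomps2 A \<and>
    as \<in> apow A1 \<and> ws \<in> wpow A2 \<longrightarrow> \<phi> (LST A as ws) = g (as, ws)"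
  proof (rule LS_ext0[OF A W])
    fix A1 A2 ws assume d: "(A1, A2) \<in> decomps2 A" and ws: "ws \<in> wpow A2"
    show "star_fun K (neg1 K) (op_kB P) A1 ?W (\<lambda>as. g (as, ws))"
    proof (cases "ws = []")
      case True
      then show ?thesis using L.star_elt_fun[OF A] nilA[OF d] ws by (simp add: g_def Lam_sp)
    next
      case False
      then show ?thesis using hz vs_zero[OF W] z[OF m(1)] by (simp add: g_def star_fun_def)
    qed
  next
    fix A1 A2 as assume d: "(A1, A2) \<in> decomps2 A" and as: "as \<in> apow A1"
    show "star_fun K \<one>\<^bsub>K\<^esub> (delta K P) A2 ?W (\<lambda>ws. g (as, ws))"
      using hz vs_zero[OF W] z[OF m(2)] star_funD(1)[OF L.star_elt_fun[OF A], of as] nilA[OF d] as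
      by (auto simp: g_def star_fun_def Lam_sp)
  qed
  then obtain \<phi> where p: "\<phi> \<in> module_hom K (LSV A) ?W"
    "\<And>A1 A2 as ws. (A1, A2) \<in> decomps2 A \<Longrightarrow> as \<in> apow A1 \<Longrightarrow> ws \<in> wpow A2 \<Longrightarrow>
      \<phi> (LST A as ws) = g (as, ws)" by blast
  have S: "(as, ws) \<in> S \<longleftrightarrow> (total as, total ws) \<in> decomps2 A \<and> as \<in> apow (total as) \<and> ws \<in> wpow (total ws)"
    for as ws unfolding S_def decomps2_def by (simp add: conj_ac)
  have "\<phi> (e s) = g s" if "s \<in> S" for s
    using that p(2)[of "total (fst s)" "total (snd s)" "fst s" "snd s"] by (cases s) (simp add: S e_def)
  with p(1) have ex: "\<exists>\<phi>\<in>module_hom K (LSV A) ?W. \<forall>s\<in>S. \<phi> (e s) = g s" by blast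
  have eS: "e s \<in> carrier (LSV A)" if s: "s \<in> S" for s
  proof -
    obtain as ws where s': "s = (as, ws)" by (cases s)
    have d: "(total as, total ws) \<in> decomps2 A" "as \<in> apow (total as)" "ws \<in> wpow (total ws)"
      using s unfolding s' S by simp_all
    show ?thesis
    proof (cases "good_as as \<and> good_ws ws")
      case True
      have "LSg A as ws" using d True A by (simp add: LSg_def is_decomp_append pow_terms_def decomps2_def)
      then show ?thesis using LS_term_closed by (simp add: e_def s')
    next
      case False
      then show ?thesis using LS_term_bad_zero[OF A d] vs_zero[OF vs_LS[OF A]] by (simp add: e_def s')
    qed
  qed
  have in_S: "(as, ws) \<in> S" if "LSg A as ws" for as ws
    using LSg_pow[OF that] unfolding S by simp
  have sub: "{LST A as ws |as ws. LSg A as ws} \<subseteq> e ` S"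
  proof clarify
    fix as ws assume "LSg A as ws"
    from imageI[OF in_S[OF this], of e] show "LST A as ws \<in> e ` S" by (simp add: e_def)
  qed
  have sp: "spanning K (LSV A) (e ` S)"
    by (rule spanning_mono[OF spanning_LS[OF A] sub]) (use eS in blast)
  have "prj A = lin_ext K (LSV A) ?W {(e s, g s) |s. s \<in> S}"
    unfolding LS_proj_def S_def e_def g_def by (simp only: split_paired_Ex split mem_Collect_eq case_prod_conv)
  then have "prj A = lin_ext K (LSV A) ?W ((\<lambda>s. (e s, g s)) ` S)"
    by (simp only: Setcompr_eq_image)
  note l = lin_ext_family[OF vs_LS[OF A] W sp ex refl, folded this]
  show "prj A \<in> module_hom K (LSV A) ?W" by (rule l(1))
  show "prj A (LST A as ws) = (if ws = [] then lel A as else \<zero>\<^bsub>?W\<^esub>)" if "LSg A as ws" for as ws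
    using l(2)[OF in_S[OF that]] by (simp add: e_def g_def)
qed

section \<open>A linear section of the projection and the contractions that it induces\<close>

definition sec :: "'a bob \<Rightarrow> ('a, 'k, 'v) star \<Rightarrow> ('a, 'k, ('a, 'k, 'v) star, ('a, 'k, 'v set) star) cnv" where
  "sec A v = cel A (A, v)
    (({}, {}), sel ({}, {}) [])"

lemma decomps2_unit: "(A, ({}, {})) \<in> decomps2 A"
  by (simp add: decomps2_def is_decomp_iff bdisj_def)

lemma nil_pow: "[] \<in> pow_terms F ({}, {})"
  by (simp add: pow_terms_def is_decomp_def)

text \<open>The section multiplies by the empty symmetric product at the pair of empty sets, so an
  exterior term becomes the same term without factors from \<open>delta\<close>. Contracting such a
  term may create a factor from \<open>delta\<close>, which is why \<open>lcmap\<close> projects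
  again afterwards.\<close>

lemma sec:
  assumes A: "A \<in> B_obj"
  shows "sec A \<in> module_hom K (LamV A) (LSV A)"
    "\<And>as. as \<in> apow A \<Longrightarrow> sec A (lel A as) = LST A as []"
proof -
  have "({}, {}) \<in> B_obj" by (simp add: B_obj_def)
  then have "sel ({}, {}) [] \<in> carrier (kb_sp (SymF) ({}, {}))"
    using star_funD(1)[OF S.star_elt_fun nil_pow] by (simp add: star_sp_simp)
  then show "sec A \<in> module_hom K (LamV A) (LSV A)"
    using conv_ctx.conv_elt_bilin[OF LS_ctx[OF A] decomps2_unit] unfolding bilin_def LS_sp sec_def[abs_def] Lam_def by blast
  show "sec A (lel A as) = LST A as []" if "as \<in> apow A" for as
    using pow_terms_total[OF that] by (simp add: sec_def LS_term_def total_def)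
qed

lemma LSg_nil:
  assumes A: "A \<in> B_obj" and as: "as \<in> apow A" "good_as as" shows "LSg A as []"
  using assms by (simp add: LSg_def pow_terms_def)

lemma lel_bad_zero:
  assumes A: "A \<in> B_obj" and as: "as \<in> apow A" and bad: "\<not> good_as as"
  shows "lel A as = \<zero>\<^bsub>LamV A\<^esub>"
proof -
  obtain D a where Da: "(D, a) \<in> set as" "\<nexists>S t. D = (S, {t}) \<and> a \<in> carrier (OP S)"
    using bad by (auto simp: good_as_def)
  then obtain l1 l2 where sp: "as = l1 @ (D, a) # l2" using split_list by metis
  note m = pow_terms_memD[OF as Da(1)]
  have "card (snd D) \<noteq> 1"
  proof
    assume "card (snd D) = 1"
    then obtain S t where "D = (S, {t})" unfolding card_Suc0_iff by blast
    then show False using Da(2) m by (simp add: op_kB_sp)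
  qed
  then have "a = \<zero>\<^bsub>kb_sp (op_kB P) D\<^esub>" using m by (cases D) (simp add: op_kB_sp zero_space_def)
  then show ?thesis
    using hom_zero[OF L.vs_F[OF conjunct1[OF m] A] vs_Lam[OF A, unfolded Lam_sp] star_funD(2)[OF L.star_elt_fun[OF A] as[unfolded sp]]]
    by (simp add: sp Lam_sp)
qed

lemma LS_proj_sec:
  assumes A: "A \<in> B_obj" and v: "v \<in> carrier (LamV A)"
  shows "prj A (sec A v) = v"
proof (rule spanning_hom_eq[OF vs_Lam[OF A] vs_Lam[OF A] _ hom_comp[OF sec(1)[OF A] LS_proj(1)[OF A]] hom_ident _ v])
  show "spanning K (LamV A) (lel A ` apow A)" unfolding Lam_sp by (rule L.spanning_star)
      (use A in simp_all)
  fix u assume "u \<in> lel A ` apow A"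
  then obtain as where as: "as \<in> apow A" and u: "u = lel A as" by blast
  show "prj A (sec A u) = u"
  proof (cases "good_as as")
    case True
    then show ?thesis using LS_proj(2)[OF A LSg_nil[OF A as]] sec(2)[OF A as] by (simp add: u)
  next
    case False
    note h = hom_comp[OF sec(1)[OF A] LS_proj(1)[OF A]]
    show ?thesis unfolding u lel_bad_zero[OF A as False] by (rule hom_zero[OF vs_Lam[OF A] vs_Lam[OF A] h])
  qed
qed

lemma LS_proj_surj:
  assumes A: "A \<in> B_obj" shows "prj A ` carrier (LSV A) = carrier (LamV A)"
  using hom_closed[OF LS_proj(1)[OF A]] hom_closed[OF sec(1)[OF A]] LS_proj_sec[OF A] by (auto simp: image_iff) metis

lemma LS_spanning_eq:
  assumes A: "A \<in> B_obj" and W: "vectorspace K W"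
    and h: "\<phi> \<in> module_hom K (LSV A) W" "\<psi> \<in> module_hom K (LSV A) W"
    and e: "\<And>as ws. LSg A as ws \<Longrightarrow> \<phi> (LST A as ws) = \<psi> (LST A as ws)"
    and v: "v \<in> carrier (LSV A)"
  shows "\<phi> v = \<psi> v"
  by (rule spanning_hom_eq[OF vs_LS[OF A] W spanning_LS[OF A] h _ v]) (use e in blast)

lemma LS_proj_nat:
  assumes A: "A \<in> B_obj" and B: "B \<in> B_obj" and h: "h \<in> B_hom A B" and v: "v \<in> carrier (LSV A)"
  shows "prj B (kb_act (LS K P) A B h v) = kb_act (Lam K P) A B h (prj A v)"
proof (rule LS_spanning_eq[OF A vs_Lam[OF B] hom_comp[OF kB_module.hom[OF kB_module_LS A B h] LS_proj(1)[OF B]]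
      hom_comp[OF LS_proj(1)[OF A] kB_module.hom[OF kB_module_Lam A B h]] _ v])
  fix as ws assume g: "LSg A as ws"
  note l = LS_proj(2)[OF A g] LS_proj(2)[OF B LSg_transport[OF g h B]] LS_act[OF A B h g]
  show "prj B (kb_act (LS K P) A B h (LST A as ws)) = kb_act (Lam K P) A B h (prj A (LST A as ws))"
  proof (cases "ws = []")
    case True
    then have "total ws = ({}, {})" by (simp add: total_def)
    then have "total as = A" using LSg_pow(1)[OF g] by (auto simp: decomps2_def is_decomp_def prod_eq_iff)
    then show ?thesis using l True L.star_act(2)[OF A B h] LSg_pow(2)[OF g] by (simp add: Lam_def)
  next
    case False
    then show ?thesis using l hom_zero[OF vs_Lam[OF A] vs_Lam[OF B] kB_module.hom[OF kB_module_Lam A B h]] by simp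
  qed
qed

definition lcmap where
  "lcmap X Y x y v = prj (X, Y) (cmap X Y x y (sec (insert x X, insert y Y) v))"

text \<open>Shows that the contraction on the exterior part does not depend on the chosen lift. On
  terms without factors from \<open>delta\<close> the section gives back the term; on all others the
  contracted term still has such a factor, so both sides vanish.\<close>

lemma lcmap_proj:
  assumes f: "finite X" "finite Y" "x \<notin> X" "y \<notin> Y" and v: "v \<in> carrier (LSV (insert x X, insert y Y))"
  shows "prj (X, Y) (cmap X Y x y v) = lcmap X Y x y (prj (insert x X, insert y Y) v)"
proof -
  let ?A = "(insert x X, insert y Y)"
  have o: "?A \<in> B_obj" "(X, Y) \<in> B_obj" using f by (auto simp: B_obj_def)
  note c = cmap_ex[OF f, THEN conjunct1]
  note h = hom_comp[OF hom_comp[OF sec(1)[OF o(1)] c] LS_proj(1)[OF o(2)], folded lcmap_def]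
  show ?thesis
  proof (rule LS_hom_eq[OF o(1) _ vs_Lam[OF o(2)] hom_comp[OF c LS_proj(1)[OF o(2)]] hom_comp[OF LS_proj(1)[OF o(1)] h] _ v, of y])
    show "y \<in> snd ?A" by simp
    fix as Z b ws assume g: "LSg ?A (as @ [((Z, {y}), b)]) ws"
    have c': "ctr X Y x y as Z b ws" using g f by (simp add: ctr_def)
    show "prj (X, Y) (cmap X Y x y (LST ?A (as @ [((Z, {y}), b)]) ws)) =
      lcmap X Y x y (prj ?A (LST ?A (as @ [((Z, {y}), b)]) ws))"
    proof (cases "ws = []")
      case True
      have "total (as @ [((Z, {y}), b)]) = ?A"
        using g is_decomp_total[of "as @ [((Z, {y}), b)]" ?A] True by (simp add: LSg_def)
      then have "as @ [((Z, {y}), b)] \<in> apow ?A" using LSg_pow(2)[OF g] by simp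
      then show ?thesis using LS_proj(2)[OF o(1) g] sec(2)[OF o(1)] True by (simp add: lcmap_def)
    next
      case False
      have "prj (X, Y) (contr_val (X, Y) x Z b as ws) = \<zero>\<^bsub>LamV (X, Y)\<^esub>"
        using LS_proj(2)[OF o(2) ctr_good(1)[OF c']] LS_proj(2)[OF o(2) ctr_good(2)[OF c']] False by (simp add: contr_val_def)
      then show ?thesis
        using LS_proj(2)[OF o(1) g] hom_zero[OF vs_Lam[OF o(1)] vs_Lam[OF o(2)] h] False by (simp add: cmap_last[OF c'])
    qed
  qed
qed

text \<open>A vector is lifted along the surjection, the identity holds for the lift, and
  \<open>lcmap_proj\<close> together with naturality of the projection brings it down.\<close>

lemma contr_sys_Lam: "contr_sys K (Lam K P) lcmap"
proof (rule contr_sys.intro[OF K kB_module_Lam])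
  fix X Y :: "'a set" and x y assume f: "finite X" "finite Y" "x \<notin> X" "y \<notin> Y"
  let ?A = "(insert x X, insert y Y)"
  have o: "?A \<in> B_obj" "(X, Y) \<in> B_obj" using f by (auto simp: B_obj_def)
  show "lcmap X Y x y \<in> module_hom K (LamV ?A) (LamV (X, Y))"
    by (rule hom_comp[OF hom_comp[OF sec(1)[OF o(1)] cmap_ex[OF f, THEN conjunct1]] LS_proj(1)[OF o(2)], folded lcmap_def])
next
  fix X Y X' Y' :: "'a set" and x y x' y' h v
  assume f: "finite X" "finite Y" "x \<notin> X" "y \<notin> Y" "x' \<notin> X'" "y' \<notin> Y'"
    and h: "h \<in> B_hom (insert x X, insert y Y) (insert x' X', insert y' Y')" and hx: "fst h x = x'" "snd h y = y'"
    and v: "v \<in> carrier (LamV (insert x X, insert y Y))"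
  let ?A = "(insert x X, insert y Y)" and ?A' = "(insert x' X', insert y' Y')"
  have fin: "finite X'" "finite Y'"
    using h f(1,2) FB_hom_finite[of "fst h" "insert x X" "insert x' X'"] FB_hom_finite[of "snd h" "insert y Y" "insert y' Y'"]
    by (simp_all add: B_hom_def mem_Times_iff)
  have o: "?A \<in> B_obj" "?A' \<in> B_obj" "(X, Y) \<in> B_obj" "(X', Y') \<in> B_obj" using f fin by (auto simp: B_obj_def)
  obtain u where u: "u \<in> carrier (LSV ?A)" "v = prj ?A u"
    using LS_proj_surj[OF o(1)] v by blast
  have hr: "B_restrict h (X, Y) \<in> B_hom (X, Y) (X', Y')"
  proof -
    have "B_image h (X, Y) = (X', Y')"
      using h f(3-6) hx inj_on_image_set_diff[of "fst h" "insert x X" "insert x X" "{x}"] inj_on_image_set_diff[of "snd h" "insert y Y" "insert y Y" "{y}"]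
      by (auto simp: B_hom_def FB_hom_def bij_betw_def mem_Times_iff B_image_def insert_ident)
    then show ?thesis using B_hom_bsub(1)[OF h, of "(X, Y)"] by (auto simp: bsub_def)
  qed
  have "lcmap X' Y' x' y' (kb_act (Lam K P) ?A ?A' h v) = lcmap X' Y' x' y' (prj ?A' (kb_act (LS K P) ?A ?A' h u))"
    by (simp add: u(2) LS_proj_nat[OF o(1,2) h u(1)])
  also have "\<dots> = prj (X', Y') (cmap X' Y' x' y' (kb_act (LS K P) ?A ?A' h u))"
    by (rule lcmap_proj[OF fin f(5,6) hom_closed[OF kB_module.hom[OF kB_module_LS o(1,2) h] u(1)], symmetric])
  also have "\<dots> = kb_act (Lam K P) (X, Y) (X', Y') (B_restrict h (X, Y)) (prj (X, Y) (cmap X Y x y u))"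
    unfolding cmap_nat[OF f h hx u(1)]
    by (rule LS_proj_nat[OF o(3,4) hr hom_closed[OF cmap_ex[OF f(1-4), THEN conjunct1] u(1)]])
  finally show "lcmap X' Y' x' y' (kb_act (Lam K P) ?A ?A' h v) =
      kb_act (Lam K P) (X, Y) (X', Y') (B_restrict h (X, Y)) (lcmap X Y x y v)"
    unfolding u(2) lcmap_proj[OF f(1-4) u(1)] .
next
  fix X Y :: "'a set" and x y x' y' v
  assume f: "finite X" "finite Y" "x \<notin> X" "x' \<notin> X" "x \<noteq> x'" "y \<notin> Y" "y' \<notin> Y" "y \<noteq> y'"
    and v: "v \<in> carrier (LamV (insert x (insert x' X), insert y (insert y' Y)))"
  let ?A = "(insert x (insert x' X), insert y (insert y' Y))"
  have o: "?A \<in> B_obj" "(X, Y) \<in> B_obj" using f by (auto simp: B_obj_def)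
  have m: "neg1 K \<in> carrier K" using perm_char_sgn[OF K] by (simp add: perm_char_def)
  obtain u where u: "u \<in> carrier (LSV ?A)" "v = prj ?A u"
    using LS_proj_surj[OF o(1)] v by blast
  have u': "u \<in> carrier (LSV (insert x' (insert x X), insert y' (insert y Y)))" "v = prj (insert x' (insert x X), insert y' (insert y Y)) u"
    using u by (simp_all add: insert_commute)
  \<comment> \<open>The four labels are quantified anew so that one computation of a double
    contraction serves both orders.\<close>
  have two: "lcmap X Y x y (lcmap (insert x X) (insert y Y) x' y' (prj (insert x' (insert x X), insert y' (insert y Y)) u)) =
      prj (X, Y) (cmap X Y x y (cmap (insert x X) (insert y Y) x' y' u))"
    "cmap X Y x y (cmap (insert x X) (insert y Y) x' y' u) \<in> carrier (LSV (X, Y))"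
    if f: "x \<notin> X" "x' \<notin> X" "x \<noteq> x'" "y \<notin> Y" "y' \<notin> Y" "y \<noteq> y'" and u: "u \<in> carrier (LSV (insert x' (insert x X), insert y' (insert y Y)))"
    for x y x' y'
  proof -
    have f1: "finite (insert x X)" "finite (insert y Y)" "x' \<notin> insert x X" "y' \<notin> insert y Y" using f \<open>finite X\<close> \<open>finite Y\<close> by auto
    note c = hom_closed[OF cmap_ex[OF f1, THEN conjunct1] u]
    show "lcmap X Y x y (lcmap (insert x X) (insert y Y) x' y' (prj (insert x' (insert x X), insert y' (insert y Y)) u)) =
      prj (X, Y) (cmap X Y x y (cmap (insert x X) (insert y Y) x' y' u))"
      unfolding lcmap_proj[OF f1 u, symmetric] lcmap_proj[OF \<open>finite X\<close> \<open>finite Y\<close> f(1,4) c] ..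
    show "cmap X Y x y (cmap (insert x X) (insert y Y) x' y' u) \<in> carrier (LSV (X, Y))"
      by (rule hom_closed[OF cmap_ex[OF \<open>finite X\<close> \<open>finite Y\<close> f(1,4), THEN conjunct1] c])
  qed
  note t1 = two[OF f(3-8) u'(1)] and t2 = two[OF f(4,3) f(5)[symmetric] f(7,6) f(8)[symmetric] u(1)]
  show "lcmap X Y x y (lcmap (insert x X) (insert y Y) x' y' v) =
    neg1 K \<odot>\<^bsub>LamV (X, Y)\<^esub> lcmap X Y x' y' (lcmap (insert x' X) (insert y' Y) x y v)"
    using t1(1) t2(1) cmap_anti[OF f u(1)] module_hom_smult[OF LS_proj(1)[OF o(2)] m t2(2)]
    unfolding u(2)[symmetric] u'(2)[symmetric] by simp
qed

lemma induced_structure_ex: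
  assumes act: "contr_structure K P act" shows "\<exists>ind. induced_structure K P act ind"
proof -
  obtain ind where i0: "D_structure K (Lam K P) ind \<and> (\<forall>X Y x y. \<forall>v\<in>carrier (LamV (insert x X, insert y Y)).
    finite X \<longrightarrow> finite Y \<longrightarrow> x \<notin> X \<longrightarrow> y \<notin> Y \<longrightarrow>
    ind (insert x X, insert y Y) (X, Y) (contr K X Y x y) v = lcmap X Y x y v)"
    using contr_sys.D_structure_ex[OF contr_sys_Lam] by (rule exE)
  note i = i0[THEN conjunct1] i0[THEN conjunct2, rule_format]
  have "lin_module_hom K (D_minus K) (LSV) act (LamV) ind (prj)"
  proof (rule D_structure_hom[OF K _ i(1)])
    show "D_structure K (LS K P) act" using act by (simp add: contr_structure_def)
    show "prj A \<in> module_hom K (LSV A) (LamV A)" if "A \<in> B_obj" for A by (rule LS_proj(1)[OF that])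
    show "prj B (kb_act (LS K P) A B h v) = kb_act (Lam K P) A B h (prj A v)"
      if "A \<in> B_obj" "B \<in> B_obj" "h \<in> B_hom A B" "v \<in> carrier (LSV A)" for A B h v by (rule LS_proj_nat[OF that])
    fix X Y :: "'a set" and x y v assume f: "finite X" "finite Y" "x \<notin> X" "y \<notin> Y" and v: "v \<in> carrier (LSV (insert x X, insert y Y))"
    have "(insert x X, insert y Y) \<in> B_obj" using f by (simp add: B_obj_def)
    then show "prj (X, Y) (act (insert x X, insert y Y) (X, Y) (contr K X Y x y) v) =
      ind (insert x X, insert y Y) (X, Y) (contr K X Y x y) (prj (insert x X, insert y Y) v)"
      using contr_structure_contr[OF act f v] lcmap_proj[OF f v] i(2)[OF hom_closed[OF LS_proj(1) v] f] by simp
  qed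
  with i(1) show ?thesis by (auto simp: induced_structure_def)
qed

lemma induced_structure_proj:
  assumes "induced_structure K P act ind" "A \<in> B_obj" "B \<in> B_obj" "f \<in> carrier (Hom (D_minus K) A B)" "u \<in> carrier (LSV A)"
  shows "ind A B f (prj A u) = prj B (act A B f u)"
  using assms unfolding induced_structure_def lin_module_hom_def D_minus_simps(1) by auto

text \<open>Since the projection is surjective, commuting with it determines the action on every
  vector of the exterior part.\<close>

lemma induced_structure_unique:
  assumes "induced_structure K P act ind" "induced_structure K P act ind'"
  shows "same_action (D_minus K) (LamV) ind ind'"
  unfolding same_action_def D_minus_simps(1)
proof (intro ballI)
  fix A B f v assume *: "A \<in> B_obj" "B \<in> B_obj" "f \<in> carrier (Hom (D_minus K) A B)" and v: "v \<in> carrier (LamV A)"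
  obtain u where u: "u \<in> carrier (LSV A)" "v = prj A u" using LS_proj_surj[OF *(1)] v by blast
  show "ind A B f v = ind' A B f v"
    unfolding u(2) induced_structure_proj[OF assms(1) * u(1)] induced_structure_proj[OF assms(2) * u(1)] ..
qed

end

section \<open>Functoriality in the operad\<close>

locale op_map = P: op_ctx K P + Q: op_ctx K Q
  for K :: "'k ring" and P :: "('a option, 'k, 'v) operad" and Q :: "('a option, 'k, 'w) operad" +
  fixes \<phi> :: "'a option set \<Rightarrow> 'v \<Rightarrow> 'w"
  assumes \<phi>: "operad_hom K P Q \<phi>"
begin

abbreviation "LSm \<equiv> LS_map K P Q \<phi>"
abbreviation "Lamm \<equiv> Lam_map K P Q \<phi>"
abbreviation "po S \<equiv> \<phi> (Some ` S)"
abbreviation "pp S \<equiv> \<phi> (pointed S)"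

section \<open>Compatibility of a morphism of operads with composition, relabelling and
  marking\<close>

lemma p_hom: "finite S \<Longrightarrow> po S \<in> module_hom K (P.OP S) (Q.OP S)" "finite S \<Longrightarrow> pp S \<in> module_hom K (P.OPp S) (Q.OPp S)"
  using \<phi> by (simp_all add: operad_hom_def)

lemma p_act: "finite A \<Longrightarrow> finite B \<Longrightarrow> f \<in> FB_hom A B \<Longrightarrow> a \<in> carrier (op_sp P A) \<Longrightarrow>
    \<phi> B (op_act P A B f a) = op_act Q A B f (\<phi> A a)"
  using \<phi>[unfolded operad_hom_def, THEN conjunct2, THEN conjunct1, rule_format, of A B f a] by blast

lemma p_comp: "composable A x B \<Longrightarrow> a \<in> carrier (op_sp P A) \<Longrightarrow> b \<in> carrier (op_sp P B) \<Longrightarrow>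
    \<phi> ((A - {x}) \<union> B) (op_comp P A x B a b) = op_comp Q A x B (\<phi> A a) (\<phi> B b)"
  using \<phi>[unfolded operad_hom_def, THEN conjunct2, THEN conjunct2, rule_format, of A x B a b] by blast

lemma p_oc: "P.okc S x Z \<Longrightarrow> a \<in> carrier (P.OP S) \<Longrightarrow> b \<in> carrier (P.OP Z) \<Longrightarrow>
    po ((S - {x}) \<union> Z) (P.oc S x Z a b) = Q.oc S x Z (po S a) (po Z b)"
  using p_comp[OF P.composable_oc(1)] by (simp add: P.oc_def Q.oc_def pointed_simps)

lemma p_dc: "P.okc S x Z \<Longrightarrow> a \<in> carrier (P.OPp S) \<Longrightarrow> b \<in> carrier (P.OP Z) \<Longrightarrow>
    pp ((S - {x}) \<union> Z) (P.dc S x Z a b) = Q.dc S x Z (pp S a) (po Z b)"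
  using p_comp[OF P.composable_oc(2)] by (simp add: P.dc_def Q.dc_def pointed_simps)

lemma p_nc: "finite X \<Longrightarrow> finite Y \<Longrightarrow> X \<inter> Y = {} \<Longrightarrow> a \<in> carrier (P.OPp X) \<Longrightarrow> b \<in> carrier (P.OPp Y) \<Longrightarrow>
    pp (X \<union> Y) (P.nc X Y a b) = Q.nc X Y (pp X a) (pp Y b)"
  unfolding P.nc_def Q.nc_def by (rule p_comp[OF P.composable_oc(3), unfolded pointed_simps])

lemma p_ract: "finite S \<Longrightarrow> inj_on f S \<Longrightarrow> a \<in> carrier (P.OP S) \<Longrightarrow> po (f ` S) (P.ract f S a) = Q.ract f S (po S a)"
  using p_act[OF _ _ olift_FB(1)] by (simp add: P.ract_def Q.ract_def)

lemma p_pact: "finite S \<Longrightarrow> inj_on f S \<Longrightarrow> a \<in> carrier (P.OPp S) \<Longrightarrow> pp (f ` S) (P.pact f S a) = Q.pact f S (pp S a)"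
  using p_act[OF _ _ olift_FB(2)] by (simp add: P.pact_def Q.pact_def)

abbreviation "dm X \<equiv> delta_map K P Q \<phi> (X, {})"

text \<open>A morphism of operads preserves composition at the distinguished point, so it sends the
  relations of \<open>delta\<close> for \<open>P\<close> to those for \<open>Q\<close>.\<close>

lemma dm:
  assumes X: "finite X"
  shows "dm X \<in> module_hom K (delta_sp K P X) (delta_sp K Q X)"
    "\<And>c. c \<in> carrier (P.OPp X) \<Longrightarrow> dm X (delta_cls K P X c) = delta_cls K Q X (pp X c)"
proof -
  have r: "delta_cls K Q X (pp X (P.nc X1 X2 a b)) = delta_cls K Q X (pp X (P.nc X2 X1 b a))"
    if *: "X1 \<union> X2 = X" "X1 \<inter> X2 = {}" "a \<in> carrier (P.OPp X1)" "b \<in> carrier (P.OPp X2)" for X1 X2 a b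
  proof -
    have f: "finite X1" "finite X2" using *(1) X by auto
    show ?thesis
      using p_nc[OF f *(2-4)] p_nc[OF f(2,1) _ *(4,3)] Q.delta_cls_rel[OF f *(2) hom_closed[OF p_hom(2)[OF f(1)] *(3)] hom_closed[OF p_hom(2)[OF f(2)] *(4)]] *(1,2)
      by (simp add: Un_commute Int_commute)
  qed
  note l = P.delta_lin_ext[OF X Q.vs_delta[OF X] hom_comp[OF p_hom(2)[OF X] Q.delta_cls_hom[OF X]] r]
  show "dm X \<in> module_hom K (delta_sp K P X) (delta_sp K Q X)" using l(1) by (simp add: delta_map_def)
  show "dm X (delta_cls K P X c) = delta_cls K Q X (pp X c)" if "c \<in> carrier (P.OPp X)" for c
    using l(2)[OF _ _ _ _ that] by (simp add: delta_map_def)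
qed

lemma dm_act:
  assumes o: "P.okc X x Z" and w: "w \<in> carrier (delta_sp K P X)" and b: "b \<in> carrier (P.OP Z)"
  shows "dm ((X - {x}) \<union> Z) (delta_act K P X x Z w b) = delta_act K Q X x Z (dm X w) (po Z b)"
proof -
  have o': "Q.okc X x Z" and f: "finite X" "finite Z" "finite ((X - {x}) \<union> Z)" using o by (auto simp: P.okc_def Q.okc_def)
  obtain c where c: "c \<in> carrier (P.OPp X)" "w = delta_cls K P X c" using w P.carrier_delta[OF f(1)] by auto
  show ?thesis
    unfolding c(2) P.delta_act(2)[OF o b c(1)] dm(2)[OF f(1) c(1)] dm(2)[OF f(3) P.dc_closed[OF o c(1) b]] p_dc[OF o c(1) b]
      Q.delta_act(2)[OF o' hom_closed[OF p_hom(1)[OF f(2)] b] hom_closed[OF p_hom(2)[OF f(1)] c(1)]] ..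
qed

lemma dm_dact:
  assumes f: "finite S" "inj_on f S" and w: "w \<in> carrier (delta_sp K P S)"
  shows "dm (f ` S) (P.dact f S w) = Q.dact f S (dm S w)"
proof -
  obtain c where c: "c \<in> carrier (P.OPp S)" "w = delta_cls K P S c" using w P.carrier_delta[OF f(1)] by auto
  have fi: "finite (f ` S)" using f by simp
  show ?thesis
    unfolding c(2) P.dact(2)[OF f c(1)] dm(2)[OF f(1) c(1)] dm(2)[OF fi hom_closed[OF P.pact_hom[OF f] c(1)]] p_pact[OF f c(1)]
      Q.dact(2)[OF f hom_closed[OF p_hom(2)[OF f(1)] c(1)]] ..
qed

lemma dm_mark:
  assumes Z: "finite Z" "x \<in> Z" and b: "b \<in> carrier (P.OP Z)"
  shows "dm (Z - {x}) (delta_mark K P Z x b) = delta_mark K Q Z x (po Z b)"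
proof -
  have "pp (Z - {x}) (P.mk x Z b) = Q.mk x Z (po Z b)"
    unfolding P.mk_def Q.mk_def by (rule p_act[OF _ _ omark_FB]) (use Z b in auto)
  then show ?thesis
    using dm(2)[of "Z - {x}"] hom_closed[OF P.mk_hom[OF Z] b] Z by (simp add: P.delta_mark_mk Q.delta_mark_mk)
qed

section \<open>The induced maps on terms and on the convolution\<close>

abbreviation "ma \<equiv> \<lambda>(D, v). (D, op_kB_map Q \<phi> D v)"
abbreviation "mw \<equiv> \<lambda>(D, v). (D, delta_map K P Q \<phi> D v)"

lemma ma_simp: "ma ((S, {t}), a) = ((S, {t}), po S a)"
  by (simp add: op_kB_map_def)

lemma map_fst_m: "map fst (map ma as) = map fst as" "map fst (map mw ws) = map fst ws"
  by (simp_all add: split_beta)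

lemma total_m: "total (map ma as) = total as" "total (map mw ws) = total ws"
  by (simp_all add: total_def split_beta)

lemma op_kB_map_hom: "D \<in> B_obj \<Longrightarrow> op_kB_map Q \<phi> D \<in> module_hom K (kb_sp (op_kB P) D) (kb_sp (op_kB Q) D)"
proof -
  assume D: "D \<in> B_obj"
  obtain X Y where e: "D = (X, Y)" by (cases D)
  show ?thesis
  proof (cases "card Y = 1")
    case True
    then show ?thesis using p_hom(1)[of X] D by (simp add: e op_kB_map_def P.op_kB_sp Q.op_kB_sp B_obj_def)
  next
    case False
    have "(\<lambda>_. \<zero>\<^bsub>op_sp Q {}\<^esub>) \<in> module_hom K V (zero_space \<zero>\<^bsub>op_sp Q {}\<^esub>)" for V :: "('k, 'v) module"
      by (rule homI) (simp_all add: zero_space_def)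
    then show ?thesis using False by (simp add: e op_kB_map_def P.op_kB_sp Q.op_kB_sp)
  qed
qed

lemma delta_map_hom: "D \<in> B_obj \<Longrightarrow> delta_map K P Q \<phi> D \<in> module_hom K (kb_sp (delta K P) D) (kb_sp (delta K Q) D)"
proof -
  assume D: "D \<in> B_obj"
  obtain X Y where e: "D = (X, Y)" by (cases D)
  show ?thesis
  proof (cases "Y = {}")
    case True
    then show ?thesis using dm(1)[of X] D by (simp add: e P.delta_kB_sp Q.delta_kB_sp B_obj_def)
  next
    case False
    have "(\<lambda>_. {}) \<in> module_hom K V (zero_space {})" for V :: "('k, 'v set) module"
      by (rule homI) (simp_all add: zero_space_def)
    then show ?thesis using False by (simp add: e delta_map_def P.delta_kB_sp Q.delta_kB_sp)
  qed
qed

lemma pow_m: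
  assumes A: "A \<in> B_obj"
  shows "as \<in> pow_terms (op_kB P) A \<Longrightarrow> map ma as \<in> pow_terms (op_kB Q) A"
    "ws \<in> pow_terms (delta K P) A \<Longrightarrow> map mw ws \<in> pow_terms (delta K Q) A"
proof -
  show "map ma as \<in> pow_terms (op_kB Q) A" if as: "as \<in> pow_terms (op_kB P) A"
    unfolding pow_terms_def mem_Collect_eq map_fst_m
    using pow_terms_memD[OF as] hom_closed[OF op_kB_map_hom[OF bsub_B_obj[OF _ A]]] as by (auto simp: pow_terms_def)
  show "map mw ws \<in> pow_terms (delta K Q) A" if as: "ws \<in> pow_terms (delta K P) A"
    unfolding pow_terms_def mem_Collect_eq map_fst_m
    using pow_terms_memD[OF as] hom_closed[OF delta_map_hom[OF bsub_B_obj[OF _ A]]] as by (auto simp: pow_terms_def)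
qed

lemma Lam_map:
  assumes A: "A \<in> B_obj"
  shows "Lamm A \<in> module_hom K (P.LamV A) (Q.LamV A)"
    "\<And>as. as \<in> pow_terms (op_kB P) A \<Longrightarrow> Lamm A (P.lel A as) = Q.lel A (map ma as)"
  using star_lin_ext[OF P.L.star_ctx_axioms Q.L.star_ctx_axioms A A, where \<theta> = "\<lambda>D. D" and \<eta> = "op_kB_map Q \<phi>", OF pow_m(1)[OF A] op_kB_map_hom[OF bsub_B_obj[OF _ A]] refl]
  unfolding Lam_map_def star_map_def P.Lam_sp Q.Lam_sp by blast+

lemma Sym_map:
  assumes A: "A \<in> B_obj"
  shows "star_map K (perm_triv K) (delta K P) (delta K Q) (delta_map K P Q \<phi>) A
      \<in> module_hom K (star_sp K (perm_triv K) (delta K P) A) (star_sp K (perm_triv K) (delta K Q) A)"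
    "\<And>ws. ws \<in> pow_terms (delta K P) A \<Longrightarrow> star_map K (perm_triv K) (delta K P) (delta K Q) (delta_map K P Q \<phi>) A
      (star_elt K (perm_triv K) (delta K P) A ws) = star_elt K (perm_triv K) (delta K Q) A (map mw ws)"
  using star_lin_ext[OF P.S.star_ctx_axioms Q.S.star_ctx_axioms A A, where \<theta> = "\<lambda>D. D" and \<eta> = "delta_map K P Q \<phi>", OF pow_m(2)[OF A] delta_map_hom[OF bsub_B_obj[OF _ A]] refl]
  unfolding star_map_def by blast+

lemma LS_map:
  assumes A: "A \<in> B_obj"
  shows "LSm A \<in> module_hom K (P.LSV A) (Q.LSV A)"
    "\<And>as ws. P.LSg A as ws \<Longrightarrow> LSm A (P.LST A as ws) = Q.LST A (map ma as) (map mw ws)"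
proof -
  have h: "Lamm D \<in> module_hom K (kb_sp (Lambda_star K (op_kB P)) D) (kb_sp (Lambda_star K (op_kB Q)) D)"
    "star_map K (perm_triv K) (delta K P) (delta K Q) (delta_map K P Q \<phi>) D
      \<in> module_hom K (kb_sp (Sym_star K (delta K P)) D) (kb_sp (Sym_star K (delta K Q)) D)" if "bsub D A" for D
    using Lam_map(1)[OF bsub_B_obj[OF that A]] Sym_map(1)[OF bsub_B_obj[OF that A]] by (simp_all add: Lam_def P.star_sp_simp)
  note l = conv_lin_ext[OF P.LS_ctx[OF A] Q.LS_ctx[OF A], where \<theta> = "\<lambda>D. D", OF _ h refl]
  show "LSm A \<in> module_hom K (P.LSV A) (Q.LSV A)"
    unfolding P.LS_sp Q.LS_sp LS_map_def conv_map_def by (rule l(1))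
  show "LSm A (P.LST A as ws) = Q.LST A (map ma as) (map mw ws)" if g: "P.LSg A as ws" for as ws
  proof -
    note p = P.LSg_pow[OF g]
    have c: "star_elt K (perm_sgn K) (op_kB P) (total as) as \<in> carrier (kb_sp (Lambda_star K (op_kB P)) (total as))"
      "star_elt K (perm_triv K) (delta K P) (total ws) ws \<in> carrier (kb_sp (Sym_star K (delta K P)) (total ws))"
      using star_funD(1)[OF P.L.star_elt_fun[OF p(4)] p(2)] star_funD(1)[OF P.S.star_elt_fun[OF p(5)] p(3)]
      by (simp_all add: P.star_sp_simp)
    show ?thesis
      unfolding LS_term_def total_m LS_map_def conv_map_def Lam_map(2)[OF p(4,2), symmetric] Sym_map(2)[OF p(5,3), symmetric]
      by (rule l(2)[OF _ _ _ p(1) c])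
  qed
qed

lemma LSg_m: "P.LSg A as ws \<Longrightarrow> Q.LSg A (map ma as) (map mw ws)"
proof -
  assume g: "P.LSg A as ws"
  have "Q.good_as (map ma as)" unfolding Q.good_as_def
  proof (clarify)
    fix S T a' assume "((S, T), a') \<in> set (map ma as)"
    then obtain a where m: "((S, T), a) \<in> set as" and a': "a' = op_kB_map Q \<phi> (S, T) a" by auto
    note s = P.LSg_sub(1)[OF g m]
    then obtain t where t: "T = {t}" by blast
    then show "\<exists>S' t. (S, T) = (S', {t}) \<and> a' \<in> carrier (Q.OP S')"
      using hom_closed[OF p_hom(1)] s a' by (simp add: op_kB_map_def)
  qed
  moreover have "Q.good_ws (map mw ws)" unfolding Q.good_ws_def
  proof (clarify)
    fix S T w' assume "((S, T), w') \<in> set (map mw ws)"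
    then obtain w where m: "((S, T), w) \<in> set ws" and w': "w' = delta_map K P Q \<phi> (S, T) w" by auto
    note s = P.LSg_sub(2)[OF g m]
    then show "\<exists>S'. (S, T) = (S', {}) \<and> w' \<in> carrier (delta_sp K Q S')"
      using hom_closed[OF dm(1)] w' by simp
  qed
  ultimately show ?thesis using g unfolding P.LSg_def Q.LSg_def map_fst_m by blast
qed

lemma LS_map_nat:
  assumes A: "A \<in> B_obj" and B: "B \<in> B_obj" and h: "h \<in> B_hom A B" and v: "v \<in> carrier (P.LSV A)"
  shows "LSm B (kb_act (LS K P) A B h v) = kb_act (LS K Q) A B h (LSm A v)"
proof (rule P.LS_spanning_eq[OF A Q.vs_LS[OF B] hom_comp[OF kB_module.hom[OF P.kB_module_LS A B h] LS_map(1)[OF B]]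
      hom_comp[OF LS_map(1)[OF A] kB_module.hom[OF Q.kB_module_LS A B h]] _ v])
  fix as ws assume g: "P.LSg A as ws"
  have "ma (transport (op_kB P) h p) = transport (op_kB Q) h (ma p)" if p: "p \<in> set as" for p
  proof -
    obtain S T a where e: "p = ((S, T), a)" by (metis surj_pair)
    note s = P.LSg_sub(1)[OF g p[unfolded e]]
    then obtain t where t: "T = {t}" by blast
    have b: "bsub (S, {t}) A" using s t by simp
    show ?thesis
      unfolding e t P.transport_op[OF h b] ma_simp Q.transport_op[OF h b]
      using p_ract[OF _ P.B_hom_inj_sub[OF h b]] s by simp
  qed
  moreover have "mw (transport (delta K P) h p) = transport (delta K Q) h (mw p)" if p: "p \<in> set ws" for p
  proof -
    obtain S T w where e: "p = ((S, T), w)" by (metis surj_pair)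
    note s = P.LSg_sub(2)[OF g p[unfolded e]]
    then have t: "T = {}" and b: "bsub (S, {}) A" by auto
    show ?thesis
      unfolding e t P.transport_delta[OF h b] split Q.transport_delta[OF h b]
      using dm_dact[OF _ P.B_hom_inj_sub[OF h b]] s by simp
  qed
  ultimately have "map ma (map (transport (op_kB P) h) as) = map (transport (op_kB Q) h) (map ma as)"
    "map mw (map (transport (delta K P) h) ws) = map (transport (delta K Q) h) (map mw ws)" by simp_all
  then show "LSm B (kb_act (LS K P) A B h (P.LST A as ws)) =
      kb_act (LS K Q) A B h (LSm A (P.LST A as ws))"
    unfolding P.LS_act[OF A B h g] LS_map(2)[OF B P.LSg_transport[OF g h B]] LS_map(2)[OF A g]
      Q.LS_act[OF A B h LSg_m[OF g]] by (simp del: map_map)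
qed

text \<open>Tested on terms with the contracted factor last. The morphism keeps all blocks, so the
  same case of the rule applies on both sides, and it commutes with insertion, with the action on
  \<open>delta\<close> and with marking.\<close>

lemma LS_map_cmap:
  assumes f: "finite X" "finite Y" "x \<notin> X" "y \<notin> Y" and v: "v \<in> carrier (P.LSV (insert x X, insert y Y))"
  shows "LSm (X, Y) (P.cmap X Y x y v) = Q.cmap X Y x y (LSm (insert x X, insert y Y) v)"
proof -
  let ?A = "(insert x X, insert y Y)"
  have o: "?A \<in> B_obj" "(X, Y) \<in> B_obj" using f by (auto simp: B_obj_def)
  show ?thesis
  proof (rule P.LS_hom_eq[OF o(1) _ Q.vs_LS[OF o(2)] hom_comp[OF P.cmap_ex[OF f, THEN conjunct1] LS_map(1)[OF o(2)]]
        hom_comp[OF LS_map(1)[OF o(1)] Q.cmap_ex[OF f, THEN conjunct1]] _ v, of y])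
    show "y \<in> snd ?A" by simp
    fix as Z b ws assume g: "P.LSg ?A (as @ [((Z, {y}), b)]) ws"
    have c: "P.ctr X Y x y as Z b ws" using g f by (simp add: P.ctr_def)
    note bc = P.ctr_basic[OF c]
    have c': "Q.ctr X Y x y (map ma as) Z (po Z b) (map mw ws)"
      using LSg_m[OF g] f by (simp add: Q.ctr_def op_kB_map_def)
    have "LSm (X, Y) (P.contr_val (X, Y) x Z b as ws) = Q.contr_val (X, Y) x Z (po Z b) (map ma as) (map mw ws)"
    proof (cases "x \<in> Z")
      case True
      then show ?thesis
        using LS_map(2)[OF o(2) P.ctr_good(1)[OF c True]] dm_mark[OF bc(5) True bc(6)]
        by (simp add: P.contr_val_def Q.contr_val_def)
    next
      case False
      have "ma (P.ins_a x Z b p) = Q.ins_a x Z (po Z b) (ma p)" if p: "p \<in> set as" for p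
      proof -
        obtain S T a where e: "p = ((S, T), a)" by (metis surj_pair)
        note ca = P.ctr_a[OF c p[unfolded e]]
        obtain t where t: "T = {t}" using ca(6) by blast
        show ?thesis
          using p_oc[OF ca(7) ca(5) bc(6)] unfolding e t ma_simp
          by (cases "x \<in> S") (simp_all add: P.ins_simps Q.ins_simps op_kB_map_def)
      qed
      moreover have "mw (P.ins_w x Z b p) = Q.ins_w x Z (po Z b) (mw p)" if p: "p \<in> set ws" for p
      proof -
        obtain S T w where e: "p = ((S, T), w)" by (metis surj_pair)
        note ca = P.ctr_w[OF c p[unfolded e]]
        show ?thesis
          using dm_act[OF ca(6) ca(4) bc(6)] unfolding e ca(5)
          by (cases "x \<in> S") (simp_all add: P.ins_simps Q.ins_simps)
      qed
      ultimately have "map ma (map (P.ins_a x Z b) as) = map (Q.ins_a x Z (po Z b)) (map ma as)"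
        "map mw (map (P.ins_w x Z b) ws) = map (Q.ins_w x Z (po Z b)) (map mw ws)" by simp_all
      then show ?thesis
        using LS_map(2)[OF o(2) P.ctr_good(2)[OF c False]] False by (simp add: P.contr_val_def Q.contr_val_def del: map_map)
    qed
    moreover have "map ma (as @ [((Z, {y}), b)]) = map ma as @ [((Z, {y}), po Z b)]" by (simp add: op_kB_map_def)
    ultimately show "LSm (X, Y) (P.cmap X Y x y (P.LST ?A (as @ [((Z, {y}), b)]) ws)) =
        Q.cmap X Y x y (LSm ?A (P.LST ?A (as @ [((Z, {y}), b)]) ws))"
      unfolding P.cmap_last[OF c] LS_map(2)[OF o(1) g] using Q.cmap_last[OF c'] by simp
  qed
qed

lemma LS_map_proj:
  assumes A: "A \<in> B_obj" and u: "u \<in> carrier (P.LSV A)"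
  shows "Q.prj A (LSm A u) = Lamm A (P.prj A u)"
proof (rule P.LS_spanning_eq[OF A Q.vs_Lam[OF A] hom_comp[OF LS_map(1)[OF A] Q.LS_proj(1)[OF A]]
      hom_comp[OF P.LS_proj(1)[OF A] Lam_map(1)[OF A]] _ u])
  fix as ws assume g: "P.LSg A as ws"
  note l = LS_map(2)[OF A g] Q.LS_proj(2)[OF A LSg_m[OF g]] P.LS_proj(2)[OF A g]
  show "Q.prj A (LSm A (P.LST A as ws)) = Lamm A (P.prj A (P.LST A as ws))"
  proof (cases "ws = []")
    case True
    have "total as = A" using g is_decomp_total[of as A] True by (simp add: P.LSg_def)
    then show ?thesis using l True Lam_map(2)[OF A] P.LSg_pow(2)[OF g] by simp
  next
    case False
    then show ?thesis using l hom_zero[OF P.vs_Lam[OF A] Q.vs_Lam[OF A] Lam_map(1)[OF A]] by simp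
  qed
qed

lemma LS_map_module_hom:
  assumes a: "contr_structure K P actP" and b: "contr_structure K Q actQ"
  shows "lin_module_hom K (D_minus K) (P.LSV) actP (Q.LSV) actQ (LSm)"
proof (rule D_structure_hom[OF P.K])
  show "D_structure K (LS K P) actP" "D_structure K (LS K Q) actQ" using a b by (simp_all add: contr_structure_def)
  show "LSm A \<in> module_hom K (P.LSV A) (Q.LSV A)" if "A \<in> B_obj" for A by (rule LS_map(1)[OF that])
  show "LSm B (kb_act (LS K P) A B h v) = kb_act (LS K Q) A B h (LSm A v)"
    if "A \<in> B_obj" "B \<in> B_obj" "h \<in> B_hom A B" "v \<in> carrier (P.LSV A)" for A B h v by (rule LS_map_nat[OF that])
  fix X Y :: "'a set" and x y v assume f: "finite X" "finite Y" "x \<notin> X" "y \<notin> Y" and v: "v \<in> carrier (P.LSV (insert x X, insert y Y))"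
  have "(insert x X, insert y Y) \<in> B_obj" using f by (simp add: B_obj_def)
  then show "LSm (X, Y) (actP (insert x X, insert y Y) (X, Y) (contr K X Y x y) v) =
      actQ (insert x X, insert y Y) (X, Y) (contr K X Y x y) (LSm (insert x X, insert y Y) v)"
    using P.contr_structure_contr[OF a f v] Q.contr_structure_contr[OF b f hom_closed[OF LS_map(1) v]] LS_map_cmap[OF f v] by simp
qed

text \<open>Deduced from the statement for the full convolution: vectors are lifted along the
  projection for \<open>P\<close>, and the square formed by the projections and the induced maps
  commutes.\<close>

lemma Lam_map_module_hom:
  assumes a: "contr_structure K P actP" "contr_structure K Q actQ"
    and i: "induced_structure K P actP indP" "induced_structure K Q actQ indQ"
  shows "lin_module_hom K (D_minus K) (P.LamV) indP (Q.LamV) indQ (Lamm)"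
  unfolding lin_module_hom_def D_minus_simps(1)
proof (intro conjI ballI)
  show "Lamm A \<in> module_hom K (P.LamV A) (Q.LamV A)" if "A \<in> B_obj" for A
    by (rule Lam_map(1)[OF that])
  fix A B f v assume *: "A \<in> B_obj" "B \<in> B_obj" "f \<in> carrier (Hom (D_minus K) A B)" and v: "v \<in> carrier (P.LamV A)"
  obtain u where u: "u \<in> carrier (P.LSV A)" "v = P.prj A u" using P.LS_proj_surj[OF *(1)] v by blast
  have c: "actP A B f u \<in> carrier (P.LSV B)"
    using hom_closed[OF D_structure_act_hom[OF _ *] u(1)] a(1) by (simp add: contr_structure_def)
  have e: "LSm B (actP A B f u) = actQ A B f (LSm A u)"
    using LS_map_module_hom[OF a] * u(1) unfolding lin_module_hom_def D_minus_simps(1) by blast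
  show "Lamm B (indP A B f v) = indQ A B f (Lamm A v)"
    unfolding u(2) P.induced_structure_proj[OF i(1) * u(1)] LS_map_proj[OF *(2) c, symmetric] e LS_map_proj[OF *(1) u(1), symmetric]
      Q.induced_structure_proj[OF i(2) * hom_closed[OF LS_map(1)[OF *(1)] u(1)]] ..
qed

end

text \<open>"Induce" is rendered as existence together with uniqueness up to
  \<open>same_action\<close>, that is, up to values outside the carriers. Naturality is stated for
  arbitrary structures satisfying the rule, so it does not depend on the ones constructed. The
  second operad enters only that clause, hence its locale is instantiated under the premises found
  there.\<close>

theorem theorem3:
  fixes K :: "'k ring"
    and P :: "('a option, 'k, 'v) operad"
    and Q :: "('a option, 'k, 'w) operad"
    and \<phi> :: "'a option set \<Rightarrow> 'v \<Rightarrow> 'w"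
  assumes "infinite (UNIV :: 'a set)"
    and "field K"
    and "\<And>n :: nat. n > 0 \<Longrightarrow> [n] \<cdot>\<^bsub>K\<^esub> \<one>\<^bsub>K\<^esub> \<noteq> \<zero>\<^bsub>K\<^esub>"
    and "nonunital_operad K P"
  shows
    "(\<exists>act. contr_structure K P act \<and>
        (\<forall>act'. contr_structure K P act' \<longrightarrow> same_action (D_minus K) (kb_sp (LS K P)) act act')) \<and>
     (\<forall>act. contr_structure K P act \<longrightarrow>
        (\<exists>ind. induced_structure K P act ind \<and>
          (\<forall>ind'. induced_structure K P act ind' \<longrightarrow>
            same_action (D_minus K) (kb_sp (Lam K P)) ind ind'))) \<and>
     (\<forall>A\<in>B_obj. LS_proj K P A ` carrier (kb_sp (LS K P) A) = carrier (kb_sp (Lam K P) A)) \<and>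
     (nonunital_operad K Q \<and> operad_hom K P Q \<phi> \<longrightarrow>
        (\<forall>actP actQ. contr_structure K P actP \<and> contr_structure K Q actQ \<longrightarrow>
          lin_module_hom K (D_minus K) (kb_sp (LS K P)) actP (kb_sp (LS K Q)) actQ
            (LS_map K P Q \<phi>) \<and>
          (\<forall>indP indQ. induced_structure K P actP indP \<and> induced_structure K Q actQ indQ \<longrightarrow>
            lin_module_hom K (D_minus K) (kb_sp (Lam K P)) indP (kb_sp (Lam K Q)) indQ
              (Lam_map K P Q \<phi>))) \<and>
        (\<forall>A\<in>B_obj. \<forall>u\<in>carrier (kb_sp (LS K P) A).
          LS_proj K Q A (LS_map K P Q \<phi> A u) = Lam_map K P Q \<phi> A (LS_proj K P A u)))"
proof -
  interpret op_ctx K P using assms by (intro op_ctx.intro)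
  have m: "op_map K P Q \<phi>" if "nonunital_operad K Q" "operad_hom K P Q \<phi>"
    by (intro op_map.intro op_ctx.intro op_map_axioms.intro) (use assms that in auto)
  show ?thesis
  proof (intro conjI allI ballI impI)
    show "\<exists>act. contr_structure K P act \<and>
        (\<forall>act'. contr_structure K P act' \<longrightarrow> same_action (D_minus K) (kb_sp (LS K P)) act act')"
      using contr_structure_ex contr_structure_unique by blast
    show "\<exists>ind. induced_structure K P act ind \<and>
        (\<forall>ind'. induced_structure K P act ind' \<longrightarrow> same_action (D_minus K) (kb_sp (Lam K P)) ind ind')"
      if "contr_structure K P act" for act
      using induced_structure_ex[OF that] induced_structure_unique by blast
    show "LS_proj K P A ` carrier (kb_sp (LS K P) A) = carrier (kb_sp (Lam K P) A)" if "A \<in> B_obj" for A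
      by (rule LS_proj_surj[OF that])
  qed (use op_map.LS_map_module_hom[OF m] op_map.Lam_map_module_hom[OF m] op_map.LS_map_proj[OF m] in blast)+
qed

end
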